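(* Let $G$ be a compact Lie group, let $X$ be a normalized left-invariant vector field on $G$, and let $\mathbb{T}=\mathbb{R}/2\pi\mathbb{Z}$. Let $p_0,\lambda,\delta\in\mathbb{R}$, $\alpha\in\mathbb{C}\setminus\{0\}$, and $q,s\in C^\infty(\mathbb{T};\mathbb{R})$ with $q\ge 0$ and $q\not\equiv 0$. Let $P:C^\infty(\mathbb{T}\times G)\to C^\infty(\mathbb{T}\times G)$ be the operator $$Pu=\partial_t u-(p_0+i\lambda q(t))Xu-(s(t)+i\delta q(t))u-\alpha q(t)\overline{u}.$$ Put $$s_0=\int_0^{2\pi}s(\tau)\,d\tau,\quad q_0=\int_0^{2\pi}q(\tau)\,d\tau,\quad A_0=s_0+i\delta q_0,\quad B_0=\alpha q_0,\quad C_0=2\pi p_0+i\lambda q_0,$$ and, for $[\xi]\in\widehat{G}$ and $1\le m\le d_\xi$, $$\rho_m(\xi)=\sqrt{(\lambda\mu_m(\xi)-i\delta)^2+|\alpha|^2},\qquad \operatorname{Re}\rho_m(\xi)\ge 0.$$ Suppose that: (I) $|\alpha|\neq|\delta|$; (II) for all $[\xi]\in\widehat{G}$ and $1\le m\le d_\xi$, there is no integer $k\in\mathbb{Z}$ satisfying both $$\operatorname{Re}\bigl(A_0(2\pi k+\mu_m(\xi)\overline{C_0})\bigr)=0\quad\text{and}\quad |2\pi k+\mu_m(\xi)C_0|^2=|A_0|^2-|B_0|^2;$$ (III) there exists $M>0$ such that, for all $[\xi]\in\widehat{G}$ with $\langle\xi\rangle\ge M$ and every $1\le m\le d_\xi$,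 $$\min\left\{\left|e^{-\rho_m(\xi)q_0}-e^{2\pi i\mu_m(\xi)p_0+s_0}\right|,\ \left|1-e^{-\rho_m(\xi)q_0+2\pi i\mu_m(\xi)p_0+s_0}\right|\right\}\ge\langle\xi\rangle^{-M}.$$ Then for every $f\in C^\infty(\mathbb{T}\times G)$ there exists $u\in C^\infty(\mathbb{T}\times G)$ such that $Pu=f$.
   Context: Functions are complex valued unless indicated otherwise. $\widehat{G}$ is the unitary dual of $G$, i.e. the set of equivalence classes $[\xi]$ of continuous irreducible unitary representations $\xi:G\to\mathbb{C}^{d_\xi\times d_\xi}$, where $d_\xi=\dim\xi$. For $X$ in the Lie algebra $\mathfrak{g}$ of $G$, the left-invariant vector field acts by $(Xf)(x)=\frac{d}{dt}\big|_{t=0}f(x\exp(tX))$, and on $\mathbb{T}\times G$ it acts in the $G$-variable. Its symbol is the matrix $\sigma_X(\xi)=\xi(x)^*(X\xi)(x)$ (independent of $x$), with $X$ applied entrywise. In each class $[\xi]$ a representative is fixed for which $\sigma_X(\xi)=\operatorname{diag}(i\mu_1(\xi),\dots,i\mu_{d_\xi}(\xi))$ with $\mu_m(\xi)\in\mathbb{R}$; the numbers $\mu_m(\xi)$ depend only on the class $[\xi]$. The vector field is normalized: $\|X\|=1$, where $\|\cdot\|$ is the norm induced by the Killing form; one has the standard estimate $|\mu_m(\xi)|\le\|X\|\langle\xi\rangle$. Let $\mathcal{L}_G$ be the Laplace–Beltrami operator of $G$; all matrix coefficients of $\xi$ satisfy $-\mathcal{L}_G\xi_{ij}=\nu_{[\xi]}\xi_{ij}$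 with a common $\nu_{[\xi]}\ge 0$, and $\langle\xi\rangle:=(1+\nu_{[\xi]})^{1/2}$. *)

theory Defs
  imports
    "HOL-Analysis.Analysis"
    "HOL-Algebra.Group"
    "Jordan_Normal_Form.Schur_Decomposition"
begin

text \<open>
  \<open>Ck_on k S f\<close> says that \<open>f\<close> is \<open>k\<close> times continuously differentiable on \<open>S\<close>;
  it is only meaningful (and only used) for open \<open>S\<close>.
\<close>

primrec Ck_on ::
    "nat \<Rightarrow> 'a::euclidean_space set \<Rightarrow> ('a \<Rightarrow> 'b::real_normed_vector) \<Rightarrow> bool" where
  "Ck_on 0 S f \<longleftrightarrow> continuous_on S f"
| "Ck_on (Suc k) S f \<longleftrightarrow>
     (\<forall>x\<in>S. f differentiable (at x)) \<and> (\<forall>v. Ck_on k S (\<lambda>x. frechet_derivative f (at x) v))"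

definition smooth_on ::
    "'a::euclidean_space set \<Rightarrow> ('a \<Rightarrow> 'b::real_normed_vector) \<Rightarrow> bool" where
  "smooth_on S f \<longleftrightarrow> (\<forall>k. Ck_on k S f)"

type_synonym ('g, 'n) chart = "'g set \<times> ('g \<Rightarrow> real ^ 'n)"

definition chart_inv :: "('g, 'n::finite) chart \<Rightarrow> real ^ 'n \<Rightarrow> 'g" where
  "chart_inv c = inv_into (fst c) (snd c)"

definition is_chart :: "('g::topological_space, 'n::finite) chart \<Rightarrow> bool" where
  "is_chart c \<longleftrightarrow> open (fst c) \<and> open (snd c ` fst c) \<and>
     homeomorphism (fst c) (snd c ` fst c) (snd c) (chart_inv c)"

definition smooth_atlas :: "('g::topological_space, 'n::finite) chart set \<Rightarrow> bool" where
  "smooth_atlas A \<longleftrightarrow> (\<forall>c\<in>A. is_chart c) \<and> (\<Union>c\<in>A. fst c) = UNIV \<and>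
     (\<forall>c\<in>A. \<forall>c'\<in>A. smooth_on (snd c ` (fst c \<inter> fst c')) (snd c' \<circ> chart_inv c))"

record ('g, 'n::finite) lie_group = "'g monoid" +
  atlas :: "('g, 'n) chart set"

text \<open>
  The underlying set is a whole type, the dimension is \<open>CARD('n)\<close>. Zero-dimensional (i.e. finite)
  groups are thereby left out; they carry no nonzero vector field. A compact Hausdorff locally
  Euclidean space is automatically second countable.
\<close>

definition compact_lie_group :: "('g::t2_space, 'n::finite) lie_group \<Rightarrow> bool" where
  "compact_lie_group G \<longleftrightarrow>
     group G \<and> carrier G = UNIV \<and> compact (UNIV :: 'g set) \<and> smooth_atlas (atlas G) \<and>
     continuous_on UNIV (\<lambda>(x, y). x \<otimes>\<^bsub>G\<^esub> y) \<and>
     continuous_on UNIV (\<lambda>x. inv\<^bsub>G\<^esub> x) \<and>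
     (\<forall>c\<in>atlas G. \<forall>c'\<in>atlas G. \<forall>c''\<in>atlas G.
        smooth_on {(snd c x, snd c' y) |x y. x \<in> fst c \<and> y \<in> fst c' \<and> x \<otimes>\<^bsub>G\<^esub> y \<in> fst c''}
          (\<lambda>(a, b). snd c'' (chart_inv c a \<otimes>\<^bsub>G\<^esub> chart_inv c' b))) \<and>
     (\<forall>c\<in>atlas G. \<forall>c'\<in>atlas G.
        smooth_on {snd c x |x. x \<in> fst c \<and> inv\<^bsub>G\<^esub> x \<in> fst c'}
          (\<lambda>a. snd c' (inv\<^bsub>G\<^esub> (chart_inv c a))))"

definition chart_at :: "('g, 'n::finite) lie_group \<Rightarrow> 'g \<Rightarrow> ('g, 'n) chart" where
  "chart_at G x = (SOME c. c \<in> atlas G \<and> x \<in> fst c)"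

text \<open>
  The Lie algebra, i.e. the tangent space at the identity, is identified with \<open>real ^ 'n\<close> by means
  of the coordinates given by one fixed chart around the identity.
\<close>

abbreviation id_coord :: "('g, 'n::finite) lie_group \<Rightarrow> 'g \<Rightarrow> real ^ 'n" where
  "id_coord G \<equiv> snd (chart_at G \<one>\<^bsub>G\<^esub>)"

definition one_parameter_subgroup ::
    "('g::topological_space, 'n::finite) lie_group \<Rightarrow> (real \<Rightarrow> 'g) \<Rightarrow> bool" where
  "one_parameter_subgroup G \<gamma> \<longleftrightarrow>
     (\<forall>s t. \<gamma> (s + t) = \<gamma> s \<otimes>\<^bsub>G\<^esub> \<gamma> t) \<and> continuous_on UNIV \<gamma> \<and>
     (\<forall>c\<in>atlas G. smooth_on (\<gamma> -` fst c) (snd c \<circ> \<gamma>))"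

definition lie_exp :: "('g::topological_space, 'n::finite) lie_group \<Rightarrow> real ^ 'n \<Rightarrow> 'g" where
  "lie_exp G X = (THE \<gamma>. one_parameter_subgroup G \<gamma> \<and>
     ((id_coord G \<circ> \<gamma>) has_vector_derivative X) (at 0)) 1"

definition left_field ::
    "('g::topological_space, 'n::finite) lie_group \<Rightarrow> real ^ 'n \<Rightarrow>
     ('g \<Rightarrow> 'b::real_normed_vector) \<Rightarrow> 'g \<Rightarrow> 'b" where
  "left_field G X f x = vector_derivative (\<lambda>t. f (x \<otimes>\<^bsub>G\<^esub> lie_exp G (t *\<^sub>R X))) (at 0)"

text \<open>
  The bracket is the commutator of left-invariant vector fields; its coordinates are obtained
  by applying the commutator to the coordinate functions and evaluating at the identity.
\<close>

definition lie_bracket ::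
    "('g::topological_space, 'n::finite) lie_group \<Rightarrow> real ^ 'n \<Rightarrow> real ^ 'n \<Rightarrow> real ^ 'n" where
  "lie_bracket G X Y =
     left_field G X (left_field G Y (id_coord G)) \<one>\<^bsub>G\<^esub> -
     left_field G Y (left_field G X (id_coord G)) \<one>\<^bsub>G\<^esub>"

definition Ad ::
    "('g::topological_space, 'n::finite) lie_group \<Rightarrow> 'g \<Rightarrow> real ^ 'n \<Rightarrow> real ^ 'n" where
  "Ad G g X = vector_derivative
     (\<lambda>t. id_coord G (g \<otimes>\<^bsub>G\<^esub> lie_exp G (t *\<^sub>R X) \<otimes>\<^bsub>G\<^esub> inv\<^bsub>G\<^esub> g)) (at 0)"

definition killing_form ::
    "('g::topological_space, 'n::finite) lie_group \<Rightarrow> real ^ 'n \<Rightarrow> real ^ 'n \<Rightarrow> real" where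
  "killing_form G X Y = trace (matrix (\<lambda>Z. lie_bracket G X (lie_bracket G Y Z)))"

definition derived_algebra ::
    "('g::topological_space, 'n::finite) lie_group \<Rightarrow> (real ^ 'n) set" where
  "derived_algebra G = Real_Vector_Spaces.span {lie_bracket G X Y |X Y. True}"

text \<open>
  The negative of the Killing form of a compact Lie group is positive definite on the derived algebra
  but vanishes on the centre, so it is an inner product only when the group is semisimple. In general
  it is extended to an \<open>Ad\<close>-invariant inner product; the extension is unique up to the choice of
  an \<open>Ad\<close>-invariant inner product on the centre.
\<close>

definition killing_metric ::
    "('g::topological_space, 'n::finite) lie_group \<Rightarrow> (real ^ 'n \<Rightarrow> real ^ 'n \<Rightarrow> real) \<Rightarrow> bool" where
  "killing_metric G ip \<longleftrightarrow>
     bilinear ip \<and> (\<forall>X Y. ip X Y = ip Y X) \<and> (\<forall>X. X \<noteq> 0 \<longrightarrow> ip X X > 0) \<and>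
     (\<forall>g X Y. ip (Ad G g X) (Ad G g Y) = ip X Y) \<and>
     (\<forall>X\<in>derived_algebra G. \<forall>Y\<in>derived_algebra G. ip X Y = - killing_form G X Y)"

text \<open>
  The inner product \<open>ip\<close> on the Lie algebra is spread over the group by left translations;
  \<open>metric_coeff G ip c y\<close> is the resulting Gram matrix of the coordinate vector fields of the
  chart \<open>c\<close>, at the point with coordinates \<open>y\<close>.
\<close>

definition to_identity ::
    "('g, 'n::finite) lie_group \<Rightarrow> ('g, 'n) chart \<Rightarrow> real ^ 'n \<Rightarrow> real ^ 'n \<Rightarrow> real ^ 'n" where
  "to_identity G c y v =
     frechet_derivative (\<lambda>z. id_coord G (inv\<^bsub>G\<^esub> (chart_inv c y) \<otimes>\<^bsub>G\<^esub> chart_inv c z)) (at y) v"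

definition metric_coeff ::
    "('g, 'n::finite) lie_group \<Rightarrow> (real ^ 'n \<Rightarrow> real ^ 'n \<Rightarrow> real) \<Rightarrow> ('g, 'n) chart \<Rightarrow>
     real ^ 'n \<Rightarrow> real ^ 'n ^ 'n" where
  "metric_coeff G ip c y =
     (\<chi> i j. ip (to_identity G c y (axis i 1)) (to_identity G c y (axis j 1)))"

definition partial_deriv ::
    "'n::finite \<Rightarrow> (real ^ 'n \<Rightarrow> 'b::real_normed_vector) \<Rightarrow> real ^ 'n \<Rightarrow> 'b" where
  "partial_deriv i h y = frechet_derivative h (at y) (axis i 1)"

definition laplace_beltrami ::
    "('g, 'n::finite) lie_group \<Rightarrow> (real ^ 'n \<Rightarrow> real ^ 'n \<Rightarrow> real) \<Rightarrow>
     ('g \<Rightarrow> complex) \<Rightarrow> 'g \<Rightarrow> complex" where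
  "laplace_beltrami G ip f x =
     (let c = chart_at G x; y = snd c x; h = f \<circ> chart_inv c;
          w = (\<lambda>z. sqrt (Determinants.det (metric_coeff G ip c z)));
          ginv = (\<lambda>i j z. vec_nth (vec_nth (matrix_inv (metric_coeff G ip c z)) i) j)
      in (1 / w y) *\<^sub>R
         (\<Sum>i\<in>UNIV. partial_deriv i
            (\<lambda>z. w z *\<^sub>R (\<Sum>j\<in>UNIV. ginv i j z *\<^sub>R partial_deriv j h z)) y))"

definition rep_dim :: "('g, 'n::finite) lie_group \<Rightarrow> ('g \<Rightarrow> complex Matrix.mat) \<Rightarrow> nat" where
  "rep_dim G \<xi> = dim_row (\<xi> \<one>\<^bsub>G\<^esub>)"

definition unitary_rep ::
    "('g::topological_space, 'n::finite) lie_group \<Rightarrow> ('g \<Rightarrow> complex Matrix.mat) \<Rightarrow> bool" where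
  "unitary_rep G \<xi> \<longleftrightarrow> (let d = rep_dim G \<xi> in
     (\<forall>x. \<xi> x \<in> carrier_mat d d \<and> mat_adjoint (\<xi> x) * \<xi> x = 1\<^sub>m d) \<and>
     (\<forall>x y. \<xi> (x \<otimes>\<^bsub>G\<^esub> y) = \<xi> x * \<xi> y) \<and>
     (\<forall>i<d. \<forall>j<d. continuous_on UNIV (\<lambda>x. \<xi> x $$ (i, j))))"

definition irreducible_rep ::
    "('g, 'n::finite) lie_group \<Rightarrow> ('g \<Rightarrow> complex Matrix.mat) \<Rightarrow> bool" where
  "irreducible_rep G \<xi> \<longleftrightarrow> (let d = rep_dim G \<xi> in d > 0 \<and>
     (\<forall>W. VectorSpace.subspace class_ring W (module_vec TYPE(complex) d) \<and>
        (\<forall>x. \<forall>v\<in>W. \<xi> x *\<^sub>v v \<in> W) \<longrightarrow> W = {0\<^sub>v d} \<or> W = carrier_vec d))"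

definition unitary_irreps ::
    "('g::topological_space, 'n::finite) lie_group \<Rightarrow> ('g \<Rightarrow> complex Matrix.mat) set" where
  "unitary_irreps G = {\<xi>. unitary_rep G \<xi> \<and> irreducible_rep G \<xi>}"

definition rep_equivalence ::
    "('g::topological_space, 'n::finite) lie_group \<Rightarrow>
     (('g \<Rightarrow> complex Matrix.mat) \<times> ('g \<Rightarrow> complex Matrix.mat)) set" where
  "rep_equivalence G = {(\<xi>, \<eta>). \<xi> \<in> unitary_irreps G \<and> \<eta> \<in> unitary_irreps G \<and>
     (\<exists>A. A \<in> carrier_mat (rep_dim G \<eta>) (rep_dim G \<xi>) \<and> invertible_mat A \<and>
        (\<forall>x. A * \<xi> x = \<eta> x * A))}"

definition unitary_dual ::
    "('g::topological_space, 'n::finite) lie_group \<Rightarrow> ('g \<Rightarrow> complex Matrix.mat) set set" where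
  "unitary_dual G = unitary_irreps G // rep_equivalence G"

text \<open>The symbol does not depend on the point; it is taken at the identity.\<close>

definition symbol ::
    "('g::topological_space, 'n::finite) lie_group \<Rightarrow> real ^ 'n \<Rightarrow>
     ('g \<Rightarrow> complex Matrix.mat) \<Rightarrow> complex Matrix.mat" where
  "symbol G X \<xi> = mat_adjoint (\<xi> \<one>\<^bsub>G\<^esub>) *
     Matrix.mat (rep_dim G \<xi>) (rep_dim G \<xi>)
       (\<lambda>(i, j). left_field G X (\<lambda>y. \<xi> y $$ (i, j)) \<one>\<^bsub>G\<^esub>)"

text \<open>Row and column indices start at 0.\<close>

definition mu ::
    "('g::topological_space, 'n::finite) lie_group \<Rightarrow> real ^ 'n \<Rightarrow>
     ('g \<Rightarrow> complex Matrix.mat) \<Rightarrow> nat \<Rightarrow> real" where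
  "mu G X \<xi> m = Im (symbol G X \<xi> $$ (m, m))"

definition diagonal_representatives ::
    "('g::topological_space, 'n::finite) lie_group \<Rightarrow> real ^ 'n \<Rightarrow>
     (('g \<Rightarrow> complex Matrix.mat) set \<Rightarrow> ('g \<Rightarrow> complex Matrix.mat)) \<Rightarrow> bool" where
  "diagonal_representatives G X rep \<longleftrightarrow> (\<forall>\<Xi>\<in>unitary_dual G. rep \<Xi> \<in> \<Xi> \<and>
     symbol G X (rep \<Xi>) = Matrix.mat (rep_dim G (rep \<Xi>)) (rep_dim G (rep \<Xi>))
       (\<lambda>(m, n). if m = n then \<i> * complex_of_real (mu G X (rep \<Xi>) m) else 0))"

definition laplace_eigenvalue ::
    "('g::topological_space, 'n::finite) lie_group \<Rightarrow> (real ^ 'n \<Rightarrow> real ^ 'n \<Rightarrow> real) \<Rightarrow>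
     ('g \<Rightarrow> complex Matrix.mat) \<Rightarrow> real" where
  "laplace_eigenvalue G ip \<xi> = (THE \<nu>. \<forall>i<rep_dim G \<xi>. \<forall>j<rep_dim G \<xi>. \<forall>x.
     - laplace_beltrami G ip (\<lambda>y. \<xi> y $$ (i, j)) x = complex_of_real \<nu> * \<xi> x $$ (i, j))"

definition japanese_bracket ::
    "('g::topological_space, 'n::finite) lie_group \<Rightarrow> (real ^ 'n \<Rightarrow> real ^ 'n \<Rightarrow> real) \<Rightarrow>
     ('g \<Rightarrow> complex Matrix.mat) \<Rightarrow> real" where
  "japanese_bracket G ip \<xi> = sqrt (1 + laplace_eigenvalue G ip \<xi>)"

text \<open>Functions on the torus are \<open>2\<pi>\<close>-periodic functions on the real line.\<close>

definition smooth_periodic :: "(real \<Rightarrow> real) \<Rightarrow> bool" where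
  "smooth_periodic q \<longleftrightarrow> smooth_on UNIV q \<and> (\<forall>t. q (t + 2 * pi) = q t)"

definition smooth_torus_group ::
    "('g::topological_space, 'n::finite) lie_group \<Rightarrow> (real \<Rightarrow> 'g \<Rightarrow> complex) \<Rightarrow> bool" where
  "smooth_torus_group G u \<longleftrightarrow> (\<forall>t x. u (t + 2 * pi) x = u t x) \<and>
     (\<forall>c\<in>atlas G. smooth_on (UNIV \<times> snd c ` fst c) (\<lambda>(t, y). u t (chart_inv c y)))"

definition operator_P ::
    "('g::topological_space, 'n::finite) lie_group \<Rightarrow> real ^ 'n \<Rightarrow>
     real \<Rightarrow> real \<Rightarrow> real \<Rightarrow> complex \<Rightarrow> (real \<Rightarrow> real) \<Rightarrow> (real \<Rightarrow> real) \<Rightarrow>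
     (real \<Rightarrow> 'g \<Rightarrow> complex) \<Rightarrow> real \<Rightarrow> 'g \<Rightarrow> complex" where
  "operator_P G X p0 lam \<delta> \<alpha> q s u t x =
     vector_derivative (\<lambda>\<tau>. u \<tau> x) (at t)
     - (complex_of_real p0 + \<i> * of_real lam * of_real (q t)) * left_field G X (u t) x
     - (of_real (s t) + \<i> * of_real \<delta> * of_real (q t)) * u t x
     - \<alpha> * of_real (q t) * cnj (u t x)"

text \<open>
  The principal square root \<open>csqrt\<close> has nonnegative real part. When the real part vanishes there are
  two admissible roots; they are negatives of each other and purely imaginary.
\<close>

definition rho :: "real \<Rightarrow> real \<Rightarrow> complex \<Rightarrow> real \<Rightarrow> complex" where
  "rho lam \<delta> \<alpha> \<mu> =
     csqrt ((of_real (lam * \<mu>) - \<i> * of_real \<delta>)\<^sup>2 + of_real ((cmod \<alpha>)\<^sup>2))"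

end

theory Submission
 imports Defs "Jordan_Normal_Form.Spectral_Radius"
begin

no_notation Matrix.scalar_prod (infix \<open>\<bullet>\<close> 70)
no_notation Matrix.vec_index (infixl \<open>$\<close> 100)

abbreviation "FD == frechet_derivative"
abbreviation "ctn == continuous_on UNIV"
abbreviation "cor == complex_of_real"
notation has_vector_derivative (infix "hvd" 50)
notation has_derivative (infix "hfd" 50)

text \<open>
 By completeness of the matrix coefficients and a polynomial bound for the dimensions, smooth functions on the
 product correspond to rapidly decaying families of Fourier coefficients. Put \<open>u = U + cnj V\<close>, where \<open>U\<close> and \<open>V\<close> are
 series in the matrix coefficients; then it suffices to solve, for each coefficient, a linear \<open>2 \<times> 2\<close> system in \<open>t\<close>
 for the coefficients of \<open>U\<close> and \<open>V\<close>. Constant matrices diagonalise it with eigenvalues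
 \<open>i p0 mu + s(t) \<plusminus> rho q(t)\<close>, where \<open>rho \<noteq> 0\<close> by (I). Each scalar equation has a unique periodic solution unless
 the exponential of the integral of the eigenvalue over a period is 1, which (II) excludes; (III) bounds the distance to 1 from below by
 a negative power of the weight. As \<open>q \<ge> 0\<close> and \<open>Re rho \<ge> 0\<close>, integrating forward for \<open>- rho\<close> and backward for
 \<open>+ rho\<close> keeps all exponentials bounded, so the solution operator loses only a power of the weight.
\<close>

section \<open>Calculus of smooth maps\<close>

text \<open>Conjugation is only real linear and sends a coefficient of a representation to one of
  the contragredient, so single Fourier modes of \<open>u\<close> do not decouple. With
  \<open>U\<close> and \<open>cnj V\<close> the equation becomes a complex linear system; the
  splitting of \<open>u\<close> is not unique, but surjectivity asks for only one, with data
  \<open>f\<close> for \<open>U\<close> and 0 for \<open>V\<close>. The integral over the group is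
  the mean of von Neumann, a functional on continuous functions built from finite averages of
  translates. No complete space of square integrable functions stands behind it, so eigenfunctions
  of convolution operators are obtained as uniform limits. The weight is defined by the
  Laplace-Beltrami operator in charts, the estimates use the sum of squares of an orthonormal
  left-invariant frame. Both agree because right translations are isometries, which makes
  left-invariant fields divergence free. The dimension bound is local: the reproducing kernel of
  finitely many representations cannot fall off faster than its gradient allows, and a covering by
  translates bounds the mean of a small ball from below.\<close>

lemma Ck_on_cong: assumes "open S" "!!x. x : S ==> f x = g x" "Ck_on k S f" shows "Ck_on k S g"
proof -
 have "ALL x:S. f x = g x" using assms(2) by simp
 with assms(3) show ?thesis proof (induction k arbitrary: f g)
  case 0
  show ?case using "0.prems" by simp
 next
  case (Suc k)
  have d: "(g hfd FD f (at x)) (at x)" if "x : S" for x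
  proof (rule has_derivative_transform_within_open[OF _ assms(1) that])
   show "(f hfd FD f (at x)) (at x)"
    using Suc.prems(1) that frechet_derivative_works by auto
  qed (use Suc.prems in auto)
  have e: "FD g (at x) = FD f (at x)" if "x : S" for x
   using frechet_derivative_at[OF d[OF that]] by simp
  have "Ck_on k S (%x. FD g (at x) v)" for v proof (rule Suc.IH)
   show "Ck_on k S (%x. FD f (at x) v)" using Suc.prems(1) by simp
  qed (simp add: e)
  moreover have "g differentiable (at x)" if "x : S" for x
   using d[OF that] by (rule differentiableI)
  ultimately show ?case by simp
 qed
qed

lemma Ck_on_subset: "Ck_on k S f ==> T \<subseteq> S ==> Ck_on k T f"
 by (induction k arbitrary: f) (auto intro: continuous_on_subset)

text \<open>Introduction with an explicit derivative: on an open set derivatives are unique, so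
  \<open>f'\<close> may stand in for the chosen \<open>frechet_derivative\<close>.\<close>

lemma Ck_on_SucI:
 assumes "open S" "!!x. x : S ==> (f hfd f' x) (at x)" "!!v. Ck_on k S (%x. f' x v)"
 shows "Ck_on (Suc k) S f" unfolding Ck_on.simps proof (intro conjI ballI allI)
 show "f differentiable (at x)" if "x : S" for x using assms(2)[OF that] by (rule differentiableI)
 have e: "f' x = FD f (at x)" if "x : S" for x
  by (rule frechet_derivative_at[OF assms(2)[OF that]])
 show "Ck_on k S (%x. FD f (at x) v)" for v
  by (rule Ck_on_cong[OF assms(1) _ assms(3)[of v]]) (simp only: e)
qed

lemma Ck_Suc_hfd:
 "Ck_on (Suc k) S f ==> x : S ==> (f hfd FD f (at x)) (at x)"
 by (simp add: frechet_derivative_works)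

lemma Ck_on_SucD: "Ck_on (Suc k) S f ==> Ck_on k S f" proof (induction k arbitrary: f)
 case 0
 thus ?case
  by (auto intro!: continuous_at_imp_continuous_on differentiable_imp_continuous_within)
next
 case (Suc k)
 thus ?case by simp
qed

lemma Ck_on_local: assumes "!!x. x : S ==> EX T. open T & x : T & Ck_on k T f" shows "Ck_on k S f"
 using assms proof (induction k arbitrary: f)
 case 0
 thus ?case
  by (metis Ck_on.simps(1) continuous_on_eq_continuous_at continuous_at_imp_continuous_on)
next
 case (Suc k)
 have "Ck_on k S (%x. FD f (at x) v)" for v proof (rule Suc.IH)
  show "EX T. open T & x : T & Ck_on k T (%x. FD f (at x) v)" if "x : S" for x
   using Suc.prems[OF that] by auto
 qed
 moreover have "f differentiable (at x)" if "x : S" for x using Suc.prems[OF that] by auto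
 ultimately show ?case by simp
qed

lemma Ck_on_const [simp]: "Ck_on k S (%x. c)"
 by (induction k arbitrary: c) auto

lemma Ck_on_bounded_linear: assumes "bounded_linear L" "open S" "Ck_on k S f"
 shows "Ck_on k S (%x. L (f x))" using assms(3) proof (induction k arbitrary: f)
 case 0
 thus ?case by (simp add: bounded_linear.continuous_on[OF assms(1)])
next
 case (Suc k)
 show ?case
  by (rule Ck_on_SucI[OF assms(2) bounded_linear.has_derivative[OF assms(1) Ck_Suc_hfd[OF Suc.prems]]])
   (use Suc in auto)
qed

lemma Ck_on_id: "Ck_on k S (%x. x)" proof (cases k)
 case (Suc j)
 show ?thesis by (simp add: Suc)
qed simp

lemma Ck_on_linear: "bounded_linear L ==> open S ==> Ck_on k S L"
 using Ck_on_bounded_linear[OF _ _ Ck_on_id] by blast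

lemma Ck_on_add: assumes "open S" "Ck_on k S f" "Ck_on k S g" shows "Ck_on k S (%x. f x + g x)"
 using assms(2,3) proof (induction k arbitrary: f g)
 case 0
 thus ?case by (auto intro: continuous_intros)
next
 case (Suc k)
 show ?case
  by (rule Ck_on_SucI[OF assms(1) has_derivative_add[OF Ck_Suc_hfd[OF Suc.prems(1)]
    Ck_Suc_hfd[OF Suc.prems(2)]]]) (use Suc in auto)
qed

text \<open>The product rule leaves two terms, each with one factor differentiated, so both factors
  have to vary in the induction.\<close>

lemma Ck_on_bilinear: assumes "bounded_bilinear b" "open S" "Ck_on k S f" "Ck_on k S g"
 shows "Ck_on k S (%x. b (f x) (g x))" using assms(3,4) proof (induction k arbitrary: f g)
 case 0
 thus ?case by (simp add: bounded_bilinear.continuous_on[OF assms(1)])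
next
 case (Suc k)
 have c: "Ck_on k S f" "Ck_on k S g" using Suc.prems by (auto dest: Ck_on_SucD simp del: Ck_on.simps)
 have d: "Ck_on k S (%x. FD f (at x) v)" "Ck_on k S (%x. FD g (at x) v)" for v
  using Suc.prems by simp_all
 show ?case
  by (rule Ck_on_SucI[OF assms(2) bounded_bilinear.FDERIV[OF assms(1) Ck_Suc_hfd[OF Suc.prems(1)]
    Ck_Suc_hfd[OF Suc.prems(2)]]])
   (assumption | rule Ck_on_add[OF assms(2) Suc.IH[OF c(1) d(2)] Suc.IH[OF d(1) c(2)]])+
qed

lemmas Ck_on_scaleR = Ck_on_bilinear[OF bounded_bilinear_scaleR]

lemma Ck_on_sum: assumes "open S" "!!i. i : I ==> Ck_on k S (f i)"
 shows "Ck_on k S (%x. SUM i:I. f i x)"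
 using assms(2) by (induction rule: infinite_finite_induct) (auto intro: Ck_on_add[OF assms(1)])

lemma Ck_on_euclidean: fixes f :: "'a::euclidean_space => 'b::euclidean_space"
 assumes "open S" "!!b. b : Basis ==> Ck_on k S (%x. f x \<bullet> b)" shows "Ck_on k S f" proof -
 have "Ck_on k S (%x. SUM b:Basis. (f x \<bullet> b) *\<^sub>R b)"
  by (intro Ck_on_sum Ck_on_scaleR assms Ck_on_const)
 thus ?thesis by (simp add: euclidean_representation)
qed

lemma linear_Basis: fixes L :: "'a::euclidean_space => 'b::real_vector" assumes "linear L"
 shows "L x = (SUM b:Basis. (x \<bullet> b) *\<^sub>R L b)" proof -
 have "L x = L (SUM b:Basis. (x \<bullet> b) *\<^sub>R b)" by (simp add: euclidean_representation)
 thus ?thesis by (simp only: linear_sum[OF assms] linear_cmul[OF assms])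
qed

lemma Ck_on_compose:
 fixes f :: "'a::euclidean_space => 'b::euclidean_space" and g :: "'b => 'c::real_normed_vector"
 assumes S: "open S" and T: "open T" and im: "!!x. x : S ==> f x : T"
  and "Ck_on k S f" "Ck_on k T g" shows "Ck_on k S (%x. g (f x))" using assms(4,5)
proof (induction k arbitrary: g)
 case 0
 thus ?case using im by (auto intro: continuous_on_compose2)
next
 case (Suc k)
 have d: "((%x. g (f x)) hfd (%v. FD g (at (f x)) (FD f (at x) v))) (at x)"
  if "x : S" for x using has_derivative_compose[OF Ck_Suc_hfd[OF Suc.prems(1) that]
    Ck_Suc_hfd[OF Suc.prems(2) im[OF that]]] .
 \<comment> \<open>The direction in which \<open>g\<close> is differentiated varies with
   \<open>x\<close>. Expanding it in the basis leaves derivatives of \<open>g\<close> in fixed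
   directions, to which the induction hypothesis applies, with scalar coefficients.\<close>
 have e: "FD g (at (f x)) (FD f (at x) v) =
   (SUM b:Basis. (FD f (at x) v \<bullet> b) *\<^sub>R FD g (at (f x)) b)" if "x : S" for x v
 proof -
  show ?thesis by (intro has_derivative_linear[OF Ck_Suc_hfd[OF Suc.prems(2) im[OF that]]] linear_Basis)
 qed
 have c: "Ck_on k S f" using Suc.prems(1) by (rule Ck_on_SucD)
 have d1: "Ck_on k S (%x. FD f (at x) v)" "Ck_on k T (%x. FD g (at x) v')" for v v'
  using Suc.prems by simp_all
 have "Ck_on k S (%x. (FD f (at x) v \<bullet> b) *\<^sub>R FD g (at (f x)) b)" for v b
  by (rule Ck_on_scaleR[OF S Ck_on_bounded_linear[OF bounded_linear_inner_left S d1(1)] Suc.IH[OF c d1(2)]])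
 from Ck_on_sum[OF S this]
 have s: "Ck_on k S (%x. SUM b:Basis. (FD f (at x) v \<bullet> b) *\<^sub>R FD g (at (f x)) b)" for v .
 show ?case by (rule Ck_on_SucI[OF S d], assumption, rule Ck_on_cong[OF S _ s]) (simp only: e)
qed

lemma smooth_cong:
 "open S ==> (!!x. x : S ==> f x = g x) ==> smooth_on S f ==> smooth_on S g"
 unfolding smooth_on_def by (rule , rule Ck_on_cong[of S f g]) auto

lemma smooth_on_subset: "smooth_on S f ==> T \<subseteq> S ==> smooth_on T f"
 unfolding smooth_on_def using Ck_on_subset by blast

lemma smooth_on_local:
 "(!!x. x : S ==> EX T. open T & x : T & smooth_on T f) ==> smooth_on S f"
 unfolding smooth_on_def by (rule , rule Ck_on_local) blast

lemma smooth_on_const [simp]: "smooth_on S (%x. c)" by (simp add: smooth_on_def)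

lemma smooth_on_id: "smooth_on S (%x. x)" by (simp add: smooth_on_def Ck_on_id)

lemma smooth_on_linear: "bounded_linear L ==> open S ==> smooth_on S L"
 by (simp add: smooth_on_def Ck_on_linear)

lemma smooth_blin: "bounded_linear L ==> open S ==> smooth_on S f ==> smooth_on S (%x. L (f x))"
 by (simp add: smooth_on_def Ck_on_bounded_linear)

lemma smooth_on_add: "open S ==> smooth_on S f ==> smooth_on S g ==> smooth_on S (%x. f x + g x)"
 by (simp add: smooth_on_def Ck_on_add)

lemma smooth_on_bilinear:
 "bounded_bilinear b ==> open S ==> smooth_on S f ==> smooth_on S g ==> smooth_on S (%x. b (f x) (g x))"
 by (simp add: smooth_on_def Ck_on_bilinear)

lemmas smooth_on_scaleR = smooth_on_bilinear[OF bounded_bilinear_scaleR]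

lemma smooth_on_diff: assumes "open S" "smooth_on S f" "smooth_on S g"
 shows "smooth_on S (%x. f x - g x)"
 using smooth_on_add[OF assms(1,2) smooth_blin[OF bounded_linear_minus[OF bounded_linear_ident] assms(1,3)]]
 by simp

lemma smooth_on_sum:
 "open S ==> (!!i. i : I ==> smooth_on S (f i)) ==> smooth_on S (%x. SUM i:I. f i x)"
 by (simp add: smooth_on_def Ck_on_sum)

lemma smooth_on_euclidean: fixes f :: "'a::euclidean_space => 'b::euclidean_space"
 shows "open S ==> (!!b. b : Basis ==> smooth_on S (%x. f x \<bullet> b)) ==> smooth_on S f"
 by (simp add: smooth_on_def Ck_on_euclidean)

lemma smooth_comp:
 fixes f :: "'a::euclidean_space => 'b::euclidean_space" and g :: "'b => 'c::real_normed_vector"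
 shows "open S ==> open T ==> (!!x. x : S ==> f x : T) ==> smooth_on S f ==> smooth_on T g
  ==> smooth_on S (%x. g (f x))"
 unfolding smooth_on_def by (rule , rule Ck_on_compose[of S T f]) auto

lemma smooth_on_Pair:
 fixes f :: "'a::euclidean_space => 'b::euclidean_space" and g :: "'a => 'c::euclidean_space"
 assumes "open S" "smooth_on S f" "smooth_on S g" shows "smooth_on S (%x. (f x, g x))"
proof (rule smooth_on_euclidean[OF assms(1)])
 fix b :: "'b \<times> 'c" assume "b : Basis"
 show "smooth_on S (%x. (f x, g x) \<bullet> b)"
  using smooth_on_add[OF assms(1) smooth_blin[OF bounded_linear_inner_left assms(1,2), of "fst b"]
    smooth_blin[OF bounded_linear_inner_left assms(1,3), of "snd b"]]
  by (simp add: inner_prod_def)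
qed

lemma smooth_on_differentiable: "smooth_on S f ==> x : S ==> f differentiable (at x)"
 unfolding smooth_on_def by (metis Ck_on.simps(2))

lemma smooth_hfd:
 "smooth_on S f ==> x : S ==> (f hfd FD f (at x)) (at x)"
 using smooth_on_differentiable frechet_derivative_works by blast

lemma smooth_FD_linear:
 "smooth_on S f ==> x : S ==> linear (FD f (at x))"
 using smooth_hfd has_derivative_linear by blast

lemma smooth_ctn: "smooth_on S f ==> continuous_on S f"
 unfolding smooth_on_def by (metis Ck_on.simps(1))

lemma smooth_FD: "smooth_on S f ==> smooth_on S (%x. FD f (at x) v)"
 unfolding smooth_on_def by (metis Ck_on.simps(2))

lemma smooth_on_frechet_apply:
 fixes f :: "'a::euclidean_space => 'b::real_normed_vector" and h :: "'a => 'a"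
 assumes "open S" "smooth_on S f" "smooth_on S h"
 shows "smooth_on S (%x. FD f (at x) (h x))" proof -
 have "smooth_on S (%x. SUM b:Basis. (h x \<bullet> b) *\<^sub>R FD f (at x) b)"
  by (intro smooth_on_sum smooth_on_scaleR smooth_blin[OF bounded_linear_inner_left] assms smooth_FD)
 moreover have "(SUM b:Basis. (h x \<bullet> b) *\<^sub>R FD f (at x) b) = FD f (at x) (h x)"
  if "x : S" for x using linear_Basis[OF smooth_FD_linear[OF assms(2) that]] by metis
 ultimately show ?thesis by (rule smooth_cong[OF assms(1), rotated])
qed

text \<open>Bootstrap for a whole class at once: if every derivative of a member is a combination of
  members with smooth coefficients, induction on the order covers all members simultaneously. It
  serves the flat exponentials, the convolutions and the series over the dual. The index set has the
  type of the domain so that it can be \<open>Basis\<close>.\<close>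

lemma smooth_on_class: fixes F :: "('a::euclidean_space => 'b::real_normed_vector) set"
 assumes S: "open S" and d: "!!f x. f : F ==> x : S ==> f differentiable (at x)"
  and step: "!!f v. f : F ==> EX I::'a set. EX a g. (ALL i:I. smooth_on S (a i :: 'a => real) & g i : F) &
   (ALL x:S. FD f (at x) v = (SUM i:I. a i x *\<^sub>R g i x))" and f: "f : F"
 shows "smooth_on S f" proof -
 have "ALL f:F. Ck_on k S f" for k proof (induction k)
  case 0
  thus ?case
   by (auto intro!: continuous_at_imp_continuous_on differentiable_imp_continuous_within d)
 next
  case (Suc k)
  show ?case proof
   fix f assume f: "f : F"
   show "Ck_on (Suc k) S f" proof (rule Ck_on_SucI[OF S])
    show "(f hfd FD f (at x)) (at x)" if "x : S" for x
     using d[OF f that] frechet_derivative_works by blast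
    fix v
    obtain I :: "'a set" and a g where *: "ALL i:I. smooth_on S (a i :: 'a => real) & g i : F"
     "ALL x:S. FD f (at x) v = (SUM i:I. a i x *\<^sub>R g i x)" using step[OF f] by blast
    have c: "Ck_on k S (%x. a i x *\<^sub>R g i x)" if "i : I" for i proof (rule Ck_on_scaleR[OF S])
     show "Ck_on k S (a i)" using *(1) that by (simp add: smooth_on_def)
     show "Ck_on k S (g i)" using *(1) that Suc by simp
    qed
    show "Ck_on k S (%x. FD f (at x) v)"
     by (rule Ck_on_cong[OF S _ Ck_on_sum[OF S c]]) (use *(2) in simp_all)
   qed
  qed
 qed
 thus ?thesis using f by (simp add: smooth_on_def)
qed

section \<open>A flat function and bump functions\<close>

definition exp_inv :: "nat => real => real" where
 "exp_inv m x = (if x > 0 then exp (- 1 / x) / x ^ m else 0)"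

text \<open>A single term of the series of \<open>exp (1 / x)\<close>, of degree
  \<open>m + 2\<close>, already beats the denominator \<open>x ^ m\<close>; the two spare powers
  make the difference quotient at 0 vanish. The denominators are carried along because
  differentiating \<open>exp (- 1 / x)\<close> produces them.\<close>

lemma exp_inv_bound: "abs (exp_inv m x) <= fact (m + 2) * x^2" proof (cases "x > 0")
 case True
 have "(1 / x) ^ (m + 2) / fact (m + 2) <= exp (1 / x)" proof -
  have "(SUM n:{m+2}. (1 / x) ^ n /\<^sub>R fact n) <= (\<Sum>n. (1 / x) ^ n /\<^sub>R fact n)"
   by (rule sum_le_suminf[OF summable_exp_generic]) (use True in auto)
  thus ?thesis by (simp add: exp_def divide_inverse mult.commute)
 qed
 hence "exp (- 1 / x) <= fact (m + 2) * x ^ (m + 2)"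
  using True by (simp add: exp_minus divide_simps mult.commute)
 hence "exp (- 1 / x) / x ^ m <= fact (m + 2) * x ^ (m + 2) / x ^ m"
  using True by (intro divide_right_mono) auto
 also have "... = fact (m + 2) * x^2" by (simp add: power2_eq_square)
 finally show ?thesis by (simp add: exp_inv_def)
qed (simp add: exp_inv_def)

lemma exp_inv_derivative:
 "(exp_inv m has_real_derivative exp_inv (m + 2) x - real m * exp_inv (m + 1) x) (at x)" proof -
 consider "x > 0" | "x < 0" | "x = 0" by linarith
 thus ?thesis proof cases
  case 1
  have "((%x. exp (- 1 / x) / x ^ m) has_real_derivative exp_inv (m + 2) x - real m * exp_inv (m + 1) x) (at x)"
   using 1 by (cases m) (auto intro!: derivative_eq_intros simp: exp_inv_def divide_simps algebra_simps, metis
    One_nat_def power_eq_if)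
  thus ?thesis by (rule has_field_derivative_transform_within_open[of _ _ _ "{0<..}"])
    (use 1 in \<open>auto simp: exp_inv_def\<close>)
 next
  case 2
  have "((%x. 0) has_real_derivative 0) (at x)" by simp
  hence "(exp_inv m has_real_derivative 0) (at x)"
   by (rule has_field_derivative_transform_within_open[of _ _ _ "{..<0}"])
    (use 2 in \<open>auto simp: exp_inv_def\<close>)
  thus ?thesis using 2 by (simp add: exp_inv_def)
 next
  case 3
  have "((%h. exp_inv m h / h) \<longlongrightarrow> 0) (at 0)" proof (rule Lim_null_comparison)
   show "\<forall>\<^sub>F h in at 0. norm (exp_inv m h / h) <= fact (m + 2) * abs h"
   proof (rule always_eventually, rule allI)
    fix h :: real
    show "norm (exp_inv m h / h) <= fact (m + 2) * abs h" using exp_inv_bound[of m h]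
     by (cases "h = 0") (simp_all add: divide_le_eq abs_mult power2_eq_square)
   qed
   show "((%h::real. fact (m + 2) * abs h) \<longlongrightarrow> 0) (at 0)"
    by (auto intro!: tendsto_eq_intros)
  qed
  thus ?thesis using 3 by (simp add: DERIV_def exp_inv_def)
 qed
qed

lemma smooth_exp_inv: "smooth_on UNIV (exp_inv m)"
proof (rule smooth_on_class[where F="range exp_inv"])
 show "f differentiable (at x)" if "f : range exp_inv" for f x
  using that exp_inv_derivative by (auto simp: real_differentiable_def)
 fix f :: "real => real" and v :: real assume "f : range exp_inv"
 then obtain m where f: "f = exp_inv m" by auto
 have "FD f (at x) v = v *\<^sub>R exp_inv (m + 2) x + (- v * real m) *\<^sub>R exp_inv (m + 1) x" for x
  using fun_cong[OF frechet_derivative_at[OF exp_inv_derivative[of m x, unfolded has_field_derivative_def]], of v]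
  by (simp add: f algebra_simps)
 thus "EX I::real set. EX a g. (ALL i:I. smooth_on UNIV (a i :: real => real) & g i : range exp_inv) &
   (ALL x:UNIV. FD f (at x) v = (SUM i:I. a i x *\<^sub>R g i x))"
  by (intro exI[of _ "{0, 1::real}"] exI[of _ "%i x. if i = 0 then v else - v * real m"]
    exI[of _ "%i. exp_inv (if i = 0 then m + 2 else m + 1)"]) auto
qed auto

text \<open>The flat function is composed with the squared distance, which is polynomial, whereas
  the norm is not smooth at the centre.\<close>

lemma smooth_bump: fixes a :: "'a::euclidean_space" assumes "r > 0"
 obtains rh :: "'a => real" where "smooth_on UNIV rh" "!!x. 0 <= rh x" "rh a > 0" "!!x. rh x ~= 0 ==> dist a x < r"
proof
 let ?rh = "%x. exp_inv 0 (r^2 - (x - a) \<bullet> (x - a))"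
 show "smooth_on UNIV ?rh" by (intro smooth_on_diff smooth_on_id smooth_on_const open_UNIV smooth_on_bilinear[OF
  bounded_bilinear_inner] smooth_comp[OF open_UNIV open_UNIV UNIV_I _ smooth_exp_inv])
 show "0 <= ?rh x" for x by (simp add: exp_inv_def)
 show "?rh a > 0" using assms by (simp add: exp_inv_def)
 show "dist a x < r" if "?rh x ~= 0" for x proof -
  have "(norm (x - a))^2 < r^2"
   using that by (simp add: exp_inv_def power2_norm_eq_inner split: if_splits)
  thus ?thesis
   using assms power2_less_imp_less[of "norm (x - a)" r] by (simp add: dist_norm norm_minus_commute)
 qed
qed

text \<open>The mean value theorem is used twice: first in direction \<open>u\<close>, on the
  difference of \<open>f\<close> along \<open>e *\<^sub>R v\<close>, and then in direction
  \<open>v\<close>, on the derivative just obtained.\<close>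

lemma second_difference: fixes f :: "'a::euclidean_space => real"
 assumes S: "open S" and f: "smooth_on S f" and c: "convex C" "C \<subseteq> S" and e: "e > 0"
  and in_C: "!!a b. 0 <= a ==> a <= e ==> 0 <= b ==> b <= e ==> x + a *\<^sub>R u + b *\<^sub>R v : C"
 obtains a b where "0 <= a" "a <= e" "0 <= b" "b <= e"
  "f (x + e *\<^sub>R u + e *\<^sub>R v) - f (x + e *\<^sub>R u) - f (x + e *\<^sub>R v) + f x =
   e^2 * FD (%y. FD f (at y) u) (at (x + a *\<^sub>R u + b *\<^sub>R v)) v"
proof -
 let ?Du = "%y. FD f (at y) u"
 let ?g = "%a. f (x + a *\<^sub>R u + e *\<^sub>R v) - f (x + a *\<^sub>R u)"
 have inS: "x + a *\<^sub>R u + b *\<^sub>R v : S" if "0 <= a" "a <= e" "0 <= b" "b <= e" for a b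
  using in_C[OF that] c(2) by auto
 have lin: "FD f (at y) (h *\<^sub>R u) = h * FD f (at y) u" if "y : S" for y h
  using linear_cmul[OF smooth_FD_linear[OF f that]] by simp
 have d: "((%a. f (x + a *\<^sub>R u + b *\<^sub>R v)) has_real_derivative ?Du (x + a *\<^sub>R u + b *\<^sub>R v))
  (at a)"
  if "0 <= a" "a <= e" "0 <= b" "b <= e" for a b proof -
  have "((%a. x + a *\<^sub>R u + b *\<^sub>R v) hfd (%h. h *\<^sub>R u)) (at a)"
   by (auto intro!: derivative_eq_intros)
  from has_derivative_compose[OF this smooth_hfd[OF f inS[OF that]]]
  show ?thesis
   by (simp add: has_field_derivative_def lin[OF inS[OF that]] mult.commute[of _ "FD _ _ _"])
 qed
 have "EX z>0. z < e & ?g e - ?g 0 = (e - 0) * (?Du (x + z *\<^sub>R u + e *\<^sub>R v) - ?Du (x + z *\<^sub>R u + 0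
  *\<^sub>R v))"
  by (rule MVT2[OF e]) (use d[of _ e] d[of _ 0] in \<open>auto intro!: DERIV_diff\<close>)
 then obtain a where a: "0 < a" "a < e"
  "?g e - ?g 0 = e * (?Du (x + a *\<^sub>R u + e *\<^sub>R v) - ?Du (x + a *\<^sub>R u + 0 *\<^sub>R v))" by auto
 let ?D2 = "%y. FD ?Du (at y)"
 have s2: "smooth_on S ?Du" by (rule smooth_FD[OF f])
 have d2: "((%b. ?Du (x + a *\<^sub>R u + b *\<^sub>R v)) has_real_derivative ?D2 (x + a *\<^sub>R u + b *\<^sub>R v)
  v) (at b)"
  if "0 <= b" "b <= e" for b proof -
  have i: "x + a *\<^sub>R u + b *\<^sub>R v : S" using inS a that by simp
  have "((%b. x + a *\<^sub>R u + b *\<^sub>R v) hfd (%h. h *\<^sub>R v)) (at b)"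
   by (auto intro!: derivative_eq_intros)
  from has_derivative_compose[OF this smooth_hfd[OF s2 i]]
  show ?thesis using linear_cmul[OF smooth_FD_linear[OF s2 i]]
   by (simp add: has_field_derivative_def mult.commute[of _ "FD _ _ _"])
 qed
 have "EX z>0. z < e & ?Du (x + a *\<^sub>R u + e *\<^sub>R v) - ?Du (x + a *\<^sub>R u + 0 *\<^sub>R v) = (e - 0) *
  ?D2 (x + a *\<^sub>R u + z *\<^sub>R v) v"
  by (rule MVT2[OF e]) (use d2 in auto)
 then obtain b where b: "0 < b" "b < e"
  "?Du (x + a *\<^sub>R u + e *\<^sub>R v) - ?Du (x + a *\<^sub>R u + 0 *\<^sub>R v) = e * ?D2 (x + a *\<^sub>R u + b
   *\<^sub>R v) v" by auto
 show thesis
  by (rule that[of a b]) (use a b in \<open>auto simp: power2_eq_square \<close>)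
qed

text \<open>The second difference is symmetric in \<open>u\<close> and \<open>v\<close>, so a value
  of one mixed derivative near \<open>x\<close> agrees with a value of the other near
  \<open>x\<close>; continuity carries this to \<open>x\<close> itself.\<close>

lemma frechet_derivative_commute: fixes f :: "'a::euclidean_space => real"
 assumes S: "open S" and f: "smooth_on S f" and x: "x : S"
 shows "FD (%y. FD f (at y) u) (at x) v =
  FD (%y. FD f (at y) v) (at x) u" (is "?A x = ?B x")
proof (rule ccontr)
 assume ne: "?A x ~= ?B x"
 define ep where "ep = abs (?A x - ?B x) / 2"
 have ep: "ep > 0" using ne by (simp add: ep_def)
 have cont: "continuous_on S ?A" "continuous_on S ?B"
  by (auto intro!: smooth_ctn smooth_FD f)
 have isC: "isCont ?A x" "isCont ?B x" using cont S x by (auto simp: continuous_on_eq_continuous_at)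
 obtain d1 where d1: "d1 > 0" "!!y. dist y x < d1 ==> dist (?A y) (?A x) < ep"
  using isC(1) ep unfolding continuous_at_eps_delta by blast
 obtain d2 where d2: "d2 > 0" "!!y. dist y x < d2 ==> dist (?B y) (?B x) < ep"
  using isC(2) ep unfolding continuous_at_eps_delta by blast
 obtain d3 where d3: "d3 > 0" "ball x d3 \<subseteq> S" using S x open_contains_ball by blast
 define d where "d = min d1 (min d2 d3)"
 have d: "d > 0" using d1 d2 d3 by (simp add: d_def)
 \<comment> \<open>With this size the whole parallelogram stays within distance \<open>d / 2\<close>
   of \<open>x\<close>.\<close>
 define e where "e = d / (2 * (norm u + norm v + 1))"
 have e: "e > 0" using d by (simp add: e_def add_nonneg_pos)
 have inb: "x + a *\<^sub>R u + b *\<^sub>R v : ball x d" if "0 <= a" "a <= e" "0 <= b" "b <= e" for a b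
 proof -
  have "norm (a *\<^sub>R u + b *\<^sub>R v) <= e * norm u + e * norm v"
   using that by (intro norm_triangle_le add_mono) (auto intro: mult_right_mono)
  also have "... <= e * (norm u + norm v + 1)" using e by (simp add: algebra_simps)
  also have "... = d / 2" proof -
   have "norm u + norm v + 1 > 0" by (simp add: add_nonneg_pos)
   thus ?thesis unfolding e_def by (simp add: field_simps)
  qed
  also have "... < d" using d by simp
  finally have "norm (- (a *\<^sub>R u + b *\<^sub>R v)) < d" by (simp only: norm_minus_cancel)
  thus ?thesis by (simp add: dist_norm)
 qed
 have C: "convex (ball x d)" "ball x d \<subseteq> S" using d3 by (auto simp: d_def)
 obtain a b where ab: "0 <= a" "a <= e" "0 <= b" "b <= e"
  "f (x + e *\<^sub>R u + e *\<^sub>R v) - f (x + e *\<^sub>R u) - f (x + e *\<^sub>R v) + f x = e^2 * ?A (x + a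
   *\<^sub>R u + b *\<^sub>R v)"
  using second_difference[OF S f C e inb] by blast
 have inb': "x + a *\<^sub>R v + b *\<^sub>R u : ball x d" if "0 <= a" "a <= e" "0 <= b" "b <= e" for a b
  using inb[of b a] that by (simp add: add.assoc add.commute[of "a *\<^sub>R v"])
 obtain a' b' where ab': "0 <= a'" "a' <= e" "0 <= b'" "b' <= e"
  "f (x + e *\<^sub>R v + e *\<^sub>R u) - f (x + e *\<^sub>R v) - f (x + e *\<^sub>R u) + f x = e^2 * ?B (x + a'
   *\<^sub>R v + b' *\<^sub>R u)"
  using second_difference[OF S f C e inb'] by blast
 have "e^2 * ?A (x + a *\<^sub>R u + b *\<^sub>R v) = e^2 * ?B (x + a' *\<^sub>R v + b' *\<^sub>R u)"
 proof -
  have eq: "x + e *\<^sub>R v + e *\<^sub>R u = x + e *\<^sub>R u + e *\<^sub>R v" by simp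
  show ?thesis using ab(5) ab'(5)[unfolded eq] by linarith
 qed
 hence eq: "?A (x + a *\<^sub>R u + b *\<^sub>R v) = ?B (x + a' *\<^sub>R v + b' *\<^sub>R u)" using e by simp
 have "dist (?A (x + a *\<^sub>R u + b *\<^sub>R v)) (?A x) < ep"
  by (rule d1(2)) (use inb[OF ab(1-4)] in \<open>simp add: d_def dist_commute\<close>)
 moreover have "dist (?B (x + a' *\<^sub>R v + b' *\<^sub>R u)) (?B x) < ep"
  by (rule d2(2)) (use inb'[OF ab'(1-4)] in \<open>simp add: d_def dist_commute\<close>)
 ultimately have "abs (?A x - ?B x) < 2 * ep" unfolding eq dist_real_def by linarith
 thus False by (simp add: ep_def)
qed

section \<open>Smooth functions on a compact Lie group\<close>

lemma open_pre:
 "continuous_on S f ==> open S ==> open B ==> open {x : S. f x : B}"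
 using continuous_open_preimage[of S f B] by (simp add: vimage_def Int_def)

lemma ctn_local: fixes f :: "'a::t2_space => 'b::topological_space"
 assumes "!!x. x : S ==> EX T. open T & x : T & continuous_on T f" shows "continuous_on S f"
proof (rule continuous_at_imp_continuous_on, rule ballI)
 fix x assume "x : S"
 then obtain T where T: "open T" "x : T" "continuous_on T f" using assms by auto
 thus "isCont f x" using continuous_on_eq_continuous_at[OF T(1), of f] by auto
qed

locale compact_lie = fixes G :: "('g::t2_space, 'n::finite) lie_group" (structure)
 assumes compact_lie: "compact_lie_group G"
begin

lemma carrier_UNIV [simp]: "carrier G = UNIV" using compact_lie by (simp add: compact_lie_group_def)

sublocale group G using compact_lie by (simp add: compact_lie_group_def)

lemma mult_cancel_simps [simp]:
 "inv x \<otimes> (x \<otimes> y) = y" "x \<otimes> (inv x \<otimes> y) = y" "x \<otimes> y \<otimes> inv y = x"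
  "x \<otimes> inv y \<otimes> y = x"
 by (simp_all add: m_assoc[symmetric]) (simp_all add: m_assoc)

lemma compact_UNIV: "compact (UNIV :: 'g set)"
 using compact_lie by (simp add: compact_lie_group_def)

lemma ctn_group_mult:
 "continuous_on S f ==> continuous_on S g ==> continuous_on S (%x. f x \<otimes> g x)"
 using continuous_on_compose2[of UNIV "%(x, y). x \<otimes> y" S "%x. (f x, g x)"] compact_lie
 by (auto simp: compact_lie_group_def intro: continuous_on_Pair)

lemma ctn_group_inv: "continuous_on S f ==> continuous_on S (%x. inv (f x))"
 using continuous_on_compose2[of UNIV "%x. inv x" S f] compact_lie
 by (auto simp: compact_lie_group_def)

definition charts :: "('g, 'n) chart set" where "charts = atlas G"

definition cdom :: "('g, 'n) chart => (real ^ 'n) set" where "cdom c = snd c ` fst c"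

lemma chart_cover: "EX c:charts. x : fst c"
 using compact_lie by (auto simp: compact_lie_group_def smooth_atlas_def charts_def)

lemma chartD: assumes "c : charts"
 shows "open (fst c)" "open (cdom c)" "continuous_on (fst c) (snd c)" "continuous_on (cdom c) (chart_inv c)"
  "!!x. x : fst c ==> chart_inv c (snd c x) = x" "!!x. x : fst c ==> snd c x : cdom c"
  "!!y. y : cdom c ==> snd c (chart_inv c y) = y" "!!y. y : cdom c ==> chart_inv c y : fst c"
using assms compact_lie by (auto simp: compact_lie_group_def smooth_atlas_def charts_def is_chart_def
 homeomorphism_def cdom_def)

lemma chart_transition: assumes "c : charts" "c' : charts"
 shows "smooth_on {y : cdom c. chart_inv c y : fst c'} (%y. snd c' (chart_inv c y))" proof -
 have "{y : cdom c. chart_inv c y : fst c'} = snd c ` (fst c \<inter> fst c')"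
  using chartD[OF assms(1)] unfolding cdom_def by auto
 thus ?thesis
  using assms compact_lie by (simp add: compact_lie_group_def smooth_atlas_def charts_def o_def)
qed

text \<open>Continuity is demanded separately: it makes the preimages of chart domains open, and
  only on open sets is \<open>smooth_on\<close> meaningful.\<close>

definition gmap_on :: "'a::euclidean_space set => ('a => 'g) => bool" where
 "gmap_on S ph \<longleftrightarrow> continuous_on S ph &
  (ALL c:charts. smooth_on {s : S. ph s : fst c} (%s. snd c (ph s)))"

lemma gmap_ctn: "gmap_on S ph ==> continuous_on S ph" by (simp add: gmap_on_def)

lemma gmap_on_smooth: "gmap_on S ph ==> c : charts ==> smooth_on {s : S. ph s : fst c} (%s. snd c (ph s))"
 by (simp add: gmap_on_def)

text \<open>One chart near each point suffices, because the transition maps carry smoothness to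
  every other chart.\<close>

lemma gmap_onI:
 assumes "!!s. s : S ==> EX T c. open T & s : T & c : charts & (ALL t:T. ph t : fst c) & smooth_on T (%t. snd c (ph
  t))"
  and S: "open S" shows "gmap_on S ph" unfolding gmap_on_def proof (intro conjI ballI)
 have cT: "continuous_on T ph" if "c : charts" "ALL t:T. ph t : fst c" "smooth_on T (%t. snd c (ph t))" for T c
 proof -
  show ?thesis by (rule continuous_on_eq, (rule continuous_on_compose2[OF chartD(4)[OF that(1)] smooth_ctn[OF
   that(3)]]), (use chartD[OF that(1)] that(2) in auto))
 qed
 show c: "continuous_on S ph" proof (rule ctn_local)
  fix s assume "s : S"
  from assms(1)[OF this] obtain T c where "open T" "s : T" "c : charts" "ALL t:T. ph t : fst c"
   "smooth_on T (%t. snd c (ph t))" by blast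
  thus "EX T. open T & s : T & continuous_on T ph" using cT by blast
 qed
 fix c' assume c': "c' : charts"
 show "smooth_on {s : S. ph s : fst c'} (%s. snd c' (ph s))" proof (rule smooth_on_local)
  fix s assume "s : {s : S. ph s : fst c'}"
  hence s: "s : S" "ph s : fst c'" by auto
  obtain T c where T: "open T" "s : T" "c : charts" "ALL t:T. ph t : fst c" "smooth_on T (%t. snd c (ph t))"
   using assms(1)[OF s(1)] by auto
  let ?T = "{t : T. ph t : fst c'}" and ?W = "{y : cdom c. chart_inv c y : fst c'}"
  have o: "open ?T" by (rule open_pre[OF cT[OF T(3-5)] T(1) chartD(1)[OF c']])
  have "smooth_on ?T (%t. snd c' (ph t))"
   by (rule smooth_cong[OF o, rotated], (rule smooth_comp[OF o open_pre[OF chartD(4,2)[OF T(3)] chartD(1)[OF c']] _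
    smooth_on_subset[OF T(5)] chart_transition[OF T(3) c']]), (use T chartD[OF T(3)] in auto))
  thus "EX T. open T & s : T & smooth_on T (%s. snd c' (ph s))" using o s(2) T(2) by blast
 qed
qed

lemma gmap_on_subset: "gmap_on S ph ==> T \<subseteq> S ==> gmap_on T ph"
 unfolding gmap_on_def by (auto intro: continuous_on_subset elim!: smooth_on_subset)

lemma gmap_on_const: "gmap_on S (%_. g)" proof -
 obtain c where "c : charts" "g : fst c" using chart_cover by blast
 hence "gmap_on UNIV (%_. g)" by (intro gmap_onI exI[of _ UNIV] exI[of _ c]) auto
 thus ?thesis by (rule gmap_on_subset) auto
qed

lemma gmap_on_chart_inv: assumes "c : charts" shows "gmap_on (cdom c) (chart_inv c)"
by (metis chartD[OF assms] assms gmap_onI[OF _ chartD(2)[OF assms]] smooth_cong[OF chartD(2)[OF assms] _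
 smooth_on_id])

lemma gmap_on_compose:
 assumes "open S" "open T" "!!s. s : S ==> h s : T" "smooth_on S h" "gmap_on T ph"
 shows "gmap_on S (%s. ph (h s))" unfolding gmap_on_def proof (intro conjI ballI)
 show c: "continuous_on S (%s. ph (h s))"
  by (rule continuous_on_compose2[OF gmap_ctn[OF assms(5)] smooth_ctn[OF assms(4)]])
   (use assms(3) in auto)
 show "smooth_on {s : S. ph (h s) : fst c} (%s. snd c (ph (h s)))" if c': "c : charts" for c
  by (rule smooth_comp[OF open_pre[OF c assms(1) chartD(1)[OF c']]
     open_pre[OF gmap_ctn[OF assms(5)] assms(2) chartD(1)[OF c']] _
     smooth_on_subset[OF assms(4)] gmap_on_smooth[OF assms(5) c']]) (use assms(3) in auto)
qed

lemma gmap_on_mult: assumes S: "open S" and ph: "gmap_on S ph" and ps: "gmap_on S ps"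
 shows "gmap_on S (%s. ph s \<otimes> ps s)" proof (rule gmap_onI[OF _ S])
 fix s assume s: "s : S"
 obtain c c' c'' where c: "c : charts" "ph s : fst c" "c' : charts" "ps s : fst c'"
  "c'' : charts" "ph s \<otimes> ps s : fst c''" using chart_cover by metis
 note cc = gmap_ctn[OF ph] gmap_ctn[OF ps]
 let ?T1 = "{s : S. ph s : fst c}" and ?T2 = "{s : S. ps s : fst c'}"
  and ?T3 = "{s : S. ph s \<otimes> ps s : fst c''}"
 let ?T = "?T1 \<inter> ?T2 \<inter> ?T3"
 have oT: "open ?T" by (auto intro!: open_pre S cc ctn_group_mult chartD c)
 let ?W = "{p : cdom c \<times> cdom c'. chart_inv c (fst p) \<otimes> chart_inv c' (snd p) : fst c''}"
 have cW: "continuous_on (cdom c \<times> cdom c') (%p. chart_inv c (fst p) \<otimes> chart_inv c' (snd p))"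
  by (intro ctn_group_mult continuous_on_compose2[OF chartD(4)[OF c(1)]]
    continuous_on_compose2[OF chartD(4)[OF c(3)]] continuous_intros) auto
 have oW: "open ?W" by (rule open_pre[OF cW]) (auto intro!: open_Times chartD c)
 \<comment> \<open>The smoothness axiom for the product is phrased with an image set; written as a
   preimage, the set is visibly open.\<close>
 have Weq: "?W = {(snd c x, snd c' y) |x y. x : fst c & y : fst c' & x \<otimes> y : fst c''}" (is "_ = ?W'")
 proof (intro subset_antisym subsetI)
  fix p assume p: "p : ?W"
  obtain a b where ab: "p = (a, b)" by (cases p)
  have "p = (snd c (chart_inv c a), snd c' (chart_inv c' b))"
   "chart_inv c a : fst c" "chart_inv c' b : fst c'" "chart_inv c a \<otimes> chart_inv c' b : fst c''"
   using p chartD[OF c(1)] chartD[OF c(3)] unfolding ab by auto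
  thus "p : ?W'" by blast
 next
  fix p assume "p : ?W'"
  thus "p : ?W" using chartD[OF c(1)] chartD[OF c(3)] by auto
 qed
 have smW: "smooth_on ?W (%p. snd c'' (chart_inv c (fst p) \<otimes> chart_inv c' (snd p)))"
  unfolding Weq using compact_lie c(1,3,5)
  by (auto simp: compact_lie_group_def charts_def case_prod_beta')
 have "smooth_on ?T (%t. (snd c (ph t), snd c' (ps t)))"
  by (intro smooth_on_Pair oT smooth_on_subset[OF gmap_on_smooth[OF ph c(1)]]
    smooth_on_subset[OF gmap_on_smooth[OF ps c(3)]]) auto
 from smooth_comp[OF oT oW _ this smW]
 have "smooth_on ?T (%t. snd c'' (chart_inv c (snd c (ph t)) \<otimes> chart_inv c' (snd c' (ps t))))"
  using chartD[OF c(1)] chartD[OF c(3)] by auto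
 hence "smooth_on ?T (%t. snd c'' (ph t \<otimes> ps t))"
  by (rule smooth_cong[OF oT, rotated]) (use chartD[OF c(1)] chartD[OF c(3)] in auto)
 thus "EX T c. open T & s : T & c : charts & (ALL t:T. ph t \<otimes> ps t : fst c) & smooth_on T (%t. snd c (ph t
  \<otimes> ps t))"
  using oT s c by (intro exI[of _ ?T] exI[of _ c'']) auto
qed

lemma gmap_on_inv: assumes S: "open S" and ph: "gmap_on S ph" shows "gmap_on S (%s. inv (ph s))"
proof (rule gmap_onI[OF _ S])
 fix s assume s: "s : S"
 obtain c c' where c: "c : charts" "ph s : fst c" "c' : charts" "inv (ph s) : fst c'"
  using chart_cover by metis
 note cc = gmap_ctn[OF ph]
 let ?T1 = "{s : S. ph s : fst c}" and ?T2 = "{s : S. inv (ph s) : fst c'}"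
 let ?T = "?T1 \<inter> ?T2"
 have oT: "open ?T"
  by (auto intro!: open_pre S cc ctn_group_inv chartD c)
 let ?W = "{a : cdom c. inv (chart_inv c a) : fst c'}"
 have oW: "open ?W" by (auto intro!: open_pre ctn_group_inv chartD c)
 have Weq: "?W = {snd c x |x. x : fst c & inv x : fst c'}" (is "_ = ?W'")
 using chartD[OF c(1)] by force
 have smW: "smooth_on ?W (%a. snd c' (inv (chart_inv c a)))"
  unfolding Weq using compact_lie c(1,3) by (auto simp: compact_lie_group_def charts_def)
 have "smooth_on ?T (%t. snd c (ph t))"
  by (intro smooth_on_subset[OF gmap_on_smooth[OF ph c(1)]]) auto
 from smooth_comp[OF oT oW _ this smW]
 have "smooth_on ?T (%t. snd c' (inv (chart_inv c (snd c (ph t)))))" using chartD[OF c(1)] by auto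
 hence "smooth_on ?T (%t. snd c' (inv (ph t)))"
  by (rule smooth_cong[OF oT, rotated]) (use chartD[OF c(1)] in auto)
 thus "EX T c. open T & s : T & c : charts & (ALL t:T. inv (ph t) : fst c) & smooth_on T (%t. snd c (inv (ph t)))"
  using oT s c by (intro exI[of _ ?T] exI[of _ c']) auto
qed

definition gsmooth :: "('g => 'b::real_normed_vector) => bool" where
 "gsmooth f \<longleftrightarrow> (ALL c:charts. smooth_on (cdom c) (%y. f (chart_inv c y)))"

lemma gsmooth_gmap: assumes S: "open S" and f: "gsmooth f" and ph: "gmap_on S ph"
 shows "smooth_on S (%s. f (ph s))" proof (rule smooth_on_local)
 fix s assume s: "s : S"
 obtain c where c: "c : charts" "ph s : fst c" using chart_cover by blast
 let ?T = "{s : S. ph s : fst c}"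
 have o: "open ?T" by (rule open_pre[OF gmap_ctn[OF ph] S chartD(1)[OF c(1)]])
 have "smooth_on ?T (%s. f (ph s))" by (rule smooth_cong[OF o, rotated], (rule smooth_comp[OF o chartD(2)[OF c(1)] _
  gmap_on_smooth[OF ph c(1)]]), (use f chartD[OF c(1)] c in \<open>auto simp: gsmooth_def\<close>))
 thus "EX T. open T & s : T & smooth_on T (%s. f (ph s))" using o s c by blast
qed

lemma gsmooth_ctn: "gsmooth f ==> continuous_on S f"
proof (rule continuous_on_subset[OF ctn_local])
 fix x assume f: "gsmooth f"
 obtain c where c: "c : charts" "x : fst c" using chart_cover by blast
 have "continuous_on (fst c) f" by (rule continuous_on_eq, (rule continuous_on_compose2[OF smooth_ctn chartD(3)[OF
  c(1)]]), (use f c chartD[OF c(1)] in \<open>auto simp: gsmooth_def\<close>))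
 thus "EX T. open T & x : T & continuous_on T f" using c chartD by blast
qed auto

end

section \<open>Ordinary differential equations\<close>

lemma smooth_on_lipschitz: fixes f :: "'a::euclidean_space => 'b::real_normed_vector"
 assumes S: "smooth_on S f" "K \<subseteq> S" "compact K" "convex K"
 obtains L where "L >= 0" "!!x y. x : K ==> y : K ==> norm (f x - f y) <= L * norm (x - y)" proof -
 have "EX M. ALL b:Basis. ALL x:K. norm (FD f (at x) b) <= M" proof -
  have "EX M. ALL x:K. norm (FD f (at x) b) <= M" for b proof -
   have "bounded ((%x. FD f (at x) b) ` K)"
    by (metis continuous_on_subset[OF smooth_ctn[OF smooth_FD[OF S(1)]] S(2)] compact_continuous_image
     compact_imp_bounded S(3))
   thus ?thesis by (simp add: bounded_iff)
  qed
  then obtain M where M: "!!b x. x : K ==> norm (FD f (at x) b) <= M b" by metis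
  have "M b <= Max (M ` Basis)" if "b : Basis" for b using that by simp
  thus ?thesis using M by (meson order_trans)
 qed
 then obtain M where M: "!!b x. b : Basis ==> x : K ==> norm (FD f (at x) b) <= M" by blast
 define L where "L = real DIM('a) * abs M"
 have on: "onorm (FD f (at x)) <= L" if x: "x : K" for x proof (rule onorm_bound)
  fix v
  have lin: "linear (FD f (at x))"
   using smooth_FD_linear[OF S(1)] S(2) x by auto
  have "norm (FD f (at x) v) <= (SUM b:Basis. norm ((v \<bullet> b) *\<^sub>R FD f (at x) b))"
   by (subst linear_Basis[OF lin]) (rule norm_sum)
  also have "... <= (SUM b:(Basis::'a set). norm v * abs M)" proof (rule sum_mono)
   fix b :: 'a assume b: "b : Basis"
   show "norm ((v \<bullet> b) *\<^sub>R FD f (at x) b) <= norm v * abs M" using M[OF b x] Basis_le_norm[OF b, of v]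
    by (simp add: mult_mono)
  qed
  finally show "norm (FD f (at x) v) <= L * norm v" by (simp add: L_def mult_ac)
 qed (simp add: L_def)
 show thesis proof
  show "L >= 0" by (simp add: L_def)
  fix x y assume xy: "x : K" "y : K"
  show "norm (f x - f y) <= L * norm (x - y)" proof (rule differentiable_bound[OF S(4) _ on xy])
   fix x assume "x : K"
   thus "(f hfd FD f (at x)) (at x within K)"
    using smooth_hfd[OF S(1)] S(2) has_derivative_at_withinI by blast
  qed
 qed
qed

text \<open>Gronwall: the squared difference times \<open>exp (- (2 * L) * t)\<close> does not
  increase for positive times, and times \<open>exp (2 * L * t)\<close> it does not decrease for
  negative ones, so it stays 0 on both sides of 0.\<close>

lemma ode_unique: fixes y z :: "real => 'a::euclidean_space"
 assumes y: "!!t. abs t < a ==> (y hvd F (y t)) (at t)" "!!t. abs t < a ==> y t : K"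
  and z: "!!t. abs t < a ==> (z hvd F (z t)) (at t)" "!!t. abs t < a ==> z t : K"
  and L: "!!x y. x : K ==> y : K ==> norm (F x - F y) <= L * norm (x - y)"
  and 0: "y 0 = z 0" and t: "abs t < a" shows "y t = z t" proof -
 define w where "w = (%t. y t - z t)"
 have dw: "(w hvd (F (y t) - F (z t))) (at t)" if "abs t < a" for t
  unfolding w_def by (intro has_vector_derivative_diff y(1) z(1) that)
 have bd: "abs (w t \<bullet> (F (y t) - F (z t))) <= L * (w t \<bullet> w t)" if "abs t < a" for t
 proof -
  have "abs (w t \<bullet> (F (y t) - F (z t))) <= norm (w t) * norm (F (y t) - F (z t))"
   by (rule Cauchy_Schwarz_ineq2)
  also have "... <= norm (w t) * (L * norm (w t))"
   unfolding w_def by (intro mult_left_mono L y(2) z(2) that) auto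
  finally show ?thesis by (simp add: power2_norm_eq_inner[symmetric] power2_eq_square mult_ac)
 qed
 have d: "((%t. (w t \<bullet> w t) * exp (c * t)) has_real_derivative
   (2 * (w t \<bullet> (F (y t) - F (z t))) + c * (w t \<bullet> w t)) * exp (c * t)) (at t)" if "abs t < a" for t c
 proof -
  have "((%t. w t \<bullet> w t) has_real_derivative 2 * (w t \<bullet> (F (y t) - F (z t)))) (at t)"
  proof -
   have "(%h. w t \<bullet> (h *\<^sub>R (F (y t) - F (z t))) + (h *\<^sub>R (F (y t) - F (z t))) \<bullet> w t) =
     (*) (2 * (w t \<bullet> (F (y t) - F (z t))))"
    by (rule ext) (simp add: inner_commute)
   thus ?thesis
    using has_derivative_inner[OF dw[OF that, unfolded has_vector_derivative_def] dw[OF that, unfolded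
     has_vector_derivative_def]]
    by (simp add: has_field_derivative_def)
  qed
  thus ?thesis by (auto intro!: derivative_eq_intros simp: algebra_simps)
 qed
 have w0: "w 0 = 0" using 0 by (simp add: w_def)
 have "w t \<bullet> w t <= 0" proof (cases "t >= 0")
  case True
  have "(w t \<bullet> w t) * exp (- (2 * L) * t) <= (w 0 \<bullet> w 0) * exp (- (2 * L) * 0)"
  proof (rule DERIV_nonpos_imp_nonincreasing[OF True, where f="%t. (w t \<bullet> w t) * exp (- (2 * L) * t)"])
   fix s assume s: "0 <= s" "s <= t"
   show "EX y. ((%t. (w t \<bullet> w t) * exp (- (2 * L) * t)) has_real_derivative y) (at s) & y <= 0"
    using d[of s "- (2 * L)"] bd[of s] s t by (intro exI) (auto simp: mult_le_0_iff)
  qed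
  thus ?thesis using w0 by (simp add: mult_le_0_iff)
 next
  case False
  have "(w t \<bullet> w t) * exp (2 * L * t) <= (w 0 \<bullet> w 0) * exp (2 * L * 0)"
  proof (rule DERIV_nonneg_imp_nondecreasing[where f="%t. (w t \<bullet> w t) * exp (2 * L * t)"])
   fix s assume s: "t <= s" "s <= 0"
   show "EX y. ((%t. (w t \<bullet> w t) * exp (2 * L * t)) has_real_derivative y) (at s) & y >= 0"
    using d[of s "2 * L"] bd[of s] s t by (intro exI conjI) auto
  qed (use False in simp)
  thus ?thesis using w0 by (simp add: mult_le_0_iff)
 qed
 hence "w t \<bullet> w t = 0" using inner_ge_zero[of "w t"] by linarith
 thus ?thesis by (simp add: w_def)
qed

text \<open>Composing the field with the nearest-point projection onto the ball makes it bounded and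
  Lipschitz everywhere, so the contraction principle applies to all bounded continuous functions;
  the fixed point stays in the ball, where the projection is the identity.\<close>

lemma picard: fixes F :: "'a::euclidean_space => 'a" assumes r: "r > 0" and L0: "L >= 0"
  and L: "!!x y. x : cball p r ==> y : cball p r ==> norm (F x - F y) <= L * norm (x - y)"
 obtains a y where "a > 0" "y 0 = p" "!!t. abs t < a ==> y t : cball p r"
  "!!t. abs t < a ==> (y hvd F (y t)) (at t)" proof -
 define cl where "cl = closest_point (cball p r)"
 have clin: "cl x : cball p r" for x unfolding cl_def by (rule closest_point_in_set) (use r in auto)
 have cl_lip: "dist (cl x) (cl y) <= dist x y" for x y
  unfolding cl_def by (rule closest_point_lipschitz) (use r in auto)
 define B where "B = norm (F p) + L * r"
 have FB: "norm (F x) <= B" if "x : cball p r" for x proof -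
  have "norm (F x) <= norm (F p) + norm (F x - F p)" by (metis add.commute diff_add_cancel norm_triangle_ineq)
  also have "norm (F x - F p) <= L * norm (x - p)" using L that r by simp
  also have "... <= L * r" using that L0 by (intro mult_left_mono) (auto simp: dist_norm norm_minus_commute)
  finally show ?thesis by (simp add: B_def)
 qed
 have B0: "B >= 0" using L0 r by (simp add: B_def)
 define H where "H = (%x. F (cl x))"
 have H_lip: "norm (H x - H y) <= L * norm (x - y)" for x y
  using L[OF clin clin, of x y] cl_lip[of x y] L0 unfolding H_def dist_norm
  by (meson mult_left_mono order_trans)
 have HB: "norm (H x) <= B" for x unfolding H_def by (rule FB[OF clin])
 have H_cont: "continuous_on A H" for A
 proof (rule continuous_on_iff[THEN iffD2], intro ballI allI impI)
  fix x and e :: real assume e: "e > 0"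
  have "dist (H x') (H x) < e" if "dist x' x < e / (L + 1)" for x' proof -
   have "dist (H x') (H x) <= (L + 1) * dist x' x"
    using H_lip[of x' x] norm_ge_zero[of "x' - x"] unfolding dist_norm distrib_right by linarith
   also have "... < e" using that L0 by (simp add: pos_less_divide_eq mult.commute)
   finally show ?thesis .
  qed
  thus "EX d>0. ALL x':A. dist x' x < d --> dist (H x') (H x) < e"
   using e L0 by (intro exI[of _ "e / (L + 1)"]) auto
 qed
 \<comment> \<open>The first bound makes the integral operator a contraction with factor 1/2, the
   second keeps the solution in the ball. The factor 3 comes from \<open>J\<close>, a difference of
   two integrals starting at \<open>- a\<close>, over lengths at most \<open>2 * a\<close> and
   \<open>a\<close>.\<close>
 define a where "a = min (1 / (6 * L + 6)) (r / (3 * B + 3))"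
 have a: "a > 0" "3 * a * L <= 1 / 2" "3 * a * B <= r" proof -
  show "a > 0" using L0 r B0 by (simp add: a_def)
  have "3 * a * L <= 3 * (1 / (6 * L + 6)) * L" unfolding a_def using L0 by (intro mult_right_mono) auto
  also have "... <= 1 / 2" using L0 by simp
  finally show "3 * a * L <= 1 / 2" .
  have "3 * a * B <= 3 * (r / (3 * B + 3)) * B" unfolding a_def using B0 by (intro mult_right_mono) auto
  also have "... <= r" using B0 r by (simp add: divide_simps)
  finally show "3 * a * B <= r" .
 qed
 \<comment> \<open>Clamping the time to the interval lets the functions live on the whole line,
   where the bounded continuous functions form a complete space.\<close>
 define cut where "cut = (%t::real. max (- a) (min a t))"
 have cut: "cut t : {- a..a}" for t using a by (auto simp: cut_def)
 define J where "J = (%(g::real => 'a) t. p + (integral {- a..t} g - integral {- a..0} g))"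
 have Jdiff: "norm (J g t - J h t) <= 3 * a * e"
  if "ctn g" "ctn h" "!!t. norm (g t - h t) <= e" "t : {-a..a}" for g h t e
 proof -
  have int: "g integrable_on {- a..s}" "h integrable_on {- a..s}" for s
   using that by (auto intro!: integrable_continuous_real intro: continuous_on_subset)
  have e0: "e >= 0" using that(3)[of 0] norm_ge_zero order_trans by blast
  have bd: "norm (integral {- a..s} g - integral {- a..s} h) <= e * (s - (- a))" if "s : {- a..a}" for s
   using integral_bound[of "-a" s "%t. g t - h t" e] \<open>ctn g\<close> \<open>ctn h\<close>
    \<open>!!t. norm (g t - h t) <= e\<close> that
   by (simp add: integral_diff int continuous_on_diff continuous_on_subset)
  have "norm (J g t - J h t) = norm ((integral {- a..t} g - integral {- a..t} h) - (integral {- a..0} g - integral {-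
   a..0} h))"
   by (simp add: J_def algebra_simps)
  also have "... <= e * (t - (- a)) + e * (0 - (- a))"
   by (rule norm_triangle_le_diff[OF add_mono[OF bd bd]]) (use that in auto)
  also have "... = e * (t + 2 * a)" by (simp add: algebra_simps)
  also have "... <= e * (3 * a)" using e0 that(4) by (intro mult_left_mono) auto
  finally show ?thesis by (simp add: mult_ac)
 qed
 have J0: "J (%_. 0) t = p" for t by (simp add: J_def)
 have Hy_cont: "continuous_on A (%t. H (apply_bcontfun y t))" for A y
  by (rule continuous_on_compose2[OF H_cont[of UNIV]]) auto
 define T where "T = (%y. Bcontfun (%t. J (%t. H (apply_bcontfun y t)) (cut t)))"
 have Tb: "(%t. J (%t. H (apply_bcontfun y t)) (cut t)) : bcontfun" for y
 proof (rule bcontfun_normI)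
  have "continuous_on {- a..a} (J (%t. H (apply_bcontfun y t)))"
   by (simp add: J_def indefinite_integral_continuous_1 integrable_continuous_real Hy_cont continuous_intros)
  thus "ctn (%t. J (%t. H (apply_bcontfun y t)) (cut t))"
   by (rule continuous_on_compose2) (use cut in \<open>auto simp: cut_def intro!: continuous_intros\<close>)
  fix t
  have "norm (J (%t. H (apply_bcontfun y t)) (cut t) - J (%_. 0) (cut t)) <= 3 * a * B"
   by (rule Jdiff) (use Hy_cont HB cut in auto)
  thus "norm (J (%t. H (apply_bcontfun y t)) (cut t)) <= norm p + r"
   unfolding J0 using a(3) norm_triangle_sub[of "J (%t. H (apply_bcontfun y t)) (cut t)" p] by linarith
 qed
 have Tapp: "apply_bcontfun (T y) t = J (%t. H (apply_bcontfun y t)) (cut t)" for y t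
  unfolding T_def using Tb by (simp add: Bcontfun_inverse)
 have "EX! y. T y = y" proof (rule banach_fix_type[of "1/2"], simp, simp, intro allI)
  fix y z
  show "dist (T y) (T z) <= 1 / 2 * dist y z" proof (rule dist_bound)
   fix t
   have "norm (H (apply_bcontfun y t) - H (apply_bcontfun z t)) <= L * dist y z" for t
    using H_lip[of "apply_bcontfun y t" "apply_bcontfun z t"] dist_bounded[of y t z] L0
    by (simp add: dist_norm) (meson mult_left_mono order_trans)
   hence "norm (J (%t. H (apply_bcontfun y t)) (cut t) - J (%t. H (apply_bcontfun z t)) (cut t)) <= 3 * a * (L * dist
    y z)"
    by (intro Jdiff Hy_cont cut) auto
   also have "... <= 1 / 2 * dist y z" using mult_right_mono[OF a(2), of "dist y z"] by simp
   finally show "dist (apply_bcontfun (T y) t) (apply_bcontfun (T z) t) <= 1 / 2 * dist y z"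
    by (simp add: Tapp dist_norm)
  qed
 qed
 then obtain Y where Y: "T Y = Y" by auto
 define y where "y = apply_bcontfun Y"
 have yeq: "y t = J (%t. H (y t)) (cut t)" for t using Tapp[of Y t] by (simp add: Y y_def)
 have y_in: "y t : cball p r" for t proof -
  have "norm (J (%t. H (y t)) (cut t) - J (%_. 0) (cut t)) <= 3 * a * B"
   unfolding y_def by (rule Jdiff) (use Hy_cont HB cut in auto)
  thus ?thesis using a(3) unfolding J0 yeq[symmetric] by (simp add: dist_norm norm_minus_commute)
 qed
 show thesis proof (rule that[of a y])
  show "y 0 = p" using a by (subst yeq) (simp add: J_def cut_def)
  fix t assume t: "abs t < a"
  have "((%t. integral {- a..t} (%t. H (y t))) hvd H (y t)) (at t within {- a..a})"
   by (rule integral_has_vector_derivative) (use Hy_cont t in \<open>auto simp: y_def\<close>)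
  hence "(J (%t. H (y t)) hvd H (y t)) (at t)" using at_within_Icc_at[of "- a" t a] t
   by (auto simp: J_def intro!: derivative_eq_intros)
  hence "(y hvd H (y t)) (at t)"
  proof (rule has_vector_derivative_transform_within_open[of _ _ _ "{- a<..<a}"])
   fix s assume "s : {- a<..<a}"
   thus "J (%t. H (y t)) s = y s" using yeq[of s] by (simp add: cut_def)
  qed (use t in auto)
  thus "(y hvd F (y t)) (at t)" by (metis closest_point_self[OF y_in] H_def cl_def)
 qed (use a y_in in auto)
qed

text \<open>Composition with \<open>F\<close> keeps the order of differentiability, and the equation
  raises it by one.\<close>

lemma ode_solution_smooth: fixes y :: "real => 'a::euclidean_space"
 assumes S: "open S" and T: "open T" and y: "!!t. t : T ==> (y hvd F (y t)) (at t)"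
  and yS: "!!t. t : T ==> y t : S" and F: "smooth_on S F" shows "smooth_on T y" proof -
 have "Ck_on k T y" for k proof (induction k)
  case 0
  show ?case by (auto intro!: continuous_at_imp_continuous_on ballI has_vector_derivative_continuous[OF y])
 next
  case (Suc k)
  have "Ck_on k T (%t. F (y t))"
   by (rule Ck_on_compose[OF T S yS Suc]) (use F in \<open>auto simp: smooth_on_def\<close>)
  hence "Ck_on k T (%t. h *\<^sub>R F (y t))" for h by (intro Ck_on_scaleR T Ck_on_const)
  from Ck_on_SucI[OF T y[unfolded has_vector_derivative_def] this] show ?case .
 qed
 thus ?thesis by (simp add: smooth_on_def)
qed

lemma FD_partial2: assumes "open S" "smooth_on S Q" "(a, b) : S"
 shows "FD (%b. Q (a, b)) (at b) v = FD Q (at (a, b)) (0, v)"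
  and "((%b. Q (a, b)) hfd (%v. FD Q (at (a, b)) (0, v))) (at b)" proof -
 have "((%b. (a, b)) hfd (%v. (0, v))) (at b)" by (auto intro!: derivative_eq_intros)
 from has_derivative_compose[OF this smooth_hfd[OF assms(2,3)]]
 show d: "((%b. Q (a, b)) hfd (%v. FD Q (at (a, b)) (0, v))) (at b)" .
 show "FD (%b. Q (a, b)) (at b) v = FD Q (at (a, b)) (0, v)"
  using frechet_derivative_at[OF d] by metis
qed

lemma smooth_on_partial2:
 fixes Q :: "'a::euclidean_space \<times> 'b::euclidean_space => 'c::real_normed_vector"
 assumes "open S" "smooth_on S Q" "open T" "smooth_on T h" "!!a. a : T ==> (a, h a) : S"
 shows "smooth_on T (%a. FD (%b. Q (a, b)) (at (h a)) v)" proof -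
 show ?thesis using smooth_comp[OF assms(3,1,5) smooth_on_Pair[OF assms(3) smooth_on_id assms(4)] smooth_FD[OF
  assms(2)]] by (rule smooth_cong[OF assms(3), rotated]) (use FD_partial2(1)[OF assms(1,2,5)] in auto)
qed

lemma hfd_transform:
 assumes "(f hfd f') (at x)" "open T" "x : T" "!!y. y : T ==> f y = g y"
 shows "(g hfd f') (at x)" using has_derivative_transform_within_open[OF assms] .

section \<open>Left-invariant derivatives and their expression in charts\<close>

context compact_lie
begin

definition c0 :: "('g, 'n) chart" where "c0 = chart_at G \<one>"
definition b0 :: "real ^ 'n" where "b0 = snd c0 \<one>"

lemma c0: "c0 : charts" "\<one> : fst c0" proof -
 have "EX c. c : atlas G & \<one> : fst c" using chart_cover[of \<one>] by (auto simp: charts_def)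
 from someI_ex[OF this] show "c0 : charts" "\<one> : fst c0"
  by (simp_all add: c0_def chart_at_def charts_def)
qed

lemma b0: "b0 : cdom c0" "chart_inv c0 b0 = \<one>"
 using chartD[OF c0(1)] c0(2) by (auto simp: b0_def)

lemma gmap_on_translate:
 "c : charts ==> gmap_on (cdom c) (%b. x \<otimes> chart_inv c b)"
 by (intro gmap_on_mult gmap_on_const gmap_on_chart_inv chartD)

lemma gmap_on_chart_mult: assumes "c : charts" "c' : charts"
 shows "gmap_on (cdom c \<times> cdom c') (%p. chart_inv c (fst p) \<otimes> chart_inv c' (snd p))"
 using assms
 by (intro gmap_on_mult open_Times chartD gmap_on_compose[OF _ chartD(2) _ _ gmap_on_chart_inv]
   smooth_on_linear bounded_linear_fst bounded_linear_snd) auto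

text \<open>The derivative along a left-invariant field, taken in the coordinates of
  \<open>c0\<close> at the identity so that it exists before the exponential map does;
  \<open>left_field_eq\<close> identifies it with \<open>left_field\<close>.\<close>

definition lder :: "real ^ 'n => ('g => 'b::real_normed_vector) => 'g => 'b" where
 "lder Y f x = FD (%b. f (x \<otimes> chart_inv c0 b)) (at b0) Y"

lemma lder_hfd: assumes "gsmooth f"
 shows "((%b. f (x \<otimes> chart_inv c0 b)) hfd (%Y. lder Y f x)) (at b0)"
 using smooth_hfd[OF gsmooth_gmap[OF chartD(2)[OF c0(1)] assms gmap_on_translate[OF c0(1)]] b0(1)]
 by (simp add: lder_def)

lemma linear_lder: "gsmooth f ==> linear (%Y. lder Y f x)"
 by (rule has_derivative_linear[OF lder_hfd])

lemma lder_translate: "lder Y (%x. f (g \<otimes> x)) x = lder Y f (g \<otimes> x)"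
 by (simp add: lder_def m_assoc)

lemma gsmooth_lder: assumes f: "gsmooth f" shows "gsmooth (lder Y f)" unfolding gsmooth_def proof
 fix c assume c: "c : charts"
 let ?S = "cdom c \<times> cdom c0"
 have "smooth_on ?S (%p. f (chart_inv c (fst p) \<otimes> chart_inv c0 (snd p)))"
  by (rule gsmooth_gmap[OF _ f gmap_on_chart_mult[OF c c0(1)]]) (intro open_Times chartD c c0)
 from smooth_on_partial2[OF open_Times[OF chartD(2)[OF c] chartD(2)[OF c0(1)]] this chartD(2)[OF c] smooth_on_const[of
  _ b0], of Y]
 show "smooth_on (cdom c) (%y. lder Y f (chart_inv c y))" unfolding lder_def using b0 by simp
qed

abbreviation toid :: "('g, 'n) chart => real ^ 'n => real ^ 'n => real ^ 'n" where
 "toid == to_identity G"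

lemma toid_def': "toid c y v = FD (%z. snd c0 (inv (chart_inv c y) \<otimes> chart_inv c z)) (at y) v"
 by (simp add: to_identity_def c0_def)

text \<open>A two-variable form of the map behind \<open>to_identity\<close>: the base point becomes
  a variable, so that smooth dependence on it can be stated.\<close>

lemma toid_set: assumes c: "c : charts"
 defines "W == {p : cdom c \<times> cdom c. inv (chart_inv c (fst p)) \<otimes> chart_inv c (snd p) : fst c0}"
 shows "open W" "smooth_on W (%p. snd c0 (inv (chart_inv c (fst p)) \<otimes> chart_inv c (snd p)))"
  "y : cdom c ==> (y, y) : W" proof -
 have g: "gmap_on (cdom c \<times> cdom c) (%p. inv (chart_inv c (fst p)) \<otimes> chart_inv c (snd p))"
  using c by (intro gmap_on_mult gmap_on_inv open_Times chartD gmap_on_compose[OF _ chartD(2) _ _ gmap_on_chart_inv]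
   smooth_on_linear bounded_linear_fst bounded_linear_snd) auto
 show "open W" unfolding W_def
  by (rule open_pre[OF gmap_ctn[OF g]]) (intro open_Times chartD c c0)+
 show "smooth_on W (%p. snd c0 (inv (chart_inv c (fst p)) \<otimes> chart_inv c (snd p)))"
  unfolding W_def by (rule gmap_on_smooth[OF g c0(1)])
 show "y : cdom c ==> (y, y) : W" using c0 by (simp add: W_def)
qed

lemma toid_hfd: assumes c: "c : charts" "y : cdom c"
 shows "((%z. snd c0 (inv (chart_inv c y) \<otimes> chart_inv c z)) hfd toid c y) (at y)"
proof -
 note W = toid_set[OF c(1)]
 have "toid c y = (%v. FD (%p. snd c0 (inv (chart_inv c (fst p)) \<otimes> chart_inv c (snd p))) (at (y, y)) (0, v))"
  using FD_partial2(1)[OF W(1,2) W(3)[OF c(2)]] by (auto simp: toid_def')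
 thus ?thesis using FD_partial2(2)[OF W(1,2) W(3)[OF c(2)]] by simp
qed

lemma linear_toid: "c : charts ==> y : cdom c ==> linear (toid c y)"
 using toid_hfd has_derivative_linear by blast

lemma smooth_toid: assumes c: "c : charts" shows "smooth_on (cdom c) (%y. toid c y v)"
 using smooth_on_partial2[OF toid_set(1,2)[OF c] chartD(2)[OF c] smooth_on_id toid_set(3)[OF c], of v]
 by (simp add: toid_def')

text \<open>In every chart the differential of \<open>f\<close> is expressed by left-invariant
  derivatives, with \<open>toid\<close> trivialising the tangent bundle by left translation. The
  later calculus on the group runs through this formula.\<close>

lemma chart_hfd: assumes f: "gsmooth f" and c: "c : charts" "y : cdom c"
 shows "((%z. f (chart_inv c z)) hfd (%v. lder (toid c y v) f (chart_inv c y))) (at y)"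
proof -
 let ?x = "chart_inv c y"
 let ?T = "{z : cdom c. inv ?x \<otimes> chart_inv c z : fst c0}"
 have o: "open ?T"
  by (rule open_pre[OF gmap_ctn[OF gmap_on_translate[OF c(1)]]]) (intro chartD c c0)+
 have "((%b. f (?x \<otimes> chart_inv c0 b)) hfd (%Y. lder Y f ?x)) (at (snd c0 (inv ?x \<otimes> chart_inv c y)))"
  using lder_hfd[OF f, of ?x] by (simp add: b0_def)
 from has_derivative_compose[OF toid_hfd[OF c] this]
 have "((%z. f (?x \<otimes> chart_inv c0 (snd c0 (inv ?x \<otimes> chart_inv c z)))) hfd (%v. lder (toid c y v) f
  ?x)) (at y)" .
 thus ?thesis
  by (rule hfd_transform[OF _ o]) (use c c0 chartD(5)[OF c0(1)] in auto)
qed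

lemma curve_has_vector_derivative: fixes f :: "'g => 'b::real_normed_vector"
 assumes f: "gsmooth f" and ga: "continuous_on T ga" "open T" "0 : T" "ga 0 = \<one>"
  "((%t. snd c0 (ga t)) hvd Y) (at 0)"
 shows "((%t. f (x \<otimes> ga t)) hvd lder Y f x) (at (0::real))" proof -
 let ?T = "{t : T. ga t : fst c0}"
 have "((%b. f (x \<otimes> chart_inv c0 b)) hfd (%Y. lder Y f x)) (at (snd c0 (ga 0)))"
  using lder_hfd[OF f, of x] by (simp add: b0_def ga)
 from has_derivative_compose[OF ga(5)[unfolded has_vector_derivative_def] this]
 have "((%t. f (x \<otimes> chart_inv c0 (snd c0 (ga t)))) hfd (%h. h *\<^sub>R lder Y f x)) (at 0)"
  by (simp add: linear_cmul[OF linear_lder[OF f]])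
 thus ?thesis unfolding has_vector_derivative_def
  by (rule hfd_transform[OF _ open_pre[OF ga(1,2) chartD(1)[OF c0(1)]]]) (use ga c0 chartD(5)[OF c0(1)] in auto)
qed

subsection \<open>The exponential map\<close>

text \<open>The left-invariant vector field through \<open>Y\<close> in the coordinates of
  \<open>c0\<close>; its integral curve starting at \<open>b0\<close> is the one-parameter
  subgroup.\<close>

definition lfield :: "real ^ 'n => real ^ 'n => real ^ 'n" where
 "lfield Y y = FD (%b. snd c0 (chart_inv c0 y \<otimes> chart_inv c0 b)) (at b0) Y"

lemma mult_chart_set: assumes c: "c : charts"
 defines "W == {p : cdom c \<times> cdom c0. chart_inv c (fst p) \<otimes> chart_inv c0 (snd p) : fst c}"
 shows "open W" "smooth_on W (%p. snd c (chart_inv c (fst p) \<otimes> chart_inv c0 (snd p)))"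
  "y : cdom c ==> (y, b0) : W" proof -
 note g = gmap_on_chart_mult[OF c c0(1)]
 show "open W" unfolding W_def
  by (rule open_pre[OF gmap_ctn[OF g]]) (intro open_Times chartD c c0)+
 show "smooth_on W (%p. snd c (chart_inv c (fst p) \<otimes> chart_inv c0 (snd p)))"
  unfolding W_def by (rule gmap_on_smooth[OF g c])
 show "y : cdom c ==> (y, b0) : W" using b0 chartD[OF c] by (simp add: W_def)
qed

lemma smooth_lfield: "smooth_on (cdom c0) (lfield Y)" unfolding lfield_def
 using smooth_on_partial2[OF mult_chart_set(1,2)[OF c0(1)] chartD(2)[OF c0(1)] smooth_on_const mult_chart_set(3)[OF
  c0(1)], of Y]
 by simp

lemma lfield_hfd: assumes "y : cdom c0"
 shows "((%b. snd c0 (chart_inv c0 y \<otimes> chart_inv c0 b)) hfd (%Y. lfield Y y)) (at b0)"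
proof -
 note W = mult_chart_set[OF c0(1)]
 show ?thesis using FD_partial2(1)[OF W(1,2) W(3)[OF assms]] FD_partial2(2)[OF W(1,2) W(3)[OF assms]]
  by (simp add: lfield_def)
qed

text \<open>Associativity allows two computations of the derivative of
  \<open>x \<otimes> (g \<otimes> b)\<close> in \<open>b\<close>; their comparison is the left
  invariance of the field.\<close>

lemma lfield_translate: assumes y: "y : cdom c0" "x \<otimes> chart_inv c0 y : fst c0"
 shows "FD (%z. snd c0 (x \<otimes> chart_inv c0 z)) (at y) (lfield Y y) = lfield Y (snd c0 (x \<otimes> chart_inv c0
  y))"
  and "((%z. snd c0 (x \<otimes> chart_inv c0 z)) hfd
    FD (%z. snd c0 (x \<otimes> chart_inv c0 z)) (at y)) (at y)" proof -
 note c = c0(1)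
 let ?W = "{z : cdom c0. x \<otimes> chart_inv c0 z : fst c0}"
 show d: "((%z. snd c0 (x \<otimes> chart_inv c0 z)) hfd
    FD (%z. snd c0 (x \<otimes> chart_inv c0 z)) (at y)) (at y)"
  by (rule smooth_hfd[OF gmap_on_smooth[OF gmap_on_translate[OF c] c]]) (use y in simp)
 let ?g = "chart_inv c0 y"
 have d': "((%z. snd c0 (x \<otimes> chart_inv c0 z)) hfd
    FD (%z. snd c0 (x \<otimes> chart_inv c0 z)) (at y)) (at (snd c0 (?g \<otimes> chart_inv c0 b0)))"
  using d y by (simp add: b0 chartD[OF c])
 let ?T = "{b : cdom c0. ?g \<otimes> chart_inv c0 b : fst c0}"
 have o: "open ?T"
  by (rule open_pre[OF gmap_ctn[OF gmap_on_translate[OF c]]]) (intro chartD c)+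
 have 1: "((%b. snd c0 (x \<otimes> (?g \<otimes> chart_inv c0 b))) hfd
   (%Y. FD (%z. snd c0 (x \<otimes> chart_inv c0 z)) (at y) (lfield Y y))) (at
    b0)" using has_derivative_compose[OF lfield_hfd[OF y(1)] d'] by (rule hfd_transform[OF _ o]) (use y b0 chartD[OF
     c] in auto)
 have 2: "((%b. snd c0 (x \<otimes> (?g \<otimes> chart_inv c0 b))) hfd (%Y. lfield Y (snd c0 (x \<otimes> ?g)))) (at
  b0)"
  using lfield_hfd[OF chartD(6)[OF c y(2)]] y(2) by (simp add: chartD[OF c] m_assoc)
 show "FD (%z. snd c0 (x \<otimes> chart_inv c0 z)) (at y) (lfield Y y) = lfield Y (snd c0 (x \<otimes> chart_inv c0
  y))"
  using has_derivative_unique[OF 1 2] by meson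
qed

lemma translate_solution:
 assumes y: "(y hvd lfield Y (y t)) (at t)" "y t : cdom c0" "x \<otimes> chart_inv c0 (y t) : fst c0"
 shows "((%t. snd c0 (x \<otimes> chart_inv c0 (y t))) hvd lfield Y (snd c0 (x \<otimes> chart_inv c0 (y t)))) (at t)"
proof -
 show ?thesis
  using has_derivative_compose[OF y(1)[unfolded has_vector_derivative_def] lfield_translate(2)[OF y(2,3)]]
   unfolding has_vector_derivative_def by (simp add: linear_cmul[OF has_derivative_linear[OF lfield_translate(2)[OF
    y(2,3)]]] lfield_translate(1)[OF y(2,3)])
qed

lemma lfield_b0: "lfield Y b0 = Y" proof -
 have "((%b. snd c0 (chart_inv c0 b0 \<otimes> chart_inv c0 b)) hfd (%Y. Y)) (at b0)" using has_derivative_ident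
  by (rule hfd_transform[OF _ chartD(2)[OF c0(1)]]) (use b0 chartD[OF c0(1)] in auto)
 from has_derivative_unique[OF this lfield_hfd[OF b0(1)]] show ?thesis by metis
qed

lemma lfield_lipschitz:
 obtains r L where "r > 0" "cball b0 r \<subseteq> cdom c0" "L >= 0"
  "!!x y. x : cball b0 r ==> y : cball b0 r ==> norm (lfield Y x - lfield Y y) <= L * norm (x - y)"
proof -
 obtain r where r: "r > 0" "cball b0 r \<subseteq> cdom c0"
  using chartD(2)[OF c0(1)] b0(1) open_contains_cball by blast
 obtain L where L: "L >= 0"
  "!!x y. x : cball b0 r ==> y : cball b0 r ==> norm (lfield Y x - lfield Y y) <= L * norm (x - y)"
  using smooth_on_lipschitz[OF smooth_lfield[of Y] r(2) compact_cball convex_cball] by auto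
 show thesis by (rule that[OF r L])
qed

lemma gmap_on_local: assumes "!!s. s : S ==> EX T. open T & s : T & gmap_on T ph"
 shows "gmap_on S ph" unfolding gmap_on_def proof (intro conjI ballI)
 show "continuous_on S ph" proof (rule ctn_local)
  show "EX T. open T & s : T & continuous_on T ph" if "s : S" for s
   using assms[OF that] gmap_ctn by auto
 qed
 fix c assume c: "c : charts"
 show "smooth_on {s : S. ph s : fst c} (%s. snd c (ph s))" proof (rule smooth_on_local)
  fix s assume s: "s : {s : S. ph s : fst c}"
  then obtain T where T: "open T" "s : T" "gmap_on T ph" using assms by auto
  show "EX T. open T & s : T & smooth_on T (%s. snd c (ph s))"
   using s T open_pre[OF gmap_ctn[OF T(3)] T(1) chartD(1)[OF c]] gmap_on_smooth[OF T(3) c]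
   by (intro exI[of _ "{s : T. ph s : fst c}"]) auto
 qed
qed

lemma gmap_on_cong: assumes "open S" "!!s. s : S ==> ph s = ps s" "gmap_on S ph"
 shows "gmap_on S ps" unfolding gmap_on_def proof (intro conjI ballI)
 show "continuous_on S ps" by (rule continuous_on_eq[OF gmap_ctn[OF assms(3)] assms(2)])
 fix c assume c: "c : charts"
 have e: "{s : S. ps s : fst c} = {s : S. ph s : fst c}" using assms(2) by auto
 show "smooth_on {s : S. ps s : fst c} (%s. snd c (ps s))" unfolding e
  by (rule smooth_cong[OF open_pre[OF gmap_ctn[OF assms(3)] assms(1) chartD(1)[OF c]] _
    gmap_on_smooth[OF assms(3) c]]) (use assms(2) in auto)
qed

text \<open>As functions of \<open>t\<close>, the curves \<open>si (s + t)\<close> and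
  \<open>si s \<otimes> si t\<close> solve the same equation with the same initial value, the second
  one because left translates of integral curves are integral curves.\<close>

lemma local_one_parameter:
 obtains a si where "a > 0" "gmap_on {- a<..<a} si"
  "!!s t. abs s < a ==> abs t < a ==> si (s + t) = si s \<otimes> si t"
  "((%t. snd c0 (si t)) hvd Y) (at 0)" proof -
 note c = c0(1)
 obtain r L where r: "r > 0" "cball b0 r \<subseteq> cdom c0" "L >= 0"
  and L: "!!x y. x : cball b0 r ==> y : cball b0 r ==> norm (lfield Y x - lfield Y y) <= L * norm (x - y)"
  using lfield_lipschitz[of Y] by blast
 obtain a y where a: "a > 0" "y 0 = b0" "!!t. abs t < a ==> y t : cball b0 r"
  "!!t. abs t < a ==> (y hvd lfield Y (y t)) (at t)"
  using picard[OF r(1,3) L] by auto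
 have yc: "y t : cdom c0" if "abs t < a" for t using a(3)[OF that] r(2) by auto
 define si where "si = (%t. chart_inv c0 (y t))"
 have sc: "snd c0 (si t) = y t" if "abs t < a" for t using yc[OF that] chartD[OF c] by (simp add: si_def)
 have sy: "smooth_on {- a<..<a} y"
  by (rule ode_solution_smooth[OF chartD(2)[OF c] _ a(4) yc smooth_lfield]) auto
 have g: "gmap_on {- a<..<a} si" unfolding si_def
  by (rule gmap_on_compose[OF open_greaterThanLessThan chartD(2)[OF c] _ sy gmap_on_chart_inv[OF c]]) (use yc in auto)
 define V where "V = {x : fst c0. snd c0 x : ball b0 r}"
 have V: "open V" unfolding V_def by (rule open_pre[OF chartD(3,1)[OF c] open_ball])
 have cont: "continuous_on ({- a<..<a} \<times> {- a<..<a}) (%p. si (fst p) \<otimes> si (snd p))"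
  by (intro ctn_group_mult continuous_on_compose2[OF gmap_ctn[OF g]] continuous_intros) auto
 let ?W = "{p : {- a<..<a} \<times> {- a<..<a}. si (fst p) \<otimes> si (snd p) : V}"
 have "open ?W" by (rule open_pre[OF cont _ V]) (intro open_Times open_greaterThanLessThan)
 moreover have "(0, 0) : ?W" using a r b0 c0 by (simp add: V_def si_def b0_def[symmetric])
 ultimately obtain e where e: "e > 0" "ball (0, 0) e \<subseteq> ?W" using open_contains_ball by blast
 \<comment> \<open>Half of \<open>a\<close> keeps \<open>s + t\<close> in the domain of the
   solution, half of \<open>e\<close> keeps the product in \<open>V\<close>.\<close>
 define d where "d = min (a / 2) (e / 2)"
 have d: "d > 0" using a e by (simp add: d_def)
 have dV: "si s \<otimes> si t : V" if "abs s < d" "abs t < d" for s t proof -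
  have "(s, t) : ball (0, 0) e" using norm_Pair_le[of s t] that by (simp add: d_def dist_norm norm_Pair)
  thus ?thesis using e(2) by auto
 qed
 have hom: "si (s + t) = si s \<otimes> si t" if st: "abs s < d" "abs t < d" for s t
 proof -
  have sa: "abs (s + u) < a" "abs u < a" if "abs u < d" for u using st that by (auto simp: d_def)
  have "y (s + t) = snd c0 (si s \<otimes> si t)"
  proof (rule ode_unique[where F="lfield Y" and K="cball b0 r" and L=L and a=d and y="%t. y (s + t)"
   and z="%t. snd c0 (si s \<otimes> si t)"])
   show "((%t. y (s + t)) hvd lfield Y (y (s + u))) (at u)" if "abs u < d" for u
   proof -
    have "((%t. s + t) hfd (%h. h)) (at u)" by (auto intro!: derivative_eq_intros)
    from has_derivative_compose[OF this a(4)[OF sa(1)[OF that], unfolded has_vector_derivative_def]]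
    show ?thesis by (simp add: has_vector_derivative_def)
   qed
   show "((%t. snd c0 (si s \<otimes> si t)) hvd lfield Y (snd c0 (si s \<otimes> si u))) (at u)" if "abs u < d" for u
    using translate_solution[OF a(4)[OF sa(2)[OF that]] yc[OF sa(2)[OF that]], of "si s"] dV[OF st(1) that]
    by (simp add: V_def si_def)
   show "y (s + u) : cball b0 r" if "abs u < d" for u using a(3) sa that by simp
   show "snd c0 (si s \<otimes> si u) : cball b0 r" if "abs u < d" for u using dV[OF st(1) that] by (simp add: V_def)
   show "y (s + 0) = snd c0 (si s \<otimes> si 0)"
    using a(2) sc[of s] sa[of 0] d by (simp add: si_def b0)
  qed (use L st in auto)
  thus ?thesis using dV[OF st] chartD(5)[OF c] by (simp add: V_def si_def)
 qed
 have "(y hvd Y) (at 0)" using a(4)[of 0] a(1,2) lfield_b0 by simp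
 hence vel: "((%t. snd c0 (si t)) hvd Y) (at 0)"
  by (rule has_vector_derivative_transform_within_open[of _ _ _ "{- a<..<a}"]) (use a sc in auto)
 show thesis by (rule that[of d si, OF d gmap_on_subset[OF g] hom vel]) (auto simp: d_def)
qed

text \<open>The extension is \<open>si (t / n) [^] n\<close> for any large \<open>n\<close>; two
  choices of \<open>n\<close> agree through their product as a common refinement. Multiplicativity
  asks \<open>si (s / n)\<close> and \<open>si (t / n)\<close> to commute, which the local addition
  rule gives.\<close>

lemma extend_local_hom: fixes si :: "real => 'g"
 assumes a: "a > 0" and hom: "!!s t. abs s < a ==> abs t < a ==> si (s + t) = si s \<otimes> si t"
 obtains ga where "!!s t. ga (s + t) = ga s \<otimes> ga t" "!!t. abs t < a ==> ga t = si t"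
proof -
 have si0: "si 0 = \<one>" using hom[of 0 0] a by simp
 have pow: "si (real k * s) = si s [^] k" if "abs (real k * s) < a" for k s using that
 proof (induction k)
  case (Suc k)
  have "(real k + 1) * abs s < a" using Suc.prems by (simp add: add.commute)
  moreover have "0 <= real k * abs s" by simp
  ultimately have 1: "abs (real k * s) < a" "abs s < a"
   unfolding abs_mult abs_of_nat distrib_right by linarith+
  show ?case using hom[OF 1] Suc.IH[OF 1(1)] by (simp add: algebra_simps)
 qed (simp add: si0)
 define N where "N = (%t. nat \<lceil>abs t / a\<rceil> + 1)"
 have N: "abs t / real n < a" if "n >= N t" for n t proof -
  have "abs t / a < real (N t)" unfolding N_def by linarith
  also have "... <= real n" using that by simp
  finally show ?thesis using a that by (simp add: divide_simps mult.commute)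
 qed
 define ga where "ga = (%t. si (t / N t) [^] N t)"
 have eq: "si (t / n) [^] n = ga t" if n: "n >= 1" "abs t / real n < a" for n t proof -
  have *: "si (t / n) [^] n = si (t / (real n * real m)) [^] (m * n)" if "abs t / real n < a" "n >= 1" "m >= 1" for n
   m
  proof -
   show ?thesis using that pow[of m "t / (real n * real m)"] by (simp add: nat_pow_pow)
  qed
  have N1: "N t >= 1" by (simp add: N_def)
  show ?thesis unfolding ga_def
   using *[OF n(2,1) N1] *[OF N[OF order_refl] N1 n(1)] by (simp add: mult.commute)
 qed
 show thesis proof
  show "ga t = si t" if "abs t < a" for t using eq[of 1 t] that by simp
  fix s t
  define n where "n = N s + N t + N (s + t)"
  have n: "n >= 1" "abs s / real n < a" "abs t / real n < a" "abs (s + t) / real n < a"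
   unfolding n_def by (rule trans_le_add1, simp add: N_def) (rule N, simp)+
  have ab: "abs (s / real n) < a" "abs (t / real n) < a" using n by simp_all
  have "ga (s + t) = (si (s / n) \<otimes> si (t / n)) [^] n" by (metis eq[OF n(1,4)] hom[OF ab] add_divide_distrib)
  also have "... = si (s / n) [^] n \<otimes> si (t / n) [^] n"
   by (rule pow_mult_distrib) (use hom[OF ab] hom[OF ab(2,1)] in \<open>auto simp: add.commute\<close>)
  finally show "ga (s + t) = ga s \<otimes> ga t" using eq[OF n(1,2)] eq[OF n(1,3)] by simp
 qed
qed

lemma one_parameter_iff:
 "one_parameter_subgroup G ga \<longleftrightarrow> (ALL s t. ga (s + t) = ga s \<otimes> ga t) & gmap_on UNIV ga"
 by (simp add: one_parameter_subgroup_def gmap_on_def charts_def vimage_def o_def)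

lemma one_parD: assumes "one_parameter_subgroup G ga"
 shows "ga (s + t) = ga s \<otimes> ga t" "gmap_on UNIV ga" "ctn ga" "ga 0 = \<one>"
proof -
 show hom: "ga (s + t) = ga s \<otimes> ga t" for s t using assms by (simp add: one_parameter_iff)
 show "gmap_on UNIV ga" using assms by (simp add: one_parameter_iff)
 thus "ctn ga" by (rule gmap_ctn)
 show "ga 0 = \<one>" using hom[of 0 0] by simp
qed

lemma one_parameter_exists:
 obtains ga where "one_parameter_subgroup G ga" "((%t. snd c0 (ga t)) hvd Y) (at 0)"
proof -
 obtain a si where a: "a > 0" "gmap_on {- a<..<a} si"
  "!!s t. abs s < a ==> abs t < a ==> si (s + t) = si s \<otimes> si t"
  "((%t. snd c0 (si t)) hvd Y) (at 0)" using local_one_parameter by blast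
 obtain ga where ga: "!!s t. ga (s + t) = ga s \<otimes> ga t" "!!t. abs t < a ==> ga t = si t"
  using extend_local_hom[OF a(1,3)] by blast
 have "gmap_on UNIV ga" proof (rule gmap_on_local)
  fix s :: real
  let ?T = "{s - a<..<s + a}"
  have "gmap_on ?T (%t. ga s \<otimes> si (t - s))"
   by (auto intro!: gmap_on_compose[OF _ _ _ _ a(2), where h="%t. t - s"] smooth_on_diff smooth_on_id gmap_on_mult
    gmap_on_const)
  hence "gmap_on ?T ga" proof (rule gmap_on_cong[rotated 2])
   fix t assume "t : ?T"
   thus "ga s \<otimes> si (t - s) = ga t" using ga(2)[of "t - s"] ga(1)[of s "t - s"] by auto
  qed simp
  thus "EX T. open T & s : T & gmap_on T ga" using a(1) by (intro exI[of _ ?T]) auto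
 qed
 moreover have "((%t. snd c0 (ga t)) hvd Y) (at 0)"
  by (rule has_vector_derivative_transform_within_open[OF a(4), of "{- a<..<a}"]) (use a ga in auto)
 ultimately show thesis using that ga(1) one_parameter_iff by blast
qed

lemma one_parameter_solution:
 assumes "one_parameter_subgroup G ga" "((%t. snd c0 (ga t)) hvd Y) (at 0)" "ga t : fst c0"
 shows "((%t. snd c0 (ga t)) hvd lfield Y (snd c0 (ga t))) (at t)" proof -
 note c = c0(1)
 note hom = one_parD(1)[OF assms(1)] and cont = one_parD(3)[OF assms(1)] and g0 = one_parD(4)[OF assms(1)]
 let ?y = "snd c0 (ga t)"
 have d: "((%b. snd c0 (ga t \<otimes> chart_inv c0 b)) hfd (%Y. lfield Y ?y)) (at (snd c0 (ga 0)))"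
  using lfield_hfd[OF chartD(6)[OF c assms(3)]] by (simp add: chartD[OF c] assms(3) g0 b0_def)
 have "((%h. snd c0 (ga t \<otimes> chart_inv c0 (snd c0 (ga h)))) hfd (%h. lfield (h *\<^sub>R Y) ?y)) (at 0)"
  using has_derivative_compose[OF assms(2)[unfolded has_vector_derivative_def] d] .
 moreover have "lfield (h *\<^sub>R Y) ?y = h *\<^sub>R lfield Y ?y" for h
  using linear_cmul[OF has_derivative_linear[OF lfield_hfd[OF chartD(6)[OF c assms(3)]]]] by simp
 ultimately have "((%h. snd c0 (ga t \<otimes> chart_inv c0 (snd c0 (ga h)))) hfd (%h. h *\<^sub>R lfield Y ?y)) (at
  0)"
  by simp
 hence "((%h. snd c0 (ga (t + h))) hfd (%h. h *\<^sub>R lfield Y ?y)) (at (t - t))"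
  unfolding hom diff_self
  by (rule hfd_transform[OF _ open_pre[OF cont open_UNIV chartD(1)[OF c]]])
   (use g0 c0 chartD[OF c] in auto)
 moreover have "((%u. u - t) hfd (%h. h)) (at t)" by (auto intro!: derivative_eq_intros)
 ultimately have "((%u. snd c0 (ga (t + (u - t)))) hfd (%h. h *\<^sub>R lfield Y ?y)) (at t)"
  by (rule has_derivative_compose[rotated])
 thus ?thesis by (simp add: has_vector_derivative_def)
qed

text \<open>Near 0 this is uniqueness for the differential equation; dividing the time by a large
  integer brings every \<open>t\<close> into that range.\<close>

lemma one_parameter_unique:
 assumes ga: "one_parameter_subgroup G ga" "((%t. snd c0 (ga t)) hvd Y) (at 0)"
  and et: "one_parameter_subgroup G et" "((%t. snd c0 (et t)) hvd Y) (at 0)"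
 shows "ga = et" proof -
 note c = c0(1)
 obtain r L where r: "r > 0" "cball b0 r \<subseteq> cdom c0" "L >= 0"
  and L: "!!x y. x : cball b0 r ==> y : cball b0 r ==> norm (lfield Y x - lfield Y y) <= L * norm (x - y)"
  using lfield_lipschitz[of Y] by blast
 define V where "V = {x : fst c0. snd c0 x : ball b0 r}"
 have V: "open V" unfolding V_def by (rule open_pre[OF chartD(3,1)[OF c] open_ball])
 have ex: "EX e>0. ALL t. abs t < e --> ga t : V" if "one_parameter_subgroup G ga" for ga
 proof -
  note cont = one_parD(3)[OF that] and g0 = one_parD(4)[OF that]
  have "open {t. ga t : V}" using open_pre[OF cont open_UNIV V] by simp
  moreover have "0 : {t. ga t : V}" using g0 c0 r by (simp add: V_def b0_def)
  ultimately obtain e where "e > 0" "ball 0 e \<subseteq> {t. ga t : V}" using open_contains_ball by blast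
  thus ?thesis by (intro exI[of _ e]) (auto simp: dist_norm)
 qed
 obtain e1 where e1: "e1 > 0" "!!t. abs t < e1 ==> ga t : V" using ex[OF ga(1)] by auto
 obtain e2 where e2: "e2 > 0" "!!t. abs t < e2 ==> et t : V" using ex[OF et(1)] by auto
 define e where "e = min e1 e2"
 have e: "e > 0" using e1 e2 by (simp add: e_def)
 have 0: "ga 0 = et 0" by (simp add: one_parD(4)[OF ga(1)] one_parD(4)[OF et(1)])
 have small: "ga t = et t" if t: "abs t < e" for t proof -
  have V': "ga u : fst c0" "snd c0 (ga u) : cball b0 r" "et u : fst c0" "snd c0 (et u) : cball b0 r" if "abs u < e"
   for u
   using e1(2)[of u] e2(2)[of u] that by (simp_all add: V_def e_def)
  have eq: "snd c0 (ga t) = snd c0 (et t)"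
   by (rule ode_unique[where F="lfield Y" and K="cball b0 r" and L=L and a=e and y="%t. snd c0 (ga t)"
    and z="%t. snd c0 (et t)"])
    (use L t 0 V' one_parameter_solution[OF ga] one_parameter_solution[OF et] in auto)
  show ?thesis by (metis eq chartD(5)[OF c V'(1)[OF t], symmetric] chartD(5)[OF c V'(3)[OF t]])
 qed
 have pow: "ph (real n * t) = ph t [^] n" if "one_parameter_subgroup G ph" for ph n t
 proof (induction n)
  case 0
  show ?case by (simp add: one_parD(4)[OF that])
 next
  case (Suc n)
  have "ph (real (Suc n) * t) = ph (real n * t + t)" by (simp add: algebra_simps)
  also have "... = ph (real n * t) \<otimes> ph t" by (rule one_parD(1)[OF that])
  finally show ?case using Suc by simp
 qed
 show ?thesis proof
  fix t
  obtain n :: nat where n: "abs t / e < real n" using reals_Archimedean2 by blast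
  have "0 <= abs t / e" using e by simp
  hence n0: "real n > 0" using n by linarith
  show "ga t = et t" using n e small pow[OF ga(1), of n "t / n"] pow[OF et(1), of n "t / n"] n0
   by (simp add: divide_simps mult.commute)
 qed
qed

text \<open>The description inside \<open>lie_exp\<close> is well defined, and for
  \<open>t *\<^sub>R Y\<close> it picks the reparametrised subgroup \<open>ga (s * t)\<close>,
  evaluated at time 1.\<close>

lemma lie_exp_curve:
 obtains ga where "one_parameter_subgroup G ga" "((%t. snd c0 (ga t)) hvd Y) (at 0)"
  "!!t. lie_exp G (t *\<^sub>R Y) = ga t" proof -
 obtain ga where ga: "one_parameter_subgroup G ga" "((%t. snd c0 (ga t)) hvd Y) (at 0)"
  using one_parameter_exists by blast
 have "lie_exp G (t *\<^sub>R Y) = ga t" for t proof -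
  have g: "one_parameter_subgroup G (%s. ga (s * t))"
   by (simp add: distrib_right one_parD(1)[OF ga(1)] one_parameter_iff gmap_on_compose[OF open_UNIV open_UNIV UNIV_I _
    one_parD(2)[OF ga(1)]] smooth_on_linear bounded_linear_mult_left open_UNIV)
  have "((%s. s * t) hfd (%h. h * t)) (at 0)" by (auto intro!: derivative_eq_intros)
  moreover have "((%t. snd c0 (ga t)) hfd (%h. h *\<^sub>R Y)) (at (0 * t))"
   using ga(2) by (simp add: has_vector_derivative_def)
  ultimately have "((%s. snd c0 (ga (s * t))) hfd (%h. (h * t) *\<^sub>R Y)) (at 0)"
   by (rule has_derivative_compose)
  hence v: "((%s. snd c0 (ga (s * t))) hvd t *\<^sub>R Y) (at 0)"
   by (simp add: has_vector_derivative_def)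
  have "(THE et. one_parameter_subgroup G et & ((id_coord G \<circ> et) hvd t *\<^sub>R Y) (at 0)) = (%s. ga (s * t))"
   unfolding o_def c0_def[symmetric] proof (rule the_equality)
   fix et assume "one_parameter_subgroup G et & ((%s. snd c0 (et s)) hvd t *\<^sub>R Y) (at 0)"
   thus "et = (%s. ga (s * t))" using one_parameter_unique[of et "t *\<^sub>R Y" "%s. ga (s * t)"] g v by simp
  qed (use g v in simp)
  thus ?thesis by (simp add: lie_exp_def)
 qed
 thus thesis by (rule that[OF ga])
qed

lemma left_field_has_vector_derivative: assumes "gsmooth f"
 shows "((%t. f (x \<otimes> lie_exp G (t *\<^sub>R Y))) hvd lder Y f x) (at 0)"
proof -
 obtain ga where ga: "one_parameter_subgroup G ga" "((%t. snd c0 (ga t)) hvd Y) (at 0)"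
  "!!t. lie_exp G (t *\<^sub>R Y) = ga t" using lie_exp_curve by blast
 show ?thesis unfolding ga(3)
  by (rule curve_has_vector_derivative[OF assms one_parD(3)[OF ga(1)] open_UNIV UNIV_I one_parD(4)[OF ga(1)] ga(2)])
qed

lemma left_field_eq: "gsmooth f ==> left_field G Y f x = lder Y f x"
 unfolding left_field_def by (rule vector_derivative_at[OF left_field_has_vector_derivative])

end

section \<open>The invariant mean\<close>

context compact_lie
begin

text \<open>Finite averages of left translates; the corresponding averages of right translates are
 obtained by conjugating with the inversion.\<close>

inductive lop :: "(('g => real) => 'g => real) => bool" where
 base: "finite S ==> S ~= {} ==> lop (%f x. (SUM a:S. f (a \<otimes> x)) / card S)"
| comp: "lop T ==> lop T' ==> lop (%f. T (T' f))"

definition rop :: "(('g => real) => 'g => real) => ('g => real) => 'g => real" where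
 "rop T f x = T (%z. f (inv z)) (inv x)"

lemma lop_bounds: assumes "lop T"
 shows "(!!x. m <= f x) ==> m <= T f x" "(!!x. f x <= M) ==> T f x <= M" using assms
proof (induction arbitrary: f x)
 case (base S)
 {
  case 1
  have "(SUM a:S. m) <= (SUM a:S. f (a \<otimes> x))" by (rule sum_mono) (rule 1)
  thus ?case using base by (simp add: le_divide_eq mult.commute)
 next
  case 2
  have "(SUM a:S. f (a \<otimes> x)) <= (SUM a:S. M)" by (rule sum_mono) (rule 2)
  thus ?case using base by (simp add: divide_le_eq mult.commute)
 }
qed auto

lemma lop_linear: assumes "lop T"
 shows "T (%x. f x + g x) = (%x. T f x + T g x)" "T (%x. c * f x) = (%x. c * T f x)" using assms
  by (induction arbitrary: f g) (simp_all add: add_divide_distrib flip: sum_distrib_left)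

lemma lop_const: "lop T ==> T (%_. c) = (%_. c)" by (induction rule: lop.induct) auto

lemma lop_diff: "lop T ==> T (%x. f x - g x) = (%x. T f x - T g x)"
 using lop_linear(1)[of T f "%x. - 1 * g x"] lop_linear(2)[of T "-1" g] by simp

lemma lop_sum: assumes "lop T" "finite A" shows "T (%x. SUM a:A. f a x) = (%x. SUM a:A. T (f a) x)"
 using assms(2) proof (induction A rule: finite_induct)
 case empty
 thus ?case using lop_const[OF assms(1), of 0] by simp
next
 case (insert a A)
 thus ?case using lop_linear(1)[OF assms(1), of "f a" "%x. SUM a:A. f a x"] by simp
qed

lemma lop_abs_bound: "lop T ==> (!!x. abs (f x) <= B) ==> abs (T f x) <= B"
 using lop_bounds(1)[of T "- B" f x] lop_bounds(2)[of T f B x] by (simp add: abs_le_iff minus_le_iff)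

lemma lop_right_translate: "lop T ==> T (%x. f (x \<otimes> b)) = (%x. T f (x \<otimes> b))"
 by (induction arbitrary: f rule: lop.induct) (simp_all add: m_assoc)

lemma lop_continuous: "lop T ==> ctn f ==> ctn (T f)"
proof (induction arbitrary: f rule: lop.induct)
 case (base S)
 show ?case by (simp add: base card_eq_0_iff continuous_on_compose2[OF base(3)] ctn_group_mult continuous_intros)
next
 case (comp T T')
 show ?case by (rule comp.IH(1)[OF comp.IH(2)[OF comp.prems]])
qed

text \<open>Left and right translations commute, and their averages with them. This exchange is what
  makes the mean unique.\<close>

lemma rop_lop_commute: "lop T ==> lop T' ==> rop T (T' f) = T' (rop T f)"
proof (induction arbitrary: f rule: lop.induct)
 case (base S)
 have "rop (%f x. (SUM a:S. f (a \<otimes> x)) / card S) g = (%x. 1 / card S * (SUM a:S. g (x \<otimes> inv a)))" for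
  g
  by (simp add: rop_def fun_eq_iff inv_mult_group)
 thus ?case
  by (simp only: lop_linear(2)[OF base(3)] lop_sum[OF base(3,1)] lop_right_translate[OF base(3), of f])
next
 case (comp T1 T2)
 have "rop (%f. T1 (T2 f)) g = rop T1 (rop T2 g)" for g by (rule ext) (simp add: rop_def)
 thus ?case using comp by simp
qed

lemma rop_const: "lop T ==> rop T (%_. c) = (%_. c)" by (simp add: rop_def lop_const fun_eq_iff)

lemma rop_diff: "lop T ==> rop T (%x. f x - g x) = (%x. rop T f x - rop T g x)"
 using lop_diff[of T "%z. f (inv z)" "%z. g (inv z)"] by (simp add: rop_def fun_eq_iff)

lemma rop_abs_bound: "lop T ==> (!!x. abs (f x) <= B) ==> abs (rop T f x) <= B"
 unfolding rop_def by (rule lop_abs_bound) auto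

text \<open>Oscillation is measured under right translations because left averages commute with
  those and therefore cannot increase it.\<close>

definition modulus :: "'g set => real => ('g => real) => bool" where
 "modulus U e f \<longleftrightarrow> (ALL x. ALL u:U. abs (f (x \<otimes> u) - f x) <= e)"

lemma lop_modulus: "lop T ==> modulus U e f ==> modulus U e (T f)" unfolding modulus_def
proof (intro allI ballI)
 fix x u assume T: "lop T" and m: "ALL x. ALL u:U. abs (f (x \<otimes> u) - f x) <= e" and u: "u : U"
 show "abs (T f (x \<otimes> u) - T f x) <= e"
  by (metis lop_abs_bound[OF T, of "%x. f (x \<otimes> u) - f x" e x] m u lop_diff[OF T] lop_right_translate[OF T, of
   f])
qed

text \<open>The compact parameter \<open>k\<close> lets one neighbourhood serve a whole family of
  functions, as the exchange of two means requires.\<close>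

lemma equicontinuous: fixes f :: "'g => 'k::topological_space => 'b::metric_space"
 assumes "ctn (%(x, k). f x k)" "compact (UNIV :: 'k set)" "e > 0"
 obtains U where "open U" "\<one> : U" "!!x u k. u : U ==> dist (f (x \<otimes> u) k) (f x k) <= e"
proof -
 let ?F = "%(u, x, k). f (x \<otimes> u) k"
 have c: "continuous_on (UNIV \<times> UNIV) ?F"
  using continuous_on_compose2[OF assms(1), of "UNIV \<times> UNIV" "%p. (case p of (u, x, k) => (x \<otimes> u, k))"]
   by (simp add: case_prod_beta' continuous_on_Pair ctn_group_mult continuous_intros)
 have "compact (UNIV :: ('g \<times> 'k) set)" using compact_Times[OF compact_UNIV assms(2)] by simp
 from continuous_on_prod_compactE[OF c this UNIV_I assms(3), of \<one>] obtain U where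
  "\<one> : U" "open U" "ALL u:U \<inter> UNIV. ALL t:UNIV. dist (?F (u, t)) (?F (\<one>, t)) <= e" .
 thus thesis by (intro that[of U]) auto
qed

text \<open>Compactness of the product of the group with itself makes the finite set independent of
  both points: from any \<open>y\<close> some translate lands in \<open>p\<close> times
  \<open>U\<close>, whatever \<open>p\<close> is.\<close>

lemma translates_cover: assumes "open U" "\<one> : U"
 obtains S where "finite S" "S ~= {}" "!!p y. EX a:S. inv p \<otimes> (a \<otimes> y) : U" proof -
 have c: "ctn (%q. inv (fst q) \<otimes> (a \<otimes> snd q))" for a
  by (intro ctn_group_mult ctn_group_inv continuous_intros)
 have o: "open {q. inv (fst q) \<otimes> (a \<otimes> snd q) : U}" for a
  using open_pre[OF c open_UNIV assms(1), of a] by simp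
 have K: "compact (UNIV :: ('g \<times> 'g) set)" using compact_Times[OF compact_UNIV compact_UNIV] by simp
 have cov: "UNIV \<subseteq> (\<Union>a\<in>UNIV. {q. inv (fst q) \<otimes> (a \<otimes> snd q) : U})"
 proof
  fix q :: "'g \<times> 'g"
  have "inv (fst q) \<otimes> (fst q \<otimes> inv (snd q) \<otimes> snd q) : U" using assms(2) by simp
  thus "q : (\<Union>a\<in>UNIV. {q. inv (fst q) \<otimes> (a \<otimes> snd q) : U})" by blast
 qed
 obtain S where S: "finite S" "UNIV \<subseteq> (\<Union>a\<in>S. {q. inv (fst q) \<otimes> (a \<otimes> snd q) : U})"
  by (rule compactE_image[OF K _ cov]) (use o in blast)+
 have "EX a:S. inv p \<otimes> (a \<otimes> y) : U" for p y proof -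
  have "(p, y) : (\<Union>a\<in>S. {q. inv (fst q) \<otimes> (a \<otimes> snd q) : U})" using S(2) by blast
  thus ?thesis by simp
 qed
 moreover hence "S ~= {}" by blast
 ultimately show thesis using that S(1) by blast
qed

text \<open>The averaging operator and the contraction factor depend only on the neighbourhood \<open>U\<close>, so that
 one operator serves a whole equicontinuous family.\<close>

lemma lop_contract: assumes U: "open U" "\<one> : U"
 obtains T ka where "lop T" "0 <= ka" "ka < 1"
  "!!f e m D. modulus U e f ==> (!!x. m <= f x & f x <= m + D) ==> 4 * e <= D
   ==> EX m'. ALL x. m' <= T f x & T f x <= m' + ka * D" proof -
 obtain S where S: "finite S" "S ~= {}" "!!p y. EX a:S. inv p \<otimes> (a \<otimes> y) : U"
  using translates_cover[OF U] by blast
 define N where "N = real (card S)"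
 have N: "N >= 1" using S card_gt_0_iff[of S] by (simp add: N_def)
 let ?T = "%f x. (SUM a:S. f (a \<otimes> x)) / card S"
 have T: "lop ?T" by (rule lop.base[OF S(1,2)])
 show thesis proof (rule that[OF T, of "1 - 1 / (4 * N)"])
  show "0 <= 1 - 1 / (4 * N)" "1 - 1 / (4 * N) < 1" using N by auto
  fix f e m D
  assume mod: "modulus U e f" and b: "!!x. m <= f x & f x <= m + D" and D: "4 * e <= D"
  have D0: "0 <= D" using b[of \<one>] by linarith
  have "1 / 2 <= 1 - 1 / (4 * N)" using N by simp
  from mult_right_mono[OF this D0] have ka: "D / 2 <= (1 - 1 / (4 * N)) * D" by simp
  \<comment> \<open>If \<open>f\<close> never drops to the lower half of its range, the range is
    already halved. Otherwise one of the \<open>N\<close> terms of each average sits near such a low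
    point and lies at least \<open>D / 4\<close> below the top, since \<open>e\<close> is at most
    \<open>D / 4\<close>.\<close>
  show "EX m'. ALL x. m' <= ?T f x & ?T f x <= m' + (1 - 1 / (4 * N)) * D"
  proof (cases "EX p. f p <= m + D / 2")
   case False
   hence "m + D / 2 <= f x" "f x <= m + D" for x using b[of x] by (auto simp: not_le less_imp_le)
   hence l: "m + D / 2 <= ?T f x" and "?T f x <= m + D" for x
    using lop_bounds[OF T, where f=f] by auto
   from this(2) have "?T f x <= m + D / 2 + (1 - 1 / (4 * N)) * D" for x by (rule order_trans) (use ka in linarith)
   with l show ?thesis by blast
  next
   case True
   then obtain p where p: "f p <= m + D / 2" by blast
   have "?T f y <= m + (1 - 1 / (4 * N)) * D" for y proof -
    obtain a where a: "a : S" "inv p \<otimes> (a \<otimes> y) : U" using S(3) by auto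
    have "abs (f (p \<otimes> (inv p \<otimes> (a \<otimes> y))) - f p) <= e" using mod a(2) unfolding modulus_def
     by blast
    hence fa: "f (a \<otimes> y) <= m + D - D / 4" using p D by simp
    have "(SUM a:S. f (a \<otimes> y)) = f (a \<otimes> y) + (SUM a:S - {a}. f (a \<otimes> y))"
     by (rule sum.remove[OF S(1) a(1)])
    also have "... <= (m + D - D / 4) + (SUM a:S - {a}. m + D)"
     by (intro add_mono sum_mono fa) (use b in blast)
    also have "... = N * (m + D) - D / 4" using S(1) a(1) N by (simp add: N_def of_nat_diff Suc_le_eq algebra_simps)
    finally show ?thesis using N by (simp add: N_def divide_right_mono field_simps)
   qed
   moreover have "m <= ?T f y" for y using lop_bounds(1)[OF T, of m f y] b by blast
   ultimately show ?thesis by blast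
  qed
 qed
qed

text \<open>The contraction is iterated until the oscillation, shrinking geometrically from
  \<open>D\<close>, is below \<open>e\<close>; the modulus survives every step, so the same operator
  can be applied again.\<close>

lemma lop_near_constant: assumes U: "open U" "\<one> : U" and e: "e > 0" and D: "D >= 0"
 obtains T where "lop T" "!!f m. modulus U (e / 4) f ==> (!!x. m <= f x & f x <= m + D) ==>
  EX c. ALL x. c <= T f x & T f x <= c + e" proof -
 obtain T ka where T: "lop T" "0 <= ka" "ka < 1"
  "!!f e m D. modulus U e f ==> (!!x. m <= f x & f x <= m + D) ==> 4 * e <= D
   ==> EX m'. ALL x. m' <= T f x & T f x <= m' + ka * D" using lop_contract[OF U] by blast
 have "EX T'. lop T' & (ALL f m. modulus U (e / 4) f --> (ALL x. m <= f x & f x <= m + D) -->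
  (EX c. ALL x. c <= T' f x & T' f x <= c + max e (ka ^ n * D)))" for n proof (induction n)
  case 0
  have "lop (%f x. (SUM a:{\<one>}. f (a \<otimes> x)) / card {\<one>})" by (rule lop.base) auto
  hence "lop (%f x. f x)" by simp
  moreover have "EX c. ALL x. c <= f x & f x <= c + max e D" if "ALL x. m <= f x & f x <= m + D" for f :: "'g => real"
   and m
  proof (intro exI[of _ m] allI conjI)
   fix x
   show "m <= f x" using that by blast
   have "f x <= m + D" using that by blast
   thus "f x <= m + max e D" by simp
  qed
  ultimately show ?case by auto
 next
  case (Suc n)
  then obtain T' where T': "lop T'" "!!f m. modulus U (e / 4) f ==> (!!x. m <= f x & f x <= m + D) ==>
  (EX c. ALL x. c <= T' f x & T' f x <= c + max e (ka ^ n * D))" by blast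
  show ?case proof (intro exI[of _ "%f. T (T' f)"] conjI allI impI)
   show "lop (%f. T (T' f))" by (rule lop.comp[OF T(1) T'(1)])
   fix f m assume f: "modulus U (e / 4) f" "ALL x. m <= f x & f x <= m + D"
   obtain c where c: "!!x. c <= T' f x & T' f x <= c + max e (ka ^ n * D)" by (metis T'(2)[OF f(1)] f(2)[rule_format])
   have "4 * (e / 4) <= max e (ka ^ n * D)" by simp
   from T(4)[OF lop_modulus[OF T'(1) f(1)] c this]
   obtain c' where c': "!!x. c' <= T (T' f) x & T (T' f) x <= c' + ka * max e (ka ^ n * D)" by blast
   have "ka * max e (ka ^ n * D) <= max e (ka ^ Suc n * D)" using T(2,3) e T(2)
    by (simp add: mult_left_le_one_le max_mult_distrib_left mult.assoc max.coboundedI1)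
   hence "T (T' f) x <= c' + max e (ka ^ Suc n * D)" for x using c'[of x] by linarith
   thus "EX c. ALL x. c <= T (T' f) x & T (T' f) x <= c + max e (ka ^ Suc n * D)"
    using c' by blast
  qed
 qed
 note ex = this
 have "(%n. ka ^ n * D) \<longlonglongrightarrow> 0 * D" using T(2,3) by (intro tendsto_mult LIMSEQ_power_zero) auto
 hence "\<forall>\<^sub>F n in sequentially. ka ^ n * D < e" using e by (intro order_tendstoD) auto
 then obtain n where n: "ka ^ n * D < e" by (auto simp: eventually_sequentially)
 hence "max e (ka ^ n * D) = e" by simp
 with ex[of n] obtain T' where T': "lop T'" "ALL f m. modulus U (e / 4) f --> (ALL x. m <= f x & f x <= m + D) -->
  (EX c. ALL x. c <= T' f x & T' f x <= c + e)" by auto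
 show thesis by (rule that[OF T'(1)]) (rule T'(2)[rule_format], auto)
qed

text \<open>The constants that finite left averages approach uniformly: the mean value in the sense
  of von Neumann.\<close>

definition haar_const :: "('g => real) => real => bool" where
 "haar_const f c \<longleftrightarrow> (ALL e>0. EX T. lop T & (ALL x. abs (T f x - c) <= e))"

definition haar :: "('g => real) => real" where
 "haar f = (THE c. haar_const f c)"

lemma bounded_continuous: fixes f :: "'g => 'b::real_normed_vector" assumes "ctn f"
 obtains B where "B >= 0" "!!x. norm (f x) <= B" proof -
 obtain B where B: "ALL y:range f. norm y <= B"
  by (metis compact_continuous_image[OF assms compact_UNIV] compact_imp_bounded bounded_iff)
 show thesis by (metis B abs_ge_self[of B] that[OF abs_ge_zero] order_trans rangeI)
qed

lemma modulus_exists: assumes "ctn f" "e > 0"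
 obtains U where "open U" "\<one> : U" "modulus U e f" proof -
 have c: "ctn (%(x, k::bool). f x)" by (simp add: case_prod_beta' continuous_on_compose2[OF assms(1)]
  continuous_intros)
 obtain U where U: "open U" "\<one> : U" "!!x u. u : U ==> dist (f (x \<otimes> u)) (f x) <= e"
  using equicontinuous[OF c _ assms(2)] by (metis (no_types) finite_imp_compact finite)
 show thesis by (rule that[OF U(1,2)]) (use U(3) in \<open>simp add: modulus_def dist_real_def\<close>)
qed

lemma lop_approx: assumes f: "ctn f" and e: "e > 0"
 obtains T c where "lop T" "!!x. abs (T f x - c) <= e" proof -
 obtain B where B: "B >= 0" "!!x. norm (f x) <= B" using bounded_continuous[OF f] by blast
 have e4: "e / 4 > 0" and B2: "2 * B >= 0" using e B by auto
 obtain U where U: "open U" "\<one> : U" "modulus U (e / 4) f" by (rule modulus_exists[OF f e4])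
 obtain T where T: "lop T" "!!f m. modulus U (e / 4) f ==> (!!x. m <= f x & f x <= m + 2 * B) ==>
  EX c. ALL x. c <= T f x & T f x <= c + e" by (rule lop_near_constant[OF U(1,2) e B2]) blast
 have "- B <= f x & f x <= - B + 2 * B" for x using B(2)[of x] by auto
 from T(2)[OF U(3) this] obtain c where "!!x. c <= T f x & T f x <= c + e" by blast
 hence c: "c <= T f x" "T f x <= c + e" for x by auto
 have "abs (T f x - c) <= e" for x using c[of x] by linarith
 thus thesis by (rule that[OF T(1)])
qed

lemma rop_approx: assumes f: "ctn f" and e: "e > 0"
 obtains T c where "lop T" "!!x. abs (rop T f x - c) <= e" proof -
 have "ctn (%z. f (inv z))"
  by (rule continuous_on_compose2[OF f]) (auto intro!: ctn_group_inv)
 from lop_approx[OF this e] show thesis using that unfolding rop_def by metis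
qed

text \<open>Applying the right average to the first estimate and the left average to the second
  compares both constants with one and the same function.\<close>

lemma left_right_constants:
 assumes "lop T" "!!x. abs (T f x - c) <= e" "lop T'" "!!x. abs (rop T' f x - c') <= e'"
 shows "abs (c - c') <= e + e'" proof -
 have "abs (rop T' (%x. T f x - c) \<one>) <= e" by (rule rop_abs_bound[OF assms(3,2)])
 moreover have "abs (T (%x. rop T' f x - c') \<one>) <= e'" by (rule lop_abs_bound[OF assms(1,4)])
 ultimately show ?thesis
  by (simp add: rop_diff[OF assms(3)] rop_const[OF assms(3)] lop_diff[OF assms(1)] lop_const[OF assms(1)]
    rop_lop_commute[OF assms(3,1)])
qed

lemma haar_const_unique: assumes f: "ctn f" and c: "haar_const f c" "haar_const f d"
 shows "c = d" proof (rule ccontr)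
 assume ne: "c ~= d"
 define e where "e = abs (c - d) / 5"
 have e: "e > 0" "abs (c - d) = 5 * e" using ne by (auto simp: e_def)
 obtain T1 where T1: "lop T1" "!!x. abs (T1 f x - c) <= e" using c(1) e(1) unfolding haar_const_def by blast
 obtain T2 where T2: "lop T2" "!!x. abs (T2 f x - d) <= e" using c(2) e(1) unfolding haar_const_def by blast
 obtain T' c' where T': "lop T'" "!!x. abs (rop T' f x - c') <= e" using rop_approx[OF f e(1)] by auto
 show False using left_right_constants[OF T1 T'] left_right_constants[OF T2 T'] e by simp
qed

lemma haar_const_exists: assumes f: "ctn f" shows "EX c. haar_const f c" proof -
 have "ALL n. EX T c. lop T & (ALL x. abs (T f x - c) <= 1 / Suc n)"
  using lop_approx[OF f] by (metis of_nat_0_less_iff zero_less_Suc zero_less_divide_1_iff)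
 then obtain T c where T: "!!n. lop (T n)" "!!n x. abs (T n f x - c n) <= 1 / Suc n" by metis
 \<comment> \<open>Two left averages are compared through a right average with arbitrarily small
   error.\<close>
 have cd: "abs (c n - c m) <= 1 / Suc n + 1 / Suc m" for n m proof (rule field_le_epsilon)
  fix e :: real assume "e > 0"
  hence "e / 2 > 0" by simp
  then obtain T' c' where T': "lop T'" "!!x. abs (rop T' f x - c') <= e / 2" using rop_approx[OF f] by blast
  show "abs (c n - c m) <= 1 / Suc n + 1 / Suc m + e"
   using left_right_constants[OF T(1) T(2) T', of n] left_right_constants[OF T(1) T(2) T', of m] by linarith
 qed
 have inv0: "(%n. 1 / real (Suc n)) \<longlonglongrightarrow> 0" using LIMSEQ_inverse_real_of_nat
  by (simp add: inverse_eq_divide)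
 have "Cauchy c" proof (rule metric_CauchyI)
  fix e :: real assume e: "e > 0"
  from inv0 e have "\<forall>\<^sub>F n in sequentially. 1 / real (Suc n) < e / 2" by (intro order_tendstoD) auto
  then obtain N where N: "!!n. n >= N ==> 1 / real (Suc n) < e / 2" by (auto simp: eventually_sequentially)
  show "EX M. ALL m>=M. ALL n>=M. dist (c m) (c n) < e" proof (intro exI[of _ N] allI impI)
   fix m n assume "m >= N" "n >= N"
   thus "dist (c m) (c n) < e" using cd[of m n] N[of m] N[of n] by (simp add: dist_real_def)
  qed
 qed
 then obtain l where l: "c \<longlonglongrightarrow> l" using Cauchy_convergent convergent_def by blast
 have "haar_const f l" unfolding haar_const_def proof (intro allI impI)
  fix e :: real assume e: "e > 0"
  have "\<forall>\<^sub>F n in sequentially. 1 / real (Suc n) < e / 2" using inv0 e by (intro order_tendstoD) auto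
  moreover have "\<forall>\<^sub>F n in sequentially. dist (c n) l < e / 2" by (rule tendstoD[OF l]) (use e in simp)
  ultimately have "\<forall>\<^sub>F n in sequentially. 1 / real (Suc n) < e / 2 & dist (c n) l < e / 2"
   by (rule eventually_conj)
  then obtain n where n: "1 / real (Suc n) < e / 2" "dist (c n) l < e / 2" by (auto simp: eventually_sequentially)
  have "abs (T n f x - l) <= e" for x using T(2)[of n x] n unfolding dist_real_def by linarith
  thus "EX T. lop T & (ALL x. abs (T f x - l) <= e)" using T(1) by auto
 qed
 thus ?thesis ..
qed

lemma haar_const: "ctn f ==> haar_const f (haar f)"
 unfolding haar_def by (rule theI') (use haar_const_exists haar_const_unique in blast)

lemma haar_eqI: "ctn f ==> haar_const f c ==> haar f = c"
 using haar_const haar_const_unique by blast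

lemma haar_constant [simp]: "haar (%_. c) = c" proof (rule haar_eqI)
 have "lop (%f x. (SUM a:{\<one>}. f (a \<otimes> x)) / card {\<one>})" by (rule lop.base) auto
 thus "haar_const (%_. c) c" unfolding haar_const_def by (intro allI impI exI) auto
qed simp

lemma haar_lop: assumes "ctn f" "lop T" shows "haar (T f) = haar f"
by (metis lop.comp[OF _ assms(2)] haar_const_def haar_eqI[OF assms(1), symmetric] haar_const[OF lop_continuous[OF
 assms(2,1)]] exI[of _ "%f. T' (T f)"])

lemma haar_add: assumes f: "ctn f" and g: "ctn g"
 shows "haar (%x. f x + g x) = haar f + haar g" proof (rule haar_eqI)
 show "ctn (%x. f x + g x)" using f g by (intro continuous_intros)
 show "haar_const (%x. f x + g x) (haar f + haar g)" unfolding haar_const_def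
 proof (intro allI impI)
  fix e :: real assume e: "e > 0"
  then obtain T where T: "lop T" "!!x. abs (T f x - haar f) <= e / 2"
   using haar_const[OF f] unfolding haar_const_def by (meson half_gt_zero)
  obtain T' where T': "lop T'" "!!x. abs (T' (T g) x - haar (T g)) <= e / 2"
   using haar_const[OF lop_continuous[OF T(1) g]] e unfolding haar_const_def by (meson half_gt_zero)
  have "abs (T' (T (%x. f x + g x)) x - (haar f + haar g)) <= e" for x proof -
   have "abs (T' (T f) x - haar f) <= e / 2" using lop_abs_bound[OF T'(1) T(2)]
    by (simp only: lop_diff[OF T'(1)] lop_const[OF T'(1)])
   moreover have "T' (T (%x. f x + g x)) x = T' (T f) x + T' (T g) x"
    by (simp only: lop_linear(1)[OF T(1)] lop_linear(1)[OF T'(1)])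
   ultimately show ?thesis using T'(2)[of x] haar_lop[OF g T(1)] by linarith
  qed
  thus "EX T. lop T & (ALL x. abs (T (%x. f x + g x) x - (haar f + haar g)) <= e)"
   using lop.comp[OF T'(1) T(1)] by auto
 qed
qed

lemma haar_cmult: assumes f: "ctn f" shows "haar (%x. c * f x) = c * haar f"
proof (rule haar_eqI)
 show "ctn (%x. c * f x)" using f by (intro continuous_intros)
 show "haar_const (%x. c * f x) (c * haar f)" unfolding haar_const_def proof (intro allI impI)
  fix e :: real assume e: "e > 0"
  hence "e / (abs c + 1) > 0" by simp
  then obtain T where T: "lop T" "!!x. abs (T f x - haar f) <= e / (abs c + 1)"
   using haar_const[OF f] unfolding haar_const_def by blast
  have "abs (T (%x. c * f x) x - c * haar f) <= e" for x proof -
   have "abs (c * (T f x - haar f)) <= (abs c + 1) * (e / (abs c + 1))"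
    unfolding abs_mult by (intro mult_mono T(2)) auto
   thus ?thesis by (simp add: lop_linear(2)[OF T(1)] right_diff_distrib)
  qed
  thus "EX T. lop T & (ALL x. abs (T (%x. c * f x) x - c * haar f) <= e)" using T(1) by auto
 qed
qed

lemma haar_nonneg: assumes f: "ctn f" "!!x. 0 <= f x" shows "0 <= haar f"
proof (rule field_le_epsilon)
 fix e :: real assume "e > 0"
 then obtain T where T: "lop T" "!!x. abs (T f x - haar f) <= e"
  using haar_const[OF f(1)] unfolding haar_const_def by blast
 have "0 <= T f \<one>" by (rule lop_bounds(1)[OF T(1) f(2)])
 thus "0 <= haar f + e" using T(2)[of \<one>] by simp
qed

lemma haar_mono:
 assumes f: "ctn f" and g: "ctn g" and "!!x. f x <= g x"
 shows "haar f <= haar g" proof -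
 have "0 <= haar (%x. g x + (- 1) * f x)"
  by (rule haar_nonneg) (use assms in \<open>auto intro!: continuous_intros\<close>)
 also have "... = haar g + haar (%x. (- 1) * f x)"
  by (rule haar_add) (use assms in \<open>auto intro!: continuous_intros\<close>)
 also have "... = haar g - haar f" using haar_cmult[OF f, of "-1"] by simp
 finally show ?thesis by simp
qed

lemma haar_left: assumes f: "ctn f" shows "haar (%x. f (a \<otimes> x)) = haar f"
proof -
 have "lop (%f x. (SUM a:{a}. f (a \<otimes> x)) / card {a})" by (rule lop.base) auto
 from haar_lop[OF f this] show ?thesis by simp
qed

text \<open>Left averages commute with right translations, so those of the translated function
  approach the same constant.\<close>

lemma haar_right: assumes f: "ctn f" shows "haar (%x. f (x \<otimes> b)) = haar f"
proof (rule haar_eqI)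
 show "ctn (%x. f (x \<otimes> b))"
  by (rule continuous_on_compose2[OF f]) (auto intro!: ctn_group_mult)
 show "haar_const (%x. f (x \<otimes> b)) (haar f)"
  using haar_const[OF f] unfolding haar_const_def by (metis lop_right_translate)
qed

text \<open>By compactness an average over finitely many translates meets the set where
  \<open>f\<close> exceeds \<open>f x0 / 2\<close> from every point, which gives it a positive lower
  bound.\<close>

lemma haar_pos: assumes f: "ctn f" "!!x. 0 <= f x" "f x0 > 0" shows "0 < haar f"
proof -
 have o: "open {x. f x > f x0 / 2}"
  using open_pre[OF f(1) open_UNIV open_greaterThan[of "f x0 / 2"]] by simp
 have c: "ctn (%u. x0 \<otimes> u)" by (intro ctn_group_mult continuous_intros)
 have "open {u. x0 \<otimes> u : {x. f x > f x0 / 2}}"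
  using open_pre[OF c open_UNIV o] by simp
 moreover have "\<one> : {u. x0 \<otimes> u : {x. f x > f x0 / 2}}" using f(3) by simp
 ultimately obtain S where S: "finite S" "S ~= {}" "!!p y. EX a:S. inv p \<otimes> (a \<otimes> y) : {u. x0 \<otimes>
  u : {x. f x > f x0 / 2}}"
  using translates_cover by metis
 let ?T = "%f x. (SUM a:S. f (a \<otimes> x)) / real (card S)"
 have T: "lop ?T" by (rule lop.base[OF S(1,2)])
 have cS: "real (card S) > 0" using S by auto
 have "f x0 / 2 / card S <= ?T f y" for y proof -
  obtain a where a: "a : S" "inv x0 \<otimes> (a \<otimes> y) : {u. x0 \<otimes> u : {x. f x > f x0 / 2}}" using S(3)
   by blast
  have "f x0 / 2 <= f (a \<otimes> y)" using a(2) by simp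
  also have "... <= (SUM a:S. f (a \<otimes> y))" by (rule member_le_sum[OF a(1)]) (use f S in auto)
  finally show ?thesis by (rule divide_right_mono) (use in simp)
 qed
 hence "haar (%_. f x0 / 2 / card S) <= haar (?T f)"
  by (intro haar_mono lop_continuous[OF T f(1)]) auto
 moreover have "f x0 / 2 / card S > 0" using f(3) cS by simp
 ultimately show ?thesis by (simp add: haar_lop[OF f(1) T])
qed

end

section \<open>Fubini, the complex mean and differentiation under the mean\<close>

context compact_lie
begin

lemma haar_diff: assumes f: "ctn f" and g: "ctn g"
 shows "haar (%x. f x - g x) = haar f - haar g"
 using haar_add[OF f, of "%x. - 1 * g x"] haar_cmult[OF g, of "-1"] g
 by (simp add: continuous_on_minus)

lemma haar_abs_bound: assumes f: "ctn f" and B: "!!x. abs (f x) <= B"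
 shows "abs (haar f) <= B" proof -
 have "f x <= B" "- B <= f x" for x using B[of x] by auto
 hence "haar f <= haar (%_. B)" "haar (%_. - B) <= haar f" by (intro haar_mono f; simp)+
 thus ?thesis by simp
qed

lemma haar_sum: assumes "finite A" "!!a. a : A ==> ctn (f a)"
 shows "haar (%x. SUM a:A. f a x) = (SUM a:A. haar (f a))" using assms
proof (induction A rule: finite_induct)
 case (insert a A)
 have "haar (%x. f a x + (SUM a:A. f a x)) = haar (f a) + haar (%x. SUM a:A. f a x)"
  by (rule haar_add) (use insert.prems in \<open>auto intro!: continuous_intros\<close>)
 thus ?case using insert by simp
qed simp

lemma ctn_slice: assumes "continuous_on (A \<times> UNIV) (%(k, x). F k x)" "k : A"
 shows "ctn (F k)" proof -
 have "ctn (%x. (k, x))" by (intro continuous_on_Pair continuous_on_const continuous_on_id)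
 from continuous_on_compose2[OF assms(1) this] assms(2) show ?thesis by auto
qed

lemma continuous_on_haar: fixes F :: "'k::topological_space => 'g => real"
 assumes F: "continuous_on (A \<times> UNIV) (%(k, x). F k x)"
 shows "continuous_on A (%k. haar (F k))" unfolding continuous_on_def proof (intro ballI tendstoI)
 fix k and e :: real assume k: "k : A" and e: "e > 0"
 hence "e / 2 > 0" by simp
 from continuous_on_prod_compactE[OF F compact_UNIV k this] obtain X where
  X: "k : X" "open X" "ALL x:X \<inter> A. ALL t:UNIV. dist (F x t) (F k t) <= e / 2" unfolding prod.case .
 have "dist (haar (F x)) (haar (F k)) < e" if "x : X \<inter> A" for x proof -
  have c: "ctn (F x)" "ctn (F k)"
   using ctn_slice[OF F] that k by auto
  have "abs (haar (%t. F x t - F k t)) <= e / 2"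
   by (rule haar_abs_bound) (use X(3) that c in \<open>auto simp: dist_real_def intro!: continuous_intros\<close>)
  thus ?thesis using e by (simp add: dist_real_def haar_diff c)
 qed
 thus "\<forall>\<^sub>F x in at k within A. dist (haar (F x)) (haar (F k)) < e"
  unfolding eventually_at_topological using X(1,2) by (intro exI[of _ X]) auto
qed

lemma lop_haar: fixes F :: "'g => 'g => real" assumes "lop T" "ctn (%(y, z). F y z)"
 shows "ctn (%(x, z). T (%y. F y z) x)"
  "haar (%z. T (%y. F y z) x) = T (%y. haar (F y)) x" using assms proof (induction arbitrary: F x)
 case (base S)
 have c: "ctn (%(x, z). F (a \<otimes> x) z)" if "ctn (%(y, z). F y z)" for a and F :: "'g => 'g => real"
 proof -
  have "ctn (%p::'g \<times> 'g. (a \<otimes> fst p, snd p))"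
   by (intro ctn_group_mult continuous_intros)
  from continuous_on_compose2[OF that this] show ?thesis by (simp add: case_prod_beta')
 qed
 {
  case 1
  thus ?case using c[of F] base by (auto simp: case_prod_beta' intro!: continuous_intros)
 next
  case 2
  show ?case using ctn_slice[of UNIV F] 2 base haar_cmult[of "%z. SUM a:S. F (a \<otimes> x) z" "1 / card S"]
   by (simp add: haar_sum continuous_on_sum)
 }
next
 case (comp T T')
 {
  case 1
  show ?case by (rule comp.IH(1)[OF comp.IH(3)[OF 1]])
 next
  case 2
  show ?case using comp.IH(2)[OF comp.IH(3)[OF 2]] comp.IH(4)[OF 2] by presburger
 }
qed

text \<open>By equicontinuity one averaging operator in \<open>y\<close> makes all slices nearly
  constant at once, and the function \<open>haar (F y)\<close> as well. A finite average commutes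
  with the mean in \<open>z\<close>, so both iterated means lie within \<open>e\<close> of the same
  number.\<close>

lemma haar_fubini: fixes F :: "'g => 'g => real" assumes F: "ctn (%(y, z). F y z)"
 shows "haar (%y. haar (F y)) = haar (%z. haar (%y. F y z))" proof -
 let ?g = "%y. haar (F y)" and ?h = "%z. haar (%y. F y z)"
 have F': "continuous_on (UNIV \<times> UNIV) (%(y, z). F y z)" using F by simp
 have "ctn (%p::'g \<times> 'g. (snd p, fst p))" by (intro continuous_intros)
 from continuous_on_compose2[OF F this] have Fs: "continuous_on (UNIV \<times> UNIV) (%(z, y). F y z)"
  by (simp add: case_prod_beta')
 have cF: "ctn (F y)" "ctn (%y. F y z)" for y z
  using ctn_slice[OF F'] ctn_slice[OF Fs] by auto
 have cg: "ctn ?g" and ch: "ctn ?h"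
  using continuous_on_haar[OF F'] continuous_on_haar[OF Fs] by auto
 have "compact (range (%(y, z). F y z))"
  using compact_continuous_image[OF F'] compact_Times[OF compact_UNIV compact_UNIV] by simp
 then obtain B where "ALL r:range (%(y, z). F y z). norm r <= B" using compact_imp_bounded bounded_iff by blast
 hence B: "abs (F y z) <= B" for y z by auto
 have B0: "2 * B >= 0" using B[of \<one> \<one>] by linarith
 have close: "abs (haar ?h - haar ?g) <= 2 * e" if e: "e > 0" for e proof -
  have "e / 4 > 0" using e by simp
  from equicontinuous[OF F compact_UNIV this] obtain U where
   U: "open U" "\<one> : U" "!!x u k. u : U ==> dist (F (x \<otimes> u) k) (F x k) <= e / 4" by blast
  obtain T where T: "lop T" "!!f m. modulus U (e / 4) f ==> (!!x. m <= f x & f x <= m + 2 * B) ==>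
   EX c. ALL x. c <= T f x & T f x <= c + e" by (rule lop_near_constant[OF U(1,2) e B0]) blast
  have near: "abs (T f x - haar f) <= e" if f: "ctn f" "modulus U (e / 4) f" "!!x. abs (f x) <= B" for f x
  proof -
   have "- B <= f x & f x <= - B + 2 * B" for x using f(3)[of x] by auto
   from T(2)[OF f(2) this] obtain c where c: "!!x. c <= T f x" "!!x. T f x <= c + e" by blast
   have "haar (%_. c) <= haar (T f)" "haar (T f) <= haar (%_. c + e)"
    by (intro haar_mono lop_continuous[OF T(1) f(1)] continuous_on_const c)+
   thus ?thesis using c[of x] by (simp add: haar_lop[OF f(1) T(1)])
  qed
  have 1: "abs (T (%y. F y z) \<one> - ?h z) <= e" for z
   by (rule near) (use cF U B in \<open>auto simp: modulus_def dist_real_def\<close>)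
  have 2: "abs (T ?g \<one> - haar ?g) <= e" proof (rule near[OF cg])
   show "modulus U (e / 4) ?g" unfolding modulus_def proof (intro allI ballI)
    fix x u assume u: "u : U"
    have "abs (haar (%z. F (x \<otimes> u) z - F x z)) <= e / 4"
     by (rule haar_abs_bound) (use U(3)[OF u] cF in \<open>auto simp: dist_real_def intro!: continuous_intros\<close>)
    thus "abs (?g (x \<otimes> u) - ?g x) <= e / 4" by (simp add: haar_diff cF)
   qed
   show "abs (?g x) <= B" for x by (rule haar_abs_bound[OF cF(1) B])
  qed
  note c = lop_haar(1)[OF T(1) F]
  have cT: "ctn (%z. T (%y. F y z) \<one>)"
   using ctn_slice[of UNIV "%x z. T (%y. F y z) x"] c by simp
  have "abs (haar (%z. T (%y. F y z) \<one> - ?h z)) <= e"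
   by (rule haar_abs_bound[OF _ 1]) (intro continuous_intros cT ch)
  hence "abs (T ?g \<one> - haar ?h) <= e"
   by (simp add: haar_diff[OF cT ch] lop_haar(2)[OF T(1) F])
  with 2 show ?thesis by simp
 qed
 show ?thesis proof (rule ccontr)
  assume ne: "haar ?g ~= haar ?h"
  define d where "d = abs (haar ?h - haar ?g)"
  have "d > 0" using ne by (simp add: d_def)
  moreover have "d <= 2 * (d / 4)" unfolding d_def by (rule close) (use ne in simp)
  ultimately show False by simp
 qed
qed

definition cint :: "('g => complex) => complex" where
 "cint f = Complex (haar (%x. Re (f x))) (haar (%x. Im (f x)))"

abbreviation cont :: "('g => complex) => bool" where "cont f == ctn f"

lemma cont_Re: "cont f ==> ctn (%x. Re (f x))"
 and cont_Im: "cont f ==> ctn (%x. Im (f x))" by (auto intro!: continuous_intros)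

lemma cint_add: "cont f ==> cont g ==> cint (%x. f x + g x) = cint f + cint g"
 by (simp add: cint_def complex_eq_iff haar_add cont_Re cont_Im)

lemma cint_cmult: "cont f ==> cint (%x. c * f x) = c * cint f"
 by (simp add: cint_def complex_eq_iff haar_add haar_diff haar_cmult cont_Re cont_Im continuous_on_mult_left)

lemma cint_diff: "cont f ==> cont g ==> cint (%x. f x - g x) = cint f - cint g"
 by (simp add: cint_def complex_eq_iff haar_diff cont_Re cont_Im)

lemma cint_const [simp]: "cint (%_. c) = c" by (simp add: cint_def)

lemma cint_cnj: "cont f ==> cint (%x. cnj (f x)) = cnj (cint f)"
 using haar_cmult[OF cont_Im[of f], of "-1"] by (simp add: cint_def complex_eq_iff)

lemma cint_sum: assumes "finite A" "!!a. a : A ==> cont (f a)"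
 shows "cint (%x. SUM a:A. f a x) = (SUM a:A. cint (f a))" using assms
proof (induction A rule: finite_induct)
 case (insert a A)
 have "cint (%x. f a x + (SUM a:A. f a x)) = cint (f a) + cint (%x. SUM a:A. f a x)"
  by (rule cint_add) (use insert.prems in \<open>auto intro!: continuous_intros\<close>)
 thus ?case using insert by simp
qed simp

lemma cint_left: "cont f ==> cint (%x. f (a \<otimes> x)) = cint f"
 using haar_left[OF cont_Re[of f]] haar_left[OF cont_Im[of f]] by (simp add: cint_def)

lemma cint_right: "cont f ==> cint (%x. f (x \<otimes> a)) = cint f"
 using haar_right[OF cont_Re[of f]] haar_right[OF cont_Im[of f]] by (simp add: cint_def)

lemma cint_of_real: "ctn f ==> cint (%x. cor (f x)) = cor (haar f)"
 by (simp add: cint_def complex_eq_iff)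

text \<open>A rotation by a phase makes the integral real and nonnegative, which avoids the factor
  lost by bounding real and imaginary parts separately.\<close>

lemma cint_bound: assumes f: "cont f" and B: "!!x. cmod (f x) <= B" shows "cmod (cint f) <= B"
proof (cases "cint f = 0")
 case True
 thus ?thesis using B[of \<one>] norm_ge_zero[of "f \<one>"] by (simp del: norm_ge_zero)
next
 case False
 define w where "w = cnj (cint f) / cmod (cint f)"
 have w: "cmod w = 1" using False by (simp add: w_def norm_divide)
 have "cor (cmod (cint f)) = w * cint f"
  using False by (simp add: w_def power2_eq_square mult.commute[of "cnj _"] flip: complex_norm_square)
 also have "... = cint (%x. w * f x)" by (simp add: cint_cmult f)
 finally have "cmod (cint f) = Re (cint (%x. w * f x))" by (metis Re_complex_of_real)
 also have "... = haar (%x. Re (w * f x))" by (simp add: cint_def)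
 also have "... <= B" proof -
  have "abs (Re (w * f x)) <= B" for x
   using abs_Re_le_cmod[of "w * f x"] B[of x] w by (simp add: norm_mult)
  hence "abs (haar (%x. Re (w * f x))) <= B"
   by (intro haar_abs_bound continuous_intros f)
  thus ?thesis by simp
 qed
 finally show ?thesis .
qed

lemma continuous_on_cint: fixes F :: "'k::topological_space => 'g => complex"
 assumes F: "continuous_on (A \<times> UNIV) (%(k, x). F k x)"
 shows "continuous_on A (%k. cint (F k))" using F
  by (simp add: case_prod_beta' cint_def Complex_eq continuous_on_haar continuous_intros)

lemma cint_fubini: fixes F :: "'g => 'g => complex" assumes F: "ctn (%(y, z). F y z)"
 shows "cint (%y. cint (F y)) = cint (%z. cint (%y. F y z))"
 using haar_fubini[of "%y z. Re (F y z)"] haar_fubini[of "%y z. Im (F y z)"] F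
 by (simp add: cint_def case_prod_beta' continuous_on_Re continuous_on_Im)

text \<open>Compactness of the group makes the continuity of the derivative in \<open>a\<close>
  uniform in \<open>z\<close>, so the linearisation error is at most \<open>e\<close> times the
  increment for all \<open>z\<close> at once.\<close>

lemma cint_has_derivative: fixes Ph :: "'a::euclidean_space => 'g => complex"
 assumes U: "open U" "a : U" and c: "!!a. a : U ==> cont (Ph a)"
  and d: "!!a z. a : U ==> ((%a. Ph a z) hfd L a z) (at a)"
  and cL: "!!v. continuous_on (U \<times> UNIV) (%(a, z). L a z v)"
 shows "((%a. cint (Ph a)) hfd (%v. cint (%z. L a z v))) (at a)"
 unfolding has_derivative_at_alt proof (intro conjI allI impI)
 have lin: "linear (L a z)" if "a : U" for a z by (rule has_derivative_linear[OF d[OF that]])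
 have cLa: "cont (%z. L a z v)" if "a : U" for a v using ctn_slice[OF cL that] .
 show "bounded_linear (%v. cint (%z. L a z v))"
  by (simp add: linear_add[OF lin[OF U(2)]] cint_add cLa U linear_cmul[OF lin[OF U(2)]] scaleR_conv_of_real cint_cmult
   linearI linear_conv_bounded_linear[THEN iffD1])
 fix e :: real assume e: "e > 0"
 \<comment> \<open>The operator norm is controlled by the sum over the basis directions, so each
   direction gets an equal share of \<open>e\<close>.\<close>
 define ep where "ep = e / DIM('a)"
 have ep: "ep > 0" using e by (simp add: ep_def)
 have "EX X. open X & a : X & (ALL x. x : X --> x : U --> (ALL z. dist (L x z b) (L a z b) <= ep))" for b
 proof -
  from continuous_on_prod_compactE[OF cL compact_UNIV U(2) ep, of b] obtain X where
   "a : X" "open X" "ALL x:X \<inter> U. ALL t:UNIV. dist (L x t b) (L a t b) <= ep" by auto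
  thus ?thesis by blast
 qed
 hence "ALL b. EX X. open X & a : X & (ALL x. x : X --> x : U --> (ALL z. dist (L x z b) (L a z b) <= ep))"
  by simp
 from choice[OF this] obtain X where "ALL b. open (X b) & a : X b & (ALL x. x : X b --> x : U --> (ALL z. dist (L x z
  b) (L a z b) <= ep))"
  ..
 hence X: "!!b. open (X b)" "!!b. a : X b" "!!b x z. x : X b ==> x : U ==> dist (L x z b) (L a z b) <= ep"
  by blast+
 have o: "open ((\<Inter>b\<in>Basis. X b) \<inter> U)" using X(1) U(1) by (intro open_Int) auto
 have "a : (\<Inter>b\<in>Basis. X b) \<inter> U" using X(2) U(2) by auto
 from openE[OF o this] obtain de where de: "de > 0" "ball a de \<subseteq> (\<Inter>b\<in>Basis. X b) \<inter> U" .
 have on: "onorm (%v. L x z v - L a z v) <= e" if x: "x : ball a de" for x z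
 proof (rule onorm_bound)
  fix v
  have xU: "x : U" and xX: "!!b. b : Basis ==> x : X b" using x de by auto
  have "norm (L x z v - L a z v) <= (SUM b:Basis. norm ((v \<bullet> b) *\<^sub>R (L x z b - L a z b)))"
   by (subst linear_Basis[OF linear_compose_sub[OF lin[OF xU] lin[OF U(2)]]]) (rule norm_sum)
  also have "... <= (SUM b:(Basis::'a set). norm v * ep)" proof (rule sum_mono)
   fix b :: 'a assume b: "b : Basis"
   show "norm ((v \<bullet> b) *\<^sub>R (L x z b - L a z b)) <= norm v * ep"
    using Basis_le_norm[OF b, of v] X(3)[OF xX[OF b] xU, of z] by (simp add: dist_norm mult_mono)
  qed
  also have "... = e * norm v" by (simp add: ep_def)
  finally show "norm (L x z v - L a z v) <= e * norm v" .
 qed (use e in simp)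
 show "EX d>0. ALL y. norm (y - a) < d --> norm (cint (Ph y) - cint (Ph a) - cint (%z. L a z (y - a))) <= e * norm (y
  - a)"
 proof (intro exI[of _ de] conjI allI impI de(1))
  fix y assume y: "norm (y - a) < de"
  hence yb: "y : ball a de" and ab: "a : ball a de" using de by (auto simp: dist_norm norm_minus_commute)
  have yU: "y : U" using yb de by auto
  have "norm (Ph y z - Ph a z - L a z (y - a)) <= norm (y - a) * e" for z
  proof (rule differentiable_bound_linearization[where S="ball a de"])
   show "a + t *\<^sub>R (y - a) : ball a de" if "t : {0..1}" for t proof -
    have "t * norm (y - a) <= norm (y - a)" using that by (intro mult_left_le_one_le) auto
    thus ?thesis using y that by (simp add: dist_norm)
   qed
   show "((%a. Ph a z) hfd L x z) (at x within ball a de)" if "x : ball a de" for x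
    using d[of x z] that de has_derivative_at_withinI by blast
   show "onorm (L x z - L a z) <= e" if "x : ball a de" for x proof -
    have "L x z - L a z = (%v. L x z v - L a z v)" by auto
    thus ?thesis using on[OF that] by simp
   qed
  qed (use ab in simp)
  hence "cmod (cint (%z. Ph y z - Ph a z - L a z (y - a))) <= norm (y - a) * e"
   by (intro cint_bound) (auto intro!: continuous_intros c U(2) yU cLa)
  thus "norm (cint (Ph y) - cint (Ph a) - cint (%z. L a z (y - a))) <= e * norm (y - a)"
   by (simp add: cint_diff c U(2) yU cLa continuous_on_diff mult.commute)
 qed
qed

end

context compact_lie
begin

subsection \<open>Calculus of left-invariant derivatives\<close>

lemma gsmooth_const: "gsmooth (%_. c)" by (simp add: gsmooth_def)

lemma gsmooth_add: "gsmooth f ==> gsmooth g ==> gsmooth (%x. f x + g x)"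
 unfolding gsmooth_def by (auto intro!: smooth_on_add chartD)

lemma gsmooth_bilinear: assumes "bounded_bilinear b" "gsmooth f" "gsmooth g"
 shows "gsmooth (%x. b (f x) (g x))"
 using assms(2,3) unfolding gsmooth_def by (auto intro!: smooth_on_bilinear[OF assms(1)] chartD)

lemmas gsmooth_mult = gsmooth_bilinear[OF bounded_bilinear_mult]

lemma gsmooth_bounded_linear: assumes "bounded_linear L" "gsmooth f" shows "gsmooth (%x. L (f x))"
 using assms(2) unfolding gsmooth_def by (auto intro!: smooth_blin[OF assms(1)] chartD)

lemma gsmooth_cnj: "gsmooth f ==> gsmooth (%x. cnj (f x))"
 by (rule gsmooth_bounded_linear[OF bounded_linear_cnj])

lemma gsmooth_sum: "(!!i. i : A ==> gsmooth (f i)) ==> gsmooth (%x. SUM i:A. f i x)"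
 unfolding gsmooth_def by (auto intro!: smooth_on_sum chartD)

lemma gsmooth_left: "gsmooth f ==> gsmooth (%x. f (g \<otimes> x))"
 unfolding gsmooth_def[of "%x. f (g \<otimes> x)"]
 by (auto intro!: gsmooth_gmap gmap_on_translate chartD)

lemma gsmooth_right: assumes "gsmooth f" shows "gsmooth (%x. f (x \<otimes> g))"
 unfolding gsmooth_def proof
 fix c assume c: "c : charts"
 show "smooth_on (cdom c) (%y. f (chart_inv c y \<otimes> g))"
  by (rule gsmooth_gmap[OF chartD(2)[OF c] assms])
   (intro gmap_on_mult gmap_on_const gmap_on_chart_inv chartD c)
qed

lemma lder_eqI: assumes "((%b. f (x \<otimes> chart_inv c0 b)) hfd L) (at b0)"
 shows "lder Y f x = L Y" using frechet_derivative_at[OF assms] by (simp add: lder_def)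

lemma lder_const: "lder Y (%_. c) x = 0" by (simp add: lder_def)

lemma lder_add: "gsmooth f ==> gsmooth g ==> lder Y (%x. f x + g x) x = lder Y f x + lder Y g x"
 by (rule lder_eqI[OF has_derivative_add[OF lder_hfd lder_hfd]])

lemma lder_bilinear: assumes "bounded_bilinear b" "gsmooth f" "gsmooth g"
 shows "lder Y (%x. b (f x) (g x)) x = b (f x) (lder Y g x) + b (lder Y f x) (g x)"
 using lder_eqI[OF bounded_bilinear.FDERIV[OF assms(1) lder_hfd[OF assms(2)] lder_hfd[OF assms(3)]]]
 by (simp add: b0)

lemmas lder_mult = lder_bilinear[OF bounded_bilinear_mult]

lemma lder_bounded_linear: assumes "bounded_linear L" "gsmooth f"
 shows "lder Y (%x. L (f x)) x = L (lder Y f x)"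
 by (rule lder_eqI[OF bounded_linear.has_derivative[OF assms(1) lder_hfd[OF assms(2)]]])

lemma lder_cnj: "gsmooth f ==> lder Y (%x. cnj (f x)) x = cnj (lder Y f x)"
 by (rule lder_bounded_linear[OF bounded_linear_cnj])

lemma lder_cmult: "gsmooth f ==> lder Y (%x. c * f x) x = c * lder Y (f :: 'g => complex) x"
 by (rule lder_bounded_linear[OF bounded_linear_mult_right])

lemma lder_sum: assumes "finite A" "!!i. i : A ==> gsmooth (f i)"
 shows "lder Y (%x. SUM i:A. f i x) x = (SUM i:A. lder Y (f i) x)"
 by (rule lder_eqI[OF has_derivative_sum]) (rule lder_hfd[OF assms(2)])

lemma lder_sum_Basis: assumes "gsmooth f"
 shows "lder Y f x = (SUM b:Basis. (Y \<bullet> b) *\<^sub>R lder b f x)"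
 by (rule linear_Basis[OF linear_lder[OF assms]])

lemma chart_mult_has_derivative: assumes f: "gsmooth f" and c: "c : charts" "y : cdom c"
 shows "((%y. f (z \<otimes> chart_inv c y)) hfd (%v. lder (toid c y v) f (z \<otimes> chart_inv c y))) (at y)"
 using chart_hfd[OF gsmooth_left[OF f, of z] c] by (simp add: lder_translate)

lemma continuous_on_lder_chart: fixes f :: "'g => 'b::real_normed_vector"
 assumes f: "gsmooth f" and c: "c : charts"
 shows "continuous_on (cdom c \<times> UNIV) (%(y, z). lder (toid c y v) f (z \<otimes> chart_inv c y))"
proof -
 have 1: "continuous_on (cdom c \<times> UNIV) (%p. lder b f (snd p \<otimes> chart_inv c (fst p)))" for b
  by (auto intro!: ctn_group_mult continuous_on_compose2[OF chartD(4)[OF c]] continuous_intros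
   continuous_on_compose2[OF gsmooth_ctn[OF gsmooth_lder[OF f]]])
 have 2: "continuous_on (cdom c \<times> UNIV) (%p::(real^'n) \<times> 'g. toid c (fst p) v)"
  by (rule continuous_on_compose2[OF smooth_ctn[OF smooth_toid[OF c]]]) (auto intro!: continuous_intros)
 have "continuous_on (cdom c \<times> UNIV) (%p. SUM b:Basis. (toid c (fst p) v \<bullet> b) *\<^sub>R lder b f (snd p
  \<otimes> chart_inv c (fst p)))"
  by (intro continuous_intros 1 2)
 thus ?thesis by (simp add: case_prod_beta' flip: lder_sum_Basis[OF f])
qed

text \<open>The argument \<open>x\<close> stands on the right, so that left-invariant derivatives in
  \<open>x\<close> fall on \<open>ph\<close> alone and continuity of \<open>g\<close>
  suffices.\<close>

definition conv :: "('g => complex) => ('g => complex) => 'g => complex" where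
 "conv ph g x = cint (%z. ph (z \<otimes> x) * g z)"

lemma conv_has_derivative: assumes ph: "gsmooth ph" and g: "cont g" and c: "c : charts" "y : cdom c"
 shows "((%y. conv ph g (chart_inv c y)) hfd (%v. conv (lder (toid c y v) ph) g (chart_inv c y))) (at y)"
 unfolding conv_def proof (rule cint_has_derivative[OF chartD(2)[OF c(1)] c(2)])
 have r: "cont (%z. f (z \<otimes> x))" if "gsmooth f" for f and x
  by (rule gsmooth_ctn[OF gsmooth_right[OF that]])
 show "cont (%z. ph (z \<otimes> chart_inv c a) * g z)" for a by (intro continuous_intros r ph g)
 show "((%a. ph (z \<otimes> chart_inv c a) * g z) hfd (%v. lder (toid c a v) ph (z \<otimes> chart_inv c a) * g z))
  (at a)"
  if "a : cdom c" for a z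
  by (rule has_derivative_mult_left[OF chart_mult_has_derivative[OF ph c(1) that]])
 show "continuous_on (cdom c \<times> UNIV) (%(a, z). lder (toid c a v) ph (z \<otimes> chart_inv c a) * g z)" for v
  using continuous_on_mult[OF continuous_on_lder_chart[OF ph c(1), of v]]
   by (simp add: case_prod_beta' continuous_on_compose2[OF g] continuous_intros)
qed

lemma linear_conv_lder: assumes "gsmooth ph" "cont g"
 shows "conv (lder Y ph) g x = (SUM b:Basis. (Y \<bullet> b) *\<^sub>R conv (lder b ph) g x)"
proof -
 have "linear (%Y. conv (lder Y ph) g x)" proof (rule linearI)
  have c: "cont (%z. lder Y ph (z \<otimes> x) * g z)" for Y
   by (intro continuous_on_mult assms(2) gsmooth_ctn[OF gsmooth_right[OF gsmooth_lder[OF assms(1)]]])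
  show "conv (lder (Y + Y') ph) g x = conv (lder Y ph) g x + conv (lder Y' ph) g x" for Y Y'
   unfolding conv_def by (simp add: linear_add[OF linear_lder[OF assms(1)]] distrib_right cint_add c)
  show "conv (lder (r *\<^sub>R Y) ph) g x = r *\<^sub>R conv (lder Y ph) g x" for r Y
   using linear_cmul[OF linear_lder[OF assms(1)], of r Y]
    by (simp add: scaleR_conv_of_real mult.assoc cint_cmult c scaleR_conv_of_real[of r "cint _"] conv_def)
 qed
 thus ?thesis by (rule linear_Basis)
qed

text \<open>The counterpart of \<open>smooth_on_class\<close> on the group: the chart coefficients
  \<open>toid\<close> are smooth, so it is enough that the class is closed under the maps
  \<open>E\<close>, which play the part of left-invariant derivatives.\<close>

lemma gsmooth_class: fixes F :: "('g => 'b::real_normed_vector) set"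
 assumes d: "!!f c y. f : F ==> c : charts ==> y : cdom c ==>
   ((%z. f (chart_inv c z)) hfd (%v. SUM b:Basis. (toid c y v \<bullet> b) *\<^sub>R E f b (chart_inv c y))) (at y)"
  and E: "!!f b. f : F ==> b : Basis ==> E f b : F" and f: "f : F" shows "gsmooth f"
 unfolding gsmooth_def proof
 fix c assume c: "c : charts"
 show "smooth_on (cdom c) (%y. f (chart_inv c y))"
 proof (rule smooth_on_class[where F="(%f y. f (chart_inv c y)) ` F", OF chartD(2)[OF c]])
  show "h differentiable (at y)" if h: "h : (%f y. f (chart_inv c y)) ` F" and y: "y : cdom c" for h y
  using h differentiableI[OF d[OF _ c y]] by auto
  fix h v assume "h : (%f y. f (chart_inv c y)) ` F"
  then obtain f where f: "f : F" "h = (%y. f (chart_inv c y))" by auto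
  show "EX I::(real^'n) set. EX a g. (ALL i:I. smooth_on (cdom c) (a i :: real^'n => real) & g i : (%f y. f (chart_inv
   c y)) ` F) &
   (ALL y:cdom c. FD h (at y) v = (SUM i:I. a i y *\<^sub>R g i y))"
  proof (intro exI conjI ballI)
   fix b :: "real^'n" assume b: "b : Basis"
   show "smooth_on (cdom c) (%y. toid c y v \<bullet> b)"
    by (rule smooth_blin[OF bounded_linear_inner_left chartD(2)[OF c] smooth_toid[OF c]])
   show "(%y. E f b (chart_inv c y)) : (%f y. f (chart_inv c y)) ` F" using E[OF f(1) b] by simp
  next
   fix y assume "y : cdom c"
   show "FD h (at y) v = (SUM b:Basis. (toid c y v \<bullet> b) *\<^sub>R E f b (chart_inv c y))"
    using fun_cong[OF frechet_derivative_at[OF d[OF f(1) c \<open>y : cdom c\<close>]], of v] f(2) by simp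
  qed
 qed (use f in auto)
qed

lemma gsmooth_conv: assumes ph: "gsmooth ph" and g: "cont g" shows "gsmooth (conv ph g)" proof -
 \<comment> \<open>A convolution need not determine its first factor, so \<open>E\<close> works with
   a chosen one.\<close>
 define E where "E h b = conv (lder b (SOME ph. gsmooth ph & h = conv ph g)) g" for h :: "'g => complex" and b
 have S: "gsmooth (SOME ph. gsmooth ph & h = conv ph g) & h = conv (SOME ph. gsmooth ph & h = conv ph g) g"
  if h: "h : {conv ph g |ph. gsmooth ph}" for h proof -
  obtain ph' where "gsmooth ph' & h = conv ph' g" using h by blast
  from someI[of "%ph. gsmooth ph & h = conv ph g", OF this] show ?thesis .
 qed
 show ?thesis proof (rule gsmooth_class[where F="{conv ph g |ph. gsmooth ph}" and E=E])
  fix h c y assume h: "h : {conv ph g |ph. gsmooth ph}" and c: "c : charts" "y : cdom c"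
  let ?ph = "SOME ph. gsmooth ph & h = conv ph g"
  have s: "gsmooth ?ph" "h = conv ?ph g" using S[OF h] by auto
  show "((%z. h (chart_inv c z)) hfd (%v. SUM b:Basis. (toid c y v \<bullet> b) *\<^sub>R E h b (chart_inv c y))) (at
   y)"
   using conv_has_derivative[OF s(1) g c]
    unfolding E_def s(2)[symmetric] linear_conv_lder[OF s(1) g, of "toid c y _"] .
 next
  fix h and b :: "real ^ 'n" assume "h : {conv ph g |ph. gsmooth ph}"
  thus "E h b : {conv ph g |ph. gsmooth ph}" using S gsmooth_lder by (auto simp: E_def)
 qed (use ph in auto)
qed

lemma toid_c0: "toid c0 b0 v = v" proof -
 have "((%z. snd c0 (inv (chart_inv c0 b0) \<otimes> chart_inv c0 z)) hfd (%v. v)) (at b0)" using has_derivative_ident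
  by (rule hfd_transform[OF _ chartD(2)[OF c0(1)]]) (use b0 chartD[OF c0(1)] in auto)
 from has_derivative_unique[OF this toid_hfd[OF c0(1) b0(1)]] show ?thesis by metis
qed

text \<open>By right invariance the mean of \<open>ph (z \<otimes> x)\<close> over \<open>z\<close>
  does not depend on \<open>x\<close>; its derivative at the identity is the mean of
  \<open>lder Y ph\<close>.\<close>

lemma cint_lder: assumes ph: "gsmooth ph" shows "cint (lder Y ph) = 0" proof -
 have "((%y. cint ph) hfd (%v. conv (lder (toid c0 b0 v) ph) (%_. 1) (chart_inv c0 b0))) (at b0)"
  using cint_right[OF gsmooth_ctn[OF ph]] conv_has_derivative[OF ph continuous_on_const[of _ 1] c0(1) b0(1)]
   by (simp add: conv_def)
 from has_derivative_unique[OF this has_derivative_const]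
 have "conv (lder (toid c0 b0 Y) ph) (%_. 1) (chart_inv c0 b0) = 0" by metis
 thus ?thesis by (simp add: toid_c0 b0 conv_def)
qed

lemma cint_by_parts: assumes "gsmooth f" "gsmooth g"
 shows "cint (%x. lder Y f x * g x) = - cint (%x. f x * lder Y g x)" proof -
 have c: "cont (%x. lder Y f x * g x)" "cont (%x. f x * lder Y g x)"
  by (intro gsmooth_ctn gsmooth_mult gsmooth_lder assms)+
 have "lder Y (%x. f x * g x) = (%x. f x * lder Y g x + lder Y f x * g x)"
  by (rule ext) (rule lder_mult[OF assms])
 thus ?thesis using cint_lder[OF gsmooth_mult[OF assms], of Y]
  by (simp add: cint_add c eq_neg_iff_add_eq_0 add.commute)
qed

text \<open>The bump is supported in the image \<open>K\<close> of a closed coordinate ball, which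
  is compact and hence closed; its complement is open, and this settles smoothness outside the
  domain of \<open>c0\<close>.\<close>

lemma group_bump: assumes U: "open U" "\<one> : U"
 obtains ph :: "'g => real" where "gsmooth ph" "!!x. 0 <= ph x" "ph \<one> > 0" "!!x. ph x ~= 0 ==> x : U"
proof -
 note c = c0(1)
 have o: "open {y : cdom c0. chart_inv c0 y : U}" by (rule open_pre[OF chartD(4,2)[OF c] U(1)])
 obtain r where r: "r > 0" "cball b0 r \<subseteq> {y : cdom c0. chart_inv c0 y : U}"
  using open_contains_cball[THEN iffD1, OF o] b0 U(2) by auto
 obtain rh :: "real^'n => real" where rh: "smooth_on UNIV rh" "!!x. 0 <= rh x" "rh b0 > 0"
  "!!x. rh x ~= 0 ==> dist b0 x < r"
  using smooth_bump[OF r(1)] by auto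
 define ph where "ph = (%x. if x : fst c0 then rh (snd c0 x) else 0)"
 define K where "K = chart_inv c0 ` cball b0 r"
 have cK: "closed K" unfolding K_def by (rule compact_imp_closed, (rule compact_continuous_image), (use chartD(4)[OF
  c] r(2) in \<open>auto intro: continuous_on_subset\<close>))
 have supp: "x : K" if "ph x ~= 0" for x proof -
  have x: "x : fst c0" "rh (snd c0 x) ~= 0" using that by (auto simp: ph_def split: if_splits)
  hence "snd c0 x : cball b0 r" using rh(4)[OF x(2)] by simp
  thus ?thesis unfolding K_def using chartD(5)[OF c x(1)] by (metis imageI)
 qed
 have "gsmooth ph" unfolding gsmooth_def proof
  fix c' assume c': "c' : charts"
  show "smooth_on (cdom c') (%y. ph (chart_inv c' y))" proof (rule smooth_on_local)
   fix y assume y: "y : cdom c'"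
   show "EX T. open T & y : T & smooth_on T (%y. ph (chart_inv c' y))"
   proof (cases "chart_inv c' y : fst c0")
    case True
    let ?T = "{y : cdom c'. chart_inv c' y : fst c0}"
    have oT: "open ?T" by (rule open_pre[OF chartD(4,2)[OF c'] chartD(1)[OF c]])
    have "smooth_on ?T (%y. ph (chart_inv c' y))"
     using smooth_comp[OF oT open_UNIV UNIV_I chart_transition[OF c' c] rh(1)]
      by (rule smooth_cong[OF oT, rotated]) (simp add: ph_def)
    thus ?thesis using oT y True by (intro exI[of _ ?T]) auto
   next
    case False
    let ?T = "{y : cdom c'. chart_inv c' y : - K}"
    have oT: "open ?T" by (rule open_pre[OF chartD(4,2)[OF c']]) (use cK in \<open>simp add: open_Compl\<close>)
    have "smooth_on ?T (%y. ph (chart_inv c' y))"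
     by (rule smooth_cong[OF oT _ smooth_on_const[of _ 0]]) (use supp in auto)
    moreover have "chart_inv c' y ~: K" using False chartD(8)[OF c] r(2) by (auto simp: K_def)
    ultimately show ?thesis using oT y by (intro exI[of _ ?T]) auto
   qed
  qed
 qed
 moreover have "x : U" if "ph x ~= 0" for x using supp[OF that] r(2) by (auto simp: K_def)
 ultimately show thesis using rh c0(2) by (intro that[of ph]) (auto simp: ph_def b0_def)
qed

end

section \<open>Unitary representations\<close>

lemma mat_adjoint_entry:
 "i < dim_col A ==> j < dim_row A ==> mat_adjoint A $$ (i, j) = cnj (A $$ (j, i))"
 by (simp add: mat_adjoint_def mat_of_rows_def)

lemma mat_adjoint_carrier: "A : carrier_mat n m ==> mat_adjoint A : carrier_mat m n"
 by (intro carrier_matI) (auto simp: mat_adjoint_def)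

lemma mat_mult_entry: assumes "A : carrier_mat n m" "B : carrier_mat m k" "i < n" "j < k"
 shows "(A * B) $$ (i, j) = (SUM l<m. A $$ (i, l) * B $$ (l, j))"
 using assms by (simp add: scalar_prod_def atLeast0LessThan)

lemma complex_eigenvector: fixes A :: "nat => nat => complex" assumes "d > 0"
 obtains v e where "EX i<d. v i ~= 0" "!!i. i < d ==> (SUM l<d. A i l * v l) = e * v i" proof -
 define M where "M = Matrix.mat d d (%(i, j). A i j)"
 have M: "M : carrier_mat d d" by (simp add: M_def)
 obtain e where "eigenvalue M e" using spectrum_non_empty[OF M assms] by (auto simp: spectrum_def)
 then obtain v where v: "v : carrier_vec d" "v ~= 0\<^sub>v d" "M *\<^sub>v v = e \<cdot>\<^sub>v v"
  using M by (auto simp: eigenvalue_def eigenvector_def)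
 show thesis proof
  show "EX i<d. vec_index v i ~= 0" using v(1) v(2) by auto
  show "(SUM l<d. A i l * vec_index v l) = e * vec_index v i" if "i < d" for i
   using arg_cong[OF v(3), of "%w. vec_index w i"] that v(1)
   by (simp add: M_def scalar_prod_def atLeast0LessThan)
 qed
qed

context compact_lie
begin

text \<open>A representation is given by its entries as functions on the group, unitarity being the
  rule for \<open>inv x\<close>. Indices from \<open>d\<close> on carry no condition.\<close>

definition urep :: "nat => (nat => nat => 'g => complex) => bool" where
 "urep d r \<longleftrightarrow> (ALL i<d. ALL j<d. cont (r i j)) &
  (ALL i<d. ALL j<d. ALL x y. r i j (x \<otimes> y) = (SUM l<d. r i l x * r l j y)) &
  (ALL i<d. ALL j<d. r i j \<one> = (if i = j then 1 else 0)) &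
  (ALL i<d. ALL j<d. ALL x. r i j (inv x) = cnj (r j i x))"

text \<open>Subspaces are encoded as predicates on sequences that see only the first
  \<open>d\<close> entries, so that kernels, images and spaces of smooth vectors can be inserted
  directly.\<close>

definition irr :: "nat => (nat => nat => 'g => complex) => bool" where
 "irr d r \<longleftrightarrow> d > 0 & (ALL P. (ALL v w. (ALL i<d. v i = w i) --> P v --> P w) --> P (%_. 0) -->
  (ALL v w. P v --> P w --> P (%i. v i + w i)) --> (ALL c v. P v --> P (%i. c * v i)) -->
  (ALL x v. P v --> P (%i. SUM l<d. r i l x * v l)) --> (ALL v. P v --> (ALL i<d. v i = 0)) | (ALL v. P v))"

lemma irrD: assumes "irr d r" "!!v w. (!!i. i < d ==> v i = w i) ==> P v ==> P w" "P (%_. 0)"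
  "!!v w. P v ==> P w ==> P (%i. v i + w i)" "!!c v. P v ==> P (%i. c * v i)"
  "!!x v. P v ==> P (%i. SUM l<d. r i l x * v l)"
 shows "(ALL v. P v --> (ALL i<d. v i = 0)) | (ALL v. P v)" proof -
 have "(ALL v w. (ALL i<d. v i = w i) --> P v --> P w) --> P (%_. 0) -->
  (ALL v w. P v --> P w --> P (%i. v i + w i)) --> (ALL c v. P v --> P (%i. c * v i)) -->
  (ALL x v. P v --> P (%i. SUM l<d. r i l x * v l)) --> (ALL v. P v --> (ALL i<d. v i = 0)) | (ALL v. P v)"
  using assms(1) unfolding irr_def by (elim conjE) (erule allE)
 thus ?thesis using assms(2-) by presburger
qed

lemma disj_all_cases:
 "(ALL v. P v --> (ALL i<d. v i = z)) | (ALL v. P v) ==> ~ P w ==> P v ==> i < (d::nat) ==> v i = z"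
 "(ALL v. P v --> (ALL i<d. v i = z)) | (ALL v. P v) ==> P u ==> i < d ==> u i ~= z ==> P w"
 by blast+

lemma urepD: assumes "urep d r" "i < d" "j < d"
 shows "cont (r i j)" "r i j (x \<otimes> y) = (SUM l<d. r i l x * r l j y)"
  "r i j \<one> = (if i = j then 1 else 0)" "r i j (inv x) = cnj (r j i x)"
 using assms unfolding urep_def by blast+

lemma urep_unitary: assumes "urep d r" "i < d" "j < d"
 shows "(SUM l<d. r i l x * cnj (r j l x)) = (if i = j then 1 else 0)"
  "(SUM l<d. cnj (r l i x) * r l j x) = (if i = j then 1 else 0)" proof -
 have "(SUM l<d. r i l x * r l j (inv x)) = r i j (x \<otimes> inv x)"
  by (rule urepD(2)[OF assms, symmetric])
 thus "(SUM l<d. r i l x * cnj (r j l x)) = (if i = j then 1 else 0)"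
  using urepD(3)[OF assms] urepD(4)[OF assms(1) _ assms(3)] by simp
 have "(SUM l<d. r i l (inv x) * r l j x) = r i j (inv x \<otimes> x)"
  by (rule urepD(2)[OF assms, symmetric])
 thus "(SUM l<d. cnj (r l i x) * r l j x) = (if i = j then 1 else 0)"
  using urepD(3)[OF assms] urepD(4)[OF assms(1,2)] by simp
qed

definition ent :: "('g => complex Matrix.mat) => nat => nat => 'g => complex" where
 "ent xi i j x = xi x $$ (i, j)"

lemma unitary_urep: assumes "unitary_rep G xi" shows "urep (rep_dim G xi) (ent xi)" proof -
 define d where "d = rep_dim G xi"
 have c: "xi x : carrier_mat d d" and u: "mat_adjoint (xi x) * xi x = 1\<^sub>m d"
  and m: "xi (x \<otimes> y) = xi x * xi y"
  and co: "i < d ==> j < d ==> ctn (%x. xi x $$ (i, j))" for x y i j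
  using assms by (auto simp: unitary_rep_def Let_def d_def)
 have ca: "mat_adjoint (xi x) : carrier_mat d d" for x by (rule mat_adjoint_carrier[OF c])
 have one: "xi \<one> = 1\<^sub>m d" proof -
  have "xi \<one> = (mat_adjoint (xi \<one>) * xi \<one>) * xi \<one>" using u c[of \<one>] by simp
  also have "... = mat_adjoint (xi \<one>) * (xi \<one> * xi \<one>)" by (rule assoc_mult_mat[OF ca c c])
  also have "... = 1\<^sub>m d" using m[of \<one> \<one>] u by simp
  finally show ?thesis .
 qed
 have inv: "xi (inv x) = mat_adjoint (xi x)" for x proof -
  have "mat_adjoint (xi x) = mat_adjoint (xi x) * (xi x * xi (inv x))"
   using m[of x "inv x"] one right_mult_one_mat[OF ca] by simp
  also have "... = xi (inv x)" by (metis u assoc_mult_mat[OF ca c c, symmetric] left_mult_one_mat[OF c])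
  finally show ?thesis by simp
 qed
 have "ent xi i j (x \<otimes> y) = (SUM l<d. ent xi i l x * ent xi l j y)" if "i < d" "j < d" for i j x y
  using mat_mult_entry[OF c c that] by (simp add: ent_def m)
 moreover have "ent xi i j (inv x) = cnj (ent xi j i x)" if "i < d" "j < d" for i j x
  using that c[of x] by (simp add: ent_def inv mat_adjoint_entry)
 ultimately show ?thesis
  unfolding urep_def d_def[symmetric] using co one by (simp add: ent_def[abs_def])
qed

lemma subspace_iff:
 "VectorSpace.subspace class_ring W (module_vec TYPE(complex) d) \<longleftrightarrow>
  W \<subseteq> carrier_vec d & (ALL v:W. ALL w:W. v + w : W) & 0\<^sub>v d : W & (ALL c. ALL v:W. c \<cdot>\<^sub>v v
   : W)"
 using vec_vs[where 'a=complex, of d] vec_module[where 'a=complex, of d]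
  by (auto simp: subspace_def submodule_def module_vec_simps)

lemma irreducible_irr: assumes u: "unitary_rep G xi" and i: "irreducible_rep G xi"
 shows "irr (rep_dim G xi) (ent xi)" unfolding irr_def proof (intro conjI allI impI)
 define d where "d = rep_dim G xi"
 have c: "xi x : carrier_mat d d" for x using u by (auto simp: unitary_rep_def Let_def d_def)
 show "rep_dim G xi > 0" using i by (simp add: irreducible_rep_def Let_def)
 fix P :: "(nat => complex) => bool"
 assume P: "ALL v w. (ALL i<rep_dim G xi. v i = w i) --> P v --> P w" "P (%_. 0)"
  "ALL v w. P v --> P w --> P (%i. v i + w i)" "ALL c v. P v --> P (%i. c * v i)"
  "ALL x v. P v --> P (%i. SUM l<rep_dim G xi. ent xi i l x * v l)"
 have Pc: "P w" if "P v" "!!i. i < d ==> v i = w i" for v w using P(1) that unfolding d_def by blast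
 define W where "W = {v : carrier_vec d. P (vec_index v)}"
 have "VectorSpace.subspace class_ring W (module_vec TYPE(complex) d)" unfolding subspace_iff W_def
 proof (intro conjI ballI allI subsetI; (elim CollectE conjE)?; (intro CollectI conjI)?)
  fix v w assume v: "v : carrier_vec d" "P (vec_index v)" and w: "w : carrier_vec d" "P (vec_index w)"
  have "P (%i. vec_index v i + vec_index w i)" using P(3) v(2) w(2) by blast
  thus "P (vec_index (v + w))" by (rule Pc) (use w in auto)
  show "v + w : carrier_vec d" using v w by simp
 next
  show "P (vec_index (0\<^sub>v d))" by (rule Pc[OF P(2)]) simp
 next
  fix c and v assume v: "v : carrier_vec d" "P (vec_index v)"
  have "P (%i. c * vec_index v i)" using P(4) v(2) by blast
  thus "P (vec_index (c \<cdot>\<^sub>v v))" by (rule Pc) (use v in auto)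
  show "c \<cdot>\<^sub>v v : carrier_vec d" using v by simp
 qed auto
 moreover have "ALL x. ALL v:W. xi x *\<^sub>v v : W" proof (intro allI ballI)
  fix x v assume "v : W"
  hence v: "v : carrier_vec d" "P (vec_index v)" by (auto simp: W_def)
  have "P (%i. SUM l<d. ent xi i l x * vec_index v l)" using P(5) v(2) unfolding d_def by blast
  hence "P (vec_index (xi x *\<^sub>v v))"
   by (rule Pc) (use v c[of x] in \<open>auto simp: ent_def scalar_prod_def atLeast0LessThan\<close>)
  thus "xi x *\<^sub>v v : W" using v c[of x] by (auto simp: W_def)
 qed
 ultimately have "W = {0\<^sub>v d} | W = carrier_vec d"
  using i unfolding irreducible_rep_def Let_def d_def[symmetric] by blast
 thus "(ALL v. P v --> (ALL i<rep_dim G xi. v i = 0)) | (ALL v. P v)" proof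
  assume W: "W = {0\<^sub>v d}"
  have "v i = 0" if "P v" "i < d" for v i proof -
   have "Matrix.vec d v : W" unfolding W_def using Pc[OF that(1), of "vec_index (Matrix.vec d v)"] by simp
   hence "Matrix.vec d v = 0\<^sub>v d" using W by simp
   from arg_cong[OF this, of "%v. vec_index v i"] show ?thesis using that(2) by simp
  qed
  thus ?thesis by (simp add: d_def)
 next
  assume W: "W = carrier_vec d"
  have "P v" for v proof -
   have "Matrix.vec d v : W" using W by simp
   thus ?thesis by (simp add: W_def Pc)
  qed
  thus ?thesis by blast
 qed
qed

text \<open>The way back from entries to matrices: completeness is proved with entry families,
  whereas the dual consists of matrix-valued maps.\<close>

lemma urep_unitary_irreps: assumes u: "urep d r" and i: "irr d r"
 defines "xi == %x. Matrix.mat d d (%(i, j). r i j x)"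
 shows "xi : unitary_irreps G" "rep_dim G xi = d" "!!i j. i < d ==> j < d ==> ent xi i j = r i j"
proof -
 have d: "rep_dim G xi = d" by (simp add: rep_dim_def xi_def)
 have ent: "ent xi i j = r i j" if "i < d" "j < d" for i j
  using that by (simp add: ent_def[abs_def] xi_def)
 have c: "xi x : carrier_mat d d" for x by (simp add: xi_def)
 have "unitary_rep G xi" unfolding unitary_rep_def Let_def d proof (intro conjI allI impI)
  show "mat_adjoint (xi x) * xi x = 1\<^sub>m d" for x proof (rule eq_matI)
   fix i j assume "i < dim_row (1\<^sub>m d :: complex Matrix.mat)" "j < dim_col (1\<^sub>m d :: complex Matrix.mat)"
   hence ij: "i < d" "j < d" by auto
   have "mat_adjoint (xi x) : carrier_mat d d" by (rule mat_adjoint_carrier[OF c])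
   from mat_mult_entry[OF this c ij]
   show "(mat_adjoint (xi x) * xi x) $$ (i, j) = 1\<^sub>m d $$ (i, j)" using ij urep_unitary(2)[OF u ij]
    by (simp add: mat_adjoint_entry xi_def)
  qed (simp_all add: mat_adjoint_def xi_def)
  show "xi (x \<otimes> y) = xi x * xi y" for x y proof (rule eq_matI)
   fix i j assume "i < dim_row (xi x * xi y)" "j < dim_col (xi x * xi y)"
   hence ij: "i < d" "j < d" by (auto simp: xi_def)
   show "xi (x \<otimes> y) $$ (i, j) = (xi x * xi y) $$ (i, j)"
    unfolding mat_mult_entry[OF c c ij] using urepD(2)[OF u ij] ij by (simp add: xi_def)
  qed (simp_all add: xi_def)
  show "ctn (%x. xi x $$ (i, j))" if "i < d" "j < d" for i j
   using urepD(1)[OF u that] that by (simp add: xi_def)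
 qed (use c in auto)
 moreover have "irreducible_rep G xi" unfolding irreducible_rep_def Let_def d
 proof (intro conjI allI impI)
  show "d > 0" using i by (simp add: irr_def)
  fix W assume W: "VectorSpace.subspace class_ring W (module_vec TYPE(complex) d) & (ALL x. ALL v:W. xi x *\<^sub>v v
   : W)"
  hence Wc: "W \<subseteq> carrier_vec d" "!!v w. v : W ==> w : W ==> v + w : W" "0\<^sub>v d : W"
   "!!c v. v : W ==> c \<cdot>\<^sub>v v : W"
   and Wx: "!!x v. v : W ==> xi x *\<^sub>v v : W" unfolding subspace_iff by blast+
  define P where "P = (%v. Matrix.vec d v : W)"
  have "(ALL v. P v --> (ALL i<d. v i = 0)) | (ALL v. P v)" proof (rule irrD[OF i])
   show "P w" if "!!i. i < d ==> v i = w i" "P v" for v w proof -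
    have "Matrix.vec d v = Matrix.vec d w" by (rule eq_vecI) (use that in auto)
    thus ?thesis using that by (simp add: P_def)
   qed
   have "Matrix.vec d (%_. 0) = 0\<^sub>v d" by auto
   thus "P (%_. 0)" unfolding P_def using Wc(3) by metis
   show "P (%i. v i + w i)" if "P v" "P w" for v w proof -
    have "Matrix.vec d (%i. v i + w i) = Matrix.vec d v + Matrix.vec d w" by auto
    thus ?thesis using Wc(2) that by (simp add: P_def)
   qed
   show "P (%i. c * v i)" if "P v" for c v proof -
    have "Matrix.vec d (%i. c * v i) = c \<cdot>\<^sub>v Matrix.vec d v" by auto
    thus ?thesis using Wc(4) that by (simp add: P_def)
   qed
   show "P (%i. SUM l<d. r i l x * v l)" if "P v" for x v proof -
    have "Matrix.vec d (%i. SUM l<d. r i l x * v l) = xi x *\<^sub>v Matrix.vec d v"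
     by (rule eq_vecI) (auto simp: xi_def scalar_prod_def atLeast0LessThan)
    thus ?thesis using Wx that by (simp add: P_def)
   qed
  qed
  thus "W = {0\<^sub>v d} | W = carrier_vec d" proof
   assume z: "ALL v. P v --> (ALL i<d. v i = 0)"
   have "v = 0\<^sub>v d" if "v : W" for v proof (rule eq_vecI)
    have vd: "v : carrier_vec d" using that Wc(1) by blast
    hence "Matrix.vec d (vec_index v) = v" by auto
    hence "P (vec_index v)" using that by (simp add: P_def)
    thus "vec_index v i = vec_index (0\<^sub>v d) i" if "i < dim_vec (0\<^sub>v d :: complex Matrix.vec)" for i
     using z that by simp
    show "dim_vec v = dim_vec (0\<^sub>v d)" using vd by simp
   qed
   thus ?thesis using Wc(3) by blast
  next
   assume z: "ALL v. P v"
   have "v : W" if "v : carrier_vec d" for v proof -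
    have "Matrix.vec d (vec_index v) = v" using that by auto
    thus ?thesis using z by (metis P_def)
   qed
   thus ?thesis using Wc(1) by auto
  qed
 qed
 ultimately show "xi : unitary_irreps G" by (simp add: unitary_irreps_def)
 show "rep_dim G xi = d" by (rule d)
 show "!!i j. i < d ==> j < d ==> ent xi i j = r i j" by (rule ent)
qed

end

context compact_lie
begin

subsection \<open>Schur's lemma\<close>

text \<open>The kernel of the intertwiner is invariant under one representation and its image under
  the other; a nonzero entry rules out the wrong alternative in each case.\<close>

lemma schur: assumes r: "urep d r" "irr d r" and r': "urep d' r'" "irr d' r'"
  and A_all: "ALL i<d. ALL k<d'. ALL g. (SUM p<d. r i p g * A p k) = (SUM q<d'. A i q * r' q k g)"
  and nz: "i0 < d" "k0 < d'" "A i0 k0 ~= 0"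
 shows "EX B. (ALL i<d. ALL j<d. (SUM k<d'. A i k * B k j) = (if i = j then 1 else 0)) &
  (ALL k<d'. ALL l<d'. (SUM i<d. B k i * A i l) = (if k = l then 1 else 0))" proof -
 have comm: "(SUM p<d. r i p g * (SUM k<d'. A p k * v k)) = (SUM q<d'. A i q * (SUM k<d'. r' q k g * v k))" if "i < d"
  for i g v
 proof -
  have "(SUM p<d. r i p g * (SUM k<d'. A p k * v k)) = (SUM k<d'. (SUM p<d. r i p g * A p k) * v k)"
   by (subst sum_distrib_right, simp only: sum_distrib_left mult.assoc) (rule sum.swap)
  also have "... = (SUM q<d'. A i q * (SUM k<d'. r' q k g * v k))" using A_all that
   by (auto simp: sum_distrib_right sum_distrib_left mult.assoc intro!: sum.swap)
  finally show ?thesis .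
 qed
 have ker: "ALL k<d'. v k = 0" if v: "!!i. i < d ==> (SUM k<d'. A i k * v k) = 0" for v proof -
  let ?P = "%v. ALL i<d. (SUM k<d'. A i k * v k) = 0"
  have disj: "(ALL v. ?P v --> (ALL i<d'. v i = 0)) | (ALL v. ?P v)" proof (rule irrD[OF r'(2)])
   show "?P w" if "!!i. i < d' ==> v i = w i" "?P v" for v w using that by simp
   show "?P (%i. v i + w i)" if "?P v" "?P w" for v w
    using that by (simp add: distrib_left)
   show "?P (%i. c * v i)" if "?P v" for c v
    using that by (simp add: mult.left_commute flip: sum_distrib_left)
   show "?P (%i. SUM l<d'. r' i l x * v l)" if "?P v" for x v using that by (simp flip: comm)
  qed simp
  have n: "~ ?P (%k. if k = k0 then 1 else 0)"
   using nz by (auto simp: if_distrib[of "(*) _"] cong: if_cong)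
  have "?P v" using v by simp
  from disj_all_cases(1)[where P="?P", OF disj n this] show ?thesis by simp
 qed
 let ?Q = "%w. EX v. ALL i<d. w i = (SUM k<d'. A i k * v k)"
 have disj: "(ALL w. ?Q w --> (ALL i<d. w i = 0)) | (ALL w. ?Q w)" proof (rule irrD[OF r(2)])
  show "?Q w" if "!!i. i < d ==> v i = w i" "?Q v" for v w using that by auto
  show "?Q (%_. 0)" by (intro exI[of _ "%_. 0"]) simp
  show "?Q (%i. v i + w i)" if Q: "?Q v" "?Q w" for v w proof -
   obtain a b where "ALL i<d. v i = (SUM k<d'. A i k * a k)" "ALL i<d. w i = (SUM k<d'. A i k * b k)" using Q by blast
   thus ?thesis by (intro exI[of _ "%k. a k + b k"]) (simp add: distrib_left)
  qed
  show "?Q (%i. c * v i)" if Q: "?Q v" for c v proof -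
   obtain a where "ALL i<d. v i = (SUM k<d'. A i k * a k)" using Q by blast
   thus ?thesis by (intro exI[of _ "%k. c * a k"]) (simp add: sum_distrib_left mult.left_commute)
  qed
  show "?Q (%i. SUM l<d. r i l x * v l)" if Q: "?Q v" for x v proof -
   obtain a where a: "ALL i<d. v i = (SUM k<d'. A i k * a k)" using Q by blast
   thus ?thesis by (intro exI[of _ "%q. SUM k<d'. r' q k x * a k"]) (simp flip: comm)
  qed
 qed
 have "?Q (%i. A i k0)" using nz(2)
  by (intro exI[of _ "%k. if k = k0 then 1 else 0"]) (simp add: if_distrib[of "(*) _"] cong: if_cong)
 from disj_all_cases(2)[where P="?Q", OF disj this nz(1,3)] have Q: "?Q w" for w .
 \<comment> \<open>Surjectivity yields a right inverse column by column. It is a left inverse too,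
   because the difference to the identity is annihilated by \<open>A\<close>, whose kernel is
   trivial.\<close>
 have "ALL j. EX v. ALL i<d. (if i = j then 1 else 0) = (SUM k<d'. A i k * v k)" by (rule , rule Q)
 from choice[OF this] obtain B' where "ALL j. ALL i<d. (if i = j then 1 else 0) = (SUM k<d'. A i k * B' j k)" ..
 hence AB: "(SUM k<d'. A i k * B' j k) = (if i = j then 1 else 0)" if "i < d" for i j using that by simp
 show ?thesis proof (intro exI[of _ "%k j. B' j k"] conjI allI impI)
  show "(SUM k<d'. A i k * B' j k) = (if i = j then 1 else 0)" if "i < d" "j < d" for i j using AB that by simp
  fix k l assume kl: "k < d'" "l < d'"
  let ?v = "%k. (SUM i<d. B' i k * A i l) - (if k = l then 1 else 0)"
  have "(SUM k<d'. A i k * ?v k) = 0" if i: "i < d" for i proof -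
   have "(SUM k<d'. A i k * (SUM j<d. B' j k * A j l)) = (SUM j<d. (SUM k<d'. A i k * B' j k) * A j l)"
    by (simp only: sum_distrib_right sum_distrib_left mult.assoc) (rule sum.swap)
   also have "... = A i l" using i by (simp add: AB if_distrib[of "%x. x * _"] cong: if_cong)
   finally show ?thesis using kl by (simp add: right_diff_distrib sum_subtractf if_distrib[of "(*) _"] cong: if_cong)
  qed
  from ker[OF this] kl show "(SUM i<d. B' i k * A i l) = (if k = l then 1 else 0)" by simp
 qed
qed

text \<open>Subtracting an eigenvalue gives an intertwiner that annihilates an eigenvector; by
  Schur's lemma it cannot have a nonzero entry.\<close>

lemma commutant_scalar: assumes r: "urep d r" "irr d r"
  and A: "!!i k g. i < d ==> k < d ==> (SUM p<d. r i p g * A p k) = (SUM q<d. A i q * r q k g)"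
 obtains c where "!!i k. i < d ==> k < d ==> A i k = (if i = k then c else 0)" proof -
 have d: "d > 0" using r(2) by (simp add: irr_def)
 obtain v e where v: "EX i<d. v i ~= 0" "!!i. i < d ==> (SUM l<d. A i l * v l) = e * v i"
  using complex_eigenvector[OF d, of A] by blast
 let ?A = "%i k. A i k - (if i = k then e else 0)"
 have A': "(SUM p<d. r i p g * ?A p k) = (SUM q<d. ?A i q * r q k g)" if "i < d" "k < d" for i k g
  using A[OF that] that by (simp add: right_diff_distrib left_diff_distrib sum_subtractf if_distrib[of "(*) _"]
   mult.commute cong: if_cong)
 have "?A i k = 0" if ik: "i < d" "k < d" for i k proof (rule ccontr)
  assume ne: "?A i k ~= 0"
  have "ALL i<d. ALL k<d. ALL g. (SUM p<d. r i p g * ?A p k) = (SUM q<d. ?A i q * r q k g)" using A' by simp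
  from schur[where A="?A", OF r r this ik ne] obtain B where
   "ALL k<d. ALL l<d. (SUM i<d. B k i * ?A i l) = (if k = l then 1 else 0)" by auto
  hence B: "(SUM i<d. B k i * ?A i l) = (if k = l then 1 else 0)" if "k < d" "l < d" for k l
   using that by blast
  have Av: "(SUM l<d. ?A i l * v l) = 0" if "i < d" for i
   using v(2)[OF that] that by (simp add: left_diff_distrib sum_subtractf if_distrib[of "%x. x * _"] cong: if_cong)
  have "v k = 0" if k: "k < d" for k proof -
   have "v k = (SUM l<d. (SUM i<d. B k i * ?A i l) * v l)"
    using k by (simp add: B if_distrib[of "%x. x * _"] cong: if_cong)
   also have "... = (SUM i<d. B k i * (SUM l<d. ?A i l * v l))"
    by (simp only: sum_distrib_right sum_distrib_left mult.assoc) (rule sum.swap)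
   also have "... = 0" by (simp add: Av)
   finally show ?thesis .
  qed
  thus False using v(1) by auto
 qed
 thus thesis by (intro that[of e]) simp
qed

lemma irrepsD: assumes "xi : unitary_irreps G"
 shows "urep (rep_dim G xi) (ent xi)" "irr (rep_dim G xi) (ent xi)" "rep_dim G xi > 0"
  "xi x : carrier_mat (rep_dim G xi) (rep_dim G xi)" using assms unitary_urep irreducible_irr
 by (auto simp: unitary_irreps_def irreducible_rep_def unitary_rep_def Let_def)

lemma equiv_rep_equivalence: "equiv (unitary_irreps G) (rep_equivalence G)" proof (rule equivI)
 show "rep_equivalence G \<subseteq> unitary_irreps G \<times> unitary_irreps G"
  by (auto simp: rep_equivalence_def)
 show "refl_on (unitary_irreps G) (rep_equivalence G)" proof (rule refl_onI)
  fix xi assume x: "xi : unitary_irreps G"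
  note c = irrepsD(4)[OF x]
  show "(xi, xi) : rep_equivalence G" using x c
   by (simp add: left_mult_one_mat[OF c] right_mult_one_mat[OF c] invertible_mat_def inverts_mat_def square_mat.simps
    rep_equivalence_def conjI exI[of _ "1\<^sub>m (rep_dim G xi)"])
 qed
 have invE: "EX B. B : carrier_mat n m & A * B = 1\<^sub>m m & B * A = 1\<^sub>m n & m = n"
  if A: "A : carrier_mat m n" and inv: "invertible_mat A" for A :: "complex Matrix.mat" and m n
 proof -
  obtain B where B: "A * B = 1\<^sub>m m" "B * A = 1\<^sub>m (dim_row B)"
   using inv A unfolding invertible_mat_def inverts_mat_def by auto
  have "dim_col B = m" using arg_cong[OF B(1), of dim_col] by simp
  moreover have "dim_row B = n" using arg_cong[OF B(2), of dim_col] A by simp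
  ultimately show ?thesis using A inv B by (auto simp: invertible_mat_def)
 qed
 show "sym (rep_equivalence G)" proof (rule symI)
  fix xi et assume "(xi, et) : rep_equivalence G"
  then obtain A where x: "xi : unitary_irreps G" "et : unitary_irreps G"
   and A: "A : carrier_mat (rep_dim G et) (rep_dim G xi)" "invertible_mat A" "!!x. A * xi x = et x * A"
   by (auto simp: rep_equivalence_def)
  note c = irrepsD(4)[OF x(1)] irrepsD(4)[OF x(2)]
  obtain B where B: "B : carrier_mat (rep_dim G xi) (rep_dim G et)" "A * B = 1\<^sub>m (rep_dim G et)"
   "B * A = 1\<^sub>m (rep_dim G xi)"
   "rep_dim G et = rep_dim G xi" using invE[OF A(1,2)] by auto
  have "invertible_mat B" unfolding invertible_mat_def inverts_mat_def using A(1) B by auto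
  moreover have "B * et x = xi x * B" for x proof -
   have "B * et x = B * (et x * (A * B))" using B(1,2) c(2)[of x] by simp
   also have "et x * (A * B) = A * (xi x * B)"
    by (metis assoc_mult_mat[OF A(1) c(1) B(1)] A(3) assoc_mult_mat[OF c(2) A(1) B(1), symmetric])
   also have "B * (A * (xi x * B)) = B * A * (xi x * B)"
    by (rule assoc_mult_mat[OF B(1) A(1), symmetric]) (use c(1)[of x] in auto)
   also have "... = xi x * B" unfolding B(3) by (rule left_mult_one_mat) (use c(1)[of x] in auto)
   finally show ?thesis .
  qed
  ultimately show "(et, xi) : rep_equivalence G" using x B(1) by (auto simp: rep_equivalence_def)
 qed
 show "trans (rep_equivalence G)" proof (rule transI)
  fix xi et ze assume "(xi, et) : rep_equivalence G" "(et, ze) : rep_equivalence G"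
  then obtain A A' where x: "xi : unitary_irreps G" "et : unitary_irreps G" "ze : unitary_irreps G"
   and A: "A : carrier_mat (rep_dim G et) (rep_dim G xi)" "invertible_mat A" "!!x. A * xi x = et x * A"
   and A': "A' : carrier_mat (rep_dim G ze) (rep_dim G et)" "invertible_mat A'" "!!x. A' * et x = ze x * A'"
   by (auto simp: rep_equivalence_def)
  note c = irrepsD(4)[OF x(1)] irrepsD(4)[OF x(2)] irrepsD(4)[OF x(3)]
  obtain B where B: "B : carrier_mat (rep_dim G xi) (rep_dim G et)" "A * B = 1\<^sub>m (rep_dim G et)"
   "B * A = 1\<^sub>m (rep_dim G xi)"
   "rep_dim G et = rep_dim G xi" using invE[OF A(1,2)] by auto
  obtain B' where B': "B' : carrier_mat (rep_dim G et) (rep_dim G ze)" "A' * B' = 1\<^sub>m (rep_dim G ze)"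
   "B' * A' = 1\<^sub>m (rep_dim G et)"
   "rep_dim G ze = rep_dim G et" using invE[OF A'(1,2)] by auto
  have 1: "(A' * A) * (B * B') = 1\<^sub>m (rep_dim G ze)" proof -
   have "(A' * A) * (B * B') = A' * (A * (B * B'))" by (rule assoc_mult_mat[OF A'(1) A(1)]) (use B(1) in auto)
   also have "A * (B * B') = B'" by (metis B(2) assoc_mult_mat[OF A(1) B(1) B'(1), symmetric] left_mult_one_mat[OF
    B'(1)])
   finally show ?thesis using B'(2) by simp
  qed
  have 2: "(B * B') * (A' * A) = 1\<^sub>m (rep_dim G xi)" proof -
   have "(B * B') * (A' * A) = B * (B' * (A' * A))" by (rule assoc_mult_mat[OF B(1) B'(1)]) (use A'(1) in auto)
   also have "B' * (A' * A) = A" by (metis B'(3) assoc_mult_mat[OF B'(1) A'(1) A(1), symmetric] left_mult_one_mat[OF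
    A(1)])
   finally show ?thesis using B(3) by simp
  qed
  have inv: "invertible_mat (A' * A)" using 1 A'(1) 2 B(1) A(1) B(4) B'(4)
   by (auto simp: invertible_mat_def inverts_mat_def)
  have "A' * A * xi x = ze x * (A' * A)" for x
   by (metis A(3) A'(3) assoc_mult_mat[OF A'(1) A(1) c(1)] assoc_mult_mat[OF A'(1) c(2) A(1), symmetric]
    assoc_mult_mat[OF c(3) A'(1) A(1)])
  thus "(xi, ze) : rep_equivalence G"
   using x inv A(1) A'(1) by (auto simp: rep_equivalence_def intro!: exI[of _ "A' * A"])
 qed
qed

lemma intertwiner_equivalence: assumes x: "xi : unitary_irreps G" "et : unitary_irreps G"
  and A: "ALL i<rep_dim G et. ALL k<rep_dim G xi. ALL g.
   (SUM p<rep_dim G et. ent et i p g * A p k) = (SUM q<rep_dim G xi. A i q * ent xi q k g)"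
  and nz: "i0 < rep_dim G et" "k0 < rep_dim G xi" "A i0 k0 ~= 0"
 shows "(xi, et) : rep_equivalence G" proof -
 define d d' where "d = rep_dim G et" and "d' = rep_dim G xi"
 from schur[where A=A, OF irrepsD(1,2)[OF x(2)] irrepsD(1,2)[OF x(1)] A nz]
 obtain B where "ALL i<d. ALL j<d. (SUM k<d'. A i k * B k j) = (if i = j then 1 else 0)"
  "ALL k<d'. ALL l<d'. (SUM i<d. B k i * A i l) = (if k = l then 1 else 0)"
  unfolding d_def d'_def by (elim exE conjE)
 hence B: "i < d ==> j < d ==> (SUM k<d'. A i k * B k j) = (if i = j then 1 else 0)"
  "k < d' ==> l < d' ==> (SUM i<d. B k i * A i l) = (if k = l then 1 else 0)" for i j k l by blast+
 \<comment> \<open>The two products of \<open>A\<close> with its inverse have the same trace, and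
   these traces are the two dimensions.\<close>
 have "complex_of_nat d = (SUM k<d'. SUM i<d. B k i * A i k)" using B(1) by (simp add: sum.swap mult.commute)
 also have "... = complex_of_nat d'" using B(2) by simp
 finally have dd: "d = d'" by simp
 define MA where "MA = Matrix.mat d d' (%(i, k). A i k)"
 define MB where "MB = Matrix.mat d' d (%(k, i). B k i)"
 have c: "MA : carrier_mat d d'" "MB : carrier_mat d' d" by (auto simp: MA_def MB_def)
 have e1: "MA * MB = 1\<^sub>m d" proof (rule eq_matI)
  fix i j assume "i < dim_row (1\<^sub>m d :: complex Matrix.mat)" "j < dim_col (1\<^sub>m d :: complex Matrix.mat)"
  hence ij: "i < d" "j < d" by auto
  show "(MA * MB) $$ (i, j) = 1\<^sub>m d $$ (i, j)"
   unfolding mat_mult_entry[OF c ij] using B(1)[OF ij] ij by (simp add: MA_def MB_def)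
 qed (use c in auto)
 have e2: "MB * MA = 1\<^sub>m d'" proof (rule eq_matI)
  fix i j assume "i < dim_row (1\<^sub>m d' :: complex Matrix.mat)" "j < dim_col (1\<^sub>m d' :: complex Matrix.mat)"
  hence ij: "i < d'" "j < d'" by auto
  show "(MB * MA) $$ (i, j) = 1\<^sub>m d' $$ (i, j)"
   unfolding mat_mult_entry[OF c(2,1) ij] using B(2)[OF ij] ij by (simp add: MA_def MB_def)
 qed (use c in auto)
 have "invertible_mat MA" unfolding invertible_mat_def inverts_mat_def using c e1 e2 dd by auto
 moreover have "MA * xi g = et g * MA" for g proof -
  have cx: "xi g : carrier_mat d' d'" "et g : carrier_mat d d"
   using irrepsD(4)[OF x(1)] irrepsD(4)[OF x(2)] by (auto simp: d_def d'_def)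
  show ?thesis proof (rule eq_matI)
   fix i k assume "i < dim_row (et g * MA)" "k < dim_col (et g * MA)"
   hence ik: "i < d" "k < d'" using cx c by auto
   show "(MA * xi g) $$ (i, k) = (et g * MA) $$ (i, k)"
    unfolding mat_mult_entry[OF c(1) cx(1) ik] mat_mult_entry[OF cx(2) c(1) ik]
    using A[rule_format, of i k g] ik by (simp add: MA_def ent_def d_def d'_def)
  qed (use cx c in auto)
 qed
 ultimately show ?thesis using x c(1) unfolding d_def d'_def by (auto simp: rep_equivalence_def)
qed

lemma equivalent_entries: assumes "(xi, et) : rep_equivalence G"
 obtains C where "!!i j x. i < rep_dim G xi ==> j < rep_dim G xi ==>
  ent xi i j x = (SUM p<rep_dim G et. SUM q<rep_dim G et. C i j p q * ent et p q x)" proof -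
 have "(et, xi) : rep_equivalence G" using assms equiv_rep_equivalence by (meson equivE symD)
 then obtain A where x: "xi : unitary_irreps G" "et : unitary_irreps G"
  and A: "A : carrier_mat (rep_dim G xi) (rep_dim G et)" "invertible_mat A" "!!x. A * et x = xi x * A"
  by (auto simp: rep_equivalence_def)
 note c = irrepsD(4)[OF x(1)] irrepsD(4)[OF x(2)]
 obtain B where B: "A * B = 1\<^sub>m (rep_dim G xi)" "B * A = 1\<^sub>m (dim_row B)"
  using A(1,2) unfolding invertible_mat_def inverts_mat_def by auto
 have Bc: "B : carrier_mat (rep_dim G et) (rep_dim G xi)"
  using arg_cong[OF B(1), of dim_col] arg_cong[OF B(2), of dim_col] A(1) by auto
 have "ent xi i j x = (SUM p<rep_dim G et. SUM q<rep_dim G et. A $$ (i, p) * B $$ (q, j) * ent et p q x)"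
  if ij: "i < rep_dim G xi" "j < rep_dim G xi" for i j x proof -
  have "xi x = xi x * (A * B)" using B(1) c(1)[of x] by simp
  also have "... = A * et x * B" unfolding A(3) by (rule assoc_mult_mat[OF c(1) A(1) Bc, symmetric])
  finally have "ent xi i j x = (A * et x * B) $$ (i, j)" by (simp add: ent_def)
  also have "... = (SUM q<rep_dim G et. (A * et x) $$ (i, q) * B $$ (q, j))"
   by (rule mat_mult_entry[OF _ Bc ij]) (use A(1) c(2)[of x] in auto)
  also have "... = (SUM q<rep_dim G et. SUM p<rep_dim G et. A $$ (i, p) * B $$ (q, j) * ent et p q x)"
   by (intro sum.cong refl) (simp add: mat_mult_entry[OF A(1) c(2) ij(1)] sum_distrib_right sum_distrib_left ent_def
    mult_ac)
  finally show ?thesis by (subst sum.swap)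
 qed
 thus thesis by (rule that)
qed

subsection \<open>Matrix entries of irreducible representations\<close>

text \<open>The vectors whose orbit functions are smooth form an invariant subspace, so one nonzero
  smooth vector is enough. It is a Garding vector, the average of a basis vector against a bump at
  the identity.\<close>

lemma irr_gsmooth: assumes r: "urep d r" "irr d r" and ij: "i < d" "j < d" shows "gsmooth (r i j)"
proof -
 have d: "0 < d" using r(2) by (simp add: irr_def)
 let ?P = "%v. ALL i<d. gsmooth (%x. SUM l<d. r i l x * v l)"
 have disj: "(ALL v. ?P v --> (ALL i<d. v i = 0)) | (ALL v. ?P v)" proof (rule irrD[OF r(2)])
  show "?P w" if "!!i. i < d ==> v i = w i" "?P v" for v w using that by simp
  show "?P (%_. 0)" by (simp add: gsmooth_const)
  show "?P (%i. v i + w i)" if "?P v" "?P w" for v w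
   using that by (simp add: distrib_left gsmooth_add)
  show "?P (%i. c * v i)" if "?P v" for c v
   using that gsmooth_mult[OF gsmooth_const[of c]] by (simp add: mult.left_commute flip: sum_distrib_left)
  show "?P (%i. SUM l<d. r i l g * v l)" if v: "?P v" for g v proof (intro allI impI)
   fix i assume i: "i < d"
   have "(SUM l<d. r i l x * (SUM m<d. r l m g * v m)) = (SUM m<d. r i m (x \<otimes> g) * v m)" for x
   using urepD(2)[OF r(1) i] by (auto simp: sum_distrib_right sum_distrib_left mult.assoc intro!: sum.swap)
   thus "gsmooth (%x. SUM l<d. r i l x * (SUM m<d. r l m g * v m))"
    using gsmooth_right[of "%x. SUM m<d. r i m x * v m" g] v i by simp
  qed
 qed
 have "EX w. ?P w & w 0 ~= 0" proof -
  have c: "cont (%z. r l 0 (inv z))" if "l < d" for l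
   by (rule continuous_on_compose2[OF urepD(1)[OF r(1) that d]]) (auto intro!: ctn_group_inv)
  let ?U = "{z : UNIV. Re (r 0 0 (inv z)) : {1/2<..}}"
  have "open ?U" by (rule open_pre[OF cont_Re[OF c[OF d]] open_UNIV open_greaterThan])
  moreover have "\<one> : ?U" using urepD(3)[OF r(1) d d] by simp
  ultimately obtain ph :: "'g => real" where ph: "gsmooth ph" "!!x. 0 <= ph x" "ph \<one> > 0"
   "!!x. ph x ~= 0 ==> x : ?U"
   using group_bump[of ?U] by blast
  have s: "gsmooth (%z. cor (ph z))" by (rule gsmooth_bounded_linear[OF bounded_linear_of_real ph(1)])
  \<comment> \<open>Component 0 has positive real part, since the bump lives where
    \<open>Re (r 0 0 (inv z))\<close> exceeds 1/2.\<close>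
  define w where "w = (%l. cint (%z. cor (ph z) * r l 0 (inv z)))"
  have cs: "cont (%z. cor (ph z))" by (rule gsmooth_ctn[OF s])
  have cc: "cont (%z. cor (ph z) * r l 0 (inv z))" if "l < d" for l
   by (intro continuous_on_mult cs c that)
  have "gsmooth (%x. SUM l<d. r i l x * w l)" if i: "i < d" for i proof -
   have "(SUM l<d. r i l x * w l) = conv (%z. cor (ph z)) (%z. r i 0 (inv z)) x" for x
   proof -
    have "(SUM l<d. r i l x * w l) = cint (%z. SUM l<d. r i l x * (cor (ph z) * r l 0 (inv z)))"
     unfolding w_def by (subst cint_sum) (auto intro!: continuous_on_mult_left cc simp: cint_cmult[OF cc])
    also have "... = cint (%z. cor (ph z) * r i 0 (x \<otimes> inv z))"
     by (simp add: urepD(2)[OF r(1) i d] sum_distrib_left mult.left_commute)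
    also have "... = cint (%z. cor (ph (z \<otimes> x)) * r i 0 (x \<otimes> inv (z \<otimes> x)))"
     by (rule cint_right[symmetric])
      (intro continuous_intros cs continuous_on_compose2[OF urepD(1)[OF r(1) i d]] ctn_group_mult ctn_group_inv, auto)
    also have "... = conv (%z. cor (ph z)) (%z. r i 0 (inv z)) x"
     by (simp add: conv_def inv_mult_group)
    finally show ?thesis .
   qed
   thus ?thesis using gsmooth_conv[OF s c[OF i]] by simp
  qed
  moreover have "Re (w 0) > 0" proof -
   have "0 < haar ph" by (rule haar_pos[OF gsmooth_ctn[OF ph(1)] ph(2,3)])
   also have "haar ph <= 2 * Re (w 0)" proof -
    have "haar ph <= haar (%z. 2 * (ph z * Re (r 0 0 (inv z))))" proof (rule haar_mono)
     show "ph z <= 2 * (ph z * Re (r 0 0 (inv z)))" for z proof (cases "ph z = 0")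
      case False
      hence "1 <= 2 * Re (r 0 0 (inv z))" using ph(4)[OF False] by simp
      from mult_left_mono[OF this ph(2)[of z]] show ?thesis by simp
     qed simp
    qed (auto intro!: continuous_intros gsmooth_ctn[OF ph(1)] c[OF d])
    also have "... = 2 * Re (w 0)"
     by (subst haar_cmult) (auto intro!: continuous_intros gsmooth_ctn[OF ph(1)] c[OF d] simp: w_def cint_def)
    finally show ?thesis .
   qed
   finally show ?thesis by simp
  qed
  ultimately show ?thesis by (intro exI[of _ w]) auto
 qed
 then obtain w where w: "?P w" "w 0 ~= 0" by blast
 have "?P v" for v by (rule disj_all_cases(2)[where P="?P", OF disj w(1) d w(2)])
 from this[of "%l. if l = j then 1 else 0"] show ?thesis
  using ij by (simp add: if_distrib[of "(*) _"] cong: if_cong)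
qed

lemma lder_entry: assumes r: "urep d r" "irr d r" and ij: "i < d" "j < d"
 shows "lder Y (r i j) x = (SUM l<d. r i l x * lder Y (r l j) \<one>)" proof -
 have "lder Y (r i j) x = lder Y (%y. r i j (x \<otimes> y)) \<one>" by (simp add: lder_translate)
 also have "... = (SUM l<d. lder Y (%y. r i l x * r l j y) \<one>)"
  by (auto simp: urepD(2)[OF r(1) ij] intro!: lder_sum gsmooth_mult gsmooth_const irr_gsmooth[OF r] ij)
 also have "... = (SUM l<d. r i l x * lder Y (r l j) \<one>)"
  by (intro sum.cong lder_cmult irr_gsmooth[OF r]) (use ij in auto)
 finally show ?thesis .
qed

lemma cont_entries: assumes "urep d r" "i < d" "j < d" "urep d' r'" "k < d'" "l < d'"
 shows "cont (%x. r i j x * cnj (r' k l x))"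
 by (intro continuous_intros urepD(1)[OF assms(1-3)] urepD(1)[OF assms(4-6)])

text \<open>Replacing \<open>x\<close> by \<open>inv g \<otimes> x\<close> under the mean moves the
  matrix of \<open>g\<close> from one representation to the other.\<close>

lemma entry_average_intertwines:
 assumes r: "urep d r" and r': "urep d' r'" and "i < d" "j < d" "k < d'" "l < d'"
 shows "(SUM p<d. r i p g * cint (%x. r p j x * cnj (r' k l x))) = (SUM q<d'. cint (%x. r i j x * cnj (r' q l x)) * r'
  q k g)"
proof -
 note c = cont_entries[OF r _ assms(4) r' _ assms(6)]
 have "(SUM p<d. r i p g * cint (%x. r p j x * cnj (r' k l x))) = cint (%x. SUM p<d. r i p g * (r p j x * cnj (r' k l
  x)))"
  by (subst cint_sum) (auto intro!: continuous_on_mult_left c simp: cint_cmult c assms)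
 also have "... = cint (%x. r i j (g \<otimes> x) * cnj (r' k l x))"
  by (simp add: urepD(2)[OF r assms(3,4)] sum_distrib_right mult.assoc)
 also have "... = cint (%x. r i j (g \<otimes> (inv g \<otimes> x)) * cnj (r' k l (inv g \<otimes> x)))"
  by (rule cint_left[symmetric])
   (intro continuous_intros continuous_on_compose2[OF urepD(1)[OF r assms(3,4)]] urepD(1)[OF r' assms(5,6)]
    ctn_group_mult, auto)
 also have "... = cint (%x. SUM q<d'. r' q k g * (r i j x * cnj (r' q l x)))"
  by (simp add: urepD(2)[OF r' assms(5,6)] urepD(4)[OF r' assms(5)] sum_distrib_left mult_ac)
 also have "... = (SUM q<d'. cint (%x. r i j x * cnj (r' q l x)) * r' q k g)"
  by (subst cint_sum) (auto intro!: continuous_on_mult_left c simp: cint_cmult c assms mult.commute)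
 finally show ?thesis .
qed

lemma orthogonality_same: assumes r: "urep d r" "irr d r" and "i < d" "j < d" "k < d" "l < d"
 shows "cint (%x. r i j x * cnj (r k l x)) = (if i = k & j = l then 1 / d else 0)" proof -
 obtain c where c: "!!i k. i < d ==> k < d ==> cint (%x. r i j x * cnj (r k l x)) = (if i = k then c else 0)"
  by (rule commutant_scalar[OF r, of "%i k. cint (%x. r i j x * cnj (r k l x))"])
   (rule entry_average_intertwines[OF r(1) r(1) _ assms(4) _ assms(6)], auto)
 \<comment> \<open>The diagonal sum determines the constant: by unitarity its integrand is
   identically 0 or 1.\<close>
 have "of_nat d * c = (SUM i<d. cint (%x. r i j x * cnj (r i l x)))" using c by simp
 also have "... = cint (%x. SUM i<d. r i j x * cnj (r i l x))"
  by (rule cint_sum[symmetric]) (auto intro!: cont_entries[OF r(1) _ _ r(1)] assms)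
 also have "... = (if j = l then 1 else 0)" proof -
  have "(SUM i<d. r i j x * cnj (r i l x)) = (if j = l then 1 else 0)" for x
   using urep_unitary(2)[OF r(1) assms(6,4), of x] by (auto simp: mult.commute)
  thus ?thesis by simp
 qed
 finally show ?thesis using assms(3) c[OF assms(3,5)] by (auto simp: field_simps)
qed

end

section \<open>Invariant inner products and the Casimir operator\<close>

locale lie_metric = compact_lie G for G :: "('g::t2_space, 'n::finite) lie_group" (structure) +
 fixes ip :: "real ^ 'n => real ^ 'n => real" assumes metric: "killing_metric G ip"
begin

lemma ip_bilinear: "bilinear ip" and ip_sym: "ip X Y = ip Y X" and ip_pos: "X ~= 0 ==> ip X X > 0"
 and ip_Ad: "ip (Ad G g X) (Ad G g Y) = ip X Y" using metric by (auto simp: killing_metric_def)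

lemma ip_linear: "linear (%X. ip X Y)" "linear (ip X)"
 using ip_bilinear by (auto simp: bilinear_def)

lemmas ip_simps = linear_add[OF ip_linear(1)] linear_add[OF ip_linear(2)] linear_diff[OF ip_linear(1)]
 linear_diff[OF ip_linear(2)] linear_cmul[OF ip_linear(1)] linear_cmul[OF ip_linear(2)]
 linear_sum[OF ip_linear(1)] linear_sum[OF ip_linear(2)] linear_0[OF ip_linear(1)] linear_0[OF ip_linear(2)]

definition ipbasis :: "('n => real ^ 'n) => bool" where
 "ipbasis v \<longleftrightarrow> (ALL i j. ip (v i) (v j) = (if i = j then 1 else 0))"

lemma ipbasis_inj: "ipbasis v ==> inj v" unfolding ipbasis_def inj_def by (metis zero_neq_one)

lemma ipbasis_expand: assumes v: "ipbasis v" shows "(SUM i:UNIV. ip Y (v i) *\<^sub>R v i) = Y"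
proof -
 have vv: "ip (v i) (v j) = (if i = j then 1 else 0)" for i j using v by (simp add: ipbasis_def)
 have "independent (range v)" unfolding dependent_finite[OF finite_imageI[OF finite[of UNIV], of v]]
 proof (rule notI, elim exE conjE bexE)
  fix u w assume w: "w : range v" "u w ~= 0" "(SUM w:range v. u w *\<^sub>R w) = 0"
  obtain j where j: "w = v j" using w(1) by auto
  have "0 = ip (SUM i:UNIV. u (v i) *\<^sub>R v i) (v j)"
   using w(3) by (simp add: sum.reindex[OF ipbasis_inj[OF v]] ip_simps)
  also have "... = u (v j)" by (simp add: ip_simps vv if_distrib[of "(*) _"] cong: if_cong)
  finally show False using w(2) j by simp
 qed
 moreover have "card (range v) = dim (UNIV :: (real^'n) set)"
  using card_image[OF ipbasis_inj[OF v]] by simp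
 ultimately have sp: "Y - (SUM i:UNIV. ip Y (v i) *\<^sub>R v i) : span (range v)"
  using card_eq_dim[of "range v" UNIV] by auto
 have z: "ip (Y - (SUM i:UNIV. ip Y (v i) *\<^sub>R v i)) (v j) = 0" for j
  by (simp add: ip_simps vv if_distrib[of "(*) _"] cong: if_cong)
 have "ip z w = 0" if "w : span (range v)" "!!j. ip z (v j) = 0" for w z
  using that(1) by (induction rule: span_induct_alt) (auto simp: ip_simps that(2))
 from this[OF sp z] have "Y - (SUM i:UNIV. ip Y (v i) *\<^sub>R v i) = 0"
  by (rule contrapos_pp[OF _ less_imp_neq[OF ip_pos, symmetric]])
 thus ?thesis by simp
qed

text \<open>Gram-Schmidt for \<open>ip\<close>, run over an initial segment of the naturals and then
  transported to the index type.\<close>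

lemma ipbasis_exists:
 obtains v where "ipbasis v" proof -
 have "EX u. ALL i<k. ALL j<k. ip (u i) (u j) = (if i = j then 1 else (0::real))" if "k <= CARD('n)" for k
  using that proof (induction k)
  case (Suc k)
  then obtain u where u: "ALL i<k. ALL j<k. ip (u i) (u j) = (if i = j then 1 else (0::real))" by auto
  have "dim (u ` {..<k}) <= card (u ` {..<k})" by (rule dim_le_card') simp
  also have "... <= k" using card_image_le[of "{..<k}" u] by simp
  finally have "dim (span (u ` {..<k})) < DIM(real^'n)" using Suc.prems by simp
  hence "span (u ` {..<k}) ~= UNIV" by (metis dim_UNIV less_irrefl)
  then obtain x where x: "x ~: span (u ` {..<k})" by blast
  define z where "z = x - (SUM i<k. ip x (u i) *\<^sub>R u i)"
  have "(SUM i<k. ip x (u i) *\<^sub>R u i) : span (u ` {..<k})"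
   by (intro span_sum span_scale span_base) auto
  hence zz: "ip z z > 0" using x by (auto simp: z_def intro!: ip_pos)
  have zu: "ip z (u j) = 0" if "j < k" for j proof -
   have "(SUM i<k. ip x (u i) * ip (u i) (u j)) = (SUM i<k. if i = j then ip x (u j) else 0)"
    using u that by (intro sum.cong) auto
   thus ?thesis using that by (simp add: z_def ip_simps)
  qed
  have uz: "ip (u j) z = 0" if "j < k" for j using zu[OF that] by (simp add: ip_sym)
  define z' where "z' = (1 / sqrt (ip z z)) *\<^sub>R z"
  show ?case using zz u zu uz by (simp add: z'_def ip_simps real_div_sqrt power2_eq_square[symmetric] field_simps
   less_Suc_eq exI[of _ "u(k := z')"])
 qed simp
 then obtain u where u: "ALL i<CARD('n). ALL j<CARD('n). ip (u i) (u j) = (if i = j then 1 else (0::real))" by blast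
 obtain h where h: "bij_betw h (UNIV :: 'n set) {0..<CARD('n)}"
  using ex_bij_betw_finite_nat[of "UNIV :: 'n set"] by auto
 have hl: "h i < CARD('n)" for i using bij_betwE[OF h] by auto
 have "ipbasis (%i. u (h i))" using bij_betw_imp_inj_on[OF h] u hl by (simp add: inj_on_def ipbasis_def)
 thus thesis by (rule that)
qed

text \<open>Invariance of a trace under orthogonal change of basis; with second derivatives in the
  place of \<open>B\<close> it frees the Casimir operator from the choice of frame.\<close>

lemma ipbasis_change: fixes B :: "real^'n => real^'n => 'b::real_vector"
 assumes v: "ipbasis v" and w: "ipbasis w" and B: "!!Y. linear (B Y)" "!!Y. linear (%X. B X Y)"
 shows "(SUM a:UNIV. B (w a) (w a)) = (SUM a:UNIV. B (v a) (v a))" proof -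
 have "B (w a) (w a) = (SUM b:UNIV. SUM c:UNIV. (ip (w a) (v b) * ip (w a) (v c)) *\<^sub>R B (v b) (v c))" for a
 proof -
  have "B (w a) (w a) = B (SUM b:UNIV. ip (w a) (v b) *\<^sub>R v b) (SUM c:UNIV. ip (w a) (v c) *\<^sub>R v c)"
   by (simp add: ipbasis_expand[OF v])
  also have "... = (SUM b:UNIV. SUM c:UNIV. (ip (w a) (v b) * ip (w a) (v c)) *\<^sub>R B (v b) (v c))"
   by (simp add: linear_sum[OF B(2)] linear_sum[OF B(1)] linear_cmul[OF B(2)] linear_cmul[OF B(1)] scaleR_sum_right)
    (subst sum.swap, simp add: mult.commute)
  finally show ?thesis .
 qed
 hence "(SUM a:UNIV. B (w a) (w a)) = (SUM a:UNIV. SUM b:UNIV. SUM c:UNIV. (ip (w a) (v b) * ip (w a) (v c)) *\<^sub>R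
  B (v b) (v c))"
  by simp
 also have "... = (SUM b:UNIV. SUM c:UNIV. (SUM a:UNIV. ip (w a) (v b) * ip (w a) (v c)) *\<^sub>R B (v b) (v c))"
  unfolding scaleR_sum_left by (subst sum.swap) (rule sum.cong[OF refl sum.swap])
 also have "... = (SUM b:UNIV. SUM c:UNIV. ip (v b) (v c) *\<^sub>R B (v b) (v c))" proof -
  have "(SUM a:UNIV. ip (w a) (v b) * ip (w a) (v c)) = ip (SUM a:UNIV. ip (v b) (w a) *\<^sub>R w a) (v c)" for b c
   by (simp add: ip_simps ip_sym[of "v b"])
  thus ?thesis by (simp add: ipbasis_expand[OF w])
 qed
 also have "... = (SUM b:UNIV. B (v b) (v b))" using v
  by (simp add: ipbasis_def if_distrib[of "%x. x *\<^sub>R _"] cong: if_cong)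
 finally show ?thesis .
qed

definition frame :: "'n => real ^ 'n" where "frame = (SOME v. ipbasis v)"

lemma frame: "ipbasis frame" unfolding frame_def using ipbasis_exists someI_ex[of ipbasis] by metis

text \<open>The Casimir operator of \<open>ip\<close>: the sum of squares over one orthonormal frame
  of left-invariant fields.\<close>

definition cas :: "('g => 'b::real_normed_vector) => 'g => 'b" where
 "cas f x = (SUM a:UNIV. lder (frame a) (lder (frame a) f) x)"

lemma gsmooth_cas: "gsmooth f ==> gsmooth (cas f)"
 unfolding cas_def by (intro gsmooth_sum gsmooth_lder)

lemma linear_lder_lder: "gsmooth f ==> linear (%Y. lder Z (lder Y f) x)" proof (rule linearI)
 assume f: "gsmooth f"
 have e: "lder (Y + Y') f = (%x. lder Y f x + lder Y' f x)" "lder (r *\<^sub>R Y) f = (%x. r *\<^sub>R lder Y f x)"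
  for Y Y' r
  by (simp_all add: fun_eq_iff linear_add[OF linear_lder[OF f]] linear_cmul[OF linear_lder[OF f]])
 show "lder Z (lder (Y + Y') f) x = lder Z (lder Y f) x + lder Z (lder Y' f) x" for Y Y'
  unfolding e by (rule lder_add) (intro gsmooth_lder f)+
 show "lder Z (lder (r *\<^sub>R Y) f) x = r *\<^sub>R lder Z (lder Y f) x" for r Y
  unfolding e by (rule lder_bounded_linear[OF bounded_linear_scaleR_right gsmooth_lder[OF f]])
qed

lemma cas_ipbasis: assumes f: "gsmooth f" and w: "ipbasis w"
 shows "(SUM a:UNIV. lder (w a) (lder (w a) f) x) = cas f x" unfolding cas_def
 by (rule ipbasis_change[OF frame w, where B="%Z Y. lder Z (lder Y f) x"])
  (intro linear_lder_lder linear_lder gsmooth_lder f)+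

text \<open>The differential of conjugation in coordinates; \<open>Ad_eq\<close> identifies it with
  \<open>Ad\<close>, whose definition runs through the exponential map.\<close>

definition adj :: "'g => real ^ 'n => real ^ 'n" where
 "adj g = FD (%b. snd c0 (g \<otimes> chart_inv c0 b \<otimes> inv g)) (at b0)"

lemma conj_set:
 "open {b : cdom c0. g \<otimes> chart_inv c0 b \<otimes> inv g : fst c0}" (is "open ?S")
 "b0 : {b : cdom c0. g \<otimes> chart_inv c0 b \<otimes> inv g : fst c0}"
 "((%b. snd c0 (g \<otimes> chart_inv c0 b \<otimes> inv g)) hfd adj g) (at b0)" proof -
 have g: "gmap_on (cdom c0) (%b. g \<otimes> chart_inv c0 b \<otimes> inv g)"
  by (intro gmap_on_mult gmap_on_const gmap_on_chart_inv chartD c0)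
 show "open ?S" by (rule open_pre[OF gmap_ctn[OF g]]) (intro chartD c0)+
 show b: "b0 : ?S" using b0 c0 by simp
 show "((%b. snd c0 (g \<otimes> chart_inv c0 b \<otimes> inv g)) hfd adj g) (at b0)"
  unfolding adj_def by (rule smooth_hfd[OF gmap_on_smooth[OF g c0(1)] b])
qed

lemma linear_adj: "linear (adj g)" by (rule has_derivative_linear[OF conj_set(3)])

lemma Ad_eq: "Ad G g Y = adj g Y" proof -
 obtain ga where ga: "one_parameter_subgroup G ga" "((%t. snd c0 (ga t)) hvd Y) (at 0)"
  "!!t. lie_exp G (t *\<^sub>R Y) = ga t" using lie_exp_curve by blast
 let ?T = "{t : UNIV. ga t : fst c0}"
 have "((%b. snd c0 (g \<otimes> chart_inv c0 b \<otimes> inv g)) hfd adj g) (at (snd c0 (ga 0)))"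
  using conj_set(3) by (simp add: one_parD(4)[OF ga(1)] b0_def)
 from has_derivative_compose[OF ga(2)[unfolded has_vector_derivative_def] this]
 have "((%t. snd c0 (g \<otimes> chart_inv c0 (snd c0 (ga t)) \<otimes> inv g)) hvd adj g Y) (at 0)"
  by (simp add: has_vector_derivative_def linear_cmul[OF linear_adj])
 hence "((%t. snd c0 (g \<otimes> ga t \<otimes> inv g)) hvd adj g Y) (at 0)"
  unfolding has_vector_derivative_def by (rule hfd_transform[OF _ open_pre[OF one_parD(3)[OF ga(1)] open_UNIV
   chartD(1)[OF c0(1)]]]) (use one_parD(4)[OF ga(1)] c0 chartD(5)[OF c0(1)] in auto)
 thus ?thesis unfolding Ad_def ga(3) c0_def[symmetric] by (rule vector_derivative_at)
qed

lemma ipbasis_adj: "ipbasis v ==> ipbasis (%a. adj g (v a))"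
 unfolding ipbasis_def using ip_Ad[of g] by (simp add: Ad_eq)

text \<open>Moving \<open>g\<close> past a curve through the identity conjugates the curve, which
  turns its direction by the adjoint action.\<close>

lemma lder_right: assumes f: "gsmooth f"
 shows "lder Y (%x. f (x \<otimes> g)) x = lder (adj (inv g) Y) f (x \<otimes> g)"
proof (rule lder_eqI)
 have "((%b. f (x \<otimes> g \<otimes> chart_inv c0 b)) hfd (%Y. lder Y f (x \<otimes> g)))
   (at (snd c0 (inv g \<otimes> chart_inv c0 b0 \<otimes> inv (inv g))))"
  using lder_hfd[OF f] by (simp add: b0 b0_def[symmetric])
 from has_derivative_compose[OF conj_set(3)[of "inv g"] this]
 have "((%b. f (x \<otimes> g \<otimes> chart_inv c0 (snd c0 (inv g \<otimes> chart_inv c0 b \<otimes> inv (inv g)))))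
  hfd
   (%Y. lder (adj (inv g) Y) f (x \<otimes> g))) (at b0)" .
 thus "((%b. f (x \<otimes> chart_inv c0 b \<otimes> g)) hfd (%Y. lder (adj (inv g) Y) f (x \<otimes> g))) (at b0)"
  by (rule hfd_transform[OF _ conj_set(1,2)[of "inv g"]])
   (use chartD(5)[OF c0(1)] in \<open>auto simp: m_assoc\<close>)
qed

text \<open>The adjoint action maps orthonormal frames to orthonormal frames by the invariance of
  \<open>ip\<close>, and the Casimir operator does not see the frame.\<close>

lemma cas_right: assumes f: "gsmooth f"
 shows "cas (%x. f (x \<otimes> g)) x = cas f (x \<otimes> g)" proof -
 have "lder Y (lder Y (%x. f (x \<otimes> g))) x = lder (adj (inv g) Y) (lder (adj (inv g) Y) f) (x \<otimes> g)" for
  Y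
 proof -
  have "lder Y (%x. f (x \<otimes> g)) = (%x. lder (adj (inv g) Y) f (x \<otimes> g))"
   by (rule ext) (rule lder_right[OF f])
  thus ?thesis by (simp add: lder_right[OF gsmooth_lder[OF f]])
 qed
 thus ?thesis using cas_ipbasis[OF f ipbasis_adj[OF frame, of "inv g"]] by (simp add: cas_def)
qed

lemma cas_left: "cas (%x. f (g \<otimes> x)) x = cas f (g \<otimes> x)" proof -
 have "lder Y (%x. f (g \<otimes> x)) = (%x. lder Y f (g \<otimes> x))" for Y by (rule ext) (rule lder_translate)
 thus ?thesis by (simp add: cas_def lder_translate)
qed

lemma cas_lin_comb: assumes "finite A" "!!i. i : A ==> gsmooth (f i)"
 shows "cas (%x. SUM i:A. c i * f i x) x = (SUM i:A. c i * cas (f i :: 'g => complex) x)" proof -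
 have s: "gsmooth (%x. c i * f i x)" if "i : A" for i
  by (intro gsmooth_mult gsmooth_const assms(2) that)
 have "lder Y (lder Y (%x. SUM i:A. c i * f i x)) x = (SUM i:A. c i * lder Y (lder Y (f i)) x)" for Y
 proof -
  have "lder Y (%x. SUM i:A. c i * f i x) = (%x. SUM i:A. c i * lder Y (f i) x)"
   by (rule ext) (simp add: lder_sum[OF assms(1) s] lder_cmult[OF assms(2)])
  moreover have "gsmooth (%x. c i * lder Y (f i) x)" if "i : A" for i
   by (intro gsmooth_mult gsmooth_const gsmooth_lder assms(2) that)
  ultimately show ?thesis
   by (simp add: lder_sum[OF assms(1)] lder_cmult[OF gsmooth_lder[OF assms(2)]])
 qed
 thus ?thesis by (simp add: cas_def sum_distrib_left) (rule sum.swap)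
qed

text \<open>Commuting with translations on both sides makes the matrix of values at the identity an
  intertwiner, hence a scalar. The scalar is real and not positive because integration by parts
  turns the quadratic form of \<open>cas\<close> into minus a sum of squares.\<close>

lemma cas_entry: assumes r: "urep d r" "irr d r"
 obtains nu where "nu >= 0" "!!i j x. i < d ==> j < d ==> cas (r i j) x = - cor nu * r i j x"
proof -
 have d: "d > 0" using r(2) by (simp add: irr_def)
 note s = irr_gsmooth[OF r]
 let ?C = "%i j. cas (r i j) \<one>"
 have left: "cas (r i j) x = (SUM l<d. r i l x * ?C l j)" if ij: "i < d" "j < d" for i j x proof -
  have "cas (r i j) x = cas (%y. r i j (x \<otimes> y)) \<one>" by (simp add: cas_left)
  also have "... = cas (%y. SUM l<d. r i l x * r l j y) \<one>" by (simp add: urepD(2)[OF r(1) ij])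
  also have "... = (SUM l<d. r i l x * ?C l j)" by (rule cas_lin_comb) (use s ij in auto)
  finally show ?thesis .
 qed
 have right: "cas (r i j) x = (SUM l<d. ?C i l * r l j x)" if ij: "i < d" "j < d" for i j x proof -
  have "cas (r i j) x = cas (%y. r i j (y \<otimes> x)) \<one>" by (simp add: cas_right s ij)
  also have "... = cas (%y. SUM l<d. r l j x * r i l y) \<one>" by (simp add: urepD(2)[OF r(1) ij] mult.commute)
  also have "... = (SUM l<d. r l j x * ?C i l)" by (rule cas_lin_comb) (use s ij in auto)
  finally show ?thesis by (simp add: mult.commute)
 qed
 obtain c where c: "!!i k. i < d ==> k < d ==> ?C i k = (if i = k then c else 0)"
 proof (rule commutant_scalar[OF r, of ?C])
  fix x i k assume ik: "i < d" "k < d"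
  show "(SUM p<d. r i p x * ?C p k) = (SUM q<d. ?C i q * r q k x)"
   using left[OF ik, of x] right[OF ik, of x] by (rule trans[OF sym])
 next
  fix c assume "!!i k. i < d ==> k < d ==> ?C i k = (if i = k then c else 0)"
  thus thesis by (rule that)
 qed
 have eig: "cas (r i j) x = c * r i j x" if "i < d" "j < d" for i j x
  unfolding left[OF that] using that by (simp add: c if_distrib[of "(*) _"] cong: if_cong)
 let ?f = "r 0 0"
 have f: "gsmooth ?f" by (rule s[OF d d])
 define N where "N = (%h. haar (%x. (cmod (h x))^2))"
 have cN: "cint (%x. h x * cnj (h x)) = cor (N h)" if "cont h" for h
  unfolding N_def complex_norm_square[symmetric]
   by (rule cint_of_real) (use that in \<open>auto intro!: continuous_intros\<close>)
 have "c * cor (N ?f) = cint (%x. cas ?f x * cnj (?f x))"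
  using eig[OF d d] by (simp add: mult.assoc cint_cmult cN[symmetric] gsmooth_ctn[OF f] continuous_on_mult)
 also have "... = (SUM a:UNIV. cint (%x. lder (frame a) (lder (frame a) ?f) x * cnj (?f x)))"
  unfolding cas_def sum_distrib_right
  by (rule cint_sum) (auto intro!: gsmooth_ctn gsmooth_mult gsmooth_lder gsmooth_cnj f)
 also have "... = (SUM a:UNIV. - cor (N (lder (frame a) ?f)))"
 proof (rule sum.cong[OF refl])
  fix a
  have "cint (%x. lder (frame a) (lder (frame a) ?f) x * cnj (?f x)) = - cint (%x. lder (frame a) ?f x * lder (frame
   a) (%x. cnj (?f x)) x)"
   by (rule cint_by_parts) (intro gsmooth_lder gsmooth_cnj f)+
  thus "cint (%x. lder (frame a) (lder (frame a) ?f) x * cnj (?f x)) = - cor (N (lder (frame a) ?f))"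
   by (simp add: lder_cnj[OF f] cN gsmooth_ctn[OF gsmooth_lder[OF f]])
 qed
 finally have e: "c * cor (N ?f) = - cor (SUM a:UNIV. N (lder (frame a) ?f))"
  by (simp add: sum_negf)
 have "N ?f > 0" unfolding N_def
  by (rule haar_pos[of _ "\<one>"]) (use urepD(3)[OF r(1) d d] gsmooth_ctn[OF f] in \<open>auto intro!:
   continuous_intros\<close>)
 moreover have "(SUM a:UNIV. N (lder (frame a) ?f)) >= 0" unfolding N_def
  by (intro sum_nonneg haar_nonneg continuous_on_power continuous_on_norm
    gsmooth_ctn[OF gsmooth_lder[OF f]] zero_le_power2)
 moreover have "c = (c * cor (N ?f)) / cor (N ?f)" using \<open>N ?f > 0\<close> by simp
 ultimately have "c = - cor ((SUM a:UNIV. N (lder (frame a) ?f)) / N ?f)"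
  "(SUM a:UNIV. N (lder (frame a) ?f)) / N ?f >= 0" by (simp_all add: e)
 with eig show thesis by (intro that[of "(SUM a:UNIV. N (lder (frame a) ?f)) / N ?f"]) simp_all
qed

end

section \<open>The Laplace-Beltrami operator\<close>

lemma permutes_fix_all_but_one: assumes p: "p permutes UNIV" and px: "!!j. j ~= i ==> p j = j"
 shows "p = id" proof -
 have "p i = i" proof (rule ccontr)
  assume "p i ~= i"
  thus False by (metis \<open>p i ~= i\<close> permutes_inj[OF p] inj_eq px)
 qed
 thus ?thesis using px by (metis eq_id_iff)
qed

text \<open>A permutation other than the identity moves at least two points, so every term of its
  derivative keeps an off-diagonal entry of the identity matrix as a factor; only the trace
  survives.\<close>

lemma det_has_derivative_mat_1: fixes J :: "'a::real_normed_vector => real^'n::finite^'n"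
 assumes d: "!!i j. ((%t. J t $ i $ j) hfd J' i j) (at a)" and a: "J a = Finite_Cartesian_Product.mat 1"
 shows "((%t. Determinants.det (J t)) hfd (%h. SUM i:UNIV. J' i i h)) (at a)" proof -
 let ?P = "{p. p permutes (UNIV :: 'n set)}"
 let ?D = "%p h. SUM i:UNIV. J' i (p i) h * (PROD j:UNIV - {i}. J a $ j $ p j)"
 have "((%t. SUM p:?P. of_int (sign p) * (PROD i:UNIV. J t $ i $ p i)) hfd
   (%h. SUM p:?P. of_int (sign p) * ?D p h)) (at a)"
  by (intro has_derivative_sum has_derivative_mult_right has_derivative_prod d)
 moreover have "(SUM p:?P. of_int (sign p) * ?D p h) = (SUM i:UNIV. J' i i h)" for h proof -
  have "?D p h = 0" if p: "p permutes UNIV" "p ~= id" for p proof (rule sum.neutral, rule ballI)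
   fix i :: 'n
   obtain j where "j ~= i" "p j ~= j" using permutes_fix_all_but_one[OF p(1)] p(2) by metis
   thus "J' i (p i) h * (PROD j:UNIV - {i}. J a $ j $ p j) = 0" by (auto simp: a Finite_Cartesian_Product.mat_def)
  qed
  hence "(SUM p:?P. of_int (sign p) * ?D p h) = (SUM p:{id}. of_int (sign p) * ?D p h)"
   by (intro sum.mono_neutral_right) auto
  thus ?thesis by (simp add: a Finite_Cartesian_Product.mat_def)
 qed
 ultimately show ?thesis by (simp add: Determinants.det_def)
qed

lemma frechet_partial1: assumes "open S" "smooth_on S Q" "(a, b) : S"
 shows "FD (%a. Q (a, b)) (at a) v = FD Q (at (a, b)) (v, 0)"
  and "((%a. Q (a, b)) hfd (%v. FD Q (at (a, b)) (v, 0))) (at a)" proof -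
 have "((%a. (a, b)) hfd (%v. (v, 0))) (at a)" by (auto intro!: derivative_eq_intros)
 from has_derivative_compose[OF this smooth_hfd[OF assms(2,3)]]
 show d: "((%a. Q (a, b)) hfd (%v. FD Q (at (a, b)) (v, 0))) (at a)" .
 show "FD (%a. Q (a, b)) (at a) v = FD Q (at (a, b)) (v, 0)"
  using frechet_derivative_at[OF d] by metis
qed

lemma linear_axis_expand: fixes L :: "real^'n::finite => 'b::real_vector" assumes "linear L"
 shows "(SUM i:UNIV. v $ i *\<^sub>R L (axis i 1)) = L v" proof -
 have "L v = L (SUM i:UNIV. v $ i *\<^sub>R axis i 1)"
  by (simp add: basis_expansion[of v, unfolded scalar_mult_eq_scaleR])
 thus ?thesis by (simp add: linear_sum[OF assms] linear_cmul[OF assms])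
qed

context lie_metric
begin

definition mult_coord :: "('g, 'n) chart => (real ^ 'n) \<times> (real ^ 'n) => real ^ 'n" where
 "mult_coord c p = snd c (chart_inv c (fst p) \<otimes> chart_inv c0 (snd p))"

text \<open>The left-invariant field through \<open>Y\<close> in the chart \<open>c\<close>;
  \<open>toid\<close> undoes it at every point.\<close>

definition efield :: "('g, 'n) chart => real ^ 'n => real ^ 'n => real ^ 'n" where
 "efield c Y z = FD (%b. mult_coord c (z, b)) (at b0) Y"

definition mult_dom :: "('g, 'n) chart => ((real ^ 'n) \<times> (real ^ 'n)) set" where
 "mult_dom c = {p : cdom c \<times> cdom c0. chart_inv c (fst p) \<otimes> chart_inv c0 (snd p) : fst c}"

lemma mult_dom: assumes "c : charts"
 shows "open (mult_dom c)" "smooth_on (mult_dom c) (mult_coord c)" "y : cdom c ==> (y, b0) : mult_dom c"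
proof -
 have e: "mult_coord c = (%p. snd c (chart_inv c (fst p) \<otimes> chart_inv c0 (snd p)))"
  by (simp add: fun_eq_iff mult_coord_def)
 show "open (mult_dom c)" "smooth_on (mult_dom c) (mult_coord c)" "y : cdom c ==> (y, b0) : mult_dom c"
  using mult_chart_set[OF assms] unfolding mult_dom_def e by blast+
qed

lemma efield_eq: assumes "c : charts" "z : cdom c"
 shows "efield c Y z = FD (mult_coord c) (at (z, b0)) (0, Y)"
  "((%b. mult_coord c (z, b)) hfd (%Y. efield c Y z)) (at b0)" proof -
 note W = mult_dom[OF assms(1)]
 show e: "efield c Y z = FD (mult_coord c) (at (z, b0)) (0, Y)" for Y
  unfolding efield_def by (rule FD_partial2(1)[OF W(1,2) W(3)[OF assms(2)]])
 show "((%b. mult_coord c (z, b)) hfd (%Y. efield c Y z)) (at b0)"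
  unfolding e by (rule FD_partial2(2)[OF W(1,2) W(3)[OF assms(2)]])
qed

lemma linear_efield: "c : charts ==> z : cdom c ==> linear (%Y. efield c Y z)"
 by (rule has_derivative_linear[OF efield_eq(2)])

lemma smooth_efield: assumes c: "c : charts" shows "smooth_on (cdom c) (%z. efield c Y z)"
 unfolding efield_def
 by (rule smooth_on_partial2[OF mult_dom(1,2)[OF c] chartD(2)[OF c] smooth_on_const mult_dom(3)[OF c]])

lemma toid_efield: assumes c: "c : charts" "z : cdom c" shows "toid c z (efield c Y z) = Y" proof -
 let ?x = "chart_inv c z"
 have 1: "mult_coord c (z, b0) = z" using c chartD[OF c(1)] by (simp add: mult_coord_def b0)
 have "((%b. snd c0 (inv ?x \<otimes> chart_inv c (mult_coord c (z, b)))) hfd (%Y. toid c z (efield c Y z))) (at b0)"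
  by (rule has_derivative_compose[OF efield_eq(2)[OF c]]) (simp add: 1 toid_hfd[OF c])
 hence "((%b. b) hfd (%Y. toid c z (efield c Y z))) (at b0)"
 proof (rule hfd_transform[where T="{b. (z, b) : mult_dom c}"])
  have "open ((%b. (z, b)) -` mult_dom c)"
   by (rule open_vimage[OF mult_dom(1)[OF c(1)]]) (intro continuous_intros)
  thus "open {b. (z, b) : mult_dom c}" by (simp add: vimage_def)
  show "b0 : {b. (z, b) : mult_dom c}" using mult_dom(3)[OF c] by simp
  show "snd c0 (inv ?x \<otimes> chart_inv c (mult_coord c (z, b))) = b" if "b : {b. (z, b) : mult_dom c}" for b
   using that chartD[OF c(1)] chartD[OF c0(1)] by (simp add: mult_dom_def mult_coord_def)
 qed
 from has_derivative_unique[OF this has_derivative_ident] show ?thesis by metis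
qed

lemma metric_coeff_apply: assumes c: "c : charts" "z : cdom c"
 shows "(SUM i:UNIV. SUM j:UNIV. u $ i * v $ j * metric_coeff G ip c z $ i $ j) = ip (toid c z u) (toid c z v)"
proof -
 have "ip (toid c z u) (toid c z v) = ip (SUM i:UNIV. u $ i *\<^sub>R toid c z (axis i 1)) (SUM i:UNIV. v $ i
  *\<^sub>R toid c z (axis i 1))"
  by (simp add: linear_axis_expand[OF linear_toid[OF c]])
 also have "... = (SUM i:UNIV. SUM j:UNIV. u $ i * v $ j * metric_coeff G ip c z $ i $ j)"
  by (simp add: ip_simps metric_coeff_def sum_distrib_left mult.assoc) (subst sum.swap, simp add: mult.left_commute)
 finally show ?thesis by simp
qed

definition vol :: "('g, 'n) chart => real ^ 'n => real" where
 "vol c z = sqrt (Determinants.det (metric_coeff G ip c z))"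

text \<open>The vectors \<open>efield c (frame a) z\<close> are orthonormal for the metric, so the
  inverse of the Gram matrix is the sum of their outer products.\<close>

lemma metric_inverse: assumes c: "c : charts" "z : cdom c"
 shows "matrix_inv (metric_coeff G ip c z) = (\<chi> i j. SUM a:UNIV. efield c (frame a) z $ i * efield c (frame a) z
  $ j)"
  and "Determinants.det (metric_coeff G ip c z) > 0" proof -
 let ?M = "(\<chi> i a. efield c (frame a) z $ i) :: real^'n^'n" and ?g = "metric_coeff G ip c z"
 have "transpose ?M ** ?g ** ?M = Finite_Cartesian_Product.mat 1" proof -
  have "(transpose ?M ** ?g ** ?M) $ a $ b = ip (toid c z (efield c (frame a) z)) (toid c z (efield c (frame b) z))"
   for a b
   by (simp add: matrix_matrix_mult_def transpose_def metric_coeff_apply[OF c, symmetric] sum_distrib_right)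
    (subst sum.swap, simp add: mult.commute mult.left_commute)
  thus ?thesis using frame by (simp add: toid_efield[OF c] ipbasis_def Finite_Cartesian_Product.mat_def
   Finite_Cartesian_Product.vec_eq_iff)
 qed
 hence m: "transpose ?M ** (?g ** ?M) = Finite_Cartesian_Product.mat 1" by (simp add: matrix_mul_assoc)
 hence "(?g ** ?M) ** transpose ?M = Finite_Cartesian_Product.mat 1" by (rule matrix_left_right_inverse[THEN iffD1])
 hence g1: "?g ** (?M ** transpose ?M) = Finite_Cartesian_Product.mat 1" by (simp add: matrix_mul_assoc)
 hence g2: "(?M ** transpose ?M) ** ?g = Finite_Cartesian_Product.mat 1"
  by (rule matrix_left_right_inverse[THEN iffD1])
 have "matrix_inv ?g = ?M ** transpose ?M" proof -
  have "?g ** matrix_inv ?g = Finite_Cartesian_Product.mat 1"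
   unfolding matrix_inv_def by (rule conjunct1[OF someI_ex]) (use g1 g2 in blast)
  hence "(?M ** transpose ?M) ** (?g ** matrix_inv ?g) = ?M ** transpose ?M" by simp
  thus ?thesis by (simp add: matrix_mul_assoc g2)
 qed
 thus "matrix_inv ?g = (\<chi> i j. SUM a:UNIV. efield c (frame a) z $ i * efield c (frame a) z $ j)"
  by (simp add: matrix_matrix_mult_def transpose_def)
 have "Determinants.det (transpose ?M ** (?g ** ?M)) = 1" by (simp add: m)
 hence "Determinants.det ?M * Determinants.det ?M * Determinants.det ?g = 1"
  by (simp add: Determinants.det_mul mult.commute mult.left_commute)
 thus "Determinants.det ?g > 0"
  using mult_nonneg_nonpos[OF zero_le_square[of "Determinants.det ?M"], of "Determinants.det ?g"]
  by (rule_tac ccontr) simp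
qed

lemma vol_differentiable: assumes c: "c : charts" "y : cdom c"
 shows "(vol c hfd FD (vol c) (at y)) (at y)" "vol c y > 0" proof -
 show p: "vol c y > 0" using metric_inverse(2)[OF c] by (simp add: vol_def)
 have t: "(%z. toid c z v) differentiable at y" for v
  by (rule smooth_on_differentiable[OF smooth_toid[OF c(1)] c(2)])
 have "bounded_bilinear ip" using ip_bilinear bilinear_conv_bounded_bilinear by blast
 have g: "(%z. metric_coeff G ip c z $ i $ j) differentiable at y" for i j proof -
  note d = t[THEN frechet_derivative_works[THEN iffD1]]
  show ?thesis by (auto simp: metric_coeff_def differentiable_def intro!: bounded_bilinear.FDERIV[OF
   \<open>bounded_bilinear ip\<close> d d])
 qed
 obtain D where D: "((%z. Determinants.det (metric_coeff G ip c z)) hfd D) (at y)"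
 proof -
  have "((%z. SUM p:{p. p permutes UNIV}. of_int (sign p) * (PROD i:UNIV. metric_coeff G ip c z $ i $ p i)) hfd
   (%h. SUM p:{p. p permutes UNIV}. of_int (sign p) * (SUM i:UNIV. FD (%z. metric_coeff G ip c z $ i $ p i) (at y) h *
    (PROD j:UNIV - {i}. metric_coeff G ip c y $ j $ p j)))) (at y)"
   by (intro has_derivative_sum has_derivative_mult_right has_derivative_prod g[THEN frechet_derivative_works[THEN
    iffD1]])
  thus thesis by (intro that) (simp add: Determinants.det_def)
 qed
 have "vol c differentiable at y" unfolding differentiable_def vol_def
  by (rule , rule has_derivative_real_sqrt[OF metric_inverse(2)[OF c] D])
 thus "(vol c hfd FD (vol c) (at y)) (at y)" by (rule frechet_derivative_works[THEN iffD1])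
qed

text \<open>In the left trivialisation the differential of right translation is the adjoint action
  of \<open>inv g\<close>, an isometry of \<open>ip\<close>. The Gram matrices are thus related by
  the Jacobian matrix, and determinants are taken.\<close>

lemma metric_right: assumes c: "c : charts" "z : cdom c" and g: "chart_inv c z \<otimes> g : fst c"
  and D: "((%z. snd c (chart_inv c z \<otimes> g)) hfd D) (at z)"
 shows "vol c (snd c (chart_inv c z \<otimes> g)) * abs (Determinants.det (matrix D)) = vol c z"
proof -
 let ?p = "%z. snd c (chart_inv c z \<otimes> g)" and ?x = "chart_inv c z"
 let ?J = "matrix D"
 have p: "?p z : cdom c" "chart_inv c (?p z) = ?x \<otimes> g" using chartD[OF c(1)] g by auto
 have gm: "gmap_on (cdom c) (%z. chart_inv c z \<otimes> g)"
  by (intro gmap_on_mult gmap_on_const gmap_on_chart_inv chartD c)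
 let ?T = "{z' : cdom c. chart_inv c z' \<otimes> g : fst c} \<inter> {z' : cdom c. inv ?x \<otimes> chart_inv c z' :
  fst c0}"
 have oT: "open ?T"
  by (intro open_Int open_pre[OF gmap_ctn[OF gm]] open_pre[OF gmap_ctn[OF gmap_on_translate[OF c(1)]]] chartD c c0)
 have key: "toid c (?p z) (D v) = adj (inv g) (toid c z v)" for v proof -
  have 1: "((%z'. snd c0 (inv (?x \<otimes> g) \<otimes> chart_inv c (?p z'))) hfd (%v. toid c (?p z) (D v))) (at z)"
   by (rule has_derivative_compose[OF D toid_hfd[OF c(1) p(1), unfolded p(2)]])
  have "(%b. snd c0 (inv g \<otimes> chart_inv c0 b \<otimes> inv (inv g))) = (%b. snd c0 (inv g \<otimes> chart_inv
   c0 b \<otimes> g))" by simp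
  note cs = conj_set(3)[of "inv g", unfolded this]
  have 2: "((%z'. snd c0 (inv g \<otimes> chart_inv c0 (snd c0 (inv ?x \<otimes> chart_inv c z')) \<otimes> g)) hfd
    (%v. adj (inv g) (toid c z v))) (at z)"
   by (rule has_derivative_compose[OF toid_hfd[OF c]]) (use cs in \<open>simp add: b0_def\<close>)
  have "((%z'. snd c0 (inv (?x \<otimes> g) \<otimes> chart_inv c (?p z'))) hfd (%v. adj (inv g) (toid c z v))) (at
   z)"
   by (rule hfd_transform[OF 2 oT])
    (use c g c0 chartD[OF c(1)] chartD[OF c0(1)] in \<open>auto simp: inv_mult_group m_assoc\<close>)
  from has_derivative_unique[OF 1 this] show ?thesis by metis
 qed
 have "metric_coeff G ip c z = transpose ?J ** metric_coeff G ip c (?p z) ** ?J" proof -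
  have "(transpose ?J ** metric_coeff G ip c (?p z) ** ?J) $ i $ j = ip (toid c (?p z) (D (axis i 1))) (toid c (?p z)
   (D (axis j 1)))" for i j
   by (simp add: matrix_def matrix_matrix_mult_def transpose_def metric_coeff_apply[OF c(1) p(1), symmetric]
    sum_distrib_right) (subst sum.swap, simp add: ac_simps)
  thus ?thesis using ip_Ad[of "inv g"] by (simp add: Finite_Cartesian_Product.vec_eq_iff key Ad_eq metric_coeff_def)
 qed
 thus ?thesis by (simp add: Determinants.det_mul Determinants.det_transpose power2_eq_square mult.commute
  mult.left_commute vol_def real_sqrt_mult)
qed

text \<open>Left-invariant fields generate right translations, and these preserve the volume:
  \<open>vol\<close> at the moved point times the Jacobian determinant is constant near 0, so its
  derivative vanishes. Exchanging the order of differentiation identifies the derivative of the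
  Jacobian with that of \<open>efield\<close>.\<close>

lemma vol_divergence: assumes c: "c : charts" "y : cdom c"
 shows "FD (vol c) (at y) (efield c Y y) +
  vol c y * (SUM i:UNIV. FD (%z. efield c Y z $ i) (at y) (axis i 1)) = 0" proof -
 note W = mult_dom[OF c(1)]
 note yW = W(3)[OF c(2)]
 \<comment> \<open>A coordinate line takes the place of the one-parameter subgroup, as only the
   velocity at 0 matters.\<close>
 let ?b = "%t. b0 + t *\<^sub>R Y"
 let ?Q = "%i p. mult_coord c p $ i"
 define J :: "real => real^'n^'n" where "J = (%t. matrix (%v. FD (mult_coord c) (at (y, ?b t)) (v, 0)))"
 define T where "T = {t. (y, ?b t) : mult_dom c}"
 have oT: "open T" proof -
  have "open ((%t. (y, ?b t)) -` mult_dom c)" by (rule open_vimage[OF W(1)]) (intro continuous_intros)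
  thus ?thesis by (simp add: vimage_def T_def)
 qed
 have T0: "0 : T" using yW by (simp add: T_def)
 have sQ: "smooth_on (mult_dom c) (?Q i)" for i
  by (rule smooth_blin[OF bounded_linear_vec_nth W(1,2)])
 have DQ: "FD (mult_coord c) (at p) v $ i = FD (?Q i) (at p) v" if "p : mult_dom c" for p v i
  using frechet_derivative_at[OF bounded_linear.has_derivative[OF bounded_linear_vec_nth smooth_hfd[OF W(2) that]], of
   i]
  by (metis (no_types))
 have Jt: "J t $ i $ j = FD (?Q i) (at (y, ?b t)) (axis j 1, 0)" if "t : T" for t i j
  using that by (simp add: J_def matrix_def DQ T_def)
 have part: "((%z. snd c (chart_inv c z \<otimes> chart_inv c0 (?b t))) hfd (%v. FD (mult_coord c) (at (y, ?b t)) (v,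
  0))) (at y)"
  if "t : T" for t
  using frechet_partial1(2)[OF W(1,2), of y "?b t"] that by (simp add: T_def mult_coord_def)
 let ?d = "%i j. FD (%z. efield c Y z $ i) (at y) (axis j 1)"
 have dJ: "((%t. J t $ i $ j) hfd (%h. h * ?d i j)) (at 0)" for i j proof -
  let ?D = "%p. FD (?Q i) (at p) (axis j 1, 0)"
  let ?E = "%p. FD (?Q i) (at p) (0, Y)"
  have "((%t. (y, ?b t)) hfd (%h. (0, h *\<^sub>R Y))) (at 0)" by (auto intro!: derivative_eq_intros)
  moreover have "(?D hfd FD ?D (at (y, b0))) (at (y, ?b 0))"
   using smooth_hfd[OF smooth_FD[OF sQ] yW] by simp
  ultimately have "((%t. ?D (y, ?b t)) hfd (%h. FD ?D (at (y, b0)) (0, h *\<^sub>R Y))) (at 0)"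
   by (rule has_derivative_compose)
  moreover have "FD ?D (at (y, b0)) (0, h *\<^sub>R Y) = h * ?d i j" for h proof -
   have "FD ?D (at (y, b0)) (0, h *\<^sub>R Y) = h * FD ?D (at (y, b0)) (0, Y)"
    using linear_cmul[OF smooth_FD_linear[OF smooth_FD[OF sQ] yW], of i "(axis j 1, 0)" h "(0, Y)"] by simp
   also have "FD ?D (at (y, b0)) (0, Y) = FD ?E (at (y, b0)) (axis j 1, 0)"
    by (rule frechet_derivative_commute[OF W(1) sQ yW])
   also have "... = ?d i j" proof -
    have "((%z. efield c Y z $ i) hfd (%v. FD ?E (at (y, b0)) (v, 0))) (at y)"
     using frechet_partial1(2)[OF W(1) smooth_FD[OF sQ] yW] by (rule hfd_transform[OF _ chartD(2)[OF c(1)] c(2)])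
      (simp add: efield_eq(1)[OF c(1)] DQ[OF W(3)])
    from frechet_derivative_at[OF this] show ?thesis by metis
   qed
   finally show ?thesis .
  qed
  ultimately show ?thesis by (simp add: Jt hfd_transform[OF _ oT T0])
 qed
 have J0: "J 0 = Finite_Cartesian_Product.mat 1" proof -
  have "((%z. z) hfd (%v. FD (mult_coord c) (at (y, b0)) (v, 0))) (at y)"
   by (rule hfd_transform[OF part[OF T0, simplified] chartD(2)[OF c(1)] c(2)])
    (simp add: b0 chartD(7)[OF c(1)])
  from has_derivative_unique[OF this has_derivative_ident]
  have "(%v. FD (mult_coord c) (at (y, b0)) (v, 0)) = (%v. v)" .
  thus ?thesis unfolding J_def by (simp add: matrix_def axis_def Finite_Cartesian_Product.mat_def)
 qed
 let ?t = "SUM i:UNIV. ?d i i"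
 have dd: "((%t. Determinants.det (J t)) hfd (%h. h * ?t)) (at 0)"
  using det_has_derivative_mat_1[OF dJ J0] by (simp add: sum_distrib_left)
 have mc0: "mult_coord c (y, b0) = y" by (simp add: mult_coord_def b0 chartD(7)[OF c(1)] c)
 have dv: "((%t. vol c (mult_coord c (y, ?b t))) hfd (%h. h * FD (vol c) (at y) (efield c Y y))) (at 0)"
 proof -
  have "((%t. ?b t) hfd (%h. h *\<^sub>R Y)) (at 0)" by (auto intro!: derivative_eq_intros)
  from has_derivative_compose[OF this, of "%b. mult_coord c (y, b)"]
  have "((%t. mult_coord c (y, ?b t)) hfd (%h. efield c (h *\<^sub>R Y) y)) (at 0)"
   using efield_eq(2)[OF c] by simp
  from has_derivative_compose[OF this, of "vol c"]
  have "((%t. vol c (mult_coord c (y, ?b t))) hfd (%h. FD (vol c) (at y) (efield c (h *\<^sub>R Y) y))) (at 0)"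
   using vol_differentiable(1)[OF c] by (simp add: mc0)
  thus ?thesis
   by (simp add: linear_cmul[OF linear_efield[OF c]] linear_cmul[OF has_derivative_linear[OF vol_differentiable(1)[OF
    c]]])
 qed
 have "((%t. vol c (mult_coord c (y, ?b t)) * Determinants.det (J t)) hfd
  (%h. h * (FD (vol c) (at y) (efield c Y y) + vol c y * ?t))) (at 0)"
  using has_derivative_mult[OF dv dd] by (simp add: mc0 J0 algebra_simps)
 \<comment> \<open>The transformation rule carries the absolute value of the determinant; near 0 the
   determinant is positive and the absolute value drops out.\<close>
 moreover have "((%t. vol c (mult_coord c (y, ?b t)) * Determinants.det (J t)) hfd (%h. 0)) (at 0)"
 proof -
  have "\<forall>\<^sub>F t in nhds 0. Determinants.det (J t) > 0" using has_derivative_continuous[OF dd]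
   by (simp add: J0 continuous_at order_tendstoD eventually_nhds_conv_at[THEN iffD2, OF conjI])
  then obtain S where S: "open S" "0 : S" "!!t. t : S ==> Determinants.det (J t) > 0"
   unfolding eventually_nhds by blast
  have "((%t::real. vol c y) hfd (%h. 0)) (at 0)" by simp
  thus ?thesis proof (rule hfd_transform[OF _ open_Int[OF oT S(1)]])
   show "0 : T \<inter> S" using T0 S(2) by simp
   fix t assume t: "t : T \<inter> S"
   have "vol c (snd c (chart_inv c y \<otimes> chart_inv c0 (?b t))) * abs (Determinants.det (J t)) = vol c y"
    unfolding J_def by (rule metric_right[OF c _ part]) (use t in \<open>auto simp: T_def mult_dom_def\<close>)
   thus "vol c y = vol c (mult_coord c (y, ?b t)) * Determinants.det (J t)"
    using S(3)[of t] t by (simp add: mult_coord_def)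
  qed
 qed
 ultimately have "(%h. h * (FD (vol c) (at y) (efield c Y y) + vol c y * ?t)) = (%h. 0)"
  by (rule has_derivative_unique)
 from fun_cong[OF this, of 1] show ?thesis by simp
qed

text \<open>With the inverse metric written by the frame, the gradient becomes a sum of frame
  derivatives. The terms in which \<open>vol\<close> or the frame coefficients are differentiated
  add up to divergences, which vanish, and the sum of squares remains.\<close>

lemma laplace_beltrami_eq: fixes f :: "'g => complex" assumes f: "gsmooth f"
 shows "laplace_beltrami G ip f x = cas f x" proof -
 define c where "c = chart_at G x"
 have c: "c : charts" and xc: "x : fst c"
  using someI_ex[OF chart_cover[of x, unfolded Bex_def]] by (auto simp: c_def chart_at_def charts_def)
 define y where "y = snd c x"
 have y: "y : cdom c" "chart_inv c y = x" using chartD[OF c] xc by (auto simp: y_def)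
 let ?h = "f \<circ> chart_inv c"
 let ?g = "%i j z. matrix_inv (metric_coeff G ip c z) $ i $ j"
 let ?E = "%a z. efield c (frame a) z"
 let ?F = "%a z. lder (frame a) f (chart_inv c z)"
 let ?w = "FD (vol c) (at y)"
 let ?e = "%a i. FD (%z. ?E a z $ i) (at y)"
 have inner: "(SUM j:UNIV. ?g i j z *\<^sub>R partial_deriv j ?h z) = (SUM a:UNIV. ?E a z $ i *\<^sub>R ?F a z)"
  if z: "z : cdom c" for i z proof -
  have p: "partial_deriv j ?h z = (SUM a:UNIV. ip (toid c z (axis j 1)) (frame a) *\<^sub>R ?F a z)" for j
  proof -
   have "partial_deriv j ?h z = lder (toid c z (axis j 1)) f (chart_inv c z)"
    unfolding partial_deriv_def o_def using frechet_derivative_at[OF chart_hfd[OF f c z]] by metis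
   also have "... = lder (SUM a:UNIV. ip (toid c z (axis j 1)) (frame a) *\<^sub>R frame a) f (chart_inv c z)"
    by (simp add: ipbasis_expand[OF frame])
   finally show ?thesis by (simp add: linear_sum[OF linear_lder[OF f]] linear_cmul[OF linear_lder[OF f]])
  qed
  have "(SUM j:UNIV. ?g i j z * ip (toid c z (axis j 1)) (frame a)) = ?E a z $ i" for a proof -
   have "(SUM j:UNIV. ?g i j z * ip (toid c z (axis j 1)) (frame a)) =
     (SUM b:UNIV. ?E b z $ i * ip (SUM j:UNIV. ?E b z $ j *\<^sub>R toid c z (axis j 1)) (frame a))"
    by (simp add: metric_inverse(1)[OF c z] ip_simps sum_distrib_right sum_distrib_left mult.assoc) (rule sum.swap)
   also have "... = ?E a z $ i"
    using frame by (simp add: ipbasis_def linear_axis_expand[OF linear_toid[OF c z]] toid_efield[OF c z] if_distrib[of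
     "(*) _"] cong: if_cong)
   finally show ?thesis .
  qed
  thus ?thesis
   by (simp add: p scaleR_sum_right) (subst sum.swap, simp add: scaleR_sum_left[symmetric])
 qed
 have dF: "(?F a hfd (%v. lder (toid c y v) (lder (frame a) f) x)) (at y)" for a
  using chart_hfd[OF gsmooth_lder[OF f] c y(1), of "frame a"] by (simp add: y)
 have part: "partial_deriv i (%z. vol c z *\<^sub>R (SUM j:UNIV. ?g i j z *\<^sub>R partial_deriv j ?h z)) y =
   (SUM a:UNIV. (?w (axis i 1) * ?E a y $ i + vol c y * ?e a i (axis i 1)) *\<^sub>R ?F a y +
    (vol c y * ?E a y $ i) *\<^sub>R lder (toid c y (axis i 1)) (lder (frame a) f) x)" for i proof -
  have "((%z. vol c z *\<^sub>R (SUM a:UNIV. ?E a z $ i *\<^sub>R ?F a z)) hfd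
   (%v. vol c y *\<^sub>R (SUM a:UNIV. ?E a y $ i *\<^sub>R lder (toid c y v) (lder (frame a) f) x + ?e a i v
    *\<^sub>R ?F a y) +
    ?w v *\<^sub>R (SUM a:UNIV. ?E a y $ i *\<^sub>R ?F a y))) (at y)"
   by (intro smooth_hfd[OF smooth_blin[OF bounded_linear_vec_nth chartD(2)[OF c] smooth_efield[OF c]] y(1)]
    has_derivative_scaleR has_derivative_sum vol_differentiable(1)[OF c y(1)] dF)
  hence "((%z. vol c z *\<^sub>R (SUM j:UNIV. ?g i j z *\<^sub>R partial_deriv j ?h z)) hfd
   (%v. vol c y *\<^sub>R (SUM a:UNIV. ?E a y $ i *\<^sub>R lder (toid c y v) (lder (frame a) f) x + ?e a i v
    *\<^sub>R ?F a y) +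
    ?w v *\<^sub>R (SUM a:UNIV. ?E a y $ i *\<^sub>R ?F a y))) (at y)"
   by (rule hfd_transform[OF _ chartD(2)[OF c] y(1)]) (simp only: inner)
  note e = fun_cong[OF frechet_derivative_at[OF this], symmetric]
  show ?thesis unfolding partial_deriv_def[of i] e unfolding scaleR_sum_right sum.distrib[symmetric]
   by (rule sum.cong[OF refl]) (simp add: scaleR_add_right scaleR_add_left)
 qed
 have "(SUM i:UNIV. partial_deriv i (%z. vol c z *\<^sub>R (SUM j:UNIV. ?g i j z *\<^sub>R partial_deriv j ?h z)) y) =
  (SUM a:UNIV. (SUM i:UNIV. ?w (axis i 1) * ?E a y $ i + vol c y * ?e a i (axis i 1)) *\<^sub>R ?F a y +
    vol c y *\<^sub>R (SUM i:UNIV. ?E a y $ i *\<^sub>R lder (toid c y (axis i 1)) (lder (frame a) f) x))"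
  unfolding part by (subst sum.swap, simp only: scaleR_sum_left scaleR_sum_right scaleR_scaleR) (simp only:
   sum.distrib)
 also have "... = (SUM a:UNIV. vol c y *\<^sub>R lder (frame a) (lder (frame a) f) x)"
 proof (rule sum.cong[OF refl])
  fix a
  have "(SUM i:UNIV. ?w (axis i 1) * ?E a y $ i + vol c y * ?e a i (axis i 1)) =
    ?w (?E a y) + vol c y * (SUM i:UNIV. ?e a i (axis i 1))"
   using linear_axis_expand[OF has_derivative_linear[OF vol_differentiable(1)[OF c y(1)]], of "?E a y"]
    by (simp add: sum_distrib_left mult.commute)
  also have "... = 0" by (rule vol_divergence[OF c y(1)])
  finally have 1: "(SUM i:UNIV. ?w (axis i 1) * ?E a y $ i + vol c y * ?e a i (axis i 1)) = 0" .
  note l = linear_compose[OF linear_toid[OF c y(1)] linear_lder[OF gsmooth_lder[OF f]], unfolded o_def]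
  have 2: "(SUM i:UNIV. ?E a y $ i *\<^sub>R lder (toid c y (axis i 1)) (lder (frame a) f) x) = lder (frame a) (lder
   (frame a) f) x"
   using linear_axis_expand[OF l, of "?E a y"] by (simp add: toid_efield[OF c y(1)])
  show "(SUM i:UNIV. ?w (axis i 1) * ?E a y $ i + vol c y * ?e a i (axis i 1)) *\<^sub>R ?F a y +
    vol c y *\<^sub>R (SUM i:UNIV. ?E a y $ i *\<^sub>R lder (toid c y (axis i 1)) (lder (frame a) f) x) =
    vol c y *\<^sub>R lder (frame a) (lder (frame a) f) x" unfolding 1 2 by simp
 qed
 also have "... = vol c y *\<^sub>R cas f x" by (simp add: cas_def scaleR_sum_right)
 finally show ?thesis using vol_differentiable(2)[OF c y(1)]
  unfolding laplace_beltrami_def Let_def c_def[symmetric] y_def[symmetric] vol_def[symmetric] by simp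
qed

end

section \<open>Completeness of the matrix coefficients\<close>

context compact_lie
begin

definition hip :: "('g => complex) => ('g => complex) => complex" where
 "hip f g = cint (%x. f x * cnj (g x))"

definition nrm2 :: "('g => complex) => real" where
 "nrm2 f = haar (%x. (cmod (f x))^2)"

lemma cont_nrm: "cont f ==> ctn (%x. (cmod (f x))^2)"
 by (intro continuous_intros)

lemma hip_self: "cont f ==> hip f f = cor (nrm2 f)"
 unfolding hip_def nrm2_def complex_norm_square[symmetric] by (rule cint_of_real[OF cont_nrm])

lemma hip_add: "cont f ==> cont g ==> cont h ==> hip (%x. f x + g x) h = hip f h + hip g h"
 unfolding hip_def distrib_right by (rule cint_add) (intro continuous_intros , assumption+)+

lemma hip_cmult: "cont f ==> cont h ==> hip (%x. c * f x) h = c * hip f h"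
 unfolding hip_def mult.assoc by (rule cint_cmult) (intro continuous_intros)

lemma hip_cnj: "cont f ==> cont h ==> hip h f = cnj (hip f h)"
 unfolding hip_def by (subst cint_cnj[symmetric]) (auto intro!: continuous_intros simp: mult.commute)

lemma hip_sum: "finite A ==> (!!a. a : A ==> cont (f a)) ==> cont h ==> hip (%x. SUM a:A. f a x) h = (SUM a:A. hip (f
 a) h)"
 unfolding hip_def sum_distrib_right by (rule cint_sum) (auto intro!: continuous_intros)

lemma cont_lin_comb: "(!!a. a : A ==> cont (f a)) ==> cont (%x. SUM a:A. c a * f a x)"
 by (intro continuous_intros)

lemma hip_lin_comb: assumes "finite A" "!!a. a : A ==> cont (f a)" "cont h"
 shows "hip (%x. SUM a:A. c a * f a x) h = (SUM a:A. c a * hip (f a) h)"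
  "hip h (%x. SUM a:A. c a * f a x) = (SUM a:A. cnj (c a) * hip h (f a))" using assms
   by (auto simp: hip_sum hip_cmult continuous_on_mult_left hip_cnj[OF assms(2,3)] hip_cnj[OF cont_lin_comb[OF
    assms(2)] assms(3)])

lemma nrm2_nonneg: "cont f ==> 0 <= nrm2 f"
 unfolding nrm2_def by (rule haar_nonneg[OF cont_nrm]) auto

lemma nrm2_zero: "cont f ==> nrm2 f = 0 ==> f x = 0"
 unfolding nrm2_def using haar_pos[OF cont_nrm, of f x] by (cases "f x = 0") auto

lemma nrm2_cmult: "cont f ==> nrm2 (%x. c * f x) = (cmod c)^2 * nrm2 f"
 unfolding nrm2_def norm_mult power_mult_distrib by (rule haar_cmult[OF cont_nrm])

lemma nrm2_bound: "cont f ==> (!!x. cmod (f x) <= B) ==> nrm2 f <= B^2"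
 using haar_mono[OF cont_nrm continuous_on_const, of f "B^2"] by (simp add: nrm2_def power_mono)

lemma nrm2_diff: assumes "cont f" "cont g"
 shows "nrm2 (%x. f x - c * g x) = nrm2 f - 2 * Re (cnj c * hip f g) + (cmod c)^2 * nrm2 g"
proof -
 have g: "cont (%x. - c * g x)" by (intro continuous_intros assms)
 have s: "cont (%x. f x + - c * g x)" by (intro continuous_intros assms)
 have "cor (nrm2 (%x. f x + - c * g x)) = hip f (%x. f x + - c * g x) - c * hip g (%x. f x + - c * g x)"
  using hip_self[OF s, symmetric] by (simp only: hip_add[OF assms(1) g s] hip_cmult[OF assms(2) s]) simp
 also have "hip f (%x. f x + - c * g x) = cor (nrm2 f) - cnj c * hip f g"
  unfolding hip_cnj[OF s assms(1)] hip_add[OF assms(1) g assms(1)] hip_cmult[OF assms(2,1)]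
  by (simp add: hip_self[OF assms(1)] hip_cnj[OF assms(1,2)])
 also have "hip g (%x. f x + - c * g x) = cnj (hip f g) - cnj c * cor (nrm2 g)"
  unfolding hip_cnj[OF s assms(2)] hip_add[OF assms(1) g assms(2)] hip_cmult[OF assms(2,2)]
  by (simp add: hip_self[OF assms(2)])
 finally have "nrm2 (%x. f x + - c * g x) = Re (cor (nrm2 f) - cnj c * hip f g - c * (cnj (hip f g) - cnj c * cor
  (nrm2 g)))"
  by (metis Re_complex_of_real)
 thus ?thesis unfolding cmod_power2 by (simp add: algebra_simps power2_eq_square)
qed

lemma hip_cauchy: assumes "cont f" "cont g" shows "(cmod (hip f g))^2 <= nrm2 f * nrm2 g"
proof (cases "nrm2 g = 0")
 case True
 thus ?thesis using nrm2_zero[OF assms(2)] True by (simp add: hip_def)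
next
 case False
 hence p: "nrm2 g > 0" using nrm2_nonneg[OF assms(2)] by simp
 define c where "c = hip f g / cor (nrm2 g)"
 have "cnj c * hip f g = cor ((cmod (hip f g))^2 / nrm2 g)"
  by (simp add: c_def complex_norm_square del: of_real_power)
 hence 1: "Re (cnj c * hip f g) = (cmod (hip f g))^2 / nrm2 g" by simp
 have 2: "(cmod c)^2 * nrm2 g = (cmod (hip f g))^2 / nrm2 g"
  using p by (simp add: c_def norm_divide power2_eq_square)
 have "0 <= nrm2 (%x. f x - c * g x)" by (rule nrm2_nonneg) (intro continuous_intros assms)
 hence "(cmod (hip f g))^2 / nrm2 g <= nrm2 f" unfolding nrm2_diff[OF assms] 1 2 by simp
 thus ?thesis using p by (simp add: field_simps)
qed

section \<open>Convolution operators and their compactness\<close>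

definition kop :: "('g => complex) => ('g => complex) => 'g => complex" where
 "kop k f x = cint (%z. k (x \<otimes> inv z) * f z)"

lemma cont_mult_inv: "cont k ==> cont (%z. k (x \<otimes> inv z))"
 by (rule continuous_on_compose2[of UNIV]) (auto intro!: ctn_group_mult ctn_group_inv)

lemma cont_right: "cont f ==> cont (%x. f (x \<otimes> a))"
 by (rule continuous_on_compose2[of UNIV]) (auto intro!: ctn_group_mult)

lemma cont_kop: "cont k ==> cont f ==> cont (kop k f)"
 unfolding kop_def[abs_def] by (rule continuous_on_cint)
  (auto simp: case_prod_beta' intro!: continuous_intros continuous_on_compose2[of UNIV k] continuous_on_compose2[of
   UNIV f]
   ctn_group_mult ctn_group_inv)

lemma kop_add: "cont k ==> cont f ==> cont g ==> kop k (%x. f x + g x) x = kop k f x + kop k g x"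
 unfolding kop_def distrib_left by (rule cint_add) (auto intro!: continuous_intros cont_mult_inv)

lemma kop_cmult: "cont k ==> cont f ==> kop k (%x. c * f x) x = c * kop k f x"
 unfolding kop_def mult.left_commute[of _ c] by (rule cint_cmult) (auto intro!: continuous_intros cont_mult_inv)

lemma kop_diff: "cont k ==> cont f ==> cont g ==> kop k (%x. f x - c * g x) x = kop k f x - c * kop k g x"
 using kop_add[of k f "%x. - c * g x" x] kop_cmult[of k g "- c" x]
  by (simp add: continuous_on_mult_left continuous_on_minus)

text \<open>The kernel depends on \<open>x \<otimes> inv z\<close> only, and both points move
  together; hence eigenspaces are invariant under right translations.\<close>

lemma kop_right: "cont k ==> cont f ==> kop k (%x. f (x \<otimes> a)) x = kop k f (x \<otimes> a)"
proof -
 assume c: "cont k" "cont f"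
 have "kop k f (x \<otimes> a) = cint (%z. k (x \<otimes> a \<otimes> inv (z \<otimes> a)) * f (z \<otimes> a))"
  unfolding kop_def
  by (rule cint_right[symmetric, of "%z. k (x \<otimes> a \<otimes> inv z) * f z"]) (intro continuous_intros
   cont_mult_inv c)
 thus ?thesis by (simp add: kop_def inv_mult_group m_assoc)
qed

lemma kop_bound: assumes k: "cont k" "!!x. cmod (k x) <= B" and f: "cont f"
 shows "(cmod (kop k f x))^2 <= B^2 * nrm2 f" proof -
 let ?k = "%z. cnj (k (x \<otimes> inv z))"
 have c: "cont ?k" by (intro continuous_on_cnj cont_mult_inv k)
 have "kop k f x = hip f ?k" by (simp add: kop_def hip_def mult.commute)
 hence "(cmod (kop k f x))^2 <= nrm2 f * nrm2 ?k" by (simp add: hip_cauchy[OF f c])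
 also have "... <= nrm2 f * B^2"
  by (intro mult_left_mono nrm2_bound c nrm2_nonneg f) (simp add: k)
 finally show ?thesis by (simp add: mult.commute)
qed

lemma kop_sup_bound:
 assumes k: "cont k" "!!x. cmod (k x) <= B" and f: "cont f" "!!x. cmod (f x) <= e"
 shows "cmod (kop k f x) <= B * e" unfolding kop_def
 by (rule cint_bound) (auto intro!: continuous_intros cont_mult_inv k f mult_mono simp: norm_mult order_trans[OF
  norm_ge_zero k(2)])

lemma hip_kop: assumes k: "cont k" "!!x. k (inv x) = cnj (k x)" and f: "cont f" and g: "cont g"
 shows "hip (kop k f) g = hip f (kop k g)" proof -
 have c: "ctn (%(x, z). k (x \<otimes> inv z) * f z * cnj (g x))"
  by (auto simp: case_prod_beta' intro!: continuous_intros continuous_on_compose2[OF k(1)] continuous_on_compose2[OF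
   f] continuous_on_compose2[OF g] ctn_group_mult ctn_group_inv)
 have "hip (kop k f) g = cint (%x. cint (%z. k (x \<otimes> inv z) * f z * cnj (g x)))" proof -
  have "kop k f x * cnj (g x) = cint (%z. k (x \<otimes> inv z) * f z * cnj (g x))" for x
   using cint_cmult[of "%z. k (x \<otimes> inv z) * f z" "cnj (g x)"]
   by (simp add: kop_def mult.commute continuous_on_mult cont_mult_inv k(1) f)
  thus ?thesis by (simp add: hip_def)
 qed
 also have "... = cint (%z. cint (%x. k (x \<otimes> inv z) * f z * cnj (g x)))" by (rule cint_fubini[OF c])
 also have "... = cint (%z. f z * cnj (kop k g z))" proof -
  have "cint (%x. k (x \<otimes> inv z) * f z * cnj (g x)) = f z * cnj (kop k g z)" for z proof -
   have e: "k (x \<otimes> inv z) = cnj (k (z \<otimes> inv x))" for x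
    using k(2)[of "z \<otimes> inv x"] by (simp add: inv_mult_group)
   have cc: "cont (%x. k (z \<otimes> inv x) * g x)" by (intro continuous_intros cont_mult_inv k g)
   have "cint (%x. k (x \<otimes> inv z) * f z * cnj (g x)) = cint (%x. f z * cnj (k (z \<otimes> inv x) * g x))"
    by (simp add: e mult_ac)
   also have "... = f z * cint (%x. cnj (k (z \<otimes> inv x) * g x))"
    by (rule cint_cmult[OF continuous_on_cnj[OF cc]])
   also have "cint (%x. cnj (k (z \<otimes> inv x) * g x)) = cnj (kop k g z)" unfolding kop_def
    by (rule cint_cnj[OF cc])
   finally show ?thesis .
  qed
  thus ?thesis by simp
 qed
 finally show ?thesis by (simp add: hip_def)
qed

text \<open>A finite net that controls the kernel for all second arguments at once; it reduces
  uniform statements about images of \<open>kop k\<close> to finitely many points.\<close>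

lemma left_modulus: assumes "cont k" "e > 0"
 obtains S where "finite S" "S ~= {}" "!!x. EX a:S. ALL w. cmod (k (x \<otimes> w) - k (a \<otimes> w)) <= e"
proof -
 have c: "ctn (%(x, b::bool). k (inv x))"
  by (simp add: continuous_on_compose2[OF assms(1)] ctn_group_inv continuous_intros continuous_on_compose2
   case_prod_beta')
 obtain U where U: "open U" "\<one> : U" "!!x u b. u : U ==> dist (k (inv (x \<otimes> u))) (k (inv x)) <= e"
  by (rule equicontinuous[OF c _ assms(2)]) (auto simp: finite_imp_compact)
 obtain S where S: "finite S" "S ~= {}" "!!p y. EX a:S. inv p \<otimes> (a \<otimes> y) : U"
  by (rule translates_cover[OF U(1,2)]) auto
 show thesis proof (rule that)
  show "finite ((%a. inv a) ` S)" "(%a. inv a) ` S ~= {}" using S by auto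
  fix x
  obtain a where a: "a : S" "x \<otimes> a : U" using S(3)[of "inv x" \<one>] by auto
  have "cmod (k (x \<otimes> w) - k (inv a \<otimes> w)) <= e" for w
   using U(3)[OF a(2), of "inv w \<otimes> inv x"] by (simp add: dist_norm norm_minus_commute inv_mult_group m_assoc)
  thus "EX b:(%a. inv a) ` S. ALL w. cmod (k (x \<otimes> w) - k (b \<otimes> w)) <= e" using a(1) by auto
 qed
qed

lemma norm_diff_add: fixes x :: "'b::real_normed_vector"
 shows "x = a - b + c ==> norm x <= norm a + norm b + norm c"
 using norm_triangle_ineq[of "a - b" c] norm_triangle_ineq4[of a b] by simp

text \<open>A cluster point of the sequence in a product of discs, compact by Tychonoff. The domain
  may be uncountable, so this replaces a diagonal subsequence.\<close>

lemma pointwise_cluster: fixes F :: "nat => 'a => complex" assumes "!!n x. cmod (F n x) <= B"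
 shows "EX h. ALL S e N. finite S --> e > 0 --> (EX n>=N. ALL x:S. cmod (F n x - h x) < e)" proof -
 let ?C = "PiE UNIV (%_::'a. cball (0::complex) B)"
 have "compact ?C"
  unfolding compactin_euclidean_iff[symmetric] euclidean_product_topology[symmetric] compactin_PiE by simp
 moreover have "filtermap F sequentially ~= bot" by (simp add: filtermap_bot_iff)
 moreover have "eventually (%ph. ph : ?C) (filtermap F sequentially)"
  using assms by (simp add: eventually_filtermap PiE_def)
 ultimately obtain h where h: "inf (nhds h) (filtermap F sequentially) ~= bot"
  unfolding compact_filter by blast
 show ?thesis proof (intro exI[of _ h] allI impI)
  fix S :: "'a set" and e :: real and N :: nat assume S: "finite S" "e > 0"
  let ?P = "%ph. ALL x:S. cmod (ph x - h x) < e"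
  have "\<forall>\<^sub>F ph in nhds h. cmod (ph x - h x) < e" for x proof -
   have "ctn (%ph::'a => complex. ph x)" by simp
   from open_vimage[OF open_ball[of "h x" e] this] show ?thesis using S(2)
    by (simp add: vimage_def dist_norm norm_minus_commute eventually_nhds exI[of _ "{ph. cmod (ph x - h x) < e}"])
  qed
  hence P: "eventually ?P (nhds h)" using S(1) by (simp add: eventually_ball_finite_distrib)
  have Q: "eventually (%ph. EX n>=N. ph = F n) (filtermap F sequentially)"
   unfolding eventually_filtermap eventually_sequentially by (intro exI[of _ N]) auto
  have "EX ph. ?P ph & (EX n>=N. ph = F n)" proof (rule contrapos_np[OF h])
   assume n: "\<nexists>ph. ?P ph & (EX n>=N. ph = F n)"
   have "eventually (%_. False) (inf (nhds h) (filtermap F sequentially))"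
    unfolding eventually_inf using P Q n by (intro exI[of _ ?P] exI[of _ "%ph. EX n>=N. ph = F n"]) auto
   thus "inf (nhds h) (filtermap F sequentially) = bot" by (simp add: eventually_False)
  qed
  thus "EX n>=N. ALL x:S. cmod (F n x - h x) < e" by auto
 qed
qed

text \<open>All images share the modulus of continuity of the kernel, so closeness to the cluster
  function on a finite net spreads over the whole group and the convergence becomes uniform.\<close>

lemma kop_cluster:
 assumes k: "cont k" "!!x. cmod (k x) <= B" and f: "!!n. cont (f n)" "!!n. nrm2 (f n) <= 1"
 obtains h s where "cont h" "!!j. s j >= j" "!!j x. cmod (kop k (f (s j)) x - h x) <= 1 / real (Suc j)"
proof -
 let ?F = "%n. kop k (f n)"
 have B: "0 <= B" using norm_ge_zero k(2) by (rule order_trans)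
 have b: "cmod (?F n x) <= B" for n x proof -
  have "(cmod (?F n x))^2 <= B^2 * nrm2 (f n)" by (rule kop_bound[OF k f(1)])
  also have "... <= B^2" using f(2)[of n] by (simp add: mult_left_le)
  finally show ?thesis using B by simp
 qed
 obtain h where "ALL S e N. finite S --> e > 0 --> (EX n>=N. ALL x:S. cmod (?F n x - h x) < e)"
  using pointwise_cluster[of ?F, OF b] by auto
 note h = this[rule_format]
 have u: "EX n>=N. ALL x. cmod (?F n x - h x) <= e" if e: "e > 0" for e N proof -
  obtain S where S: "finite S" "S ~= {}" "!!x. EX a:S. ALL w. cmod (k (x \<otimes> w) - k (a \<otimes> w)) <= e / 4"
   by (rule left_modulus[OF k(1), of "e / 4"]) (use e in auto)
  obtain r where r: "!!x. r x : S" "!!x w. cmod (k (x \<otimes> w) - k (r x \<otimes> w)) <= e / 4" using S(3)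
   by metis
  have F: "cmod (?F n x - ?F n (r x)) <= e / 4" for n x proof -
   let ?k = "%w. k (x \<otimes> inv w) - k (r x \<otimes> inv w)"
   let ?g = "%w. cnj (?k w)"
   have c: "cont ?g" by (intro continuous_intros cont_mult_inv k)
   have "(cmod (?F n x - ?F n (r x)))^2 <= nrm2 (f n) * nrm2 ?g" using hip_cauchy[OF f(1) c, of n]
    by (simp add: cint_diff[symmetric] algebra_simps kop_def hip_def continuous_intros cont_mult_inv k f)
   also have "... <= 1 * (e / 4)^2"
    by (intro mult_mono f nrm2_bound c nrm2_nonneg) (use r(2) in \<open>auto simp flip: complex_cnj_diff\<close>)
   finally have "(cmod (?F n x - ?F n (r x)))^2 <= (e / 4)^2" by simp
   thus ?thesis by (rule power2_le_imp_le) (use e in simp)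
  qed
  have H: "cmod (h x - h (r x)) <= e / 2" for x proof -
   obtain n where n: "ALL y:{x, r x}. cmod (?F n y - h y) < e / 8" using h[of "{x, r x}" "e / 8" 0] e by auto
   have "cmod (h x - h (r x)) <= cmod (?F n x - ?F n (r x)) + cmod (?F n x - h x) + cmod (?F n (r x) - h (r x))"
    by (rule norm_diff_add) simp
   thus ?thesis using F[of n x] n by simp
  qed
  obtain n where n: "n >= N" "ALL x:S. cmod (?F n x - h x) < e / 4" using h[OF S(1), of "e / 4" N] e by auto
  have "cmod (?F n x - h x) <= e" for x proof -
   have "cmod (?F n x - h x) <= cmod (?F n x - ?F n (r x)) + cmod (h x - h (r x)) + cmod (?F n (r x) - h (r x))"
    by (rule norm_diff_add) simp
   thus ?thesis using F[of n x] H[of x] n(2)[rule_format, OF r(1)[of x]] by linarith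
  qed
  thus ?thesis using n(1) by auto
 qed
 have "ALL j. EX n>=j. ALL x. cmod (?F n x - h x) <= 1 / real (Suc j)" using u by simp
 from choice[OF this] obtain s where "ALL j. s j >= j & (ALL x. cmod (?F (s j) x - h x) <= 1 / real (Suc j))" by auto
 hence s: "!!j. s j >= j" "!!j x. cmod (?F (s j) x - h x) <= 1 / real (Suc j)" by blast+
 have "uniform_limit UNIV (%j. ?F (s j)) h sequentially" proof (rule uniform_limitI)
  fix e :: real assume "e > 0"
  show "\<forall>\<^sub>F j in sequentially. ALL x:UNIV. dist (?F (s j) x) (h x) < e"
   using order_tendstoD(2)[OF LIMSEQ_Suc[OF lim_inverse_n'] \<open>e > 0\<close>]
    by eventually_elim (use s(2) in \<open>auto simp: dist_norm intro: order.strict_trans1\<close>)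
 qed
 hence "cont h" by (rule uniform_limit_theorem[rotated]) (auto intro!: always_eventually cont_kop k f)
 thus thesis using s by (rule that)
qed

end

section \<open>Spectral theory on the orthogonal complement of the matrix coefficients\<close>

context compact_lie
begin

definition perp :: "('g => complex) => bool" where
 "perp f \<longleftrightarrow> cont f & (ALL d r i j. urep d r --> irr d r --> i < d --> j < d --> hip f (r i j) = 0)"

lemma perpD: "perp f ==> cont f"
 and perpD2: "perp f ==> urep d r ==> irr d r ==> i < d ==> j < d ==> hip f (r i j) = 0"
 by (auto simp: perp_def)

lemma perp_lin_comb: assumes "finite A" "!!a. a : A ==> perp (f a)"
 shows "perp (%x. SUM a:A. c a * f a x)" unfolding perp_def proof (intro conjI allI impI)
 show "cont (%x. SUM a:A. c a * f a x)" by (rule cont_lin_comb[OF perpD[OF assms(2)]])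
 fix d r i j assume r: "urep d r" "irr d r" "i < d" "j < d"
 show "hip (%x. SUM a:A. c a * f a x) (r i j) = 0"
  by (simp add: hip_lin_comb(1)[OF assms(1) perpD[OF assms(2)] urepD(1)[OF r(1,3,4)]] perpD2[OF assms(2) r])
qed

lemma perp_add: "perp f ==> perp g ==> perp (%x. f x + g x)"
 using perp_lin_comb[of "UNIV :: bool set" "%b. if b then f else g" "%_. 1"] by (simp add: UNIV_bool add.commute)

lemma perp_cmult: "perp f ==> perp (%x. c * f x)"
 using perp_lin_comb[of "{()}" "%_. f" "%_. c"] by simp

lemma perp_right: assumes f: "perp f" shows "perp (%x. f (x \<otimes> g))" unfolding perp_def
proof (intro conjI allI impI)
 note c = perpD[OF f]
 show "cont (%x. f (x \<otimes> g))" by (rule cont_right[OF c])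
 fix d r i j assume r: "urep d r" "irr d r" "i < d" "j < d"
 have cr: "cont (r i l)" if "l < d" for l by (rule urepD(1)[OF r(1,3) that])
 have "hip (%x. f (x \<otimes> g)) (r i j) = cint (%x. (%x. f x * cnj (r i j (x \<otimes> inv g))) (x \<otimes> g))"
  by (simp add: hip_def)
 also have "... = hip f (%x. r i j (x \<otimes> inv g))" unfolding hip_def
  by (rule cint_right) (intro continuous_intros cont_right c cr r)
 also have "... = hip f (%x. SUM l<d. r l j (inv g) * r i l x)" by (simp add: urepD(2)[OF r(1,3,4)] mult.commute)
 also have "... = 0" by (subst hip_lin_comb(2)) (use cr c perpD2[OF f r(1,2,3)] in auto)
 finally show "hip (%x. f (x \<otimes> g)) (r i j) = 0" .
qed

text \<open>The operator maps the coefficients of a representation into their own span, and by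
  self-adjointness it then preserves the orthogonal complement.\<close>

lemma perp_kop: assumes k: "cont k" "!!x. k (inv x) = cnj (k x)" and f: "perp f"
 shows "perp (kop k f)" unfolding perp_def proof (intro conjI allI impI)
 note c = perpD[OF f]
 show "cont (kop k f)" by (rule cont_kop[OF k(1) c])
 fix d r i j assume r: "urep d r" "irr d r" "i < d" "j < d"
 have cr: "cont (r l j)" if "l < d" for l by (rule urepD(1)[OF r(1) that r(4)])
 have ck: "cont (%z. k (inv z))" using cont_mult_inv[OF k(1), of \<one>] by simp
 have "kop k (r i j) x = (SUM l<d. cint (%z. k (inv z) * r i l z) * r l j x)" for x proof -
  have "kop k (r i j) x = cint (%z. k (x \<otimes> inv (z \<otimes> x)) * r i j (z \<otimes> x))"
   unfolding kop_def by (rule cint_right[symmetric, of "%z. k (x \<otimes> inv z) * r i j z"])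
    (intro continuous_intros cont_mult_inv k cr r)
  also have "... = cint (%z. SUM l<d. r l j x * (k (inv z) * r i l z))"
   by (simp add: inv_mult_group m_assoc[symmetric] urepD(2)[OF r(1,3,4)] sum_distrib_left mult_ac)
  also have "... = (SUM l<d. r l j x * cint (%z. k (inv z) * r i l z))"
   by (subst cint_sum) (auto intro!: continuous_intros ck simp: cint_cmult continuous_on_mult ck urepD(1)[OF r(1,3)])
  finally show ?thesis by (simp add: mult.commute)
 qed
 hence "kop k (r i j) = (%x. SUM l<d. cint (%z. k (inv z) * r i l z) * r l j x)" by auto
 moreover have "hip (kop k f) (r i j) = hip f (kop k (r i j))" by (rule hip_kop[OF k c cr[OF r(3)]])
 ultimately have "hip (kop k f) (r i j) = hip f (%x. SUM l<d. cint (%z. k (inv z) * r i l z) * r l j x)" by simp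
 also have "... = 0" by (subst hip_lin_comb(2)) (use cr c perpD2[OF f r(1,2) _ r(4)] in auto)
 finally show "hip (kop k f) (r i j) = 0" .
qed

text \<open>A maximising sequence for the operator norm of \<open>kop k\<close> clusters at an eigenvector of its square.\<close>

lemma kop_eigenvector:
 assumes k: "cont k" "!!x. k (inv x) = cnj (k x)" and g: "perp g" "kop k g x0 ~= 0"
 obtains L h where "L > 0" "perp h" "h ~= (%_. 0)" "!!x. kop k (kop k h) x = cor L * h x"
proof -
 obtain B where B: "B >= 0" "!!x. cmod (k x) <= B" by (rule bounded_continuous[OF k(1)]) auto
 define A where "A = {nrm2 (kop k f) |f. perp f & nrm2 f <= 1}"
 \<comment> \<open>The square of the operator norm on the orthogonal complement.\<close>
 define L where "L = Sup A"
 have bound: "nrm2 (kop k f) <= B^2" if f: "perp f" "nrm2 f <= 1" for f proof -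
  have "nrm2 (kop k f) <= B^2" proof (rule nrm2_bound[OF cont_kop[OF k(1) perpD[OF f(1)]]])
   fix x
   have "(cmod (kop k f x))^2 <= B^2 * nrm2 f" by (rule kop_bound[OF k(1) B(2) perpD[OF f(1)]])
   also have "... <= B^2" using f(2) by (simp add: mult_left_le)
   finally show "cmod (kop k f x) <= B" using B(1) by simp
  qed
  thus ?thesis .
 qed
 have bdd: "bdd_above A" unfolding A_def by (rule bdd_aboveI[of _ "B^2"]) (use bound in auto)
 have upper1: "nrm2 (kop k f) <= L" if "perp f" "nrm2 f <= 1" for f
  unfolding L_def by (rule cSup_upper[OF _ bdd]) (use that in \<open>auto simp: A_def\<close>)
 have upper: "nrm2 (kop k f) <= L * nrm2 f" if f: "perp f" for f proof (cases "nrm2 f = 0")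
  case True
  hence "f = (%_. 0)" using nrm2_zero[OF perpD[OF f]] by auto
  thus ?thesis by (simp add: kop_def nrm2_def)
 next
  case False
  hence p: "nrm2 f > 0" using nrm2_nonneg[OF perpD[OF f]] by simp
  define c where "c = cor (1 / sqrt (nrm2 f))"
  have c: "(cmod c)^2 = 1 / nrm2 f" using p by (simp add: c_def norm_divide power_divide)
  have "nrm2 (kop k (%x. c * f x)) <= L"
   by (rule upper1[OF perp_cmult[OF f]]) (use in \<open>simp add: nrm2_cmult[OF perpD[OF f]] c\<close>)
  moreover have "kop k (%x. c * f x) = (%x. c * kop k f x)" by (rule ext) (rule kop_cmult[OF k(1) perpD[OF f]])
  ultimately show ?thesis using p by (simp add: nrm2_cmult[OF cont_kop[OF k(1) perpD[OF f]]] c field_simps)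
 qed
 have Lpos: "L > 0" proof -
  have "nrm2 (kop k g) ~= 0" using nrm2_zero[OF cont_kop[OF k(1) perpD[OF g(1)]]] g(2) by blast
  hence "0 < L * nrm2 g"
   using upper[OF g(1)] nrm2_nonneg[OF cont_kop[OF k(1) perpD[OF g(1)]]] by linarith
  thus ?thesis using nrm2_nonneg[OF perpD[OF g(1)]] by (simp add: zero_less_mult_iff)
 qed
 have "EX f. perp f & nrm2 f <= 1 & nrm2 (kop k f) > L - 1 / real (Suc n)" for n proof -
  have "L - 1 / real (Suc n) < Sup A" by (simp add: L_def)
  moreover have "A ~= {}" using perp_cmult[OF g(1), of 0] by (auto simp: A_def nrm2_def)
  ultimately obtain a where "a : A" "L - 1 / real (Suc n) < a" using less_cSupD by blast
  thus ?thesis by (auto simp: A_def)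
 qed
 from choice[OF allI[OF this]] obtain f where "ALL n. perp (f n) & nrm2 (f n) <= 1 & nrm2 (kop k (f n)) > L - 1 / real
  (Suc n)" by (rule exE)
 hence f: "!!n. perp (f n)" "!!n. nrm2 (f n) <= 1" "!!n. nrm2 (kop k (f n)) > L - 1 / real (Suc n)" by blast+
 note cf = perpD[OF f(1)] and pF = perp_kop[OF k f(1)]
 note cF = perpD[OF pF] and pT = perp_kop[OF k pF]
 note cT = perpD[OF pT]
 obtain h s where h: "cont h" "!!j. s j >= j" "!!j x. cmod (kop k (f (s j)) x - h x) <= 1 / real (Suc j)"
 proof (rule kop_cluster[of k B f, OF k(1) B(2) cf f(2)])
  fix h s assume "cont h" "!!j. s j >= j" "!!j x. cmod (kop k (f (s j)) x - h x) <= 1 / real (Suc j)"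
  thus thesis by (rule that)
 qed
 \<comment> \<open>The squared norm of \<open>?u\<close>, the defect of \<open>f n\<close> as an
   eigenvector of the squared operator, is at most \<open>L\<close> times the deficit
   \<open>L - nrm2 (kop k (f n))\<close>. One more application of \<open>kop k\<close> turns this
   into a uniform estimate.\<close>
 have near: "cmod (kop k (kop k (kop k (f n))) x - cor L * kop k (f n) x) <= B * sqrt (L / real (Suc n))" for n x
 proof -
  let ?u = "%x. kop k (kop k (f n)) x - cor L * f n x"
  have cu: "cont ?u" by (intro continuous_intros cT cf)
  have "nrm2 ?u <= L * (L - nrm2 (kop k (f n)))"
   using hip_kop[OF k cF cf, of n n] upper[OF pF, of n] mult_left_le[OF f(2)[of n], of "L^2"]
    by (simp add: hip_self[OF cF] power2_eq_square nrm2_diff[OF cT cf] algebra_simps)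
  also have "... <= L * (1 / real (Suc n))" using f(3)[of n] Lpos by (intro mult_left_mono) auto
  finally have u: "nrm2 ?u <= L / real (Suc n)" by simp
  have "(cmod (kop k (kop k (kop k (f n))) x - cor L * kop k (f n) x))^2 <= B^2 * nrm2 ?u"
   using kop_bound[OF k(1) B(2) cu] by (simp add: kop_diff[OF k(1) cT cf, symmetric])
  also have "... <= B^2 * (L / real (Suc n))" by (intro mult_left_mono u) simp
  also have "... = (B * sqrt (L / real (Suc n)))^2" using Lpos by (simp add: power_mult_distrib)
  finally show ?thesis by (rule power2_le_imp_le) (use B(1) Lpos in simp)
 qed
 have eig: "kop k (kop k h) x = cor L * h x" for x proof -
  have "cmod (kop k (kop k h) x - cor L * h x) <= B * sqrt (L / real (Suc j)) + (B * (B * (1 / real (Suc j))) + L * (1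
   / real (Suc j)))" for j
  proof -
   let ?F = "kop k (f (s j))"
   let ?v = "%x. ?F x - 1 * h x"
   have cv: "cont ?v" by (intro continuous_intros cF h)
   have "kop k ?v = (%x. kop k ?F x - 1 * kop k h x)" by (rule ext) (rule kop_diff[OF k(1) cF h(1)])
   hence e: "kop k (kop k ?v) x = kop k (kop k ?F) x - kop k (kop k h) x"
    using kop_diff[OF k(1) cT cont_kop[OF k(1) h(1)], of "s j" 1 x] by simp
   have b1: "cmod (kop k ?v x) <= B * (1 / real (Suc j))" for x
    by (rule kop_sup_bound[OF k(1) B(2) cv]) (simp add: h(3) del: of_nat_Suc)
   have b2: "cmod (kop k (kop k ?v) x) <= B * (B * (1 / real (Suc j)))"
    by (rule kop_sup_bound[OF k(1) B(2) cont_kop[OF k(1) cv] b1])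
   have "cmod (kop k (kop k h) x - cor L * h x) <=
     cmod (kop k (kop k ?F) x - cor L * ?F x) + cmod (kop k (kop k ?v) x) + cmod (cor L * (?F x - h x))"
    by (rule norm_diff_add) (simp add: e[simplified] algebra_simps)
   moreover have "cmod (cor L * (?F x - h x)) <= L * (1 / real (Suc j))"
    unfolding norm_mult using Lpos mult_left_mono[OF h(3)[of j x], of L] by simp
   moreover have "B * sqrt (L / real (Suc (s j))) <= B * sqrt (L / real (Suc j))"
    using B(1) Lpos h(2)[of j] by (intro mult_left_mono real_sqrt_le_mono divide_left_mono) auto
   ultimately show ?thesis using near[of "s j" x] b2 by linarith
  qed
  moreover have "(%j. B * sqrt (L / real (Suc j)) + (B * (B * (1 / real (Suc j))) + L * (1 / real (Suc j))))
   \<longlonglongrightarrow> B * sqrt (L * 0) + (B * (B * 0) + L * 0)"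
  proof -
   have "(%j. 1 / real (Suc j)) \<longlonglongrightarrow> 0" by (rule LIMSEQ_Suc[OF lim_inverse_n'])
   hence "(%j. B * sqrt (L * (1 / real (Suc j))) + (B * (B * (1 / real (Suc j))) + L * (1 / real (Suc j))))
    \<longlonglongrightarrow> B * sqrt (L * 0) + (B * (B * 0) + L * 0)"
    by (intro tendsto_intros)
   thus ?thesis by simp
  qed
  ultimately have "cmod (kop k (kop k h) x - cor L * h x) <= B * sqrt (L * 0) + (B * (B * 0) + L * 0)"
   by (intro LIMSEQ_le_const) auto
  thus ?thesis by simp
 qed
 \<comment> \<open>A vanishing limit would drive \<open>nrm2 (kop k (f n))\<close> to 0 along the
   subsequence, whereas these numbers approach \<open>L\<close>.\<close>
 have "h ~= (%_. 0)" proof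
  assume "h = (%_. 0)"
  hence "L - 1 / real (Suc j) <= (1 / real (Suc j))^2" for j proof -
   have "nrm2 (kop k (f (s j))) <= (1 / real (Suc j))^2"
    by (rule nrm2_bound[OF cF]) (use h(3)[of j] \<open>h = (%_. 0)\<close> in simp)
   moreover have "1 / real (Suc (s j)) <= 1 / real (Suc j)" using h(2)[of j] by (simp add: field_simps)
   ultimately show ?thesis using f(3)[of "s j"] by simp
  qed
  moreover have "(%j. (1 / real (Suc j))^2 + 1 / real (Suc j)) \<longlonglongrightarrow> 0\<^sup>2 + 0"
   by (intro tendsto_intros LIMSEQ_Suc[OF lim_inverse_n'])
  ultimately have "L <= 0^2 + 0" by (intro LIMSEQ_le_const) (auto simp: algebra_simps)
  thus False using Lpos by simp
 qed
 moreover have "perp h" unfolding perp_def proof (intro conjI allI impI)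
  show "cont h" by (rule h)
  fix d r i j assume r: "urep d r" "irr d r" "i < d" "j < d"
  have cr: "cont (r i j)" by (rule urepD(1)[OF r(1,3,4)])
  obtain C where C: "C >= 0" "!!x. cmod (r i j x) <= C" by (rule bounded_continuous[OF cr]) auto
  have "cmod (hip h (r i j)) <= C * (1 / real (Suc m))" for m proof -
   let ?F = "kop k (f (s m))"
   have cv: "cont (%x. h x - ?F x)" by (intro continuous_intros h cF)
   have "hip h (r i j) = hip (%x. h x - ?F x) (r i j)"
    using hip_add[OF cv cF cr, of "s m"] perpD2[OF pF r, of "s m"] by simp
   also have "cmod ... <= C * (1 / real (Suc m))" unfolding hip_def proof (rule cint_bound)
    show "cont (%x. (h x - ?F x) * cnj (r i j x))" by (intro continuous_intros cv cr)
    have "cmod (h x - ?F x) * cmod (r i j x) <= 1 / real (Suc m) * C" for x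
     by (rule mult_mono) (use h(3)[of m x] C in \<open>auto simp: norm_minus_commute simp del: \<close>)
    thus "cmod ((h x - ?F x) * cnj (r i j x)) <= C * (1 / real (Suc m))" for x by (simp add: norm_mult)
   qed
   finally show ?thesis .
  qed
  moreover have "(%m. C * (1 / real (Suc m))) \<longlonglongrightarrow> C * 0"
   by (intro tendsto_intros LIMSEQ_Suc[OF lim_inverse_n'])
  ultimately have "cmod (hip h (r i j)) <= C * 0" by (intro LIMSEQ_le_const) auto
  thus "hip h (r i j) = 0" by simp
 qed
 ultimately show thesis using that[of L h] Lpos eig by blast
qed

section \<open>Finite orthonormal systems\<close>

definition ons :: "nat => (nat => 'g => complex) => bool" where
 "ons d f \<longleftrightarrow> (ALL i<d. cont (f i)) & (ALL i<d. ALL j<d. hip (f i) (f j) = (if i = j then 1 else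
  0))"

lemma onsD: "ons d f ==> i < d ==> cont (f i)"
 "ons d f ==> i < d ==> j < d ==> hip (f i) (f j) = (if i = j then 1 else 0)"
 by (auto simp: ons_def)

lemma ons_hip: assumes "ons d f" "j < d" shows "hip (%x. SUM i<d. v i * f i x) (f j) = v j"
 by (subst hip_lin_comb(1)) (use onsD[OF assms(1)] assms(2) in \<open>auto simp: if_distrib[of "(*) _"] cong:
  if_cong\<close>)

lemma ons_nrm2: assumes f: "ons d f"
 shows "nrm2 (%x. SUM i<d. v i * f i x) = (SUM i<d. (cmod (v i))^2)" proof -
 let ?F = "%x. SUM i<d. v i * f i x"
 have c: "cont ?F" by (rule cont_lin_comb) (use onsD[OF f] in auto)
 have "cor (nrm2 ?F) = hip ?F ?F" by (rule hip_self[OF c, symmetric])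
 also have "... = (SUM i<d. cnj (v i) * hip ?F (f i))" by (rule hip_lin_comb(2)) (use onsD[OF f] c in auto)
 also have "... = cor (SUM i<d. (cmod (v i))^2)"
  by (simp add: ons_hip[OF f] complex_norm_square mult.commute del: of_real_power)
 finally show ?thesis by (simp only: of_real_eq_iff)
qed

lemma ons_residual: assumes f: "ons d f" and h: "cont h"
 defines "e == %x. h x - (SUM i<d. hip h (f i) * f i x)"
 shows "cont e" "j < d ==> hip e (f j) = 0" "nrm2 e = nrm2 h - (SUM i<d. (cmod (hip h (f i)))^2)"
proof -
 let ?S = "%x. SUM i<d. hip h (f i) * f i x"
 have S: "cont ?S" by (rule cont_lin_comb) (use onsD[OF f] in auto)
 show e: "cont e" unfolding e_def by (intro continuous_intros h S)
 show "hip e (f j) = 0" if "j < d"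
  using hip_add[OF e S onsD(1)[OF f that]] ons_hip[OF f that, of "%i. hip h (f i)"] by (simp add: e_def)
 have "hip h ?S = (SUM i<d. cnj (hip h (f i)) * hip h (f i))" by (rule hip_lin_comb(2)) (use onsD[OF f] h in auto)
 also have "... = cor (SUM i<d. (cmod (hip h (f i)))^2)"
  by (simp add: complex_norm_square mult.commute del: of_real_power)
 finally show "nrm2 e = nrm2 h - (SUM i<d. (cmod (hip h (f i)))^2)"
  using nrm2_diff[OF h S, of 1] by (simp add: e_def ons_nrm2[OF f])
qed

lemma ons_bessel: "ons d f ==> cont h ==> (SUM i<d. (cmod (hip h (f i)))^2) <= nrm2 h"
 using nrm2_nonneg[OF ons_residual(1), of d f h] ons_residual(3)[of d f h] by simp

lemma ons_extend:
 assumes f: "ons d f" and e: "cont e" "!!j. j < d ==> hip e (f j) = 0" "nrm2 e ~= 0"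
 obtains c where "ons (Suc d) (f(d := %x. c * e x))" proof (rule that)
 define c where "c = cor (1 / sqrt (nrm2 e))"
 have p: "nrm2 e > 0" using e(3) nrm2_nonneg[OF e(1)] by simp
 have ce: "cont (%x. c * e x)" by (intro continuous_intros e)
 have cc: "(cmod c)^2 = 1 / nrm2 e" using p by (simp add: c_def norm_divide power_divide)
 have 1: "hip (%x. c * e x) (%x. c * e x) = 1"
  using p by (simp add: hip_self[OF ce] nrm2_cmult[OF e(1)] cc)
 have 2: "hip (%x. c * e x) (f j) = 0" "hip (f j) (%x. c * e x) = 0" if "j < d" for j proof -
  show "hip (%x. c * e x) (f j) = 0" using e(2)[OF that] by (simp add: hip_cmult[OF e(1) onsD(1)[OF f that]])
  thus "hip (f j) (%x. c * e x) = 0" using hip_cnj[OF ce onsD(1)[OF f that]] by simp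
 qed
 show "ons (Suc d) (f(d := %x. c * e x))"
  unfolding ons_def using onsD[OF f] ce 1 2 by auto
qed

text \<open>An orthonormal system of maximal length in a space of continuous functions spans it.\<close>

lemma ons_maximal:
 assumes W: "!!h. W h ==> cont h" "!!h h'. W h ==> W h' ==> W (%x. h x + h' x)" "!!c h. W h ==> W (%x. c * h x)"
  "W (%_. 0)" and N: "!!d f. ons d f ==> ALL i<d. W (f i) ==> d <= N"
 obtains d f where "ons d f" "ALL i<d. W (f i)" "!!h x. W h ==> h x = (SUM i<d. hip h (f i) * f i x)"
proof -
 define Q where "Q d \<longleftrightarrow> (EX f. ons d f & (ALL i<d. W (f i)))" for d
 have "Q 0" by (simp add: Q_def ons_def)
 define d where "d = (GREATEST d. Q d)"
 have "Q d" unfolding d_def by (rule GreatestI_nat[of Q 0 N, OF \<open>Q 0\<close>]) (use N in \<open>auto simp: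
  Q_def\<close>)
 then obtain f where f: "ons d f" "ALL i<d. W (f i)" by (auto simp: Q_def)
 have "h x = (SUM i<d. hip h (f i) * f i x)" if h: "W h" for h x proof -
  let ?e = "%x. h x - (SUM i<d. hip h (f i) * f i x)"
  note r = ons_residual[OF f(1) W(1)[OF h]]
  have Ws: "W (%x. SUM i<m. hip h (f i) * f i x)" if "m <= d" for m
   using that by (induction m) (auto intro!: W(4) W(2,3) f(2)[rule_format])
  have We: "W ?e" using W(2)[OF h W(3)[OF Ws[of d], of "-1"]] by simp
  have "nrm2 ?e = 0" proof (rule ccontr)
   assume n: "nrm2 ?e ~= 0"
   obtain c where "ons (Suc d) (f(d := %x. c * ?e x))" by (rule ons_extend[OF f(1) r(1,2) n])
   hence "Q (Suc d)"
    unfolding Q_def using f(2) W(3)[OF We, of c] by (intro exI[of _ "f(d := %x. c * ?e x)"]) auto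
   hence "Suc d <= d" unfolding d_def by (rule Greatest_le_nat[of Q _ N]) (use N in \<open>auto simp: Q_def\<close>)
   thus False by simp
  qed
  thus ?thesis using nrm2_zero[OF r(1), of x] by simp
 qed
 thus thesis using f that by blast
qed

text \<open>The squared moduli of the mutual coefficients sum to \<open>m\<close> when grouped by
  \<open>g\<close>, and by Bessel to at most \<open>d\<close> when grouped by
  \<open>f\<close>.\<close>

lemma ons_in_span:
 assumes f: "ons d f" and g: "ons m g" and s: "!!j x. j < m ==> g j x = (SUM i<d. v j i * f i x)"
 shows "m <= d" proof -
 have ge: "g j = (%x. SUM i<d. v j i * f i x)" if "j < m" for j using s[OF that] by auto
 have v: "v j i = hip (g j) (f i)" if "j < m" "i < d" for i j
  unfolding ge[OF that(1)] by (rule ons_hip[OF f that(2), symmetric])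
 have one: "nrm2 (g j) = 1" if "j < m" for j
  using hip_self[OF onsD(1)[OF g that]] onsD(2)[OF g that that] by simp
 have onef: "nrm2 (f i) = 1" if "i < d" for i
  using hip_self[OF onsD(1)[OF f that]] onsD(2)[OF f that that] by simp
 have "real m = (SUM j<m. nrm2 (g j))" by (simp add: one)
 also have "... = (SUM j<m. SUM i<d. (cmod (v j i))^2)" by (intro sum.cong refl) (simp add: ge ons_nrm2[OF f])
 also have "... = (SUM i<d. SUM j<m. (cmod (hip (f i) (g j)))^2)"
  by (subst sum.swap) (intro sum.cong refl, simp add: v hip_cnj[OF onsD(1)[OF g] onsD(1)[OF f]])
 also have "... <= (SUM i<d. nrm2 (f i))" by (intro sum_mono ons_bessel g) (use onsD[OF f] in auto)
 also have "... = real d" by (simp add: onef)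
 finally show ?thesis by simp
qed

text \<open>For fixed \<open>x\<close> the combination of the \<open>f i\<close> with weights
  \<open>cnj (f i x)\<close> takes, after two applications of \<open>kop k\<close>, the value
  \<open>L\<close> times the sum of squares at \<open>x\<close>. The bounds of the operator limit
  this sum pointwise, and its mean is the number of functions.\<close>

lemma eigenspace_dim: assumes k: "cont k" "!!x. cmod (k x) <= B" and L: "L > 0" and f: "ons d f"
  and e: "!!i x. i < d ==> kop k (kop k (f i)) x = cor L * f i x"
 shows "real d <= (B * B / L)^2" proof -
 have B: "0 <= B" using norm_ge_zero k(2) by (rule order_trans)
 let ?C = "B * B / L"
 have S: "(SUM i<d. (cmod (f i x))^2) <= ?C^2" for x proof -
  let ?S = "SUM i<d. (cmod (f i x))^2" and ?F = "%y. SUM i<d. cnj (f i x) * f i y"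
  have cF: "cont ?F" by (rule cont_lin_comb) (use onsD[OF f] in auto)
  have lin: "kop k (%y. SUM i<d. c i * g i y) x = (SUM i<d. c i * kop k (g i) x)" if "!!i. i < d ==> cont (g i)" for c
   g x
  proof -
   have "cont (%z. k (x \<otimes> inv z) * g i z)" if "i < d" for i
    by (intro continuous_intros cont_mult_inv k that \<open>!!i. i < d ==> cont (g i)\<close>)
   thus ?thesis unfolding kop_def sum_distrib_left mult.left_commute[of "k _"]
    by (subst cint_sum) (auto intro!: continuous_on_mult_left simp: cint_cmult)
  qed
  have "kop k ?F = (%y. SUM i<d. cnj (f i x) * kop k (f i) y)" by (rule ext) (rule lin[OF onsD(1)[OF f]])
  hence "kop k (kop k ?F) x = (SUM i<d. cnj (f i x) * kop k (kop k (f i)) x)"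
   by (simp add: lin[OF cont_kop[OF k(1) onsD(1)[OF f]]])
  also have "... = cor (L * ?S)"
   by (simp add: e complex_norm_square sum_distrib_left mult_ac del: of_real_power)
  finally have "cmod (kop k (kop k ?F) x) = L * ?S" using L by (simp add: norm_mult sum_nonneg del: of_real_sum)
  moreover have b1: "cmod (kop k ?F y) <= B * sqrt ?S" for y proof -
   have "(cmod (kop k ?F y))^2 <= (B * sqrt ?S)^2" using kop_bound[OF k cF]
    by (simp add: ons_nrm2[OF f] power_mult_distrib sum_nonneg)
   thus ?thesis by (rule power2_le_imp_le) (use B in \<open>simp add: sum_nonneg\<close>)
  qed
  moreover have "cmod (kop k (kop k ?F) x) <= B * (B * sqrt ?S)" by (rule kop_sup_bound[OF k cont_kop[OF k(1) cF] b1])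
  ultimately have LS: "L * ?S <= B * (B * sqrt ?S)" by simp
  define T where "T = sqrt ?S"
  have T: "?S = T * T" "0 <= T" by (simp_all add: T_def sum_nonneg)
  have "T <= ?C" proof (cases "T = 0")
   case False
   thus ?thesis using LS T(2) L by (simp add: field_simps T_def[symmetric] T(1))
  qed (use B L in simp)
  thus ?thesis by (metis T(2) T(1) power2_eq_square[of T] power_mono)
 qed
 have one: "nrm2 (f i) = 1" if "i < d" for i
  using hip_self[OF onsD(1)[OF f that]] onsD(2)[OF f that that] by simp
 have "real d = (SUM i<d. nrm2 (f i))" by (simp add: one)
 also have "... = haar (%x. SUM i<d. (cmod (f i x))^2)"
  unfolding nrm2_def by (rule haar_sum[symmetric]) (auto intro: cont_nrm[OF onsD(1)[OF f]])
 also have "... <= haar (%_. ?C^2)"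
  by (rule haar_mono[OF continuous_on_sum[OF cont_nrm[OF onsD(1)[OF f]]] continuous_on_const S]) simp
 finally show ?thesis by simp
qed

end

section \<open>Invariant systems and the Peter-Weyl theorem\<close>

context compact_lie
begin

text \<open>An orthonormal basis of a space that is invariant under right translations and
  orthogonal to all irreducible coefficients; \<open>no_inv_ons\<close> leaves only the empty
  one.\<close>

definition inv_ons :: "nat => (nat => 'g => complex) => bool" where
 "inv_ons d f \<longleftrightarrow> ons d f & (ALL i<d. perp (f i)) &
  (ALL j<d. ALL g x. f j (x \<otimes> g) = (SUM i<d. hip (%y. f j (y \<otimes> g)) (f i) * f i x))"

lemma inv_onsD: "inv_ons d f ==> ons d f" "inv_ons d f ==> i < d ==> perp (f i)"
 "inv_ons d f ==> i < d ==> f i (x \<otimes> g) = (SUM l<d. hip (%y. f i (y \<otimes> g)) (f l) * f l x)"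
 unfolding inv_ons_def by blast+

text \<open>The matrix of right translation on the invariant space; it is unitary because the mean
  is right invariant.\<close>

lemma inv_ons_urep: assumes f: "inv_ons d f"
 shows "urep d (%i j g. hip (%x. f j (x \<otimes> g)) (f i))" (is "urep d ?r") proof -
 note o = inv_onsD(1)[OF f]
 note c = onsD(1)[OF o]
 have cr: "cont (%x. f j (x \<otimes> g))" if "j < d" for j g by (rule cont_right[OF c[OF that]])
 have "cont (?r i j)" if ij: "i < d" "j < d" for i j unfolding hip_def
  by (rule continuous_on_cint) (auto simp: case_prod_beta' intro!: continuous_intros continuous_on_compose2[OF c[OF
   ij(2)]] continuous_on_compose2[OF c[OF ij(1)]] ctn_group_mult)
 moreover have "?r i j (g \<otimes> h) = (SUM l<d. ?r i l g * ?r l j h)" if ij: "i < d" "j < d" for i j g h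
 proof -
  have "?r i j (g \<otimes> h) = hip (%x. SUM l<d. ?r l j h * f l (x \<otimes> g)) (f i)"
   using inv_onsD(3)[OF f ij(2), of "_ \<otimes> g" h] by (simp add: m_assoc)
  also have "... = (SUM l<d. ?r l j h * ?r i l g)" by (rule hip_lin_comb(1)) (use cr c ij in auto)
  finally show ?thesis by (simp add: mult.commute)
 qed
 moreover have "?r i j \<one> = (if i = j then 1 else 0)" if "i < d" "j < d" for i j
  using onsD(2)[OF o that(2,1)] by auto
 moreover have "?r i j (inv g) = cnj (?r j i g)" if ij: "i < d" "j < d" for i j g proof -
  have "?r i j (inv g) = cint (%x. (%x. f j (x \<otimes> inv g) * cnj (f i x)) (x \<otimes> g))"
   unfolding hip_def by (rule cint_right[symmetric]) (intro continuous_intros cr c ij)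
  also have "... = hip (f j) (%x. f i (x \<otimes> g))" by (simp add: hip_def)
  also have "... = cnj (?r j i g)" by (rule hip_cnj[OF cr[OF ij(1)] c[OF ij(2)]])
  finally show ?thesis .
 qed
 ultimately show ?thesis unfolding urep_def by blast
qed

text \<open>Minimal positive length gives irreducibility: a proper nonzero invariant predicate
  \<open>P\<close> leads to a shorter invariant system, namely a maximal orthonormal system among
  the functions \<open>lc v\<close> with \<open>P v\<close>.\<close>

lemma inv_ons_irr:
 assumes f: "inv_ons d f" and d: "d > 0" and min: "!!m f'. 0 < m ==> m < d ==> ~ inv_ons m f'"
 shows "irr d (%i j g. hip (%x. f j (x \<otimes> g)) (f i))" (is "irr d ?r") unfolding irr_def
proof (intro conjI allI impI d)
 note o = inv_onsD(1)[OF f]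
 note c = onsD(1)[OF o]
 fix P :: "(nat => complex) => bool"
 assume P0: "ALL v w. (ALL i<d. v i = w i) --> P v --> P w" and Pz: "P (%_. 0)"
  and Pa: "ALL v w. P v --> P w --> P (%i. v i + w i)" and Pc: "ALL c v. P v --> P (%i. c * v i)"
  and Pr: "ALL x v. P v --> P (%i. SUM l<d. ?r i l x * v l)"
 show "(ALL v. P v --> (ALL i<d. v i = 0)) | (ALL v. P v)" proof (rule ccontr)
  assume "~ ?thesis"
  then obtain v0 i0 u where v0: "P v0" "i0 < d" "v0 i0 ~= 0" and u: "~ P u" by blast
  define lc where "lc v x = (SUM i<d. v i * f i x)" for v x
  define W where "W h \<longleftrightarrow> (EX v. P v & h = lc v)" for h
  have clc: "cont (lc v)" for v unfolding lc_def[abs_def] by (rule cont_lin_comb) (use c in auto)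
  have hlc: "hip (lc v) (f i) = v i" if "i < d" for v i unfolding lc_def[abs_def] by (rule ons_hip[OF o that])
  have Wc: "cont h" if "W h" for h using that clc by (auto simp: W_def)
  have Wa: "W (%x. h x + h' x)" if "W h" "W h'" for h h' proof -
   from that obtain v v' where v: "P v" "h = lc v" "P v'" "h' = lc v'" unfolding W_def by blast
   show ?thesis unfolding W_def v(2,4) by (intro exI[of _ "%i. v i + v' i"] conjI Pa[rule_format, OF v(1,3)]) (simp
    add: lc_def fun_eq_iff distrib_right)
  qed
  have Wm: "W (%x. a * h x)" if "W h" for a h proof -
   from that obtain v where v: "P v" "h = lc v" unfolding W_def by blast
   show ?thesis unfolding W_def v(2)
    by (intro exI[of _ "%i. a * v i"] conjI Pc[rule_format, OF v(1)]) (simp add: lc_def fun_eq_iff sum_distrib_left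
     mult.assoc)
  qed
  have Wz: "W (%_. 0)" unfolding W_def by (intro exI[of _ "%_. 0"] conjI Pz) (simp add: lc_def fun_eq_iff)
  have span: "g j x = (SUM i<d. hip (g j) (f i) * f i x)" if W: "ALL j<m. W (g j)" and j: "j < m" for g and j m :: nat
   and x
  using W j by (auto simp: hlc lc_def W_def)
  have N: "m <= d" if "ons m g" "ALL i<m. W (g i)" for m g
   by (rule ons_in_span[OF o that(1), of "%j i. hip (g j) (f i)"]) (rule span[OF that(2)])
  show False proof (rule ons_maximal[of W d, OF Wc Wa Wm Wz N])
   fix m g assume g: "ons m g" "ALL i<m. W (g i)" and full: "!!h x. W h ==> h x = (SUM i<m. hip h (g i) * g i x)"
   have m0: "m > 0" proof (rule ccontr)
    assume "~ m > 0"
    hence z: "lc v0 x = 0" for x using full[of "lc v0" x] v0(1) by (auto simp: W_def)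
    have "v0 i0 = hip (lc v0) (f i0)" using hlc[OF v0(2)] by simp
    also have "... = 0" by (simp add: hip_def z)
    finally show False using v0(3) by simp
   qed
   let ?e = "%x. lc u x - (SUM i<m. hip (lc u) (g i) * g i x)"
   note res = ons_residual[OF g(1) clc[of u]]
   have ne: "nrm2 ?e ~= 0" proof
    assume "nrm2 ?e = 0"
    hence lu: "lc u x = (SUM i<m. hip (lc u) (g i) * g i x)" for x using nrm2_zero[OF res(1), of x] by simp
    have "W (%x. SUM i<l. hip (lc u) (g i) * g i x)" if "l <= m" for l
     using that by (induction l) (auto intro!: Wz Wa Wm g(2)[rule_format])
    from this[of m] have "W (lc u)" by (simp flip: lu)
    then obtain v where v: "P v" "lc u = lc v" unfolding W_def by blast
    show False by (metis u hlc[of _ v] hlc[of _ u] P0 v(1) v(2))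
   qed
   obtain a where a: "ons (Suc m) (g(m := %x. a * ?e x))" by (rule ons_extend[OF g(1) res(1,2) ne])
   \<comment> \<open>The normalised residual of the missing vector \<open>u\<close> can be adjoined
     without leaving the span of \<open>f\<close>, so \<open>m\<close> is strictly below
     \<open>d\<close>.\<close>
   have "Suc m <= d" proof (rule ons_in_span[OF o a])
    fix j x assume j: "j < Suc m"
    show "(g(m := %x. a * ?e x)) j x = (SUM i<d. (if j = m then a * (u i - (SUM l<m. hip (lc u) (g l) * hip (g l) (f
     i))) else hip (g j) (f i)) * f i x)"
    proof (cases "j = m")
     case True
     have "(SUM l<m. hip (lc u) (g l) * g l x) = (SUM l<m. SUM i<d. hip (lc u) (g l) * hip (g l) (f i) * f i x)"
      by (intro sum.cong refl, subst span[OF g(2)]) (auto simp: sum_distrib_left mult.assoc)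
     also have "... = (SUM i<d. (SUM l<m. hip (lc u) (g l) * hip (g l) (f i)) * f i x)"
      by (subst sum.swap) (simp add: sum_distrib_right)
     finally show ?thesis using True by (simp add: lc_def sum_subtractf[symmetric] left_diff_distrib[symmetric]
      sum_distrib_left mult.assoc)
    next
     case False
     thus ?thesis using span[OF g(2), of j x] j by simp
    qed
   qed
   moreover have "inv_ons m g" unfolding inv_ons_def proof (intro conjI allI impI g(1))
    fix j assume j: "j < m"
    then obtain v where v: "P v" "g j = lc v" using g(2) unfolding W_def by blast
    show "perp (g j)" unfolding v(2) lc_def[abs_def] by (rule perp_lin_comb) (use inv_onsD(2)[OF f] in auto)
    fix h x
    have "(%y. g j (y \<otimes> h)) = lc (%i. SUM l<d. ?r i l h * v l)" proof
     fix y
     have "g j (y \<otimes> h) = (SUM l<d. v l * (SUM i<d. ?r i l h * f i y))"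
      unfolding v(2) lc_def by (intro sum.cong refl arg_cong2[where f="(*)"] inv_onsD(3)[OF f]) simp
     also have "... = (SUM i<d. (SUM l<d. ?r i l h * v l) * f i y)"
      by (simp add: sum_distrib_left mult_ac) (rule sum.swap)
     finally show "g j (y \<otimes> h) = lc (%i. SUM l<d. ?r i l h * v l) y" by (simp add: lc_def)
    qed
    hence "W (%y. g j (y \<otimes> h))" unfolding W_def using Pr v(1) by blast
    from full[OF this, of x] show "g j (x \<otimes> h) = (SUM i<m. hip (%y. g j (y \<otimes> h)) (g i) * g i x)" .
   qed
   ultimately show False using min[OF m0, of g] by simp
  qed
 qed
qed

lemma no_inv_ons: assumes "inv_ons d f" shows "d = 0" proof (rule ccontr)
 assume "d ~= 0"
 hence ex: "EX d. d > 0 & (EX f. inv_ons d f)" using assms by auto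
 define m where "m = (LEAST d. d > 0 & (EX f. inv_ons d f))"
 obtain f where m: "m > 0" and f: "inv_ons m f" using LeastI_ex[OF ex] unfolding m_def by blast
 have least: "~ inv_ons l f'" if "0 < l" "l < m" for l f'
  using not_less_Least[OF that(2)[unfolded m_def]] that(1) by blast
 let ?r = "%i j g. hip (%x. f j (x \<otimes> g)) (f i)"
 have r: "urep m ?r" "irr m ?r" by (rule inv_ons_urep[OF f], rule inv_ons_irr[OF f m least])
 note o = inv_onsD(1)[OF f]
 \<comment> \<open>Evaluating the translation formula at the identity writes \<open>f 0\<close> in
   coefficients of the representation on its own span, to which it is orthogonal.\<close>
 have "f 0 g = (SUM i<m. f i \<one> * ?r i 0 g)" for g
  using inv_onsD(3)[OF f m, of \<one> g] by (simp add: mult.commute)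
 hence "hip (f 0) (f 0) = hip (f 0) (%g. SUM i<m. f i \<one> * ?r i 0 g)" by (metis ext)
 also have "... = (SUM i<m. cnj (f i \<one>) * hip (f 0) (?r i 0))"
  by (rule hip_lin_comb(2)) (use urepD(1)[OF r(1) _ m] onsD(1)[OF o m] in auto)
 also have "... = 0" by (simp add: perpD2[OF inv_onsD(2)[OF f m] r _ m])
 finally show False using onsD(2)[OF o m m] by simp
qed

text \<open>If \<open>g x\<close> were not 0, convolution with a symmetric kernel near the identity
  would not annihilate \<open>g\<close> at \<open>x\<close>. The squared operator then has a
  positive eigenvalue on the orthogonal complement, with an eigenspace that is finite-dimensional
  and right invariant, against \<open>no_inv_ons\<close>.\<close>

theorem completeness: assumes g: "perp g" shows "g x = 0" proof (rule ccontr)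
 assume x0: "g x ~= 0"
 note cg = perpD[OF g]
 have c1: "ctn (%u. Re (cnj (g x) * g (inv u \<otimes> x)))"
  by (intro continuous_intros continuous_on_compose2[OF cg] ctn_group_mult ctn_group_inv) auto
 let ?U = "{u. Re (cnj (g x) * g (inv u \<otimes> x)) > 0}"
 have oU: "open ?U" using open_pre[OF c1 open_UNIV open_greaterThan[of 0]] by simp
 have "cnj (g x) * g x = cor ((cmod (g x))^2)" by (metis complex_norm_square mult.commute)
 hence Re1: "Re (cnj (g x) * g x) > 0" using x0 by simp
 hence U1: "\<one> : ?U" by simp
 obtain ph :: "'g => real" where ph: "gsmooth ph" "!!x. 0 <= ph x" "ph \<one> > 0" "!!x. ph x ~= 0 ==> x : ?U"
  using group_bump[OF oU U1] by blast
 \<comment> \<open>Multiplying the bump by its inverted copy makes the kernel symmetric and keeps it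
   nonnegative.\<close>
 define k where "k = (%u. ph u * ph (inv u))"
 have ck: "ctn k" unfolding k_def by (intro continuous_intros continuous_on_compose2[OF gsmooth_ctn[OF ph(1)]]
  ctn_group_inv) auto
 let ?k = "%u. cor (k u)"
 have ckc: "cont ?k" by (intro continuous_intros ck)
 have sym: "?k (inv u) = cnj (?k u)" for u by (simp add: k_def)
 have "Re (cnj (g x) * kop ?k g x) = haar (%z. k (x \<otimes> inv z) * Re (cnj (g x) * g z))"
 proof -
  have "cnj (g x) * kop ?k g x = cint (%z. cnj (g x) * (?k (x \<otimes> inv z) * g z))"
   unfolding kop_def by (rule cint_cmult[symmetric]) (intro continuous_intros cont_mult_inv[OF ckc] cg)
  hence "Re (cnj (g x) * kop ?k g x) = haar (%z. Re (cnj (g x) * (?k (x \<otimes> inv z) * g z)))"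
   by (simp add: cint_def)
  also have "(%z. Re (cnj (g x) * (?k (x \<otimes> inv z) * g z))) = (%z. k (x \<otimes> inv z) * Re (cnj (g x) * g
   z))"
   by (simp add: algebra_simps)
  finally show ?thesis .
 qed
 also have "... > 0" proof (rule haar_pos[of _ x])
  show "ctn (%z. k (x \<otimes> inv z) * Re (cnj (g x) * g z))"
   by (intro continuous_intros cg continuous_on_compose2[OF ck] ctn_group_mult ctn_group_inv) auto
  show "k (x \<otimes> inv x) * Re (cnj (g x) * g x) > 0" using Re1 ph(3) by (simp add: k_def)
  fix z
  show "0 <= k (x \<otimes> inv z) * Re (cnj (g x) * g z)"
  proof (cases "ph (x \<otimes> inv z) = 0")
   case False
   hence "Re (cnj (g x) * g z) > 0" using ph(4)[OF False] by (simp add: inv_mult_group)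
   moreover have "k (x \<otimes> inv z) >= 0" by (simp add: k_def ph(2))
   ultimately show ?thesis by simp
  qed (simp add: k_def)
 qed
 finally have nz: "kop ?k g x ~= 0" by auto
 obtain B where B: "!!x. cmod (?k x) <= B" by (rule bounded_continuous[OF ckc]) auto
 obtain L h where L: "L > 0" and h: "perp h" "h ~= (%_. 0)" "!!x. kop ?k (kop ?k h) x = cor L * h x"
  by (rule kop_eigenvector[OF ckc sym g nz]) (rule that)
 define V where "V f \<longleftrightarrow> perp f & (ALL x. kop ?k (kop ?k f) x = cor L * f x)" for f
 have Vp: "perp f" and Ve: "kop ?k (kop ?k f) x = cor L * f x" if "V f" for f x using that by (auto simp: V_def)
 have Vc: "cont f" if "V f" for f by (rule perpD[OF Vp[OF that]])
 have Va: "V (%x. f x + f' x)" if "V f" "V f'" for f f' proof -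
  have "kop ?k (%x. f x + f' x) = (%x. kop ?k f x + kop ?k f' x)"
   by (rule ext) (rule kop_add[OF ckc Vc[OF that(1)] Vc[OF that(2)]])
  thus ?thesis unfolding V_def
   by (simp add: perp_add Vp that kop_add[OF ckc] cont_kop[OF ckc Vc] Ve distrib_left)
 qed
 have Vm: "V (%x. a * f x)" if "V f" for a f proof -
  have "kop ?k (%x. a * f x) = (%x. a * kop ?k f x)" by (rule ext) (rule kop_cmult[OF ckc Vc[OF that]])
  thus ?thesis unfolding V_def
   by (simp add: perp_cmult Vp that kop_cmult[OF ckc] cont_kop[OF ckc Vc] Ve)
 qed
 have Vh: "V h" using h by (simp add: V_def)
 have Vz: "V (%_. 0)" using Vm[OF Vh, of 0] by simp
 have Vr: "V (%x. f (x \<otimes> a))" if "V f" for a f proof -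
  have "kop ?k (%x. f (x \<otimes> a)) = (%x. kop ?k f (x \<otimes> a))"
   by (rule ext) (rule kop_right[OF ckc Vc[OF that]])
  thus ?thesis unfolding V_def
   by (simp add: perp_right Vp that kop_right[OF ckc] cont_kop[OF ckc Vc] Ve)
 qed
 have N: "d <= nat \<lceil>(B * B / L)\<^sup>2\<rceil>" if "ons d f" "ALL i<d. V (f i)" for d f
 proof -
  have "real d <= (B * B / L)^2"
   by (rule eigenspace_dim[OF ckc B L that(1)]) (rule Ve, use that(2) in blast)
  thus ?thesis by linarith
 qed
 show False proof (rule ons_maximal[of V, OF Vc Va Vm Vz N])
  fix d f assume f: "ons d f" "ALL i<d. V (f i)" and full: "!!h x. V h ==> h x = (SUM i<d. hip h (f i) * f i x)"
  have "d = 0" using f Vp full[OF Vr] by (auto simp: inv_ons_def intro!: no_inv_ons)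
  hence "h x = 0" for x using full[OF Vh, of x] by simp
  thus False using h(2) by auto
 qed
qed

end

section \<open>The unitary dual\<close>

locale lie_dual = lie_metric G ip for G :: "('g::t2_space, 'n::finite) lie_group" (structure) and ip +
 fixes X :: "real ^ 'n" and rep :: "('g => complex Matrix.mat) set => ('g => complex Matrix.mat)"
 assumes rep: "diagonal_representatives G X rep"
begin

abbreviation dual where "dual == unitary_dual G"
abbreviation dm where "dm Xi == rep_dim G (rep Xi)"
abbreviation br where "br Xi == japanese_bracket G ip (rep Xi)"
abbreviation mus where "mus Xi m == mu G X (rep Xi) m"
abbreviation e where "e Xi == ent (rep Xi)"

lemma rep_in: "Xi : dual ==> rep Xi : Xi" and rep_irreps: "Xi : dual ==> rep Xi : unitary_irreps G"
using rep in_quotient_imp_subset[OF equiv_rep_equivalence]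
 by (auto simp: diagonal_representatives_def unitary_dual_def)

lemmas rep_urep = irrepsD(1)[OF rep_irreps] and rep_irr = irrepsD(2)[OF rep_irreps]
 and dm_pos = irrepsD(3)[OF rep_irreps]

lemma gsmooth_e: "Xi : dual ==> i < dm Xi ==> j < dm Xi ==> gsmooth (e Xi i j)"
 by (rule irr_gsmooth[OF rep_urep rep_irr])

lemma cont_e: "Xi : dual ==> i < dm Xi ==> j < dm Xi ==> cont (e Xi i j)"
 by (rule gsmooth_ctn[OF gsmooth_e])

lemma irreps_class: "xi : unitary_irreps G ==> rep_equivalence G `` {xi} : dual"
 unfolding unitary_dual_def by (rule quotientI)

lemma cas_e: assumes "Xi : dual"
 shows "br Xi >= 1" "i < dm Xi ==> j < dm Xi ==> cas (e Xi i j) x = - cor ((br Xi)^2 - 1) * e Xi i j x"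
proof -
 note d = dm_pos[OF assms]
 obtain nu where nu: "nu >= 0" "!!i j x. i < dm Xi ==> j < dm Xi ==> cas (e Xi i j) x = - cor nu * e Xi i j x"
  by (rule cas_entry[OF rep_urep[OF assms] rep_irr[OF assms]]) (rule that)
 have L: "laplace_beltrami G ip (%y. rep Xi y $$ (i, j)) x = - cor nu * rep Xi x $$ (i, j)"
  if "i < dm Xi" "j < dm Xi" for i j x
  using laplace_beltrami_eq[OF gsmooth_e[OF assms that], of x] nu(2)[OF that, of x] by (simp add: ent_def[abs_def])
 \<comment> \<open>The described eigenvalue is unique because the entry \<open>(0, 0)\<close> equals
   1 at the identity.\<close>
 have "laplace_eigenvalue G ip (rep Xi) = nu" using L d L[OF d d, of \<one>] urepD(3)[OF rep_urep[OF assms] d d]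
  unfolding laplace_eigenvalue_def by (force simp: ent_def)
 thus "br Xi >= 1" "i < dm Xi ==> j < dm Xi ==> cas (e Xi i j) x = - cor ((br Xi)^2 - 1) * e Xi i j x"
  using nu(1) nu(2) by (auto simp: japanese_bracket_def)
qed

text \<open>The symbol is diagonal, so \<open>X\<close> acts on column \<open>j\<close> of the
  coefficient matrix by a scalar. This decouples the modes.\<close>

lemma lder_X: assumes "Xi : dual" and ij: "i < dm Xi" "j < dm Xi"
 shows "lder X (e Xi i j) x = \<i> * cor (mus Xi j) * e Xi i j x" proof -
 note u = rep_urep[OF assms(1)]
 have "lder X (e Xi l j) \<one> = (if l = j then \<i> * cor (mus Xi j) else 0)" if l: "l < dm Xi" for l
 proof -
  let ?M = "Matrix.mat (dm Xi) (dm Xi) (%(i, j). left_field G X (%y. rep Xi y $$ (i, j)) \<one>)"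
  have c: "rep Xi \<one> : carrier_mat (dm Xi) (dm Xi)" by (rule irrepsD(4)[OF rep_irreps[OF assms(1)]])
  have "symbol G X (rep Xi) $$ (l, j) = (SUM k<dm Xi. mat_adjoint (rep Xi \<one>) $$ (l, k) * ?M $$ (k, j))"
   unfolding symbol_def by (rule mat_mult_entry[OF mat_adjoint_carrier[OF c] _ l ij(2)]) simp
  also have "... = (SUM k<dm Xi. if k = l then ?M $$ (k, j) else 0)" proof (rule sum.cong[OF refl])
   fix k assume k: "k : {..<dm Xi}"
   hence "mat_adjoint (rep Xi \<one>) $$ (l, k) = cnj (ent (rep Xi) k l \<one>)"
    using c l by (subst mat_adjoint_entry) (auto simp: ent_def)
   thus "mat_adjoint (rep Xi \<one>) $$ (l, k) * ?M $$ (k, j) = (if k = l then ?M $$ (k, j) else 0)"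
    using k l by (simp add: urepD(3)[OF u])
  qed
  also have "... = left_field G X (e Xi l j) \<one>" using l ij by (simp add: ent_def[abs_def])
  also have "... = lder X (e Xi l j) \<one>" by (rule left_field_eq[OF gsmooth_e[OF assms(1) l ij(2)]])
  finally have "lder X (e Xi l j) \<one> = symbol G X (rep Xi) $$ (l, j)" by simp
  also have "symbol G X (rep Xi) = Matrix.mat (dm Xi) (dm Xi) (%(m, n). if m = n then \<i> * cor (mus Xi m) else 0)"
   using rep assms(1) by (simp add: diagonal_representatives_def)
  finally show ?thesis using l ij by auto
 qed
 thus ?thesis
  using ij by (simp add: lder_entry[OF u rep_irr[OF assms(1)] ij] if_distrib[of "(*) _"] cong: if_cong)
qed

lemma e_orthogonal:
 assumes Xi: "Xi : dual" "i < dm Xi" "j < dm Xi" and Xi': "Xi' : dual" "k < dm Xi'" "l < dm Xi'"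
 shows "hip (e Xi i j) (e Xi' k l) = (if Xi = Xi' & i = k & j = l then 1 / of_nat (dm Xi) else 0)"
proof (cases "Xi = Xi'")
 case True
 thus ?thesis
  using orthogonality_same[OF rep_urep[OF Xi(1)] rep_irr[OF Xi(1)] Xi(2,3)] Xi' unfolding hip_def by simp
next
 case False
 have "hip (e Xi i j) (e Xi' k l) = 0" proof (rule ccontr)
  assume nz: "hip (e Xi i j) (e Xi' k l) ~= 0"
  let ?A = "%i k. hip (e Xi i j) (e Xi' k l)"
  have "ALL i<dm Xi. ALL k<dm Xi'. ALL g. (SUM p<dm Xi. e Xi i p g * ?A p k) = (SUM q<dm Xi'. ?A i q * e Xi' q k g)"
   unfolding hip_def using entry_average_intertwines[OF rep_urep[OF Xi(1)] rep_urep[OF Xi'(1)] _ Xi(3) _ Xi'(3)]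
    by blast
  hence "(rep Xi', rep Xi) : rep_equivalence G"
   by (rule intertwiner_equivalence[OF rep_irreps[OF Xi'(1)] rep_irreps[OF Xi(1)] _ Xi(2) Xi'(2)]) (rule nz)
  thus False by (metis quotient_eqI[OF equiv_rep_equivalence] rep_in Xi(1) Xi'(1) False unitary_dual_def)
 qed
 thus ?thesis using False by simp
qed

text \<open>\<open>perp\<close> tests against every irreducible representation; within a class the
  entries of any member are combinations of those of the chosen representative.\<close>

lemma e_complete:
 assumes g: "cont g" and o: "!!Xi i j. Xi : dual ==> i < dm Xi ==> j < dm Xi ==> hip g (e Xi i j) = 0"
 shows "g x = 0" proof (rule completeness)
 show "perp g" unfolding perp_def proof (intro conjI allI impI g)
  fix d r i j assume r: "urep d r" "irr d r" and ij: "i < d" "j < d"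
  define xi where "xi = (%x. Matrix.mat d d (%(i, j). r i j x))"
  note xi = urep_unitary_irreps[OF r, folded xi_def]
  define Xi where "Xi = rep_equivalence G `` {xi}"
  have Xi: "Xi : dual" unfolding Xi_def by (rule irreps_class[OF xi(1)])
  have eqv: "(xi, rep Xi) : rep_equivalence G" using rep_in[OF Xi] by (simp add: Xi_def)
  obtain C where C: "!!i j x. i < rep_dim G xi ==> j < rep_dim G xi ==>
    ent xi i j x = (SUM p<dm Xi. SUM q<dm Xi. C i j p q * e Xi p q x)"
  by (blast intro: equivalent_entries[OF eqv])
  have "r i j = (%x. SUM p:{..<dm Xi} \<times> {..<dm Xi}. C i j (fst p) (snd p) * e Xi (fst p) (snd p) x)"
   using C[of i j] ij by (simp add: xi(2,3) fun_eq_iff sum.cartesian_product case_prod_beta')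
  thus "hip g (r i j) = 0"
   by (simp only:) (subst hip_lin_comb(2), use g cont_e[OF Xi] o[OF Xi] in \<open>auto intro!: sum.neutral\<close>)
 qed
qed

section \<open>The differential of a representation and size estimates for its entries\<close>

definition dent where "dent Xi Y l j = lder Y (e Xi l j) \<one>"

lemma lder_e: "Xi : dual ==> i < dm Xi ==> j < dm Xi ==> lder Y (e Xi i j) x = (SUM l<dm Xi. e Xi i l x * dent Xi Y l
 j)"
 unfolding dent_def by (rule lder_entry[OF rep_urep rep_irr])

text \<open>The derivative at the identity of the unitarity relation between two rows.\<close>

lemma dent_skew: assumes "Xi : dual" and ij: "i < dm Xi" "j < dm Xi"
 shows "dent Xi Y i j = - cnj (dent Xi Y j i)" proof -
 note u = rep_urep[OF assms(1)] and s = gsmooth_e[OF assms(1)]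
 let ?f = "%l x. e Xi i l x * cnj (e Xi j l x)"
 have "0 = lder Y (%x. SUM l<dm Xi. ?f l x) \<one>" by (simp add: urep_unitary(1)[OF u ij] lder_const)
 also have "... = (SUM l<dm Xi. lder Y (?f l) \<one>)"
  by (rule lder_sum) (auto intro!: gsmooth_mult gsmooth_cnj s ij)
 also have "... = (SUM l<dm Xi. (if l = i then cnj (dent Xi Y j l) else 0) + (if l = j then dent Xi Y i l else 0))"
 proof (rule sum.cong[OF refl])
  fix l assume "l : {..<dm Xi}"
  hence l: "l < dm Xi" by simp
  show "lder Y (?f l) \<one> = (if l = i then cnj (dent Xi Y j l) else 0) + (if l = j then dent Xi Y i l else 0)"
   using ij l by (simp add: lder_mult[OF s[OF ij(1) l] gsmooth_cnj[OF s[OF ij(2) l]]] lder_cnj[OF s[OF ij(2) l]]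
    dent_def urepD(3)[OF u])
 qed
 also have "... = cnj (dent Xi Y j i) + dent Xi Y i j" using ij by simp
 finally show ?thesis by (simp add: eq_neg_iff_add_eq_0 add.commute)
qed

text \<open>Each matrix of the differential is skew-Hermitian, so a diagonal entry of its square is
  minus the squared length of a column; summed over the frame this is the Casimir
  eigenvalue.\<close>

lemma dent_frame: assumes "Xi : dual" and j: "j < dm Xi"
 shows "(SUM a:UNIV. SUM l<dm Xi. (cmod (dent Xi (frame a) l j))^2) = (br Xi)^2 - 1"
proof -
 note u = rep_urep[OF assms(1)] and s = gsmooth_e[OF assms(1)]
 have "- cor ((br Xi)^2 - 1) = cas (e Xi j j) \<one>"
  using cas_e(2)[OF assms(1) j j, of \<one>] by (simp add: urepD(3)[OF u j j])
 also have "... = (SUM a:UNIV. SUM l<dm Xi. - cor ((cmod (dent Xi (frame a) l j))^2))"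
  unfolding cas_def proof (rule sum.cong[OF refl])
  fix a
  let ?Y = "frame a"
  have "lder ?Y (e Xi j j) = (%x. SUM l<dm Xi. dent Xi ?Y l j * e Xi j l x)"
   by (rule ext) (simp add: lder_e[OF assms(1) j j] mult.commute)
  hence "lder ?Y (lder ?Y (e Xi j j)) \<one> = (SUM l<dm Xi. dent Xi ?Y l j * dent Xi ?Y j l)"
   by (simp only:) (subst lder_sum, auto intro!: gsmooth_mult gsmooth_const j simp: lder_cmult s j dent_def)
  also have "... = (SUM l<dm Xi. - cor ((cmod (dent Xi ?Y l j))^2))"
   by (intro sum.cong refl) (simp add: dent_skew[OF assms(1) j, of _ ?Y] complex_norm_square del: of_real_power)
  finally show "lder ?Y (lder ?Y (e Xi j j)) \<one> = (SUM l<dm Xi. - cor ((cmod (dent Xi ?Y l j))^2))" .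
 qed
 also have "... = - cor (SUM a:UNIV. SUM l<dm Xi. (cmod (dent Xi (frame a) l j))^2)"
  by (simp add: sum_negf)
 finally show ?thesis by (simp only: neg_equal_iff_equal of_real_eq_iff)
qed

text \<open>The l1 size of \<open>Y\<close> in frame coordinates, suited to expanding a derivative
  along \<open>Y\<close> in the frame.\<close>

definition ysize :: "real ^ 'n => real" where "ysize Y = (SUM a:UNIV. abs (ip Y (frame a)))"

lemma dent_col_bound: assumes "Xi : dual" and j: "j < dm Xi"
 shows "L2_set (%l. cmod (dent Xi (frame a) l j)) {..<dm Xi} <= br Xi" proof -
 have "(SUM l<dm Xi. (cmod (dent Xi (frame a) l j))^2) <= (SUM a:UNIV. SUM l<dm Xi. (cmod (dent Xi (frame a) l j))^2)"
  by (rule member_le_sum) (auto intro: sum_nonneg)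
 also have "... <= (br Xi)^2" by (simp add: dent_frame[OF assms])
 finally show ?thesis unfolding L2_set_def using cas_e(1)[OF assms(1)] by (intro real_le_lsqrt) auto
qed

lemma e_row: "Xi : dual ==> i < dm Xi ==> L2_set (%l. cmod (e Xi i l x)) {..<dm Xi} = 1" proof -
 assume Xi: "Xi : dual" "i < dm Xi"
 have "cor (SUM l<dm Xi. (cmod (e Xi i l x))^2) = 1"
  using urep_unitary(1)[OF rep_urep[OF Xi(1)] Xi(2,2)] by (simp add: complex_norm_square del: of_real_power)
 hence "(SUM l<dm Xi. (cmod (e Xi i l x))^2) = 1" by blast
 thus ?thesis by (simp add: L2_set_def)
qed

lemma e_bound: "Xi : dual ==> i < dm Xi ==> j < dm Xi ==> cmod (e Xi i j x) <= 1"
 using member_le_L2_set[of "{..<dm Xi}" j "%l. cmod (e Xi i l x)"] by (simp add: e_row)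

lemma linear_comb_frame: assumes "gsmooth f"
 shows "lder Y f x = (SUM a:UNIV. ip Y (frame a) *\<^sub>R lder (frame a) f x)" proof -
 have "lder Y f x = lder (SUM a:UNIV. ip Y (frame a) *\<^sub>R frame a) f x" by (simp add: ipbasis_expand[OF frame])
 thus ?thesis by (simp add: linear_sum[OF linear_lder[OF assms]] linear_cmul[OF linear_lder[OF assms]])
qed

lemma lder_frame_bound: assumes "gsmooth f" "!!a. norm (lder (frame a) f x) <= B"
 shows "norm (lder Y f x) <= ysize Y * B" proof -
 have "norm (lder Y f x) <= (SUM a:UNIV. norm (ip Y (frame a) *\<^sub>R lder (frame a) f x))"
  unfolding linear_comb_frame[OF assms(1), of Y] by (rule norm_sum)
 also have "... <= (SUM a:UNIV. abs (ip Y (frame a)) * B)" by (intro sum_mono) (simp add: mult_left_mono assms(2))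
 finally show ?thesis by (simp add: ysize_def sum_distrib_right)
qed

text \<open>Cauchy-Schwarz between a row of a unitary matrix, of length 1, and a column of the
  differential, so that no factor of the dimension is lost.\<close>

lemma lder_e_bound: assumes "Xi : dual" "i < dm Xi" "j < dm Xi"
 shows "cmod (lder Y (e Xi i j) x) <= ysize Y * br Xi"
proof (rule lder_frame_bound[OF gsmooth_e[OF assms]])
 fix a
 have "cmod (lder (frame a) (e Xi i j) x) <= (SUM l<dm Xi. abs (cmod (e Xi i l x)) * abs (cmod (dent Xi (frame a) l
  j)))"
  unfolding lder_e[OF assms] by (rule order_trans[OF norm_sum]) (simp add: norm_mult)
 also have "... <= L2_set (%l. cmod (e Xi i l x)) {..<dm Xi} * L2_set (%l. cmod (dent Xi (frame a) l j)) {..<dm Xi}"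
  by (rule L2_set_mult_ineq)
 also have "... <= br Xi" by (simp add: e_row assms dent_col_bound)
 finally show "cmod (lder (frame a) (e Xi i j) x) <= br Xi" .
qed

lemma mus_bound: assumes "Xi : dual" "j < dm Xi" shows "abs (mus Xi j) <= ysize X * br Xi"
 using lder_e_bound[OF assms assms(2), of X \<one>]
 by (simp add: lder_X[OF assms assms(2)] urepD(3)[OF rep_urep[OF assms(1)] assms(2,2)] norm_mult)

end

section \<open>A polynomial bound for the dimensions\<close>

text \<open>A grid of side \<open>s / CARD('n)\<close>: points of one cell are within
  \<open>s\<close> of each other in the l1 norm. One point of the ball is taken from each occupied
  cell, since the corners of a cell may lie outside the ball.\<close>

lemma ball_net: fixes b :: "real^'n::finite" and rh s :: real
 assumes rh: "rh > 0" and s: "0 < s" "s <= rh"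
 obtains N where "finite N" "N \<subseteq> cball b rh" "real (card N) <= (5 * CARD('n) * rh / s) ^ CARD('n)"
  "!!z. z : cball b rh ==> EX y:N. norm (z - y) <= s" proof -
 let ?n = "CARD('n)"
 have n: "real ?n >= 1" by simp
 define t where "t = s / real ?n"
 have t: "t > 0" using s by (simp add: t_def)
 define q where "q = (%z::real^'n. %i. \<lfloor>(z $ i - b $ i) / t\<rfloor>)"
 define m where "m = \<lfloor>rh / t\<rfloor> + 1"
 have m0: "m >= 1" using rh t by (simp add: m_def)
 have qr: "q z : PiE UNIV (%_. {-m..m})" if "z : cball b rh" for z proof -
  have "abs ((z $ i - b $ i) / t) <= rh / t" for i using that component_le_norm_cart[of "z - b" i] t
   by (simp add: dist_norm norm_minus_commute abs_divide divide_right_mono)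
  moreover have "- (\<lfloor>w\<rfloor> + 1) <= \<lfloor>u\<rfloor> & \<lfloor>u\<rfloor> <= \<lfloor>w\<rfloor> + 1"
   if "abs u <= w" for u w :: real
   using that by linarith
  ultimately show ?thesis by (auto simp: q_def m_def)
 qed
 let ?I = "q ` cball b rh"
 have fin: "finite (PiE (UNIV :: 'n set) (%_. {-m..m}))" by (rule finite_PiE) auto
 have sub: "?I \<subseteq> PiE UNIV (%_. {-m..m})" using qr by blast
 define N where "N = inv_into (cball b rh) q ` ?I"
 show thesis proof (rule that[of N])
  show "finite N" unfolding N_def using finite_subset[OF sub fin] by simp
  show "N \<subseteq> cball b rh" unfolding N_def using inv_into_into[of _ q "cball b rh"] by blast
  have "card N <= card ?I" unfolding N_def by (rule card_image_le[OF finite_subset[OF sub fin]])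
  also have "... <= nat (2 * m + 1) ^ ?n" using card_mono[OF fin sub] by (simp add: card_PiE)
  finally have "real (card N) <= real (nat (2 * m + 1) ^ ?n)" by simp
  also have "... = (2 * real_of_int m + 1) ^ ?n" using m0 by simp
  also have "... <= (5 * ?n * rh / s) ^ ?n" proof (rule power_mono)
   have "1 <= rh / s" using s by simp
   hence "1 <= rh / s * real ?n" using n by (metis mult_mono' mult_1 zero_le_one)
   hence r: "1 <= rh / t" by (simp add: t_def)
   \<comment> \<open>As \<open>rh / t\<close> is at least 1, \<open>2 * m + 1\<close> is at most
     \<open>2 * (rh / t) + 3\<close> and so at most \<open>5 * (rh / t)\<close>.\<close>
   have "real_of_int m <= rh / t + 1" by (simp add: m_def)
   hence "2 * real_of_int m + 1 <= 5 * (rh / t)" using r by linarith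
   thus "2 * real_of_int m + 1 <= 5 * ?n * rh / s" by (simp add: t_def mult.commute mult.left_commute)
  qed (use m0 in simp)
  finally show "real (card N) <= (5 * CARD('n) * rh / s) ^ CARD('n)" .
  fix z assume z: "z : cball b rh"
  let ?y = "inv_into (cball b rh) q (q z)"
  have qy: "q ?y = q z" by (rule f_inv_into_f) (use z in blast)
  have "abs ((z - ?y) $ i) <= t" for i proof -
   have "\<lfloor>(z $ i - b $ i) / t\<rfloor> = \<lfloor>(?y $ i - b $ i) / t\<rfloor>" using fun_cong[OF qy, of i]
    by (simp add: q_def)
   hence "abs ((z $ i - b $ i) / t - (?y $ i - b $ i) / t) < 1" by linarith
   thus ?thesis using t by (simp add: diff_divide_distrib[symmetric] abs_divide)
  qed
  hence "(SUM i:UNIV. abs ((z - ?y) $ i)) <= (SUM i:(UNIV :: 'n set). t)" by (intro sum_mono)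
  hence "norm (z - ?y) <= s" using norm_le_l1_cart[of "z - ?y"] by (simp add: t_def)
  thus "EX y:N. norm (z - y) <= s" using z by (intro bexI[of _ ?y]) (auto simp: N_def)
 qed
qed

section \<open>Coverings by small balls and lower bounds for the mean\<close>

context compact_lie
begin

definition cball_image :: "real => 'g set" where "cball_image r = chart_inv c0 ` cball b0 r"

text \<open>Finitely many translates of one coordinate ball cover the group, and each is refined by
  a net. The map \<open>inv y \<otimes> z\<close> is Lipschitz in coordinates, so a point near the
  net point \<open>y\<close> lies in the small ball translated by \<open>y\<close>; only a constant
  is lost.\<close>

lemma covering:
 obtains C r0 where "C > 0" "r0 > 0" "cball b0 r0 \<subseteq> cdom c0"
  "!!r. 0 < r ==> r <= r0 ==> EX S. finite S & real (card S) <= C * (1 / r) ^ CARD('n) & (ALL x. EX a:S. inv a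
   \<otimes> x : cball_image r)"
proof -
 let ?Q = "%p. snd c0 (inv (chart_inv c0 (fst p)) \<otimes> chart_inv c0 (snd p))"
 define W where "W = {p : cdom c0 \<times> cdom c0. inv (chart_inv c0 (fst p)) \<otimes> chart_inv c0 (snd p) : fst
  c0}"
 note Wp = toid_set[OF c0(1), folded W_def]
 obtain d where d: "d > 0" "cball (b0, b0) d \<subseteq> W"
  using open_contains_cball[THEN iffD1, OF Wp(1)] Wp(3)[OF b0(1)] by blast
 define rh where "rh = d / 2"
 have rh: "rh > 0" using d by (simp add: rh_def)
 have sub: "cball b0 rh \<times> cball b0 rh \<subseteq> W" proof
  fix p assume p: "p : cball b0 rh \<times> cball b0 rh"
  show "p : W" using sqrt_sum_squares_le_sum[of "dist b0 (fst p)" "dist b0 (snd p)"] p d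
   by (auto simp: dist_Pair_Pair rh_def)
 qed
 obtain L where L: "L >= 0" "!!p q. p : cball b0 rh \<times> cball b0 rh ==> q : cball b0 rh \<times> cball b0 rh ==>
  norm (?Q p - ?Q q) <= L * norm (p - q)"
  by (rule smooth_on_lipschitz[OF Wp(2) sub]) (auto intro!: compact_Times convex_Times)
 have cb: "cball b0 rh \<subseteq> cdom c0" using sub by (auto simp: W_def)
 define U where "U = chart_inv c0 ` ball b0 rh"
 have Ue: "U = {x : fst c0. snd c0 x : ball b0 rh}" proof (rule subset_antisym[OF subsetI subsetI])
  fix x assume "x : U"
  thus "x : {x : fst c0. snd c0 x : ball b0 rh}"
   unfolding U_def using cb chartD(7,8)[OF c0(1)] by (auto simp: subset_iff)
 next
  fix x assume "x : {x : fst c0. snd c0 x : ball b0 rh}"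
  thus "x : U" unfolding U_def using chartD(5)[OF c0(1)] by (metis (mono_tags, lifting) imageI mem_Collect_eq)
 qed
 have oU: "open U" unfolding Ue by (rule open_pre[OF chartD(3,1)[OF c0(1)] open_ball])
 have U1: "\<one> : U" unfolding Ue using c0 rh by (simp add: b0_def)
 obtain S0 where S0: "finite S0" "S0 ~= {}" "!!p y. EX a:S0. inv p \<otimes> (a \<otimes> y) : U"
  by (rule translates_cover[OF oU U1]) auto
 define K where "K = real (card S0) * (5 * CARD('n) * rh * (L + 1)) ^ CARD('n)"
 show thesis proof (rule that[of K rh])
  show "K > 0" using S0 rh L(1) by (auto simp: K_def intro!: mult_pos_pos)
  show "rh > 0" "cball b0 rh \<subseteq> cdom c0" by fact+
  fix r assume r: "0 < r" "r <= rh"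
  let ?s = "r / (L + 1)"
  have "?s <= r" using r L(1) by (simp add: field_simps)
  hence s: "0 < ?s" "?s <= rh" using r L(1) by auto
  obtain N where N: "finite N" "N \<subseteq> cball b0 rh" "real (card N) <= (5 * CARD('n) * rh / ?s) ^ CARD('n)"
   "!!z. z : cball b0 rh ==> EX y:N. norm (z - y) <= ?s"
   by (rule ball_net[OF rh s, of b0]) (rule that)
  define S where "S = (%(a, y). inv a \<otimes> chart_inv c0 y) ` (S0 \<times> N)"
  show "EX S. finite S & real (card S) <= K * (1 / r) ^ CARD('n) & (ALL x. EX a:S. inv a \<otimes> x : cball_image r)"
  proof (intro exI[of _ S] conjI allI)
   show "finite S" unfolding S_def using S0(1) N(1) by simp
   have "card S <= card S0 * card N" unfolding S_def using card_image_le[of "S0 \<times> N"] S0(1) N(1) by simp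
   hence "real (card S) <= real (card S0) * real (card N)" by (metis of_nat_le_iff of_nat_mult)
   also have "... <= real (card S0) * (5 * CARD('n) * rh / ?s) ^ CARD('n)" by (intro mult_left_mono N) simp
   also have "5 * CARD('n) * rh / ?s = (5 * CARD('n) * rh * (L + 1)) * (1 / r)" by simp
   finally show "real (card S) <= K * (1 / r) ^ CARD('n)" by (simp only: K_def power_mult_distrib)
   fix x
   obtain a where a: "a : S0" "a \<otimes> x : U" using S0(3)[of \<one> x] by auto
   then obtain z where z: "z : ball b0 rh" "a \<otimes> x = chart_inv c0 z" unfolding U_def by blast
   hence zc: "z : cball b0 rh" by simp
   obtain y where y: "y : N" "norm (z - y) <= ?s" using N(4)[OF zc] by auto
   hence yc: "y : cball b0 rh" using N(2) by auto
   have "(y, z) : W" using yc zc sub by blast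
   hence w: "inv (chart_inv c0 y) \<otimes> chart_inv c0 z : fst c0" by (simp add: W_def)
   have "norm (?Q (y, z) - ?Q (y, y)) <= L * norm ((y, z) - (y, y))" by (rule L(2)) (use yc zc in auto)
   also have "... <= (L + 1) * ?s" using y(2) L(1) by (intro mult_mono) auto
   also have "... = r" using L(1) by simp
   finally have "chart_inv c0 (?Q (y, z)) : cball_image r"
    by (simp add: dist_norm norm_minus_commute b0_def cball_image_def)
   moreover have "inv (inv a \<otimes> chart_inv c0 y) \<otimes> x = inv (chart_inv c0 y) \<otimes> (a \<otimes> x)"
    by (simp add: inv_mult_group m_assoc)
   ultimately have "inv (inv a \<otimes> chart_inv c0 y) \<otimes> x : cball_image r" using w chartD(5)[OF c0(1)]
    by (simp add: z(2))
   thus "EX a:S. inv a \<otimes> x : cball_image r" unfolding S_def using a(1) y(1) by force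
  qed
 qed
qed

text \<open>The translates of the ball by \<open>S\<close> cover the group, so the sum of the
  translates of \<open>f\<close> is at least \<open>B\<close> everywhere, and all of them have the
  same mean.\<close>

lemma haar_cball_lower:
 assumes f: "ctn f" "!!x. 0 <= f x" and B: "!!x. x : cball_image r ==> B <= f x"
  and S: "finite S" "!!x. EX a:S. inv a \<otimes> x : cball_image r"
 shows "B <= real (card S) * haar f" proof -
 have c: "ctn (%x. f (inv a \<otimes> x))" for a
  by (rule continuous_on_compose2[OF f(1)]) (auto intro!: ctn_group_mult)
 have "B <= (SUM a:S. f (inv a \<otimes> x))" for x proof -
  obtain a where a: "a : S" "inv a \<otimes> x : cball_image r" using S(2) by auto
  have "B <= f (inv a \<otimes> x)" by (rule B[OF a(2)])
  also have "... <= (SUM a:S. f (inv a \<otimes> x))" by (rule member_le_sum[OF a(1) f(2) S(1)])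
  finally show ?thesis .
 qed
 hence "haar (%_. B) <= haar (%x. SUM a:S. f (inv a \<otimes> x))"
  by (intro haar_mono continuous_on_const continuous_on_sum c)
 also have "... = (SUM a:S. haar (%x. f (inv a \<otimes> x)))" by (rule haar_sum) (use S c in auto)
 also have "... = real (card S) * haar f" by (simp add: haar_left[OF f(1)])
 finally show ?thesis by simp
qed

end

context lie_dual
begin

lemma ysize_bound: "EX K>0. ALL Y. ysize Y <= K * norm Y" proof -
 have "EX B. ALL Y. abs (ip Y (frame a)) <= B * norm Y" for a
  using linear_bounded[OF ip_linear(1)[of "frame a"]] by simp
 from choice[OF allI[OF this]] obtain B where B: "ALL a Y. abs (ip Y (frame a)) <= B a * norm Y" by (rule exE)
 show ?thesis proof (intro exI[of _ "abs (SUM a:UNIV. B a) + 1"] conjI allI)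
  fix Y
  have "ysize Y <= (SUM a:UNIV. B a * norm Y)" unfolding ysize_def by (intro sum_mono) (use B in blast)
  also have "... = (SUM a:UNIV. B a) * norm Y" by (simp add: sum_distrib_right)
  also have "... <= (abs (SUM a:UNIV. B a) + 1) * norm Y" by (intro mult_right_mono) auto
  finally show "ysize Y <= (abs (SUM a:UNIV. B a) + 1) * norm Y" .
 qed simp
qed

lemma toid_bound: assumes c: "c : charts" and K: "compact K" "K \<subseteq> cdom c"
 shows "EX B>0. ALL b:K. ALL v. ysize (toid c b v) <= B * norm v" proof -
 obtain A where A: "A > 0" "!!Y. ysize Y <= A * norm Y" using ysize_bound by blast
 have "EX B. ALL b:K. norm (toid c b (axis i 1)) <= B" for i proof -
  have "compact ((%b. toid c b (axis i 1)) ` K)"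
   by (rule compact_continuous_image[OF continuous_on_subset[OF smooth_ctn[OF smooth_toid[OF c]] K(2)] K(1)])
  from compact_imp_bounded[OF this] show ?thesis by (simp add: bounded_iff)
 qed
 from choice[OF allI[OF this]] obtain B where B: "ALL i. ALL b:K. norm (toid c b (axis i 1)) <= B i" by (rule exE)
 show ?thesis
 proof (intro exI[of _ "A * (\<bar>SUM i:UNIV. \<bar>B i\<bar>\<bar> + 1)"] conjI ballI allI)
  fix b v assume b: "b : K"
  have "norm (toid c b v) = norm (SUM i:UNIV. v $ i *\<^sub>R toid c b (axis i 1))"
   using linear_axis_expand[OF linear_toid[OF c], of b v] b K(2) by auto
  also have "... <= (SUM i:UNIV. norm v * abs (B i))" proof (rule sum_norm_le)
   fix i
   show "norm (v $ i *\<^sub>R toid c b (axis i 1)) <= norm v * abs (B i)"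
    using B[rule_format, OF b, of i] component_le_norm_cart[of v i] by (simp add: mult_mono)
  qed
  also have "... = (SUM i:UNIV. abs (B i)) * norm v" by (simp add: sum_distrib_left[symmetric])
  also have "... <= (\<bar>SUM i:UNIV. \<bar>B i\<bar>\<bar> + 1) * norm v" by (intro mult_right_mono) auto
  finally have "A * norm (toid c b v) <= A * ((\<bar>SUM i:UNIV. \<bar>B i\<bar>\<bar> + 1) * norm v)" using A(1)
   by simp
  thus "ysize (toid c b v) <= A * (\<bar>SUM i:UNIV. \<bar>B i\<bar>\<bar> + 1) * norm v"
   using A(2)[of "toid c b v"] by simp
 qed (use A(1) in \<open>simp add: add_nonneg_pos sum_nonneg\<close>)
qed

text \<open>The function \<open>H\<close> is the reproducing kernel at \<open>\<one>\<close> of the span of the coefficients. Its square norm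
 equals \<open>H \<one>\<close>, and its gradient bound keeps it above \<open>H \<one> / 2\<close> on a ball of radius
  about \<open>1 / R\<close>.\<close>

lemma dimension_bound:
 "EX C>0. ALL \<X> R. finite \<X> --> \<X> \<subseteq> dual --> R >= 1 --> (ALL Xi:\<X>. br Xi <= R) -->
  (SUM Xi:\<X>. (real (dm Xi))^2) <= C * R ^ CARD('n)" proof -
 obtain C r0 where C: "C > 0" "r0 > 0" "cball b0 r0 \<subseteq> cdom c0"
  "!!r. 0 < r ==> r <= r0 ==> EX S. finite S & real (card S) <= C * (1 / r) ^ CARD('n) & (ALL x. EX a:S. inv a
   \<otimes> x : cball_image r)"
  by (rule covering) (rule that)
 obtain K where K: "K > 0" "!!b v. b : cball b0 r0 ==> ysize (toid c0 b v) <= K * norm v"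
  using toid_bound[OF c0(1) compact_cball C(3)] by auto
 show ?thesis proof (intro exI[of _ "4 * C * (1 / r0 + 2 * K) ^ CARD('n)"] conjI allI impI)
  show "4 * C * (1 / r0 + 2 * K) ^ CARD('n) > 0" using C K by (intro mult_pos_pos zero_less_power add_pos_pos) auto
  fix \<X> :: "('g => complex Matrix.mat) set set" and R :: real
  assume \<X>: "finite \<X>" "\<X> \<subseteq> dual" and R1: "R >= 1" "ALL Xi:\<X>. br Xi <= R"
  note R = R1(1) R1(2)[rule_format]
  define P where "P = Sigma \<X> (%Xi. {..<dm Xi})"
  define D where "D = (SUM Xi:\<X>. (real (dm Xi))^2)"
  define H where "H x = (SUM p:P. of_nat (dm (fst p)) * e (fst p) (snd p) (snd p) x)" for x
  have P: "finite P" "!!p. p : P ==> fst p : dual" "!!p. p : P ==> snd p < dm (fst p)" "!!p. p : P ==> fst p : \<X>"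
   using \<X> by (auto simp: P_def)
  have ce: "cont (e (fst p) (snd p) (snd p))" and se: "gsmooth (e (fst p) (snd p) (snd p))" if "p : P" for p
   using cont_e gsmooth_e P(2,3)[OF that] by blast+
  have cH: "cont H" unfolding H_def[abs_def] by (rule cont_lin_comb[OF ce])
  have sH: "gsmooth H" unfolding H_def[abs_def] by (intro gsmooth_sum gsmooth_mult gsmooth_const se)
  have PR: "(SUM p:P. real (dm (fst p))) = D" proof -
   have "(SUM p:P. real (dm (fst p))) = (SUM Xi:\<X>. SUM i<dm Xi. real (dm Xi))"
    unfolding P_def by (subst sum.Sigma) (use \<X>(1) in \<open>auto simp: case_prod_beta'\<close>)
   thus ?thesis by (simp add: D_def power2_eq_square)
  qed
  have PD: "(SUM p:P. of_nat (dm (fst p))) = cor D" unfolding PR[symmetric] by simp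
  have he: "hip H (e (fst q) (snd q) (snd q)) = 1" if q: "q : P" for q proof -
   have "hip H (e (fst q) (snd q) (snd q)) = (SUM p:P. of_nat (dm (fst p)) * hip (e (fst p) (snd p) (snd p)) (e (fst
    q) (snd q) (snd q)))"
    unfolding H_def[abs_def] by (rule hip_lin_comb(1)[OF P(1) ce ce[OF q]])
   also have "... = (SUM p:P. if p = q then 1 else 0)" proof (rule sum.cong[OF refl])
    fix p assume p: "p : P"
    show "of_nat (dm (fst p)) * hip (e (fst p) (snd p) (snd p)) (e (fst q) (snd q) (snd q)) = (if p = q then 1 else
     0)"
     unfolding e_orthogonal[OF P(2)[OF p] P(3)[OF p] P(3)[OF p] P(2)[OF q] P(3)[OF q] P(3)[OF q]]
     using dm_pos[OF P(2)[OF p]] by (auto simp: prod_eq_iff)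
   qed
   also have "... = 1" using P(1) q by simp
   finally show ?thesis .
  qed
  have nH: "nrm2 H = D" proof -
   have "cor (nrm2 H) = hip H H" by (rule hip_self[OF cH, symmetric])
   also have "... = (SUM p:P. cnj (of_nat (dm (fst p))) * hip H (e (fst p) (snd p) (snd p)))"
    by (subst (2) H_def[abs_def], rule hip_lin_comb(2)[OF P(1) ce cH])
   also have "... = cor D" by (simp add: he PD)
   finally show ?thesis by simp
  qed
  have DH: "cmod (lder Y H x) <= ysize Y * (D * R)" for Y x proof -
   have "lder Y H x = (SUM p:P. of_nat (dm (fst p)) * lder Y (e (fst p) (snd p) (snd p)) x)"
    unfolding H_def[abs_def] by (subst lder_sum) (auto intro!: gsmooth_mult gsmooth_const se P simp: lder_cmult se)
   also have "cmod ... <= (SUM p:P. real (dm (fst p)) * (ysize Y * R))" proof (rule sum_norm_le)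
    fix p assume p: "p : P"
    have "cmod (lder Y (e (fst p) (snd p) (snd p)) x) <= ysize Y * br (fst p)"
     by (rule lder_e_bound[OF P(2)[OF p] P(3)[OF p] P(3)[OF p]])
    also have "... <= ysize Y * R" by (rule mult_left_mono[OF R(2)[OF P(4)[OF p]]]) (simp add: ysize_def)
    finally show "cmod (of_nat (dm (fst p)) * lder Y (e (fst p) (snd p) (snd p)) x) <= real (dm (fst p)) * (ysize Y *
     R)"
     by (simp add: norm_mult mult_left_mono)
   qed
   also have "... = ysize Y * (D * R)" unfolding sum_distrib_right[symmetric] PR by simp
   finally show ?thesis .
  qed
  have D0: "D >= 0" by (simp add: D_def sum_nonneg)
  show "(SUM Xi:\<X>. (real (dm Xi))^2) <= 4 * C * (1 / r0 + 2 * K) ^ CARD('n) * R ^ CARD('n)"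
  proof (cases "D = 0")
   case True
   thus ?thesis unfolding D_def[symmetric] using C K R by simp
  next
   case False
   hence Dp: "D > 0" using D0 by simp
   \<comment> \<open>Over this distance the gradient bound \<open>K * (D * R)\<close> changes
     \<open>H\<close> by at most \<open>D / 2\<close>, while \<open>H\<close> takes the value
     \<open>D\<close> at the identity.\<close>
   define r where "r = min r0 (1 / (2 * K * R))"
   have r: "0 < r" "r <= r0" "r <= 1 / (2 * K * R)" using C K R by (auto simp: r_def)
   have near: "cmod (H (chart_inv c0 b) - H (chart_inv c0 b0)) <= (K * (D * R)) * norm (b - b0)" if b:
    "b : cball b0 r0" for b
   proof (rule differentiable_bound[of "cball b0 r0" "%b. H (chart_inv c0 b)"
    "%b v. lder (toid c0 b v) H (chart_inv c0 b)"])
    fix b assume b: "b : cball b0 r0"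
    show "((%b. H (chart_inv c0 b)) hfd (%v. lder (toid c0 b v) H (chart_inv c0 b))) (at b within cball b0 r0)"
     by (rule has_derivative_at_withinI[OF chart_hfd[OF sH c0(1)]]) (use b C(3) in blast)
    show "onorm (%v. lder (toid c0 b v) H (chart_inv c0 b)) <= K * (D * R)" proof (rule onorm_bound)
     show "0 <= K * (D * R)" using K(1) D0 R(1) by simp
     fix v
     have "cmod (lder (toid c0 b v) H (chart_inv c0 b)) <= ysize (toid c0 b v) * (D * R)" by (rule DH)
     also have "... <= (K * norm v) * (D * R)" by (intro mult_right_mono K(2)[OF b]) (use D0 R(1) in simp)
     finally show "cmod (lder (toid c0 b v) H (chart_inv c0 b)) <= K * (D * R) * norm v" by (simp add: mult_ac)
    qed
   qed (use b C(2) in auto)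
   have low: "(D / 2)^2 <= (cmod (H x))^2" if "x : cball_image r" for x proof -
    obtain b where b: "x = chart_inv c0 b" "b : cball b0 r" using \<open>x : cball_image r\<close>
     unfolding cball_image_def by blast
    have "cmod (H x - of_real D) <= (K * (D * R)) * norm (b - b0)"
     using near[of b] b r(2) by (simp add: urepD(3)[OF rep_urep[OF P(2)] P(3) P(3)] PD H_def b0)
    also have "... <= (K * (D * R)) * (1 / (2 * K * R))"
     using b(2) r(3) K(1) D0 R(1) by (intro mult_left_mono) (auto simp: dist_norm norm_minus_commute)
    also have "... = D / 2" using K(1) R(1) by simp
    finally have "cmod (H x - of_real D) <= D / 2" .
    moreover have "cmod (of_real D) <= cmod (H x) + cmod (H x - of_real D)"
     by (metis norm_minus_commute norm_triangle_sub)
    ultimately show ?thesis using D0 by simp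
   qed
   obtain S where S: "finite S" "real (card S) <= C * (1 / r) ^ CARD('n)"
    "ALL x. EX a:S. inv a \<otimes> x : cball_image r"
    using C(4)[OF r(1,2)] by auto
   \<comment> \<open>The covering gives \<open>(D / 2)^2 <= real (card S) * D\<close>, because the
     mean of the squared modulus of \<open>H\<close> is \<open>D\<close> itself.\<close>
   have "D <= 4 * real (card S)" using haar_cball_lower[of "%x. (cmod (H x))^2" r "(D / 2)^2" S, OF cont_nrm[OF cH] _
    low S(1)] S(3) nH Dp by (simp add: nrm2_def power2_eq_square)
   also have "... <= 4 * (C * (1 / r) ^ CARD('n))" using S(2) by simp
   also have "... <= 4 * (C * ((1 / r0 + 2 * K) * R) ^ CARD('n))" proof -
    have "1 / r <= (1 / r0 + 2 * K) * R" proof (cases "r0 <= 1 / (2 * K * R)")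
     case True
     hence "1 / r = 1 / r0 * 1" by (simp add: r_def)
     also have "... <= (1 / r0 + 2 * K) * R" by (rule mult_mono) (use C K R in auto)
     finally show ?thesis .
    next
     case False
     hence "1 / r = (2 * K) * R" by (simp add: r_def)
     also have "... <= (1 / r0 + 2 * K) * R" by (rule mult_right_mono) (use C R in auto)
     finally show ?thesis .
    qed
    thus ?thesis using r(1) C(1) by (intro mult_left_mono power_mono) auto
   qed
   finally show ?thesis unfolding D_def[symmetric] by (simp add: power_mult_distrib)
  qed
 qed
qed

lemma dm_bound: "EX C>0. ALL Xi:dual. (real (dm Xi))^2 <= C * br Xi ^ CARD('n)" proof -
 obtain C where C: "C > 0" "ALL \<X> R. finite \<X> --> \<X> \<subseteq> dual --> R >= 1 --> (ALL Xi:\<X>. br Xi <= R)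
  -->
  (SUM Xi:\<X>. (real (dm Xi))^2) <= C * R ^ CARD('n)" using dimension_bound by blast
 have "(real (dm Xi))^2 <= C * br Xi ^ CARD('n)" if "Xi : dual" for Xi
  using C(2)[rule_format, of "{Xi}" "br Xi"] cas_e(1)[OF that] that by simp
 thus ?thesis using C(1) by auto
qed

text \<open>Each class contributes at least 1 to the sum of squared dimensions, which is bounded on
  every finite subset.\<close>

lemma finite_br: "finite {Xi : dual. br Xi <= R}" proof -
 obtain C where C: "C > 0" "ALL \<X> R. finite \<X> --> \<X> \<subseteq> dual --> R >= 1 --> (ALL Xi:\<X>. br Xi <= R)
  -->
  (SUM Xi:\<X>. (real (dm Xi))^2) <= C * R ^ CARD('n)" using dimension_bound by blast
 let ?R = "max R 1"
 show ?thesis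
 proof (rule conjunct1[OF finite_if_finite_subsets_card_bdd[of _ "nat \<lceil>C * ?R ^ CARD('n)\<rceil>"]])
  fix \<X> assume \<X>: "\<X> \<subseteq> {Xi : dual. br Xi <= R}" "finite \<X>"
  have "real (card \<X>) = (SUM Xi:\<X>. 1^2)" by simp
  also have "... <= (SUM Xi:\<X>. (real (dm Xi))^2)"
   using \<X> dm_pos by (intro sum_mono power_mono) (auto simp: Suc_le_eq)
  also have "... <= C * ?R ^ CARD('n)" using \<X> by (intro C(2)[rule_format]) auto
  finally show "card \<X> <= nat \<lceil>C * ?R ^ CARD('n)\<rceil>" by linarith
 qed
qed

end

section \<open>Summable weights and an enumeration of the matrix coefficients\<close>

context lie_dual
begin

text \<open>Classes are grouped by the integer part of their weight. The shell at \<open>k\<close>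
  is estimated by the full ball of radius \<open>k + 1\<close>, and the two extra powers in the
  exponent leave a multiple of \<open>1 / k ^ 2\<close>.\<close>

lemma dual_sum_bound: "EX C. ALL \<X>. finite \<X> --> \<X> \<subseteq> dual -->
  (SUM Xi:\<X>. (real (dm Xi))^2 * (1 / br Xi) ^ (CARD('n) + 2)) <= C" proof -
 let ?n = "CARD('n)"
 obtain C where C: "C > 0" "ALL \<X> R. finite \<X> --> \<X> \<subseteq> dual --> R >= 1 --> (ALL Xi:\<X>. br Xi <= R)
  -->
  (SUM Xi:\<X>. (real (dm Xi))^2) <= C * R ^ ?n" using dimension_bound by blast
 have sm: "summable (%m. C * 2 ^ ?n * inverse (real m ^ 2))"
  by (intro summable_mult inverse_power_summable) simp
 have "(SUM Xi:\<X>. (real (dm Xi))^2 * (1 / br Xi) ^ (?n + 2)) <= (\<Sum>m. C * 2 ^ ?n * inverse (real m ^ 2))"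
  if \<X>: "finite \<X>" "\<X> \<subseteq> dual" for \<X> proof -
  let ?f = "%Xi. (real (dm Xi))^2 * (1 / br Xi) ^ (?n + 2)"
  define m where "m Xi = nat \<lfloor>br Xi\<rfloor>" for Xi
  have m: "1 <= m Xi" "real (m Xi) <= br Xi" "br Xi <= real (m Xi) + 1" if "Xi : \<X>" for Xi
  proof -
   have b: "br Xi >= 1" using cas_e(1) that \<X>(2) by blast
   thus "1 <= m Xi" unfolding m_def by (simp add: le_nat_iff)
   show "real (m Xi) <= br Xi" "br Xi <= real (m Xi) + 1" unfolding m_def using b by linarith+
  qed
  have "(SUM Xi:\<X>. ?f Xi) = (SUM k:m ` \<X>. SUM Xi:{Xi : \<X>. m Xi = k}. ?f Xi)"
   by (rule sum.image_gen[OF \<X>(1)])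
  also have "... <= (SUM k:m ` \<X>. C * 2 ^ ?n * inverse (real k ^ 2))" proof (rule sum_mono)
   fix k assume "k : m ` \<X>"
   hence k: "1 <= k" using m(1) by auto
   let ?Y = "{Xi : \<X>. m Xi = k}"
   have "(SUM Xi:?Y. ?f Xi) <= (SUM Xi:?Y. (real (dm Xi))^2 * (1 / real k) ^ (?n + 2))"
   proof (intro sum_mono mult_left_mono power_mono)
    fix Xi assume "Xi : ?Y"
    thus "1 / br Xi <= 1 / real k" "0 <= 1 / br Xi" using m(2)[of Xi] k by (auto intro!: divide_left_mono)
   qed simp
   also have "... = (SUM Xi:?Y. (real (dm Xi))^2) * (1 / real k) ^ (?n + 2)" by (rule sum_distrib_right[symmetric])
   also have "... <= (C * (real k + 1) ^ ?n) * (1 / real k) ^ (?n + 2)"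
    by (intro mult_right_mono C(2)[rule_format]) (use \<X> m(3) in auto)
   also have "... <= (C * (2 * real k) ^ ?n) * (1 / real k) ^ (?n + 2)"
    using k C(1) by (intro mult_right_mono mult_left_mono power_mono) auto
   also have "... = C * 2 ^ ?n * inverse (real k ^ 2)"
    using k by (simp add: power_add power_divide power2_eq_square field_simps)
   finally show "(SUM Xi:?Y. ?f Xi) <= C * 2 ^ ?n * inverse (real k ^ 2)" .
  qed
  also have "... <= (\<Sum>m. C * 2 ^ ?n * inverse (real m ^ 2))"
   by (rule sum_le_suminf[OF sm]) (use \<X>(1) C(1) in auto)
  finally show ?thesis .
 qed
 thus ?thesis by blast
qed

lemma countable_dual: "countable dual" proof -
 have "dual \<subseteq> (\<Union>k::nat. {Xi : dual. br Xi <= real k})" by (auto intro: real_arch_simple)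
 moreover have "countable (\<Union>k::nat. {Xi : dual. br Xi <= real k})"
  by (rule countable_UN[OF _ countable_finite[OF finite_br]]) simp
 ultimately show ?thesis by (rule countable_subset)
qed

definition idx where "idx = Sigma dual (%Xi. {..<dm Xi} \<times> {..<dm Xi})"

definition ixs :: "nat set" where "ixs = to_nat_on idx ` idx"

definition cls where "cls n = fst (from_nat_into idx n)"
definition row where "row n = fst (snd (from_nat_into idx n))"
definition col where "col n = snd (snd (from_nat_into idx n))"

text \<open>Indices outside \<open>ixs\<close> carry the zero function; their weights are chosen summable as well.\<close>

definition fam :: "nat => 'g => complex" where
 "fam n = (if n : ixs then e (cls n) (row n) (col n) else (%_. 0))"

definition wt :: "nat => real" where "wt n = (if n : ixs then br (cls n) else real n + 1)"

lemma countable_idx: "countable idx"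
 unfolding idx_def by (rule countable_SIGMA[OF countable_dual]) auto

lemma ixsD: assumes "n : ixs"
 shows "cls n : dual" "row n < dm (cls n)" "col n < dm (cls n)" "n = to_nat_on idx (cls n, row n, col n)"
using assms countable_idx by (auto simp: ixs_def cls_def row_def col_def idx_def)

lemma idx_ixs: assumes "Xi : dual" "i < dm Xi" "j < dm Xi"
 obtains n where "n : ixs" "cls n = Xi" "row n = i" "col n = j" using assms countable_idx unfolding ixs_def
  by (force simp: idx_def cls_def row_def col_def)

lemma wt_ge_1: "wt n >= 1" using cas_e(1)[OF ixsD(1)] by (simp add: wt_def)

lemma wt_pos: "wt n > 0" using wt_ge_1[of n] by linarith

lemma summable_wt: "summable (%n. (1 / wt n) ^ (CARD('n) + 2))" proof -
 let ?n = "CARD('n)"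
 obtain C where C: "ALL \<X>. finite \<X> --> \<X> \<subseteq> dual --> (SUM Xi:\<X>. (real (dm Xi))^2 * (1 / br Xi) ^
  (?n + 2)) <= C"
  using dual_sum_bound by blast
 have sm: "summable (%m. inverse (real (Suc m) ^ 2))"
  using inverse_power_summable[of 2, where 'a=real] by (subst summable_Suc_iff) simp
 let ?S = "\<Sum>m. inverse (real (Suc m) ^ 2)"
 show ?thesis proof (rule bounded_imp_summable)
  fix k
  let ?f = "%n. (1 / wt n) ^ (?n + 2)"
  let ?A = "{..k} \<inter> ixs" and ?B = "{..k} - ixs"
  have fA: "finite ?A" by simp
  have "sum ?f {..k} = sum ?f ?A + sum ?f ?B" by (subst sum.Int_Diff[of _ _ ixs]) auto
  moreover have "sum ?f ?B <= ?S" proof -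
   have "sum ?f ?B <= (SUM m:?B. inverse (real (Suc m) ^ 2))" proof (rule sum_mono)
    fix m assume m: "m : ?B"
    have "(1 / (real m + 1)) ^ (?n + 2) <= (1 / (real m + 1)) ^ 2" by (rule power_decreasing) auto
    thus "?f m <= inverse (real (Suc m) ^ 2)" using m by (simp add: wt_def power_divide inverse_eq_divide add.commute)
   qed
   also have "... <= ?S" by (rule sum_le_suminf[OF sm]) auto
   finally show ?thesis .
  qed
  moreover have "sum ?f ?A <= C" proof -
   let ?X = "cls ` ?A"
   have "sum ?f ?A = (SUM Xi:?X. SUM n:{n : ?A. cls n = Xi}. ?f n)" by (rule sum.image_gen[OF fA])
   also have "... <= (SUM Xi:?X. (real (dm Xi))^2 * (1 / br Xi) ^ (?n + 2))"
   proof (rule sum_mono)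
    fix Xi assume "Xi : ?X"
    let ?Y = "{n : ?A. cls n = Xi}"
    have Xd: "Xi : dual" using \<open>Xi : ?X\<close> ixsD(1) by blast
    have "sum ?f ?Y = real (card ?Y) * (1 / br Xi) ^ (?n + 2)" by (simp add: wt_def)
    also have "... <= (real (dm Xi))^2 * (1 / br Xi) ^ (?n + 2)" proof (rule mult_right_mono)
     have "inj_on (%n. (row n, col n)) ?Y"
      by (rule inj_onI) (use ixsD(4) in \<open>metis (mono_tags, lifting) IntD2 mem_Collect_eq\<close>)
     moreover have "(%n. (row n, col n)) ` ?Y \<subseteq> {..<dm Xi} \<times> {..<dm Xi}" using ixsD(2,3) by auto
     ultimately have "card ?Y <= card ({..<dm Xi} \<times> {..<dm Xi})" by (intro card_inj_on_le) auto
     thus "real (card ?Y) <= (real (dm Xi))^2" by (simp add: power2_eq_square flip: of_nat_mult)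
     show "0 <= (1 / br Xi) ^ (?n + 2)" using cas_e(1)[OF Xd] by simp
    qed
    finally show "sum ?f ?Y <= (real (dm Xi))^2 * (1 / br Xi) ^ (?n + 2)" .
   qed
   also have "... <= C" by (rule C[rule_format]) (use ixsD(1) in auto)
   finally show ?thesis .
  qed
  ultimately show "sum ?f {..k} <= C + ?S" by simp
 qed (use wt_pos in \<open>simp add: less_imp_le\<close>)
qed

lemma gsmooth_fam: "gsmooth (fam n)"
 unfolding fam_def using gsmooth_e[OF ixsD(1-3)] by (auto intro: gsmooth_const)

lemma cont_fam: "cont (fam n)" by (rule gsmooth_ctn[OF gsmooth_fam])

end

section \<open>Periodic solutions of linear equations\<close>

lemma periodic_shift: fixes f :: "real => 'a" assumes "!!t. f (t + 2 * pi) = f t"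
 shows "f (t + 2 * pi * of_int k) = f t" proof -
 have n: "f (t + 2 * pi * real m) = f t" for m t proof (induction m)
  case (Suc m)
  thus ?case using assms[of "t + 2 * pi * real m"] by (simp add: algebra_simps)
 qed simp
 show ?thesis proof (cases k)
  case (nonneg m)
  thus ?thesis using n[of t m] by simp
 next
  case (neg m)
  hence z: "of_int k + real (Suc m) = (0 :: real)" by simp
  have "t + 2 * pi * of_int k + 2 * pi * real (Suc m) = t + 2 * pi * (of_int k + real (Suc m))"
   by (simp add: distrib_left)
  hence e: "t + 2 * pi * of_int k + 2 * pi * real (Suc m) = t" unfolding z by simp
  show ?thesis using n[of "t + 2 * pi * of_int k" "Suc m"] unfolding e by (rule sym)
 qed
qed

lemma periodic_reduce: fixes f :: "real => 'a" assumes "!!t. f (t + 2 * pi) = f t"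
 shows "EX s:{0..2 * pi}. f t = f s" proof -
 let ?k = "\<lfloor>t / (2 * pi)\<rfloor>"
 let ?s = "t + 2 * pi * of_int (- ?k)"
 have "of_int ?k * (2 * pi) <= t" by (rule pos_le_divide_eq[THEN iffD1]) simp_all
 moreover have "t <= (of_int ?k + 1) * (2 * pi)" by (rule pos_divide_le_eq[THEN iffD1]) (simp, linarith)
 ultimately have "?s : {0..2 * pi}" by (simp add: algebra_simps)
 moreover have "f t = f ?s" using periodic_shift[of f, OF assms, of t "- ?k"] by simp
 ultimately show ?thesis by blast
qed

lemma periodic_bounded: fixes f :: "real => 'a::real_normed_vector"
 assumes "ctn f" "!!t. f (t + 2 * pi) = f t" shows "EX B. ALL t. norm (f t) <= B"
proof -
 obtain B where "ALL y:f ` {0..2 * pi}. norm y <= B" using compact_imp_bounded bounded_iff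
  by (blast intro: compact_continuous_image[OF continuous_on_subset[OF assms(1)]])
 hence "norm (f t) <= B" for t using periodic_reduce[of f, OF assms(2), of t] by auto
 thus ?thesis by blast
qed

lemma antiderivative_real_line: fixes f :: "real => 'a::banach" assumes f: "ctn f"
 shows "EX F. F 0 = 0 & (ALL t. (F hvd f t) (at t)) & (ALL t>=0. F t = integral {0..t} f)"
proof -
 \<comment> \<open>The left endpoint moves with \<open>t\<close> because an integral over a reversed
   interval is 0; any endpoint far enough to the left gives the same difference.\<close>
 define F where "F t = integral {- (abs t + 1)..t} f - integral {- (abs t + 1)..0} f" for t
 have c: "continuous_on {a..b} f" for a b using f by (rule continuous_on_subset) simp
 have int: "f integrable_on {a..b}" for a b by (rule integrable_continuous_real[OF c])
 have eq: "F t = integral {- N..t} f - integral {- N..0} f" if "abs t + 1 <= N" for t N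
 proof -
  have 1: "integral {- N..- (abs t + 1)} f + integral {- (abs t + 1)..t} f = integral {- N..t} f"
   by (rule Henstock_Kurzweil_Integration.integral_combine[OF _ _ int]) (use that in auto)
  have 2: "integral {- N..- (abs t + 1)} f + integral {- (abs t + 1)..0} f = integral {- N..0} f"
   by (rule Henstock_Kurzweil_Integration.integral_combine[OF _ _ int]) (use that in auto)
  show ?thesis unfolding F_def 1[symmetric] 2[symmetric] by simp
 qed
 have "(F hvd f t) (at t)" for t proof -
  define N where "N = abs t + 2"
  have "((%u. integral {- N..u} f) hvd f t) (at t within {- N..N})"
   by (rule integral_has_vector_derivative[OF c]) (auto simp: N_def)
  hence "((%u. integral {- N..u} f) hvd f t) (at t)"
   by (subst (asm) at_within_interior) (auto simp: N_def)
  hence "((%u. integral {- N..u} f - integral {- N..0} f) hvd f t) (at t)"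
   using has_vector_derivative_diff[OF _ has_vector_derivative_const] by fastforce
  thus ?thesis unfolding has_vector_derivative_def
  proof (rule has_derivative_transform_within_open[of _ _ _ _ "{t - 1<..<t + 1}"])
   fix x assume "x : {t - 1<..<t + 1}"
   hence "abs x + 1 <= N" by (auto simp: N_def)
   thus "integral {- N..x} f - integral {- N..0} f = F x" by (rule eq[symmetric])
  qed auto
 qed
 moreover have "F t = integral {0..t} f" if "t >= 0" for t proof -
  have "integral {- (abs t + 1)..0} f + integral {0..t} f = integral {- (abs t + 1)..t} f"
   by (rule Henstock_Kurzweil_Integration.integral_combine[OF _ _ int]) (use that in auto)
  thus ?thesis by (simp add: F_def algebra_simps)
 qed
 moreover have "F 0 = 0" by (simp add: F_def)
 ultimately show ?thesis by blast
qed

lemma constant_if_hfd_0: fixes f :: "real => 'a::real_normed_vector"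
 assumes "!!t. (f hvd 0) (at t)" shows "f t = f s" proof -
 have "EX c. ALL x:UNIV. f x = c"
  by (rule has_derivative_zero_constant[OF convex_UNIV]) (use assms in \<open>simp add:
   has_vector_derivative_def\<close>)
 thus ?thesis by auto
qed

lemma hvd_shift:
 "(f hvd f') (at (t + c)) ==> ((%t. f (t + c)) hvd f') (at (t :: real))"
 using vector_diff_chain_at[of "%t. t + c" "1 + 0" t f f',
  OF has_vector_derivative_add[OF has_vector_derivative_id has_vector_derivative_const]] by (simp add: o_def)

lemma hvd_reflect:
 "(f hvd f') (at (- t)) ==> ((%t. f (- t)) hvd - f') (at (t :: real))"
 using vector_diff_chain_at[of "%t. - t" "- 1" t f f', OF has_vector_derivative_minus[OF has_vector_derivative_id]]
 by (simp add: o_def)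

lemma antiderivative_periodic: fixes f :: "real => 'a::banach"
 assumes f: "ctn f" "!!t. f (t + 2 * pi) = f t"
 shows "EX F. (ALL t. (F hvd f t) (at t)) & (ALL t. F (t + 2 * pi) = F t + integral {0..2 * pi} f)"
proof -
 obtain F where F: "F 0 = 0" "!!t. (F hvd f t) (at t)" "!!t. t >= 0 ==> F t = integral {0..t} f"
  using antiderivative_real_line[OF f(1)] by auto
 have "((%t. F (t + 2 * pi) - F t) hvd 0) (at t)" for t proof -
  have "((%t. F (t + 2 * pi) - F t) hvd f (t + 2 * pi) - f t) (at t)"
   by (intro has_vector_derivative_diff hvd_shift F(2))
  thus ?thesis by (simp add: f(2))
 qed
 from constant_if_hfd_0[OF this] have "F (t + 2 * pi) - F t = F (0 + 2 * pi) - F 0" for t .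
 thus ?thesis using F(1) F(3)[of "2 * pi"] F(2) by (auto simp: algebra_simps)
qed

text \<open>Variation of constants, with the initial value fixed by periodicity. In the bound only
  exponentials of \<open>K t - K u\<close> with \<open>u <= t\<close> may occur, since
  \<open>Re ka\<close> is bounded from above only; the constant then depends on \<open>S\<close> and
  \<open>D\<close> but not on the size of \<open>ka\<close>.\<close>

lemma periodic_ode: fixes ka K g :: "real => complex"
 assumes K: "!!t. (K hvd ka t) (at t)" "!!t. K (t + 2 * pi) = K t + P"
  and ka: "!!t. ka (t + 2 * pi) = ka t" "!!t. Re (ka t) <= S" "S >= 0"
  and g: "ctn g" "!!t. g (t + 2 * pi) = g t" "!!t. cmod (g t) <= B"
  and D: "D > 0" "cmod (1 - exp P) >= D"
 shows "EX y. (ALL t. (y hvd (ka t * y t + g t)) (at t)) & (ALL t. y (t + 2 * pi) = y t) &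
  (ALL t. cmod (y t) <= 2 * pi * exp (2 * pi * S) * (exp (2 * pi * S) / D + 1) * B)" proof -
 have cK: "ctn K"
  by (rule continuous_at_imp_continuous_on) (use K(1) has_vector_derivative_continuous in blast)
 obtain I where I: "I 0 = 0" "!!t. (I hvd exp (- K t) * g t) (at t)"
  using antiderivative_real_line[of "%t. exp (- K t) * g t"] cK g(1) by (force intro!: continuous_intros)
 have B: "B >= 0" using norm_ge_zero g(3) by (rule order_trans)
 have eK: "((%t. exp (K t)) hvd exp (K t) * ka t) (at t)" for t
  using field_vector_diff_chain_at[OF K(1)[of t] DERIV_exp] by (simp add: o_def mult.commute)
 define P' where "P' = I (2 * pi)"
 have I2: "I (t + 2 * pi) = exp (- P) * I t + P'" for t proof -
  have "((%t. I (t + 2 * pi) - exp (- P) * I t) hvd 0) (at t)" for t proof -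
   have "((%t. I (t + 2 * pi) - exp (- P) * I t) hvd
    exp (- K (t + 2 * pi)) * g (t + 2 * pi) - exp (- P) * (exp (- K t) * g t)) (at t)"
    by (intro has_vector_derivative_diff hvd_shift I(2) has_vector_derivative_mult_right)
   thus ?thesis by (simp add: K(2) g(2) exp_add[symmetric] mult.assoc[symmetric] add.commute)
  qed
  from constant_if_hfd_0[OF this, of t 0] show ?thesis by (simp add: I(1) P'_def algebra_simps)
 qed
 have ne: "1 - exp P ~= 0" using D by auto
 \<comment> \<open>The fixed point of the passage through one period, which sends \<open>y0\<close>
   to \<open>exp P * (y0 + P')\<close>.\<close>
 define y0 where "y0 = exp P * P' / (1 - exp P)"
 have y0: "exp P * (y0 + P') = y0" using ne by (simp add: y0_def field_simps)
 define y where "y t = exp (K t) * (y0 + I t)" for t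
 have "(y hvd (ka t * y t + g t)) (at t)" for t proof -
  have "((%t. exp (K t) * (y0 + I t)) hvd exp (K t) * (0 + exp (- K t) * g t) + exp (K t) * ka t * (y0 + I t)) (at t)"
   by (intro has_vector_derivative_mult eK has_vector_derivative_add has_vector_derivative_const I)
  moreover have "exp (K t) * (0 + exp (- K t) * g t) + exp (K t) * ka t * (y0 + I t) = ka t * y t + g t"
  by (simp add: exp_minus y_def mult.commute[of "exp (K t)" "ka t"] mult.assoc add.commute)
  ultimately show ?thesis by (simp only: y_def[abs_def])
 qed
 moreover have per: "y (t + 2 * pi) = y t" for t proof -
  have "y (t + 2 * pi) = exp (K t) * (exp P * (y0 + P') + exp P * exp (- P) * I t)"
   unfolding y_def K(2) I2 by (simp add: exp_add algebra_simps)
  thus ?thesis by (simp add: y0 y_def exp_add[symmetric])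
 qed
 moreover have "cmod (y t) <= 2 * pi * exp (2 * pi * S) * (exp (2 * pi * S) / D + 1) * B" for t
 proof -
  have mono: "Re (K t - K s) <= S * (t - s)" if "s <= t" for s t proof -
   have "Re (K t) - S * t <= Re (K s) - S * s" proof (rule DERIV_nonpos_imp_nonincreasing[OF that])
    fix x assume "s <= x" "x <= t"
    have "((%x. Re (K x) - S * x) has_real_derivative Re (ka x) - S * 1) (at x)"
     using bounded_linear.has_vector_derivative[OF bounded_linear_Re K(1)]
      by (intro DERIV_diff DERIV_cmult DERIV_ident) (simp add: has_real_derivative_iff_has_vector_derivative)
    thus "EX y. ((%x. Re (K x) - S * x) has_real_derivative y) (at x) & y <= 0" using ka(2)[of x] by auto
   qed
   thus ?thesis by (simp add: algebra_simps)
  qed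
  let ?E = "exp (2 * pi * S)"
  have EI: "cmod (exp (K t) * I t) <= 2 * pi * ?E * B" if t: "0 <= t" "t <= 2 * pi" for t proof -
   have "cmod (exp (K t) * I t - exp (K t) * I 0) <= (?E * B) * norm (t - 0)"
   proof (rule differentiable_bound[of "{0..t}" "%u. exp (K t) * I u"
    "%u h. h *\<^sub>R (exp (K t) * (exp (- K u) * g u))"])
    fix u assume u: "u : {0..t}"
    show "((%u. exp (K t) * I u) hfd (%h. h *\<^sub>R (exp (K t) * (exp (- K u) * g u)))) (at u within {0..t})"
     using has_vector_derivative_mult_right[OF I(2)[of u], of "exp (K t)"]
     unfolding has_vector_derivative_def by (rule has_derivative_at_withinI)
    have "Re (K t - K u) <= 2 * pi * S" proof -
     have "Re (K t - K u) <= S * (t - u)" by (rule mono) (use u in auto)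
     also have "... <= S * (2 * pi)" by (rule mult_left_mono) (use u t ka(3) in auto)
     finally show ?thesis by (simp add: mult.commute)
    qed
    hence "cmod (exp (K t) * (exp (- K u) * g u)) <= ?E * B"
     unfolding mult.assoc[symmetric] exp_add[symmetric] norm_mult by (intro mult_mono g(3)) simp_all
    thus "onorm (%h. h *\<^sub>R (exp (K t) * (exp (- K u) * g u))) <= ?E * B"
     by (intro onorm_bound) (auto simp: B mult.commute mult_left_mono)
   qed (use t in auto)
   also have "... <= (?E * B) * (2 * pi)" using t B by (intro mult_left_mono) auto
   finally show ?thesis by (simp add: I(1) mult_ac)
  qed
  obtain s where s: "s : {0..2 * pi}" "y t = y s" using periodic_reduce[of y, OF per, of t] by blast
  \<comment> \<open>The initial value is rewritten by the integral up to \<open>2 * pi\<close>, so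
    that its estimate uses forward exponentials as well.\<close>
  have KP: "exp (K (2 * pi)) * I (2 * pi) = exp (K 0) * (exp P * P')" using K(2)[of 0] by (simp add: exp_add P'_def)
  have "cmod (exp (K s) * y0) <= ?E * (2 * pi * ?E * B / D)" proof -
   have "exp (K s) * y0 = exp (K s - K 0) * ((exp (K 0) * (exp P * P')) / (1 - exp P))"
    by (simp add: y0_def exp_diff)
   also have "cmod ... <= ?E * (2 * pi * ?E * B / D)"
    unfolding norm_mult[of "exp (K s - K 0)"] norm_divide KP[symmetric]
   proof (intro mult_mono frac_le EI D)
    have "Re (K s - K 0) <= S * (s - 0)" by (rule mono) (use s in auto)
    also have "... <= S * (2 * pi)" by (rule mult_left_mono) (use s ka(3) in auto)
    finally show "cmod (exp (K s - K 0)) <= ?E" by (simp add: mult.commute)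
   qed (use B D in auto)
   finally show ?thesis .
  qed
  moreover have "cmod (exp (K s) * I s) <= 2 * pi * ?E * B" by (rule EI) (use s in auto)
  moreover have "y s = exp (K s) * y0 + exp (K s) * I s" by (simp add: y_def algebra_simps)
  ultimately have "cmod (y s) <= ?E * (2 * pi * ?E * B / D) + 2 * pi * ?E * B" by (metis add_mono norm_triangle_le)
  thus ?thesis unfolding s(2) by (simp add: algebra_simps)
 qed
 ultimately show ?thesis by blast
qed

text \<open>Reversal of time exchanges the upper bound of \<open>Re ka\<close> for a lower one, and
  \<open>P\<close> for \<open>- P\<close>.\<close>

lemma periodic_ode_reverse: fixes ka K g :: "real => complex"
 assumes K: "!!t. (K hvd ka t) (at t)" "!!t. K (t + 2 * pi) = K t + P"
  and ka: "!!t. ka (t + 2 * pi) = ka t" "!!t. - S <= Re (ka t)" "S >= 0"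
  and g: "ctn g" "!!t. g (t + 2 * pi) = g t" "!!t. cmod (g t) <= B"
  and D: "D > 0" "cmod (1 - exp (- P)) >= D"
 shows "EX y. (ALL t. (y hvd (ka t * y t + g t)) (at t)) & (ALL t. y (t + 2 * pi) = y t) &
  (ALL t. cmod (y t) <= 2 * pi * exp (2 * pi * S) * (exp (2 * pi * S) / D + 1) * B)" proof -
 have per: "f (- (t + 2 * pi)) = f (- t)" if "!!t. f (t + 2 * pi) = f t" for f :: "real => complex" and t
  using that[of "- (t + 2 * pi)"] by simp
 have "EX y. (ALL t. (y hvd (- ka (- t) * y t + - g (- t))) (at t)) & (ALL t. y (t + 2 * pi) = y t) &
  (ALL t. cmod (y t) <= 2 * pi * exp (2 * pi * S) * (exp (2 * pi * S) / D + 1) * B)"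
 proof (rule periodic_ode[of "%t. K (- t)" _ "- P"])
  show "((%t. K (- t)) hvd - ka (- t)) (at t)" for t
   by (rule hvd_reflect[OF K(1)])
  show "K (- (t + 2 * pi)) = K (- t) + - P" for t using K(2)[of "- (t + 2 * pi)"] by simp
  show "- ka (- (t + 2 * pi)) = - ka (- t)" "- g (- (t + 2 * pi)) = - g (- t)" for t
   using per[of ka, OF ka(1)] per[of g, OF g(2)] by simp_all
  show "Re (- ka (- t)) <= S" "cmod (- g (- t)) <= B" for t using ka(2)[of "- t"] g(3) by simp_all
  show "ctn (%t. - g (- t))"
   by (intro continuous_intros continuous_on_compose2[OF g(1)]) auto
 qed (use D ka(3) in auto)
 then obtain y where y: "!!t. (y hvd (- ka (- t) * y t + - g (- t))) (at t)" "!!t. y (t + 2 * pi) = y t"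
  "!!t. cmod (y t) <= 2 * pi * exp (2 * pi * S) * (exp (2 * pi * S) / D + 1) * B" by blast
 show ?thesis proof (intro exI[of _ "%t. y (- t)"] conjI allI)
  show "((%t. y (- t)) hvd ka t * y (- t) + g t) (at t)" for t
   using hvd_reflect[OF y(1)[of "- t"]] by (simp add: add.commute)
  show "y (- (t + 2 * pi)) = y (- t)" for t by (rule per[of y, OF y(2)])
 qed (rule y(3))
qed

section \<open>Rapidly decaying and tempered families\<close>

context lie_dual
begin

text \<open>Polynomial growth in the weight, uniformly in \<open>t\<close>: the multipliers of
  rapidly decaying families.\<close>

definition tempered :: "(nat => real => complex) => bool" where
 "tempered y \<longleftrightarrow> (EX C N. ALL n t. cmod (y n t) <= C * wt n ^ N)"

definition rapid :: "(nat => real => complex) => bool" where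
 "rapid y \<longleftrightarrow> (ALL N. EX C. ALL n t. cmod (y n t) * wt n ^ N <= C)"

text \<open>\<open>Q\<close> is imposed on the family and its derivatives up to order
  \<open>k\<close>. The derivative enters as a witness, which joins differentiability and bound in
  one statement.\<close>

primrec dif :: "((nat => real => complex) => bool) => nat => (nat => real => complex) => bool" where
 "dif Q 0 y \<longleftrightarrow> Q y & (ALL n. ctn (y n))"
| "dif Q (Suc k) y \<longleftrightarrow> Q y & (EX y'. (ALL n t. (y n hvd y' n t) (at t)) & dif Q k y')"

abbreviation "tm == dif tempered"
abbreviation "rd == dif rapid"

lemma hvd_ctn:
 "(!!t. (y hvd y' t) (at t)) ==> ctn (y :: real => 'b::real_normed_vector)"
 by (rule continuous_at_imp_continuous_on) (use has_vector_derivative_continuous in blast)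

lemma wt_power_mono: "N <= M ==> wt n ^ N <= wt n ^ M" by (rule power_increasing[OF _ wt_ge_1])

lemma wt_power_pos: "0 < wt n ^ N" by (rule zero_less_power[OF wt_pos])

lemma temperedE: assumes "tempered y"
 obtains C N where "C >= 0" "!!n t. cmod (y n t) <= C * wt n ^ N" proof -
 obtain C N where C: "ALL n t. cmod (y n t) <= C * wt n ^ N" using assms unfolding tempered_def by blast
 have "cmod (y n t) <= abs C * wt n ^ N" for n t
  by (rule order_trans[OF C[rule_format]], rule mult_right_mono) (use wt_power_pos[of n N] in auto)
 thus thesis by (intro that[of "abs C" N]) auto
qed

lemma tempered_add: assumes "tempered y" "tempered z" shows "tempered (%n t. y n t + z n t)" proof -
 obtain C N where C: "C >= 0" "!!n t. cmod (y n t) <= C * wt n ^ N" by (rule temperedE[OF assms(1)]) (rule that)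
 obtain D M where D: "D >= 0" "!!n t. cmod (z n t) <= D * wt n ^ M" by (rule temperedE[OF assms(2)]) (rule that)
 have "cmod (y n t + z n t) <= (C + D) * wt n ^ (N + M)" for n t unfolding distrib_right
  by (rule order_trans[OF norm_triangle_le[OF add_mono[OF C(2) D(2)]]])
   (intro add_mono mult_left_mono wt_power_mono C D; simp)
 thus ?thesis unfolding tempered_def by blast
qed

lemma tempered_mult: assumes "tempered y" "tempered z" shows "tempered (%n t. y n t * z n t)" proof -
 obtain C N where C: "C >= 0" "!!n t. cmod (y n t) <= C * wt n ^ N" by (rule temperedE[OF assms(1)]) (rule that)
 obtain D M where D: "D >= 0" "!!n t. cmod (z n t) <= D * wt n ^ M" by (rule temperedE[OF assms(2)]) (rule that)
 have "cmod (y n t * z n t) <= (C * D) * wt n ^ (N + M)" for n t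
  using mult_mono[OF C(2)[of n t] D(2)[of n t]] C(1) less_imp_le[OF wt_power_pos[of n N]]
  by (simp add: norm_mult power_add mult_ac)
 thus ?thesis unfolding tempered_def by blast
qed

lemma tempered_bounded: "ALL t. cmod (y t) <= B ==> tempered (%n. y)"
 unfolding tempered_def by (rule exI[of _ B], rule exI[of _ 0]) simp

lemma tempered_const: "tempered (%n t. c)" by (rule tempered_bounded[of _ "cmod c"]) simp

lemma rapidE: assumes "rapid y"
 obtains C where "C >= 0" "!!n t. cmod (y n t) * wt n ^ N <= C" proof -
 obtain C where C: "ALL n t. cmod (y n t) * wt n ^ N <= C" using assms unfolding rapid_def by blast
 have "0 <= cmod (y 0 0) * wt 0 ^ N" by (intro mult_nonneg_nonneg less_imp_le[OF wt_power_pos]) auto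
 hence "0 <= C" using C by (rule_tac order_trans) blast+
 thus thesis using C by (intro that) auto
qed

lemma rapid_add: assumes "rapid y" "rapid z" shows "rapid (%n t. y n t + z n t)" unfolding rapid_def proof
 fix N
 obtain C where C: "!!n t. cmod (y n t) * wt n ^ N <= C" by (rule rapidE[OF assms(1)]) (rule that)
 obtain D where D: "!!n t. cmod (z n t) * wt n ^ N <= D" by (rule rapidE[OF assms(2)]) (rule that)
 have "cmod (y n t + z n t) * wt n ^ N <= C + D" for n t
  using mult_right_mono[OF norm_triangle_ineq[of "y n t" "z n t"] less_imp_le[OF wt_power_pos[of n N]]] C[of n t] D[of
   n t]
  by (simp add: distrib_right)
 thus "EX C. ALL n t. cmod (y n t + z n t) * wt n ^ N <= C" by blast
qed

lemma rapid_mult: assumes "tempered a" "rapid y" shows "rapid (%n t. a n t * y n t)" unfolding rapid_def proof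
 fix N
 obtain C M where C: "C >= 0" "!!n t. cmod (a n t) <= C * wt n ^ M" by (rule temperedE[OF assms(1)]) (rule that)
 obtain D where D: "!!n t. cmod (y n t) * wt n ^ (M + N) <= D" by (rule rapidE[OF assms(2), of "M + N"]) (rule that)
 have "cmod (a n t * y n t) * wt n ^ N <= C * D" for n t
  using mult_right_mono[OF C(2)[of n t], of "cmod (y n t) * wt n ^ N"] mult_left_mono[OF D[of n t] C(1)]
   wt_power_pos[of n N]
  by (simp add: norm_mult power_add mult_ac)
 thus "EX C. ALL n t. cmod (a n t * y n t) * wt n ^ N <= C" by blast
qed

lemma dif_Suc: "dif Q (Suc k) y ==> dif Q k y" proof (induction k arbitrary: y)
 case 0
 thus ?case by (auto intro: hvd_ctn)
next
 case (Suc k)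
 then obtain y' where y': "Q y" "ALL n t. (y n hvd y' n t) (at t)" "dif Q (Suc k) y'" by (auto simp del: dif.simps(1))
 show ?case by (metis y' dif.simps Suc.IH[OF y'(3)])
qed

lemma dif_add: assumes "!!y z. Q y ==> Q z ==> Q (%n t. y n t + z n t)"
 shows "dif Q k y ==> dif Q k z ==> dif Q k (%n t. y n t + z n t)" proof (induction k arbitrary: y z)
 case 0
 thus ?case by (auto intro!: assms continuous_intros)
next
 case (Suc k)
 obtain y' z' where y': "Q y" "ALL n t. (y n hvd y' n t) (at t)" "dif Q k y'"
  and z': "Q z" "ALL n t. (z n hvd z' n t) (at t)" "dif Q k z'" using Suc.prems unfolding dif.simps by blast
 show ?case unfolding dif.simps
  by (intro conjI exI[of _ "%n t. y' n t + z' n t"] assms y'(1) z'(1) Suc.IH[OF y'(3) z'(3)] allI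
   has_vector_derivative_add y'(2)[rule_format] z'(2)[rule_format])
qed

lemma dif_mult:
 assumes "!!y z. Q y ==> Q z ==> Q (%n t. y n t + z n t)" "!!y z. tempered y ==> Q z ==> Q (%n t. y n t * z n t)"
 shows "tm k y ==> dif Q k z ==> dif Q k (%n t. y n t * z n t)" proof (induction k arbitrary: y z)
 case 0
 thus ?case by (auto intro!: assms(2) continuous_intros)
next
 case (Suc k)
 obtain y' z' where y': "tempered y" "ALL n t. (y n hvd y' n t) (at t)" "tm k y'"
  and z': "Q z" "ALL n t. (z n hvd z' n t) (at t)" "dif Q k z'" using Suc.prems unfolding dif.simps by blast
 show ?case unfolding dif.simps
  by (intro conjI exI[of _ "%n t. y n t * z' n t + y' n t * z n t"] assms(2) y'(1) z'(1) dif_add assms(1) allI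
   has_vector_derivative_mult y'(2)[rule_format] z'(2)[rule_format]
   Suc.IH[OF dif_Suc[OF Suc.prems(1)] z'(3)] Suc.IH[OF y'(3) dif_Suc[OF Suc.prems(2)]])
qed

lemma tm_const: "tempered (%n t. c n) ==> tm k (%n t. c n)" proof (induction k arbitrary: c)
 case (Suc k)
 show ?case using Suc.prems by (auto simp: dif.simps intro!: Suc.IH[OF tempered_const] conjI exI[of _ "%n t. 0"] allI
  has_vector_derivative_const)
qed simp

definition RD where "RD y \<longleftrightarrow> (ALL k. rd k y)"
definition TM where "TM y \<longleftrightarrow> (ALL k. tm k y)"

lemma RD_deriv: assumes "RD y"
 obtains y' where "!!n t. (y n hvd y' n t) (at t)" "RD y'" proof -
 obtain y' where y': "ALL n t. (y n hvd y' n t) (at t)"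
  using assms unfolding RD_def by (metis dif.simps(2))
 have "rd k y'" for k by (metis assms vector_derivative_unique_at y' RD_def dif.simps(2) ext)
 thus thesis using y' by (intro that[of y']) (auto simp: RD_def)
qed

lemma RD_deriv_unique: assumes y: "RD y" and d: "!!n t. (y n hvd y' n t) (at t)" shows "RD y'"
proof -
 obtain z where z: "!!n t. (y n hvd z n t) (at t)" "RD z" by (rule RD_deriv[OF y]) (rule that)
 show ?thesis by (metis z(2) ext vector_derivative_unique_at[OF z(1) d])
qed

lemma RD_rapid: "RD y ==> rapid y" unfolding RD_def by (metis dif.simps(1))
lemma RD_add: "RD y ==> RD z ==> RD (%n t. y n t + z n t)" by (simp add: RD_def dif_add rapid_add)
lemma RD_mult: "TM a ==> RD y ==> RD (%n t. a n t * y n t)" by (simp add: RD_def TM_def dif_mult rapid_add rapid_mult)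
lemma TM_add: "TM y ==> TM z ==> TM (%n t. y n t + z n t)" by (simp add: TM_def dif_add tempered_add)
lemma TM_mult: "TM y ==> TM z ==> TM (%n t. y n t * z n t)" by (simp add: TM_def dif_mult tempered_add tempered_mult)
lemma TM_const: "tempered (%n t. c n) ==> TM (%n t. c n)" unfolding TM_def using tm_const by blast
lemma TM_constant: "TM (%n t. c)" by (rule TM_const[OF tempered_const])

text \<open>The equation expresses the derivative by the data and by the solution with a tempered
  factor, so decay of the solution alone passes to all its derivatives.\<close>

lemma RD_ode: assumes a: "TM a" and g: "RD g" and y: "rapid y"
 and ode: "!!n t. (y n hvd (a n t * y n t + g n t)) (at t)" shows "RD y"
 unfolding RD_def
proof
 fix k show "rd k y" proof (induction k)
  case 0
  show ?case using y hvd_ctn[OF ode] by simp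
 next
  case (Suc k)
  show ?case unfolding dif.simps
   by (intro conjI y exI[of _ "%n t. a n t * y n t + g n t"] allI ode dif_add dif_mult rapid_add rapid_mult
    a[unfolded TM_def, rule_format] Suc g[unfolded RD_def, rule_format])
 qed
qed

text \<open>The derivatives of a smooth periodic function are again periodic, and therefore
  bounded.\<close>

lemma TM_periodic: assumes "smooth_periodic q" shows "TM (%n t. cor (q t))" proof -
 have "tm k (%n t. cor (q t))" for k using assms proof (induction k arbitrary: q)
  case (0 q)
  have c: "ctn q" and p: "!!t. q (t + 2 * pi) = q t"
   using 0 smooth_ctn by (auto simp: smooth_periodic_def)
  obtain B where "ALL t. norm (q t) <= B" using periodic_bounded[OF c p] by blast
  thus ?case using c by (simp add: tempered_bounded[of _ B] continuous_intros)
 next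
  case (Suc k q)
  have s: "smooth_on UNIV q" and p: "!!t. q (t + 2 * pi) = q t" using Suc.prems by (auto simp: smooth_periodic_def)
  let ?q' = "%t. FD q (at t) 1"
  have d: "(q hvd ?q' t) (at t)" for t proof -
   note D = smooth_hfd[OF s UNIV_I, of t]
   have lin: "FD q (at t) h = h *\<^sub>R ?q' t" for h
    using linear_cmul[OF has_derivative_linear[OF D], of h 1] by simp
   show ?thesis unfolding has_vector_derivative_def by (rule has_derivative_eq_rhs[OF D ext[OF lin]])
  qed
  have "?q' (t + 2 * pi) = ?q' t" for t using hvd_shift[where f=q and t=t and c="2 * pi", OF d]
   by (simp add: p vector_derivative_unique_at[OF _ d])
  hence sp: "smooth_periodic ?q'" using smooth_FD[OF s] by (simp add: smooth_periodic_def)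
  have te: "tempered (%n t. cor (q t))" proof -
   obtain B where "ALL t. norm (q t) <= B" using periodic_bounded[of q, OF smooth_ctn[OF s] p] by blast
   thus ?thesis by (intro tempered_bounded[of _ B]) simp
  qed
  show ?case by (auto simp: dif.simps intro!: allI bounded_linear.has_vector_derivative[OF bounded_linear_of_real d]
   conjI te exI[of _ "%n t. cor (?q' t)"] Suc.IH[OF sp])
 qed
 thus ?thesis by (simp add: TM_def)
qed

end

section \<open>Smooth functions on the product of the torus and the group\<close>

context lie_dual
begin

definition tsm :: "(real => 'g => complex) => bool" where
 "tsm f \<longleftrightarrow> (ALL c:charts. smooth_on (UNIV \<times> cdom c) (%p. f (fst p) (chart_inv c (snd p))))"

lemma smooth_torus_group_iff: "smooth_torus_group G f \<longleftrightarrow> (ALL t x. f (t + 2 * pi) x = f t x) & tsm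
 f"
 by (simp add: smooth_torus_group_def tsm_def charts_def cdom_def case_prod_beta')

lemma open_cylinder: "c : charts ==> open ((UNIV :: real set) \<times> cdom c)"
 by (intro open_Times open_UNIV chartD)

lemma tsmD: "tsm f ==> c : charts ==> smooth_on (UNIV \<times> cdom c) (%p. f (fst p) (chart_inv c (snd p)))"
 by (simp add: tsm_def)

lemma tsm_gsmooth: assumes f: "tsm f" shows "gsmooth (f t)" unfolding gsmooth_def proof
 fix c assume c: "c : charts"
 have "smooth_on (cdom c) (%y. (t, y))" by (rule smooth_on_Pair[OF chartD(2)[OF c] smooth_on_const smooth_on_id])
 from smooth_comp[OF chartD(2)[OF c] open_cylinder[OF c] _ this tsmD[OF f c]]
 show "smooth_on (cdom c) (%y. f t (chart_inv c y))" by simp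
qed

lemma tsm_continuous: assumes f: "tsm f" shows "ctn (%p. f (fst p) (snd p))"
proof (rule ctn_local)
 fix p :: "real \<times> 'g"
 obtain c where c: "c : charts" "snd p : fst c" using chart_cover by blast
 let ?T = "(UNIV :: real set) \<times> fst c"
 have "continuous_on ?T (%p. f (fst (fst p, snd c (snd p))) (chart_inv c (snd (fst p, snd c (snd p)))))"
  by (rule continuous_on_compose2[OF smooth_ctn[OF tsmD[OF f c(1)]]])
   (use chartD(6)[OF c(1)] in \<open>auto intro!: continuous_intros continuous_on_compose2[OF chartD(3)[OF
    c(1)]]\<close>)
 hence "continuous_on ?T (%p. f (fst p) (snd p))"
  by (rule continuous_on_eq) (use chartD(5)[OF c(1)] in auto)
 thus "EX T. open T & p : T & continuous_on T (%p. f (fst p) (snd p))"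
  using c chartD(1)[OF c(1)] by (intro exI[of _ ?T]) (auto intro: open_Times simp: mem_Times_iff)
qed

definition dt :: "(real => 'g => complex) => real => 'g => complex" where
 "dt f t x = vector_derivative (%t. f t x) (at t)"

lemma dt_chart: assumes f: "tsm f" and c: "c : charts" "y : cdom c"
 shows "((%t. f t (chart_inv c y)) hvd
  FD (%p. f (fst p) (chart_inv c (snd p))) (at (t, y)) (1, 0)) (at t)" proof -
 let ?F = "%p. f (fst p) (chart_inv c (snd p))"
 have m: "(t, y) : UNIV \<times> cdom c" using c by simp
 note l = smooth_FD_linear[OF tsmD[OF f c(1)] m]
 have 1: "((%t. ?F (t, y)) hfd (%v. FD ?F (at (t, y)) (v, 0))) (at t)"
  by (rule frechet_partial1(2)[OF open_cylinder[OF c(1)] tsmD[OF f c(1)] m])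
 have 2: "FD ?F (at (t, y)) (v, 0) = v *\<^sub>R FD ?F (at (t, y)) (1, 0)" for v
  using linear_cmul[OF l, of v "(1, 0)"] by simp
 show ?thesis using has_derivative_eq_rhs[OF 1 ext[OF 2]] unfolding has_vector_derivative_def fst_conv snd_conv .
qed

lemma dt_hvd: assumes f: "tsm f"
 shows "((%t. f t x) hvd dt f t x) (at t)" proof -
 obtain c where c: "c : charts" "x : fst c" using chart_cover by blast
 note v = dt_chart[OF f c(1) chartD(6)[OF c], unfolded chartD(5)[OF c], of t]
 show ?thesis unfolding dt_def vector_derivative_at[OF v] by (rule v)
qed

lemma tsm_dt: assumes f: "tsm f" shows "tsm (dt f)" unfolding tsm_def proof
 fix c assume c: "c : charts"
 show "smooth_on (UNIV \<times> cdom c) (%p. dt f (fst p) (chart_inv c (snd p)))" using smooth_FD[OF tsmD[OF f c]]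
  by (rule smooth_cong[OF open_cylinder[OF c], rotated])
   (auto simp: dt_def vector_derivative_at[OF dt_chart[OF f c]])
qed

lemma lder_chart: assumes f: "tsm f" and c: "c : charts" "y : cdom c"
 shows "lder Y (f t) (chart_inv c y) =
  FD (%p. f (fst p) (chart_inv c (snd p))) (at (t, y)) (0, efield c Y y)" proof -
 let ?F = "%p. f (fst p) (chart_inv c (snd p))"
 have m: "(t, y) : UNIV \<times> cdom c" using c by simp
 have 1: "((%y. f t (chart_inv c y)) hfd (%v. FD ?F (at (t, y)) (0, v))) (at y)"
  using FD_partial2(2)[OF open_cylinder[OF c(1)] tsmD[OF f c(1)] m] by simp
 from has_derivative_unique[OF chart_hfd[OF tsm_gsmooth[OF f] c, of t] 1]
 show ?thesis by (metis toid_efield[OF c] fun_cong)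
qed

lemma tsm_lder: assumes f: "tsm f" shows "tsm (%t. lder Y (f t))" unfolding tsm_def proof
 fix c assume c: "c : charts"
 note o = open_cylinder[OF c]
 have 1: "smooth_on (UNIV \<times> cdom c) (%p :: real \<times> (real^'n). snd p)"
  by (rule smooth_on_linear[OF bounded_linear_snd o])
 have 2: "smooth_on (UNIV \<times> cdom c) (%p :: real \<times> (real^'n). efield c Y (snd p))"
  by (rule smooth_comp[OF o chartD(2)[OF c] _ 1 smooth_efield[OF c]]) auto
 have "smooth_on (UNIV \<times> cdom c) (%p :: real \<times> (real^'n). (0 :: real, efield c Y (snd p)))"
  by (rule smooth_on_Pair[OF o smooth_on_const 2])
 from smooth_on_frechet_apply[OF o tsmD[OF f c] this]
 show "smooth_on (UNIV \<times> cdom c) (%p. lder Y (f (fst p)) (chart_inv c (snd p)))"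
  by (rule smooth_cong[OF o, rotated]) (auto simp: lder_chart[OF f c])
qed

lemma tsm_add: "tsm f ==> tsm g ==> tsm (%t x. f t x + g t x)"
 unfolding tsm_def by (intro ballI smooth_on_add open_cylinder) auto

lemma tsm_diff: "tsm f ==> tsm g ==> tsm (%t x. f t x - g t x)"
 unfolding tsm_def by (intro ballI smooth_on_diff open_cylinder) auto

lemma tsm_sum: "(!!a. a : A ==> tsm (f a)) ==> tsm (%t x. SUM a:A. f a t x)"
 unfolding tsm_def by (intro ballI smooth_on_sum open_cylinder) auto

lemma tsm_cnj: "tsm f ==> tsm (%t x. cnj (f t x))"
 unfolding tsm_def by (intro ballI smooth_blin[OF bounded_linear_cnj] open_cylinder) auto

lemma tsm_cas: "tsm f ==> tsm (%t. cas (f t))"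
 unfolding cas_def[abs_def] by (intro tsm_sum tsm_lder)

lemma tsm_bounded: assumes f: "tsm f" and p: "!!t x. f (t + 2 * pi) x = f t x"
 shows "EX B. ALL t x. cmod (f t x) <= B" proof -
 have "compact ((%p. f (fst p) (snd p)) ` ({0..2 * pi} \<times> UNIV))"
  by (simp add: compact_Times compact_Icc compact_UNIV compact_continuous_image continuous_on_subset[OF
   tsm_continuous[OF f]])
 then obtain B where B: "ALL z:(%p. f (fst p) (snd p)) ` ({0..2 * pi} \<times> UNIV). cmod z <= B"
  using compact_imp_bounded bounded_iff by metis
 have "cmod (f t x) <= B" for t x proof -
  obtain s where "s : {0..2 * pi}" "f t = f s" by (metis periodic_reduce[of f t] ext p)
  thus ?thesis using B by force
 qed
 thus ?thesis by blast
qed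

lemma hip_has_vector_derivative: assumes f: "tsm f" and ph: "cont ph"
 shows "((%t. hip (f t) ph) hvd hip (dt f t) ph) (at t)" proof -
 have cd: "cont (%z. dt f t z * cnj (ph z))" for t
  by (intro continuous_intros ph gsmooth_ctn[OF tsm_gsmooth[OF tsm_dt[OF f]]])
 have "((%a. cint (%z. f a z * cnj (ph z))) hfd (%v. cint (%z. of_real v * (dt f t z * cnj (ph z))))) (at t)"
 using has_vector_derivative_mult_left[OF dt_hvd[OF f]] tsm_continuous[OF tsm_dt[OF f]]
  by (auto simp: has_vector_derivative_def scaleR_conv_of_real case_prod_beta' continuous_intros continuous_on_cnj
   continuous_on_compose2[OF ph] intro!: cint_has_derivative[OF open_UNIV UNIV_I] continuous_intros ph gsmooth_ctn[OF
    tsm_gsmooth[OF f]])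
 thus ?thesis by (simp add: has_vector_derivative_def hip_def cint_cmult[OF cd] scaleR_conv_of_real)
qed

lemma hip_lder: assumes "gsmooth g" "gsmooth ph" shows "hip (lder Y g) ph = - hip g (lder Y ph)"
 unfolding hip_def using cint_by_parts[OF assms(1) gsmooth_cnj[OF assms(2)], of Y]
 by (simp add: lder_cnj[OF assms(2)])

lemma hip_cas: assumes g: "gsmooth g" and ph: "gsmooth ph" shows "hip (cas g) ph = hip g (cas ph)"
using gsmooth_ctn hip_lin_comb(2)[of UNIV "%a. lder (frame a) (lder (frame a) ph)" g "%_. 1"]
 unfolding cas_def[abs_def] by (force simp: hip_lder gsmooth_lder g ph cas_def[abs_def] hip_sum)

text \<open>\<open>cas\<close> is symmetric for \<open>hip\<close> and has the coefficient as an
  eigenfunction, so subtracting it from the identity multiplies by the squared weight; smoothness is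
  traded for decay.\<close>

lemma hip_helmholtz: assumes g: "gsmooth g" and n: "n : ixs"
 shows "hip (%x. g x - cas g x) (fam n) = cor ((wt n)^2) * hip g (fam n)" proof -
 note c = gsmooth_ctn
 have cas: "cas (fam n) = (%x. - cor ((wt n)^2 - 1) * fam n x)"
  using n cas_e(2)[OF ixsD(1-3)[OF n]] by (simp add: fam_def wt_def fun_eq_iff)
 have "hip (%x. g x + - 1 * cas g x) (fam n) = hip g (fam n) + - 1 * hip (cas g) (fam n)"
  unfolding hip_cmult[OF c[OF gsmooth_cas[OF g]] cont_fam, symmetric]
  by (rule hip_add[OF c[OF g] continuous_on_mult_left[OF c[OF gsmooth_cas[OF g]]] cont_fam])
 moreover have "hip (cas g) (fam n) = - cor ((wt n)^2 - 1) * hip g (fam n)"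
 proof -
  have "hip (cas g) (fam n) = cnj (hip (cas (fam n)) g)"
   by (metis hip_cas[OF g gsmooth_fam] hip_cnj[OF c[OF gsmooth_cas[OF gsmooth_fam]] c[OF g]])
  also have "hip (cas (fam n)) g = - cor ((wt n)^2 - 1) * hip (fam n) g"
   unfolding cas by (rule hip_cmult[OF cont_fam c[OF g]])
  finally show ?thesis by (simp add: hip_cnj[OF cont_fam c[OF g]])
 qed
 ultimately show ?thesis by (simp add: algebra_simps)
qed

lemma fam_bound: "cmod (fam n x) <= 1" using e_bound[OF ixsD(1-3)] by (auto simp: fam_def)

text \<open>Each passage from \<open>f\<close> to \<open>f - cas f\<close> gains two powers of the
  weight, while the coefficients of any bounded function are bounded.\<close>

lemma rapid_coefficients: assumes "tsm f" "!!t x. f (t + 2 * pi) x = f t x"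
 shows "rapid (%n t. hip (f t) (fam n))" proof -
 have "EX C. ALL n t. cmod (hip (f t) (fam n)) * wt n ^ (2 * N) <= C" for N using assms
 proof (induction N arbitrary: f)
  case (0 f)
  obtain B where B: "ALL t x. cmod (f t x) <= B" using tsm_bounded[of f] 0 by blast
  have "cmod (hip (f t) (fam n)) <= B" for n t unfolding hip_def proof (rule cint_bound)
   show "cont (%x. f t x * cnj (fam n x))"
    by (intro continuous_intros cont_fam gsmooth_ctn[OF tsm_gsmooth[OF 0(1)]])
   show "cmod (f t x * cnj (fam n x)) <= B" for x
    using mult_mono[OF B[rule_format, of t x] fam_bound[of n x]] order_trans[OF norm_ge_zero B[rule_format, of t x]]
    by (simp add: norm_mult)
  qed
  thus ?case by auto
 next
  case (Suc N f)
  let ?g = "%t x. f t x - cas (f t) x"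
  have p: "?g (t + 2 * pi) x = ?g t x" for t x by (metis ext Suc.prems(2))
  obtain C where C: "ALL n t. cmod (hip (?g t) (fam n)) * wt n ^ (2 * N) <= C"
   using Suc.IH[of ?g, OF tsm_diff[OF Suc.prems(1) tsm_cas[OF Suc.prems(1)]] p] by auto
  have "cmod (hip (f t) (fam n)) * wt n ^ (2 * Suc N) <= abs C" for n t
  proof (cases "n : ixs")
   case True
   have "cmod (hip (f t) (fam n)) * wt n ^ (2 * Suc N) = cmod (hip (?g t) (fam n)) * wt n ^ (2 * N)"
    unfolding hip_helmholtz[OF tsm_gsmooth[OF Suc.prems(1)] True] by (simp add: norm_mult power2_eq_square)
   also have "... <= abs C" using C by (meson abs_ge_self order_trans)
   finally show ?thesis .
  qed (simp add: fam_def hip_def)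
  thus ?case by blast
 qed
 hence C: "ALL N. EX C. ALL n t. cmod (hip (f t) (fam n)) * wt n ^ (2 * N) <= C" by blast
 show ?thesis unfolding rapid_def proof
  fix N
  obtain C where C: "ALL n t. cmod (hip (f t) (fam n)) * wt n ^ (2 * N) <= C" using C by blast
  have "cmod (hip (f t) (fam n)) * wt n ^ N <= C" for n t
   by (rule order_trans[OF mult_left_mono[OF wt_power_mono] C[rule_format]]) auto
  thus "EX C. ALL n t. cmod (hip (f t) (fam n)) * wt n ^ N <= C" by blast
 qed
qed

lemma dt_periodic: assumes f: "tsm f" and p: "!!t x. f (t + 2 * pi) x = f t x"
 shows "dt f (t + 2 * pi) x = dt f t x" using hvd_shift[where f="%t. f t x" and t=t
  and c="2 * pi", OF dt_hvd[OF f, of x "t + 2 * pi"]]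
   by (simp add: p vector_derivative_unique_at[OF _ dt_hvd[OF f, of x t]])

lemma RD_coefficients: assumes "tsm f" "!!t x. f (t + 2 * pi) x = f t x"
 shows "RD (%n t. hip (f t) (fam n))" proof -
 have "rd k (%n t. hip (f t) (fam n))" for k using assms proof (induction k arbitrary: f)
  case (0 f)
  show ?case using hvd_ctn[OF hip_has_vector_derivative[OF 0(1) cont_fam]] rapid_coefficients[of f, OF 0(1,2)] by simp
 next
  case (Suc k f)
  show ?case using Suc.IH[OF tsm_dt[OF Suc.prems(1)] dt_periodic[OF Suc.prems(1,2)]] unfolding dif.simps
   by (intro conjI rapid_coefficients[of f, OF Suc.prems(1,2)] exI[of _ "%n t. hip (dt f t) (fam n)"] allI
    hip_has_vector_derivative[OF Suc.prems(1) cont_fam])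
 qed
 thus ?thesis by (simp add: RD_def)
qed

end

section \<open>Series over the dual\<close>

context lie_dual
begin

text \<open>Every iterated left-invariant derivative grows at most like a power of the weight. The
  class is closed under \<open>lder\<close>, so a differentiated series is again of the same
  kind.\<close>

definition tmg :: "(nat => 'g => complex) => bool" where
 "tmg g \<longleftrightarrow> (ALL n. gsmooth (g n)) & (ALL Ys. EX C N. ALL n x. cmod (foldr lder Ys (g n) x) <= C *
  wt n ^ N)"

lemma tmg_gsmooth: "tmg g ==> gsmooth (g n)" by (simp add: tmg_def)

lemma tmg_bound: assumes "tmg g"
 obtains C N where "!!n x. cmod (g n x) <= C * wt n ^ N" proof -
 from assms have "EX C N. ALL n x. cmod (foldr lder [] (g n) x) <= C * wt n ^ N" unfolding tmg_def by blast
 thus thesis using that by auto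
qed

lemma tmg_lder: "tmg g ==> tmg (%n. lder Y (g n))" unfolding tmg_def proof (intro conjI allI)
 assume g: "(ALL n. gsmooth (g n)) & (ALL Ys. EX C N. ALL n x. cmod (foldr lder Ys (g n) x) <= C * wt n ^ N)"
 show "gsmooth (lder Y (g n))" for n using g gsmooth_lder by blast
 fix Ys
 have "EX C N. ALL n x. cmod (foldr lder (Ys @ [Y]) (g n) x) <= C * wt n ^ N" using g by blast
 thus "EX C N. ALL n x. cmod (foldr lder Ys (lder Y (g n)) x) <= C * wt n ^ N" by simp
qed

lemma ysize_nonneg: "0 <= ysize Y" by (simp add: ysize_def)

lemma dent_bound: "Xi : dual ==> l < dm Xi ==> j < dm Xi ==> cmod (dent Xi Y l j) <= ysize Y * br Xi"
 unfolding dent_def by (rule lder_e_bound)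

text \<open>A derivative of an entry is a combination of entries of the same row; each
  differentiation costs the number of terms times the size of the differential.\<close>

lemma foldr_lder_e: assumes Xi: "Xi : dual" and ij: "i < dm Xi" "j < dm Xi"
 shows "EX c. foldr lder Ys (e Xi i j) = (%x. SUM l<dm Xi. c l * e Xi i l x) &
  (ALL l<dm Xi. cmod (c l) <= (\<Prod>Y\<leftarrow>Ys. ysize Y) * (real (dm Xi) * br Xi) ^ length Ys)"
proof (induction Ys)
 case Nil
 show ?case using ij by (intro exI[of _ "%l. if l = j then 1 else 0"]) (auto simp: if_distrib[of "%x. x * _"] cong:
  if_cong)
next
 case (Cons Y Ys)
 then obtain c where c: "foldr lder Ys (e Xi i j) = (%x. SUM l<dm Xi. c l * e Xi i l x)"
  "ALL l<dm Xi. cmod (c l) <= (\<Prod>Y\<leftarrow>Ys. ysize Y) * (real (dm Xi) * br Xi) ^ length Ys" by auto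
 let ?B = "(\<Prod>Y\<leftarrow>Ys. ysize Y) * (real (dm Xi) * br Xi) ^ length Ys"
 have s: "gsmooth (e Xi i l)" if "l < dm Xi" for l by (rule gsmooth_e[OF Xi ij(1) that])
 have "lder Y (foldr lder Ys (e Xi i j)) x = (SUM l<dm Xi. (SUM p<dm Xi. dent Xi Y l p * c p) * e Xi i l x)" for x
 proof -
  have "lder Y (foldr lder Ys (e Xi i j)) x = (SUM p<dm Xi. c p * lder Y (e Xi i p) x)"
   unfolding c(1) by (subst lder_sum) (auto intro!: gsmooth_mult gsmooth_const simp: lder_cmult s)
  also have "... = (SUM p<dm Xi. SUM l<dm Xi. dent Xi Y l p * c p * e Xi i l x)"
   by (intro sum.cong refl) (simp add: lder_e[OF Xi ij(1)] sum_distrib_left mult_ac)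
  also have "... = (SUM l<dm Xi. (SUM p<dm Xi. dent Xi Y l p * c p) * e Xi i l x)"
   by (subst sum.swap) (simp add: sum_distrib_right)
  finally show ?thesis .
 qed
 moreover have "cmod (SUM p<dm Xi. dent Xi Y l p * c p) <= (\<Prod>Y\<leftarrow>Y # Ys. ysize Y) * (real (dm Xi) * br
  Xi) ^ length (Y # Ys)"
  if l: "l < dm Xi" for l proof -
  have "cmod (SUM p<dm Xi. dent Xi Y l p * c p) <= (SUM p<dm Xi. (ysize Y * br Xi) * ?B)"
  proof (rule sum_norm_le)
   fix p assume "p : {..<dm Xi}"
   hence p: "p < dm Xi" by simp
   show "cmod (dent Xi Y l p * c p) <= (ysize Y * br Xi) * ?B"
    unfolding norm_mult using c(2) p cas_e(1)[OF Xi]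
    by (intro mult_mono dent_bound Xi l) (auto intro!: mult_nonneg_nonneg ysize_nonneg)
  qed
  also have "... = (\<Prod>Y\<leftarrow>Y # Ys. ysize Y) * (real (dm Xi) * br Xi) ^ length (Y # Ys)" by simp
  finally show ?thesis .
 qed
 ultimately show ?case
  by auto
qed

lemma dm_wt: "EX C>=0. ALL n:ixs. real (dm (cls n)) <= C * wt n ^ CARD('n)" proof -
 obtain C where C: "C > 0" "ALL Xi:dual. (real (dm Xi))^2 <= C * br Xi ^ CARD('n)" using dm_bound by blast
 have "real (dm (cls n)) <= C * wt n ^ CARD('n)" if n: "n : ixs" for n proof -
  have "real (dm (cls n)) <= (real (dm (cls n)))^2" using dm_pos[OF ixsD(1)[OF n]] by (simp add: power2_eq_square)
  also have "... <= C * wt n ^ CARD('n)" using C(2) ixsD(1)[OF n] n by (simp add: wt_def)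
  finally show ?thesis .
 qed
 thus ?thesis using C(1) by (intro exI[of _ C]) auto
qed

lemma tmg_fam: "tmg fam" unfolding tmg_def proof (intro conjI allI gsmooth_fam)
 fix Ys :: "(real^'n) list"
 obtain D where D: "D >= 0" "ALL n:ixs. real (dm (cls n)) <= D * wt n ^ CARD('n)" using dm_wt by blast
 let ?n = "CARD('n)" and ?k = "length Ys" and ?P = "\<Prod>Y\<leftarrow>Ys. ysize Y"
 have P: "?P >= 0" by (induction Ys) (auto intro: ysize_nonneg mult_nonneg_nonneg)
 have "cmod (foldr lder Ys (fam n) x) <= (D * (?P * D ^ ?k)) * wt n ^ (?n + (?n + 1) * ?k)" for n x
 proof (cases "n : ixs")
  case False
  have "lder Y (%_. 0 :: complex) = (%_. 0)" for Y by (rule ext) (rule lder_const)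
  hence "foldr lder Ys (%_. 0 :: complex) = (%_. 0)" by (induction Ys) simp_all
  thus ?thesis using False D(1) P less_imp_le[OF wt_power_pos] by (simp add: fam_def)
 next
  case True
  note i = ixsD[OF True]
  let ?Xi = "cls n"
  obtain c where c: "foldr lder Ys (e ?Xi (row n) (col n)) = (%x. SUM l<dm ?Xi. c l * e ?Xi (row n) l x)"
   "ALL l<dm ?Xi. cmod (c l) <= ?P * (real (dm ?Xi) * br ?Xi) ^ ?k" using foldr_lder_e[OF i(1-3), of Ys] by auto
  have "cmod (foldr lder Ys (fam n) x) <= (SUM l<dm ?Xi. ?P * (real (dm ?Xi) * br ?Xi) ^ ?k)"
   using True unfolding fam_def if_P[OF True] c(1) proof (intro sum_norm_le)
   fix l assume "l : {..<dm ?Xi}"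
   hence l: "l < dm ?Xi" by simp
   have "cmod (c l) * cmod (e ?Xi (row n) l x) <= (?P * (real (dm ?Xi) * br ?Xi) ^ ?k) * 1"
    using c(2) l cas_e(1)[OF i(1)] P by (intro mult_mono e_bound i) auto
   thus "cmod (c l * e ?Xi (row n) l x) <= ?P * (real (dm ?Xi) * br ?Xi) ^ ?k" by (simp add: norm_mult)
  qed
  also have "... <= (D * wt n ^ ?n) * (?P * ((D * wt n ^ ?n) * wt n) ^ ?k)" using D(2) True P wt_pos[of n]
   by (simp add: wt_def mult_mono power_mono mult_left_mono mult_nonneg_nonneg D less_imp_le)
  also have "... = (D * (?P * D ^ ?k)) * wt n ^ (?n + (?n + 1) * ?k)"
   by (simp add: power_add power_mult[symmetric] algebra_simps)
  finally show ?thesis .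
 qed
 thus "EX C N. ALL n x. cmod (foldr lder Ys (fam n) x) <= C * wt n ^ N" by blast
qed

text \<open>The common summable majorant of all series over the coefficients.\<close>

definition ew :: "nat => real" where "ew n = (1 / wt n) ^ (CARD('n) + 2)"

lemma ew_nonneg: "0 <= ew n" unfolding ew_def using wt_pos[of n] by simp

lemma summable_ew: "summable ew" using summable_wt by (simp add: ew_def[abs_def])

lemma term_bound: assumes y: "rapid y" and g: "tmg g"
 obtains C where "C >= 0" "!!n t x. cmod (y n t) * cmod (g n x) <= C * ew n" proof -
 obtain D N where D: "!!n x. cmod (g n x) <= D * wt n ^ N" by (rule tmg_bound[OF g]) (rule that)
 obtain B where B: "B >= 0" "!!n t. cmod (y n t) * wt n ^ (N + (CARD('n) + 2)) <= B"
  by (rule rapidE[OF y, of "N + (CARD('n) + 2)"]) (rule that)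
 have D0: "D >= 0" using order_trans[OF norm_ge_zero D[of 0 undefined]] wt_power_pos[of 0 N]
  by (simp add: zero_le_mult_iff)
 show thesis proof (rule that[of "B * D"])
  show "B * D >= 0" using B D0 by simp
  fix n t x
  have "cmod (y n t) * cmod (g n x) <= cmod (y n t) * (D * wt n ^ N)" by (intro mult_left_mono D) simp
  also have "... = (cmod (y n t) * wt n ^ (N + (CARD('n) + 2))) * D * ew n"
   using wt_pos[of n] by (simp add: ew_def power_add field_simps)
  also have "... <= B * D * ew n" by (intro mult_right_mono B D0 ew_nonneg)
  finally show "cmod (y n t) * cmod (g n x) <= B * D * ew n" .
 qed
qed

definition ser :: "(nat => real => complex) => (nat => 'g => complex) => real => 'g => complex" where
 "ser y g t x = (\<Sum>n. y n t * g n x)"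

lemma ser_sums: assumes "rapid y" "tmg g" shows "(%n. y n t * g n x) sums ser y g t x" proof -
 obtain C where C: "C >= 0" "!!n t x. cmod (y n t) * cmod (g n x) <= C * ew n"
  by (rule term_bound[OF assms]) (rule that)
 show ?thesis by (simp add: norm_mult C ser_def summable_comparison_test'[OF summable_mult[OF summable_ew, of C]]
  summable_sums)
qed

lemma ser_linear: assumes y: "rapid y" and g: "tmg g"
 shows "linear (%Y. ser y (%n. lder Y (g n)) t x)" proof (rule linearI)
 note l = linear_lder[OF tmg_gsmooth[OF g]]
 fix Y Z and r :: real
 show "ser y (%n. lder (Y + Z) (g n)) t x = ser y (%n. lder Y (g n)) t x + ser y (%n. lder Z (g n)) t x"
  by (auto simp: linear_add[OF l] distrib_left intro!: sums_add ser_sums y tmg_lder g sums_unique2[OF ser_sums[OF y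
   tmg_lder[OF g]]])
 have "(%n. r *\<^sub>R (y n t * lder Y (g n) x)) sums (r *\<^sub>R ser y (%n. lder Y (g n)) t x)"
  by (intro sums_scaleR_right ser_sums y tmg_lder g)
 thus "ser y (%n. lder (r *\<^sub>R Y) (g n)) t x = r *\<^sub>R ser y (%n. lder Y (g n)) t x"
  by (simp add: linear_cmul[OF l] sums_unique2[OF ser_sums[OF y tmg_lder[OF g]]])
qed

text \<open>Differentiation term by term, in time and space together: on a closed coordinate ball
  \<open>toid\<close> is bounded, so the differentiated terms are dominated by \<open>ew\<close>
  times the length of the increment, uniformly in the point.\<close>

lemma ser_hfd:
 assumes y: "rapid y" "!!n t. (y n hvd y' n t) (at t)" "rapid y'" and g: "tmg g"
  and c: "c : charts" "b : cdom c"
 shows "((%p. ser y g (fst p) (chart_inv c (snd p))) hfd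
  (%h. fst h *\<^sub>R ser y' g t (chart_inv c b) + ser y (%n. lder (toid c b (snd h)) (g n)) t (chart_inv c b))) (at
   (t, b))"
proof -
 obtain r where r: "r > 0" "cball b r \<subseteq> cdom c"
  using open_contains_cball[THEN iffD1, OF chartD(2)[OF c(1)]] c(2) by blast
 let ?S = "(UNIV :: real set) \<times> ball b r"
 let ?x = "%p. chart_inv c (snd p)"
 let ?f = "%n p. y n (fst p) * g n (?x p)"
 let ?f' = "%n p h. fst h *\<^sub>R (y' n (fst p) * g n (?x p)) + y n (fst p) * lder (toid c (snd p) (snd h)) (g n)
  (?x p)"
 let ?g' = "%p h. fst h *\<^sub>R ser y' g (fst p) (?x p) + ser y (%n. lder (toid c (snd p) (snd h)) (g n)) (fst p)
  (?x p)"
 have s: "gsmooth (g n)" for n by (rule tmg_gsmooth[OF g])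
 obtain B where B: "B > 0" and B2: "ALL b':cball b r. ALL v. ysize (toid c b' v) <= B * norm v"
  using toid_bound[OF c(1) compact_cball r(2)] by auto
 obtain C1 where C1: "C1 >= 0" "!!n t x. cmod (y' n t) * cmod (g n x) <= C1 * ew n"
  by (rule term_bound[OF y(3) g]) (rule that)
 have "ALL a. EX C. ALL n t x. cmod (y n t) * cmod (lder (frame a) (g n) x) <= C * ew n" proof
  fix a
  obtain C where "C >= 0" "!!n t x. cmod (y n t) * cmod (lder (frame a) (g n) x) <= C * ew n"
   by (rule term_bound[OF y(1) tmg_lder[OF g, of "frame a"]]) (rule that)
  thus "EX C. ALL n t x. cmod (y n t) * cmod (lder (frame a) (g n) x) <= C * ew n" by blast
 qed
 from choice[OF this] obtain Ca where Ca: "ALL a n t x. cmod (y n t) * cmod (lder (frame a) (g n) x) <= Ca a * ew n"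
  by auto
 define C2 where "C2 = (SUM a:UNIV. abs (Ca a))"
 have C2: "C2 >= 0" by (simp add: C2_def)
 have Y: "cmod (y n t * lder Y (g n) x) <= ysize Y * (C2 * ew n)" for n t x Y proof -
  have "cmod (y n t * lder Y (g n) x) = cmod (SUM a:UNIV. ip Y (frame a) *\<^sub>R (y n t * lder (frame a) (g n) x))"
   by (simp add: linear_comb_frame[OF s, of Y] sum_distrib_left)
  also have "... <= (SUM a:UNIV. abs (ip Y (frame a)) * (C2 * ew n))" proof (rule sum_norm_le)
   fix a
   have "cmod (y n t * lder (frame a) (g n) x) <= Ca a * ew n" using Ca by (simp add: norm_mult)
   also have "... <= C2 * ew n" proof (rule mult_right_mono[OF _ ew_nonneg])
    have "abs (Ca a) <= C2" unfolding C2_def by (rule member_le_sum) auto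
    thus "Ca a <= C2" by simp
   qed
   finally show "norm (ip Y (frame a) *\<^sub>R (y n t * lder (frame a) (g n) x)) <= abs (ip Y (frame a)) * (C2 * ew
    n)"
    by (simp add: mult_left_mono)
  qed
  also have "... = ysize Y * (C2 * ew n)" by (simp add: ysize_def sum_distrib_right)
  finally show ?thesis .
 qed
 let ?K = "C1 + B * C2"
 have fb: "cmod (?f' n p h) <= (?K * norm h) * ew n" if p: "p : ?S" for n p h proof -
  have nh: "norm (fst h) <= norm h" "norm (snd h) <= norm h"
   using norm_fst_le[of "fst h" "snd h"] norm_snd_le[of "snd h" "fst h"] by simp_all
  have sp: "snd p : cball b r" using p by auto
  have "cmod (fst h *\<^sub>R (y' n (fst p) * g n (?x p))) <= norm h * (C1 * ew n)"
   using mult_mono[OF nh(1) C1(2)[of n "fst p" "?x p"]] by (simp add: norm_mult)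
  moreover have "cmod (y n (fst p) * lder (toid c (snd p) (snd h)) (g n) (?x p)) <= (B * norm h) * (C2 * ew n)"
  proof (rule order_trans[OF Y mult_right_mono])
   have "ysize (toid c (snd p) (snd h)) <= B * norm (snd h)" by (rule B2[rule_format, OF sp])
   also have "... <= B * norm h" using B nh(2) by simp
   finally show "ysize (toid c (snd p) (snd h)) <= B * norm h" .
   show "0 <= C2 * ew n" using C2 ew_nonneg by simp
  qed
  ultimately show ?thesis by (simp add: algebra_simps norm_triangle_le[OF add_mono])
 qed
 have sums': "(%n. ?f' n p h) sums ?g' p h" for p h
  by (intro sums_add sums_scaleR_right ser_sums y tmg_lder g)
 have "EX G. ALL p:?S. (%n. ?f n p) sums (G p) & (G hfd ?g' p) (at p within ?S)"
 proof (rule has_derivative_series)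
  show "convex ?S" by (intro convex_Times convex_UNIV convex_ball)
  show "(t, b) : ?S" using r(1) by simp
  show "(%n. ?f n (t, b)) sums ser y g t (chart_inv c b)" using ser_sums[OF y(1) g] by simp
  fix n p assume p: "p : ?S"
  have pc: "snd p : cdom c" using p r(2) by auto
  have "((%p. y n (fst p)) hfd (%h. fst h *\<^sub>R y' n (fst p))) (at p)"
   by (rule has_derivative_compose[OF has_derivative_fst[OF has_derivative_ident] y(2)[unfolded
    has_vector_derivative_def]])
  moreover have "((%p. g n (?x p)) hfd (%h. lder (toid c (snd p) (snd h)) (g n) (?x p))) (at p)"
   by (rule has_derivative_compose[OF has_derivative_snd[OF has_derivative_ident] chart_hfd[OF s c(1) pc]])
  ultimately have "(?f n hfd (%h. y n (fst p) * lder (toid c (snd p) (snd h)) (g n) (?x p) + fst h *\<^sub>R y' n (fst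
   p) * g n (?x p))) (at p)"
   by (rule has_derivative_mult)
  thus "(?f n hfd ?f' n p) (at p within ?S)" by (simp add: add.commute has_derivative_at_withinI)
 next
  fix ep :: real assume ep: "ep > 0"
  have "(%n. ?K * (suminf ew - sum ew {..<n})) \<longlonglongrightarrow> ?K * (suminf ew - suminf ew)"
   by (intro tendsto_intros summable_LIMSEQ summable_ew)
  hence "\<forall>\<^sub>F n in sequentially. ?K * (suminf ew - sum ew {..<n}) < ep" using ep
   by (intro order_tendstoD(2)) simp_all
  thus "\<forall>\<^sub>F n in sequentially. ALL p:?S. ALL h. norm ((SUM i<n. ?f' i p h) - ?g' p h) <= ep * norm h"
  proof eventually_elim
   case (elim n)
   show ?case proof (intro ballI allI)
    fix p and h :: "real \<times> (real^'n)" assume p: "p : ?S"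
    have e1: "?g' p h - (SUM i<n. ?f' i p h) = (\<Sum>i. ?f' (i + n) p h)"
     using suminf_minus_initial_segment[OF sums_summable[OF sums'[of h p]], of n] sums_unique[OF sums'[of h p]]
      by simp
    have e2: "cmod (\<Sum>i. ?f' (i + n) p h) <= (\<Sum>i. (?K * norm h) * ew (i + n))"
     by (rule norm_suminf_le) (use fb[OF p] summable_ew in \<open>auto intro!: summable_mult \<close>)
    have e3: "(\<Sum>i. (?K * norm h) * ew (i + n)) = (?K * norm h) * (suminf ew - sum ew {..<n})"
     using suminf_minus_initial_segment[OF summable_ew, of n] suminf_mult[OF summable_ignore_initial_segment[OF
      summable_ew, of n], of "?K * norm h"] by simp
    have e4: "(?K * norm h) * (suminf ew - sum ew {..<n}) <= ep * norm h"
     using mult_right_mono[OF less_imp_le[OF elim] norm_ge_zero[of h]] by (simp add: mult_ac)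
    have "norm (?g' p h - (SUM i<n. ?f' i p h)) <= ep * norm h"
     unfolding e1 by (rule order_trans[OF e2]) (unfold e3, rule e4)
    thus "norm ((SUM i<n. ?f' i p h) - ?g' p h) <= ep * norm h" by (subst norm_minus_commute)
   qed
  qed
 qed
 then obtain G where G: "!!p. p : ?S ==> (%n. ?f n p) sums (G p)" "!!p. p : ?S ==> (G hfd ?g' p) (at p within ?S)"
  by blast
 have m: "(t, b) : ?S" and oS: "open ?S" using r(1) by (auto intro: open_Times)
 show ?thesis using G(2)[OF m] at_within_open[OF m oS]
  by (simp add: hfd_transform[OF _ oS m] sums_unique2[OF G(1) ser_sums[OF y(1) g]])
qed

end

lemma sum_Basis_prod:
 fixes f :: "'a::euclidean_space \<times> 'b::euclidean_space => 'c::comm_monoid_add"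
 shows "sum f Basis = (SUM i:Basis. f (i, 0)) + (SUM i:Basis. f (0, i))" proof -
 have i: "inj_on (%u. (u :: 'a, 0 :: 'b)) Basis" "inj_on (%v. (0 :: 'a, v :: 'b)) Basis" by (auto simp: inj_on_def)
 show ?thesis unfolding Basis_prod_def
  by (subst sum.union_disjoint) (auto simp: sum.reindex[OF i(1)] sum.reindex[OF i(2)])
qed

context lie_dual
begin

lemma ser_chart_hfd:
 assumes y: "RD y" and d: "!!n t. (y n hvd y' n t) (at t)" and g: "tmg g" and c: "c : charts" "b : cdom c"
 shows "FD (%p. ser y g (fst p) (chart_inv c (snd p))) (at (t, b)) h =
  fst h *\<^sub>R ser y' g t (chart_inv c b) + ser y (%n. lder (toid c b (snd h)) (g n)) t (chart_inv c b)"
 using fun_cong[OF frechet_derivative_at[OF ser_hfd[OF RD_rapid[OF y] d RD_rapid[OF RD_deriv_unique[OF y d]] g c, of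
  t]], of h] by simp

lemma tsm_ser: assumes "RD y" "tmg g" shows "tsm (ser y g)" unfolding tsm_def proof
 fix c assume c: "c : charts"
 let ?S = "(UNIV :: real set) \<times> cdom c"
 define F where "F = {%p. ser y g (fst p) (chart_inv c (snd p)) |y g. RD y & tmg g}"
 note o = open_cylinder[OF c]
 show "smooth_on ?S (%p. ser y g (fst p) (chart_inv c (snd p)))" proof (rule smooth_on_class[OF o])
  show "(%p. ser y g (fst p) (chart_inv c (snd p))) : F" unfolding F_def using assms by blast
 next
  fix f p assume "f : F" and p: "p : ?S"
  then obtain y g where f: "f = (%p. ser y g (fst p) (chart_inv c (snd p)))" "RD y" "tmg g" unfolding F_def by blast
  obtain y' where y': "!!n t. (y n hvd y' n t) (at t)" "RD y'" by (rule RD_deriv[OF f(2)]) (rule that)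
  have pc: "snd p : cdom c" using p by auto
  note D = ser_hfd[OF RD_rapid[OF f(2)] y'(1) RD_rapid[OF y'(2)] f(3) c pc, of "fst p", unfolded prod.collapse]
  show "f differentiable (at p)" unfolding differentiable_def f(1) by (rule , rule D)
 next
  fix f and v :: "real \<times> (real^'n)" assume "f : F"
  then obtain y g where f: "f = (%p. ser y g (fst p) (chart_inv c (snd p)))" "RD y" "tmg g" unfolding F_def by blast
  obtain y' where y': "!!n t. (y n hvd y' n t) (at t)" "RD y'" by (rule RD_deriv[OF f(2)]) (rule that)
  \<comment> \<open>A basis vector of the product is either the time direction or a space direction;
    \<open>fst b\<close> tells which.\<close>
  define a :: "real \<times> (real^'n) => real \<times> (real^'n) => real"
   where "a b p = (if fst b ~= 0 then fst v else toid c (snd p) (snd v) \<bullet> snd b)" for b p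
  define h where "h b p = (if fst b ~= 0 then ser y' g (fst p) (chart_inv c (snd p))
   else ser y (%n. lder (snd b) (g n)) (fst p) (chart_inv c (snd p)))" for b :: "real \<times>
    (real^'n)" and p :: "real \<times> (real^'n)"
  show "EX I::(real \<times> (real^'n)) set. EX a g. (ALL i:I. smooth_on ?S (a i :: _ => real) & g i : F) &
   (ALL x:?S. FD f (at x) v = (SUM i:I. a i x *\<^sub>R g i x))"
  proof (intro exI conjI ballI)
   fix b :: "real \<times> (real^'n)" assume "b : Basis"
   have "smooth_on ?S (%p. toid c (snd p) (snd v))"
    by (rule smooth_comp[OF o chartD(2)[OF c] _ smooth_on_linear[OF bounded_linear_snd o] smooth_toid[OF c]]) auto
   from smooth_blin[OF bounded_linear_inner_left o this, of "snd b"]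
   have s2: "smooth_on ?S (%p. toid c (snd p) (snd v) \<bullet> snd b)" .
   show "smooth_on ?S (a b)"
    using s2 by (cases "fst b = 0") (simp_all add: a_def[abs_def])
   show "h b : F" proof (cases "fst b = 0")
    case True
    thus ?thesis using f(2) tmg_lder[OF f(3)] by (auto simp: h_def fun_eq_iff F_def)
   next
    case False
    thus ?thesis using y'(2) f(3) by (auto simp: h_def fun_eq_iff F_def)
   qed
  next
   fix p assume p: "p : ?S"
   hence pc: "snd p : cdom c" by auto
   have "FD f (at p) v = fst v *\<^sub>R ser y' g (fst p) (chart_inv c (snd p)) +
     ser y (%n. lder (toid c (snd p) (snd v)) (g n)) (fst p) (chart_inv c (snd p))"
    using ser_chart_hfd[OF f(2) y'(1) f(3) c pc, of "fst p" v] unfolding prod.collapse f(1) .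
   also have "ser y (%n. lder (toid c (snd p) (snd v)) (g n)) (fst p) (chart_inv c (snd p)) =
     (SUM b:Basis. (toid c (snd p) (snd v) \<bullet> b) *\<^sub>R ser y (%n. lder b (g n)) (fst p) (chart_inv c (snd
      p)))"
    by (rule linear_Basis[OF ser_linear[OF RD_rapid[OF f(2)] f(3)]])
   finally show "FD f (at p) v = (SUM b:Basis. a b p *\<^sub>R h b p)"
    by (simp add: sum_Basis_prod a_def h_def)
  qed
 qed
qed

lemma dt_ser:
 assumes y: "RD y" and d: "!!n t. (y n hvd y' n t) (at t)" and g: "tmg g"
 shows "dt (ser y g) t x = ser y' g t x" proof -
 obtain c where c: "c : charts" "x : fst c" using chart_cover by blast
 note xc = chartD(6)[OF c]
 note v = dt_chart[OF tsm_ser[OF y g] c(1) xc, of t]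
 have "dt (ser y g) t x = ser y' g t x + ser y (%n. lder (toid c (snd c x) 0) (g n)) t x"
  using vector_derivative_at[OF v] by (simp add: chartD(5)[OF c] dt_def ser_chart_hfd[OF y d g c(1) xc])
 also have "ser y (%n. lder (toid c (snd c x) 0) (g n)) t x = 0"
  by (simp add: linear_0[OF linear_toid[OF c(1) xc]] linear_0[OF ser_linear[OF RD_rapid[OF y] g]])
 finally show ?thesis by simp
qed

lemma lder_ser: assumes y: "RD y" and g: "tmg g"
 shows "lder Y (ser y g t) x = ser y (%n. lder Y (g n)) t x" proof -
 obtain c where c: "c : charts" "x : fst c" using chart_cover by blast
 note xc = chartD(6)[OF c]
 obtain y' where y': "!!n t. (y n hvd y' n t) (at t)" by (rule RD_deriv[OF y]) (rule that)
 show ?thesis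
  using lder_chart[OF tsm_ser[OF y g] c(1) xc, of Y t] ser_chart_hfd[OF y y' g c(1) xc, of t
   "(0, efield c Y (snd c x))"]
  by (simp add: chartD(5)[OF c] toid_efield[OF c(1) xc])
qed

lemma ser_tail: assumes y: "rapid y" and g: "tmg g"
 obtains C where "C >= 0" "!!N t x. cmod (ser y g t x - (SUM n<N. y n t * g n x)) <= C * (suminf ew - sum ew {..<N})"
proof -
 obtain C where C: "C >= 0" "!!n t x. cmod (y n t) * cmod (g n x) <= C * ew n"
  by (rule term_bound[OF y g]) (rule that)
 show thesis proof (rule that[OF C(1)])
  fix N t x
  note s = ser_sums[OF y g, of t x]
  have e1: "ser y g t x - (SUM n<N. y n t * g n x) = (\<Sum>n. y (n + N) t * g (n + N) x)"
   using suminf_minus_initial_segment[OF sums_summable[OF s], of N] sums_unique[OF s] by simp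
  have e2: "cmod (\<Sum>n. y (n + N) t * g (n + N) x) <= (\<Sum>n. C * ew (n + N))"
   by (rule norm_suminf_le) (use C summable_ew in \<open>auto intro!: summable_mult simp: norm_mult\<close>)
  show "cmod (ser y g t x - (SUM n<N. y n t * g n x)) <= C * (suminf ew - sum ew {..<N})"
   using suminf_minus_initial_segment[OF summable_ew, of N] suminf_mult[OF summable_ignore_initial_segment[OF
    summable_ew, of N], of C] by (simp add: e1 order_trans[OF e2])
 qed
qed

lemma fam_orthogonal: assumes m: "m : ixs"
 shows "hip (fam n) (fam m) = (if n = m then 1 / of_nat (dm (cls m)) else 0)"
proof (cases "n : ixs")
 case True
 show ?thesis by (metis ixsD(4)[OF True] ixsD(4)[OF m] True m e_orthogonal[OF ixsD(1-3)[OF True] ixsD(1-3)[OF m]]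
  fam_def)
next
 case False
 thus ?thesis using m by (auto simp: fam_def hip_def)
qed

text \<open>The factor \<open>dm\<close> compensates the squared norm \<open>1 / dm\<close> of a
  matrix coefficient.\<close>

definition coef :: "(real => 'g => complex) => nat => real => complex" where
 "coef f n t = (if n : ixs then of_nat (dm (cls n)) else 0) * hip (f t) (fam n)"

lemma RD_coef: assumes f: "tsm f" "!!t x. f (t + 2 * pi) x = f t x" shows "RD (coef f)" proof -
 obtain C where C: "C >= 0" "ALL n:ixs. real (dm (cls n)) <= C * wt n ^ CARD('n)" using dm_wt by blast
 have "tempered (%n t. if n : ixs then of_nat (dm (cls n)) else 0)" unfolding tempered_def
 proof (intro exI allI)
  show "cmod (if n : ixs then of_nat (dm (cls n)) else 0) <= C * wt n ^ CARD('n)" for n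
   using C less_imp_le[OF wt_power_pos] by auto
 qed
 from RD_mult[OF TM_const[OF this] RD_coefficients[of f, OF f]] show ?thesis by (simp add: coef_def[abs_def])
qed

text \<open>By the uniform tail bound the series is continuous with the same Fourier coefficients as
  \<open>f t\<close>; completeness then makes them equal.\<close>

lemma expansion: assumes f: "tsm f" "!!t x. f (t + 2 * pi) x = f t x"
 shows "ser (coef f) fam t x = f t x" proof -
 note y = RD_coef[of f, OF f] and g = tmg_fam
 let ?F = "ser (coef f) fam t"
 have cF: "cont ?F" by (rule gsmooth_ctn[OF tsm_gsmooth[OF tsm_ser[OF y g]]])
 have cf: "cont (f t)" by (rule gsmooth_ctn[OF tsm_gsmooth[OF f(1)]])
 obtain C where C: "C >= 0" "!!N t x. cmod (ser (coef f) fam t x - (SUM n<N. coef f n t * fam n x)) <= C * (suminf ew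
  - sum ew {..<N})"
  by (rule ser_tail[OF RD_rapid[OF y] g]) (rule that)
 have hF: "hip ?F (fam m) = hip (f t) (fam m)" if m: "m : ixs" for m proof -
  have "cmod (hip ?F (fam m) - hip (f t) (fam m)) <= C * (suminf ew - sum ew {..<N})" if N: "m < N" for N
  proof -
   let ?s = "%x. SUM n<N. coef f n t * fam n x"
   have cs: "cont ?s" by (rule cont_lin_comb[OF cont_fam])
   have "hip ?s (fam m) = (SUM n<N. coef f n t * hip (fam n) (fam m))"
    by (rule hip_lin_comb(1)) (auto intro: cont_fam)
   also have "... = coef f m t / of_nat (dm (cls m))"
    using N by (simp add: fam_orthogonal[OF m] if_distrib[of "(*) _"] cong: if_cong)
   also have "... = hip (f t) (fam m)" using dm_pos[OF ixsD(1)[OF m]] m by (simp add: coef_def)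
   finally have 1: "hip ?s (fam m) = hip (f t) (fam m)" .
   have cd: "cont (%x. ?F x - ?s x)" by (intro continuous_on_diff cF cs)
   have e: "hip ?F (fam m) - hip (f t) (fam m) = hip (%x. ?F x - ?s x) (fam m)"
    using hip_add[OF cd cs cont_fam, of m] 1 by simp
   show ?thesis unfolding e unfolding hip_def proof (rule cint_bound)
    show "cont (%x. (?F x - ?s x) * cnj (fam m x))" by (intro continuous_on_mult cd continuous_on_cnj cont_fam)
    show "cmod ((?F x - ?s x) * cnj (fam m x)) <= C * (suminf ew - sum ew {..<N})" for x
     using mult_mono[OF C(2)[of t x N] fam_bound[of m x]] order_trans[OF norm_ge_zero C(2)[of t x N]]
      by (simp add: norm_mult)
   qed
  qed
  moreover have "(%N. C * (suminf ew - sum ew {..<N})) \<longlonglongrightarrow> C * (suminf ew - suminf ew)"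
   by (intro tendsto_intros summable_LIMSEQ summable_ew)
  ultimately have "cmod (hip ?F (fam m) - hip (f t) (fam m)) <= C * (suminf ew - suminf ew)"
   by (intro LIMSEQ_le_const) (auto intro!: exI[of _ "Suc m"])
  thus ?thesis by simp
 qed
 have "?F x - f t x = 0" proof (rule e_complete)
  show cd: "cont (%x. ?F x - f t x)" by (intro continuous_on_diff cF cf)
  fix Xi i j assume Xi: "Xi : dual" "i < dm Xi" "j < dm Xi"
  obtain m where m: "m : ixs" "cls m = Xi" "row m = i" "col m = j" by (rule idx_ixs[OF Xi])
  hence e: "e Xi i j = fam m" by (simp add: fam_def)
  show "hip (%x. ?F x - f t x) (e Xi i j) = 0" using hip_add[OF cd cf cont_fam, of m] hF[OF m(1)] by (simp add: e)
 qed
 thus ?thesis by simp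
qed

text \<open>Every mode has a solution bounded by the supremum of its data times a fixed power of the
  weight. Rapid decay of the data absorbs this power, and \<open>RD_ode\<close> supplies the
  derivatives.\<close>

lemma RD_solution:
 assumes a: "TM a" and g: "RD g" and z: "!!n t. n ~: ixs ==> g n t = 0" and M: "M >= 0"
  and ex: "!!n B. n : ixs ==> ALL t. cmod (g n t) <= B ==>
   EX y. (ALL t. (y hvd (a n t * y t + g n t)) (at t)) & (ALL t. y (t + 2 * pi) = y t) &
    (ALL t. cmod (y t) <= M * wt n ^ N * B)"
 shows "EX y. RD y & (ALL n t. (y n hvd (a n t * y n t + g n t)) (at t)) & (ALL n t. y n (t + 2 * pi) = y n t)"
proof -
 define B where "B n = (SUP t. cmod (g n t))" for n
 have bd: "bdd_above (range (%t. cmod (g n t)))" for n proof -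
  obtain C where C: "!!n t. cmod (g n t) * wt n ^ 0 <= C" by (rule rapidE[OF RD_rapid[OF g], of 0]) (rule that)
  thus ?thesis by (intro bdd_aboveI[of _ C]) auto
 qed
 have B: "ALL t. cmod (g n t) <= B n" for n unfolding B_def using cSUP_upper[OF UNIV_I bd] by blast
 have "EX y. (ALL t. (y hvd (a n t * y t + g n t)) (at t)) & (ALL t. y (t + 2 * pi) = y t) &
    (ALL t. cmod (y t) <= M * wt n ^ N * B n)" for n proof (cases "n : ixs")
  case True
  thus ?thesis by (rule ex[OF _ B])
 next
  case False
  show ?thesis using B[of n] norm_ge_zero order_trans False M z
   by (simp add: exI[of _ "%_. 0"] mult_nonneg_nonneg less_imp_le[OF wt_power_pos])
 qed
 from choice[OF allI[OF this]] obtain y where "ALL n. (ALL t. (y n hvd (a n t * y n t + g n t)) (at t)) &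
   (ALL t. y n (t + 2 * pi) = y n t) & (ALL t. cmod (y n t) <= M * wt n ^ N * B n)" by (rule exE)
 hence y: "!!n t. (y n hvd (a n t * y n t + g n t)) (at t)" "!!n t. y n (t + 2 * pi) = y n t"
  "!!n t. cmod (y n t) <= M * wt n ^ N * B n" by blast+
 have "rapid y" unfolding rapid_def proof
  fix K
  obtain C where C: "C >= 0" "!!n t. cmod (g n t) * wt n ^ (N + K) <= C"
   by (rule rapidE[OF RD_rapid[OF g], of "N + K"]) (rule that)
  have "cmod (y n t) * wt n ^ K <= M * C" for n t proof -
   have "B n <= C / wt n ^ (N + K)" unfolding B_def
    by (rule cSUP_least) (use C wt_power_pos in \<open>auto simp: pos_le_divide_eq\<close>)
   hence BC: "B n * wt n ^ (N + K) <= C" using wt_power_pos by (simp add: pos_le_divide_eq)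
   have "cmod (y n t) * wt n ^ K <= (M * wt n ^ N * B n) * wt n ^ K"
    by (intro mult_right_mono y less_imp_le[OF wt_power_pos])
   also have "... = M * (B n * wt n ^ (N + K))" by (simp add: power_add)
   also have "... <= M * C" by (intro mult_left_mono BC M)
   finally show ?thesis .
  qed
  thus "EX C. ALL n t. cmod (y n t) * wt n ^ K <= C" by blast
 qed
 thus ?thesis by (metis y RD_ode[OF a g _ y(1)])
qed

end

section \<open>Solvability\<close>

lemma rho_square: "(rho lam de al mm)^2 = (of_real (lam * mm) - \<i> * of_real de)^2 + of_real ((cmod al)^2)"
 by (simp add: rho_def)

lemma rho_Re: "0 <= Re (rho lam de al mm)" unfolding rho_def by (rule Re_csqrt)

lemma rho_upper: "cmod (rho lam de al mm) <= abs lam * abs mm + abs de + cmod al"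
proof -
 let ?b = "abs lam * abs mm + abs de"
 have "(cmod (of_real (lam * mm) - \<i> * of_real de))^2 <= ?b^2"
  using norm_triangle_ineq4[of "of_real (lam * mm) :: complex" "\<i> * of_real de"] by (simp add: norm_mult abs_mult)
 moreover have "(cmod (rho lam de al mm))^2 <= (cmod (of_real (lam * mm) - \<i> * of_real de))^2 + (cmod al)^2"
  unfolding norm_power[symmetric] rho_square by (rule order_trans[OF norm_triangle_ineq]) simp
 ultimately have "(cmod (rho lam de al mm))^2 <= ?b^2 + (cmod al)^2" by linarith
 also have "... <= (?b + cmod al)^2" by (simp add: power2_sum)
 finally show ?thesis by simp
qed

text \<open>In the squared modulus of the radicand all terms besides
  \<open>((cmod al)^2 - de^2)^2\<close> are nonnegative. Under hypothesis (I) this bounds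
  \<open>rho\<close> away from 0 independently of the mode.\<close>

lemma rho_lower: "abs ((cmod al)\<^sup>2 - de^2) <= (cmod (rho lam de al mm))^2"
proof -
 let ?a = "(cmod al)^2" and ?x = "(lam * mm)^2"
 let ?z = "(of_real (lam * mm) - \<i> * of_real de)^2 + of_real ?a :: complex"
 have "abs (?a - de^2)^2 <= (cmod ?z)^2" proof -
  have "(cmod ?z)^2 = (?a - de^2)^2 + (?x^2 + 2 * ?x * ?a + 2 * ?x * de^2)"
   unfolding cmod_power2 by (simp add: power2_eq_square algebra_simps)
  moreover have "0 <= ?x^2 + 2 * ?x * ?a + 2 * ?x * de^2" by simp
  ultimately show ?thesis by simp
 qed
 hence "abs (?a - de^2) <= cmod ?z" by (rule power2_le_imp_le) simp
 thus ?thesis unfolding rho_square[symmetric] norm_power .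
qed

text \<open>The case \<open>w = \<plusminus> rho q0\<close> says that \<open>\<plusminus> rho q0\<close> equals \<open>s0 + i (2 \<pi> k + 2 \<pi> mm p0)\<close> up to sign;
 squaring turns this into the two real equations of hypothesis (II).\<close>

lemma resonance:
 assumes r: "exp (w + 2 * of_real pi * \<i> * of_real mm * of_real p0 + of_real s0) = 1"
  and w: "w^2 = (rho lam de al mm)^2 * (of_real q0)^2"
  and A0: "A0 = of_real s0 + \<i> * of_real de * of_real q0" and B0: "B0 = al * of_real q0"
  and C0: "C0 = 2 * of_real pi * of_real p0 + \<i> * of_real lam * of_real q0"
 shows "EX k::int. Re (A0 * (2 * of_real pi * of_int k + of_real mm * cnj C0)) = 0 &
  (cmod (2 * of_real pi * of_int k + of_real mm * C0))^2 = (cmod A0)^2 - (cmod B0)^2"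
proof -
 let ?z = "w + 2 * of_real pi * \<i> * of_real mm * of_real p0 + of_real s0"
 obtain n :: int where n: "Re ?z = 0" "Im ?z = of_int (2 * n) * pi" using r unfolding exp_eq_1 by blast
 \<comment> \<open>The real part of \<open>2 * pi * k + mm * C0\<close> for
   \<open>k = - n\<close>.\<close>
 define c where "c = 2 * pi * of_int (- n) + 2 * pi * mm * p0"
 have wr: "Re w = - s0" using n(1) by simp
 have wi: "Im w = - c" using n(2) by (simp add: c_def algebra_simps)
 have w2: "w^2 = ((of_real (lam * mm) - \<i> * of_real de)^2 + of_real ((cmod al)^2)) * (of_real q0)^2" using w
  unfolding rho_square .
 \<comment> \<open>The imaginary part of the squared relation is the first condition, its real part
   the second.\<close>
 show ?thesis proof (intro exI[of _ "- n"] conjI)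
  show "Re (A0 * (2 * of_real pi * of_int (- n) + of_real mm * cnj C0)) = 0" using arg_cong[OF w2, of Im]
   by (simp add: wr wi power2_eq_square mult_ac A0 C0 c_def algebra_simps)
  have "(cmod (2 * of_real pi * of_int (- n) + of_real mm * C0))^2 = c^2 + (lam * mm)^2 * q0^2"
  proof -
   have 1: "Re (2 * of_real pi * of_int (- n) + of_real mm * C0) = c" by (simp add: C0 c_def)
   have 2: "Im (2 * of_real pi * of_int (- n) + of_real mm * C0) = lam * mm * q0" by (simp add: C0)
   show ?thesis unfolding cmod_power2 1 2 by (simp add: power_mult_distrib)
  qed
  moreover have "(cmod A0)^2 = s0^2 + de^2 * q0^2" unfolding cmod_power2 by (simp add: A0 power_mult_distrib)
  moreover have "(cmod B0)^2 = (cmod al)^2 * q0^2" by (simp add: B0 norm_mult power_mult_distrib)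
  ultimately show "(cmod (2 * of_real pi * of_int (- n) + of_real mm * C0))^2 = (cmod A0)^2 - (cmod B0)^2"
   using arg_cong[OF w2, of Re] by (simp add: wr wi power2_eq_square algebra_simps)
 qed
qed

context lie_dual
begin

text \<open>The classes of small weight are finitely many and their divisors are nonzero by (II),
  hence they have a positive minimum; for the other classes (III) applies. The divisors are stated
  in the form in which the forward equation for \<open>- rho\<close> and the backward equation for
  \<open>+ rho\<close> produce them.\<close>

lemma mode_bounds: fixes p0 lam de s0 q0 :: real and al A0 B0 C0 :: complex
 defines "rh == %Xi m. rho lam de al (mus Xi m)"
  and "th == %Xi m. 2 * of_real pi * \<i> * of_real (mus Xi m) * of_real p0 + of_real s0 :: complex"
 assumes A0: "A0 = of_real s0 + \<i> * of_real de * of_real q0" and B0: "B0 = al * of_real q0"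
  and C0: "C0 = 2 * of_real pi * of_real p0 + \<i> * of_real lam * of_real q0"
  and II: "ALL Xi:dual. ALL m<dm Xi. ~ (EX k::int.
     Re (A0 * (2 * of_real pi * of_int k + of_real (mus Xi m) * cnj C0)) = 0 &
     (cmod (2 * of_real pi * of_int k + of_real (mus Xi m) * C0))^2 = (cmod A0)^2 - (cmod B0)^2)"
  and III: "EX M>0. ALL Xi:dual. br Xi >= M --> (ALL m<dm Xi.
    min (cmod (exp (- rh Xi m * of_real q0) - exp (th Xi m))) (cmod (1 - exp (- rh Xi m * of_real q0 + th Xi m)))
    >= br Xi powr (- M))" shows "EX c N. c > 0 & (ALL Xi:dual. ALL m<dm Xi.
  c / br Xi ^ N <= cmod (1 - exp (th Xi m - rh Xi m * of_real q0)) &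
  c / br Xi ^ N <= cmod (1 - exp (- (th Xi m + rh Xi m * of_real q0))))" proof -
 let ?D1 = "%Xi m. cmod (1 - exp (th Xi m - rh Xi m * of_real q0))"
 let ?D2 = "%Xi m. cmod (1 - exp (- (th Xi m + rh Xi m * of_real q0)))"
 obtain M where M: "M > 0" and III': "!!Xi m. Xi : dual ==> br Xi >= M ==> m < dm Xi ==>
    min (cmod (exp (- rh Xi m * of_real q0) - exp (th Xi m))) (cmod (1 - exp (- rh Xi m * of_real q0 + th Xi m)))
    >= br Xi powr (- M)" using III by blast
 \<comment> \<open>The first entry of the minimum in (III) is the backward divisor up to the factor
   \<open>exp s0\<close>; this is why \<open>exp (- s0)\<close> enters the constant
   \<open>c\<close>.\<close>
 have D2: "cmod (exp (- rh Xi m * of_real q0) - exp (th Xi m)) = exp s0 * ?D2 Xi m" for Xi m proof -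
  have "exp (- rh Xi m * of_real q0) - exp (th Xi m) = - exp (th Xi m) * (1 - exp (- (th Xi m + rh Xi m * of_real
   q0)))"
   by (simp add: right_diff_distrib exp_add[symmetric])
  thus ?thesis by (simp add: norm_mult norm_minus_cancel norm_exp_eq_Re th_def)
 qed
 have nz: "?D1 Xi m > 0" "?D2 Xi m > 0" if Xi: "Xi : dual" "m < dm Xi" for Xi m proof -
  have no: False if "exp (w + th Xi m) = 1" "w^2 = (rh Xi m)^2 * (of_real q0)^2" for w
   using resonance[OF that(1)[unfolded th_def add.assoc[symmetric]] that(2)[unfolded rh_def] A0 B0 C0] II Xi by blast
  show "?D1 Xi m > 0" using no[of "- rh Xi m * of_real q0"] by (auto simp: power_mult_distrib)
  have "exp (th Xi m + rh Xi m * of_real q0) ~= 1"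
   using no[of "rh Xi m * of_real q0"] by (auto simp: power_mult_distrib add.commute)
  thus "?D2 Xi m > 0" unfolding exp_minus by auto
 qed
 define N where "N = nat \<lceil>M\<rceil>"
 define Y where "Y = Sigma {Xi : dual. br Xi <= M} (%Xi. {..<dm Xi})"
 \<comment> \<open>The element 1 keeps the set nonempty if no class has small weight.\<close>
 define V where "V = insert 1 ((%(Xi, m). min (?D1 Xi m) (?D2 Xi m)) ` Y)"
 have fV: "finite V" "V ~= {}" by (auto simp: V_def Y_def intro!: finite_SigmaI[OF finite_br])
 have V0: "Min V > 0" unfolding Min_gr_iff[OF fV] using nz by (auto simp: V_def Y_def)
 define c where "c = min (Min V) (min 1 (exp (- s0)))"
 have c: "c > 0" "c <= Min V" "c <= 1" "c <= exp (- s0)" using V0 by (auto simp: c_def)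
 have "c / br Xi ^ N <= ?D1 Xi m & c / br Xi ^ N <= ?D2 Xi m" if Xi: "Xi : dual" "m < dm Xi" for Xi m
 proof -
  have b: "br Xi >= 1" by (rule cas_e(1)[OF Xi(1)])
  hence bN: "br Xi ^ N >= 1" by simp
  show ?thesis proof (cases "br Xi <= M")
   case True
   hence "min (?D1 Xi m) (?D2 Xi m) : V" using Xi by (auto simp: V_def Y_def)
   hence "Min V <= min (?D1 Xi m) (?D2 Xi m)" by (rule Min_le[OF fV(1)])
   moreover have "c / br Xi ^ N <= c" using bN c(1) by (simp add: divide_le_eq)
   ultimately show ?thesis using c(2) by auto
  next
   case False
   hence br: "br Xi >= M" by simp
   have "br Xi powr M <= br Xi powr real N" by (rule powr_mono) (use b M in \<open>auto simp: N_def\<close>)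
   hence p: "1 / br Xi ^ N <= br Xi powr (- M)" using b by (simp add: powr_realpow powr_minus divide_simps)
   note m = III'[OF Xi(1) br Xi(2)]
   have "?D1 Xi m >= br Xi powr (- M)" using m by simp
   moreover have "c / br Xi ^ N <= 1 / br Xi ^ N" using c(3) bN by (intro divide_right_mono) auto
   moreover have "c / br Xi ^ N <= ?D2 Xi m" proof -
    have "1 / br Xi ^ N <= exp s0 * ?D2 Xi m" using m p unfolding D2 by simp
    hence "exp (- s0) * (1 / br Xi ^ N) <= exp (- s0) * (exp s0 * ?D2 Xi m)" by (rule mult_left_mono) simp
    also have "... = ?D2 Xi m" by (simp add: exp_add[symmetric])
    finally have "exp (- s0) / br Xi ^ N <= ?D2 Xi m" by simp
    moreover have "c / br Xi ^ N <= exp (- s0) / br Xi ^ N" using c(4) bN by (intro divide_right_mono) auto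
    ultimately show ?thesis by simp
   qed
   ultimately show ?thesis using p by linarith
  qed
 qed
 thus ?thesis using c(1) by auto
qed

end

section \<open>Assembly of the solution\<close>

context lie_dual
begin

lemma ser_combination: assumes y: "rapid y" "rapid z" "rapid w" and g: "tmg g"
 shows "(%n. (a * y n t + b * z n t + c * w n t) * g n x) sums (a * ser y g t x + b * ser z g t x + c * ser w g t x)"
proof -
 have "(%n. a * (y n t * g n x) + b * (z n t * g n x) + c * (w n t * g n x)) sums (a * ser y g t x + b * ser z g t x +
  c * ser w g t x)"
  by (intro sums_add sums_mult ser_sums y g)
 thus ?thesis by (simp add: algebra_simps)
qed

lemma solvable: fixes p0 lam de s0 q0 :: real and al A0 B0 C0 :: complex and q s :: "real => real"
 assumes q: "smooth_periodic q" "ALL t. q t >= 0" and s: "smooth_periodic s"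
  and s0: "s0 = integral {0..2 * pi} s" and q0: "q0 = integral {0..2 * pi} q"
  and A0: "A0 = of_real s0 + \<i> * of_real de * of_real q0" and B0: "B0 = al * of_real q0"
  and C0: "C0 = 2 * of_real pi * of_real p0 + \<i> * of_real lam * of_real q0"
  and I: "cmod al ~= abs de" and II: "ALL Xi:dual. ALL m<dm Xi. ~ (EX k::int.
     Re (A0 * (2 * of_real pi * of_int k + of_real (mus Xi m) * cnj C0)) = 0 &
     (cmod (2 * of_real pi * of_int k + of_real (mus Xi m) * C0))^2 = (cmod A0)^2 - (cmod B0)^2)"
  and III: "EX M>0. ALL Xi:dual. br Xi >= M --> (ALL m<dm Xi. min
     (cmod (exp (- rho lam de al (mus Xi m) * of_real q0)
      - exp (2 * of_real pi * \<i> * of_real (mus Xi m) * of_real p0 + of_real s0)))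
     (cmod (1 - exp (- rho lam de al (mus Xi m) * of_real q0
      + 2 * of_real pi * \<i> * of_real (mus Xi m) * of_real p0 + of_real s0)))
    >= br Xi powr (- M))" and f: "smooth_torus_group G f"
 shows "EX u. smooth_torus_group G u & (ALL t x. operator_P G X p0 lam de al q s u t x = f t x)"
proof -
 have ft: "tsm f" and fp: "!!t x. f (t + 2 * pi) x = f t x" using f by (auto simp: smooth_torus_group_iff)
 define g where "g = coef f"
 have g: "RD g" unfolding g_def by (rule RD_coef[of f, OF ft fp])
 have gz: "g n t = 0" if "n ~: ixs" for n t using that by (simp add: g_def coef_def)
 have gp: "g n (t + 2 * pi) = g n t" for n t by (metis g_def coef_def ext fp)
 have gc: "ctn (g n)" for n by (metis RD_deriv[OF g] hvd_ctn)
 have sp: "ctn s" "s (t + 2 * pi) = s t" and qp: "ctn q" "q (t + 2 * pi) = q t" for t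
  using s q(1) smooth_ctn by (auto simp: smooth_periodic_def)
 obtain S where S: "!!t. abs (s t) <= S" using periodic_bounded[of s, OF sp] by auto
 have S0: "S >= 0" using S[of 0] by linarith
 obtain Sg where Sg: "!!t. (Sg hvd s t) (at t)" "!!t. Sg (t + 2 * pi) = Sg t + s0"
  using antiderivative_periodic[of s, OF sp] unfolding s0 by blast
 obtain Q where Q: "!!t. (Q hvd q t) (at t)" "!!t. Q (t + 2 * pi) = Q t + q0"
  using antiderivative_periodic[of q, OF qp] unfolding q0 by blast
 \<comment> \<open>The default 0 outside \<open>ixs\<close> keeps the growth bounds valid for every
   index.\<close>
 define mm where "mm n = (if n : ixs then mus (cls n) (col n) else 0)" for n
 define rh where "rh n = rho lam de al (mm n)" for n
 have mmt: "tempered (%n t. cor (mm n))" unfolding tempered_def proof (intro exI allI)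
  show "cmod (cor (mm n)) <= ysize X * wt n ^ 1" for n
   using mus_bound[OF ixsD(1,3)] ysize_nonneg[of X] by (auto simp: mm_def wt_def)
 qed
 have r0: "abs ((cmod al)\<^sup>2 - de^2) > 0"
  using I power2_eq_iff_nonneg[of "cmod al" "abs de"] by simp
 have rhnz: "rh n ~= 0" for n using rho_lower[of al de lam "mm n"] r0 by (auto simp: rh_def)
 have rht: "tempered (%n t. rh n)" proof -
  let ?K = "abs lam * ysize X + abs de + cmod al"
  have "cmod (rh n) <= ?K * wt n ^ 1" for n proof -
   have "abs lam * abs (mm n) <= abs lam * (ysize X * wt n)"
    using mus_bound[OF ixsD(1,3)] ysize_nonneg[of X] wt_ge_1[of n] by (simp add: mm_def wt_def mult_left_mono)
   moreover have "abs de + cmod al <= (abs de + cmod al) * wt n"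
    using mult_left_mono[OF wt_ge_1[of n], of "abs de + cmod al"] by simp
   ultimately show ?thesis using rho_upper[of lam de al "mm n"] by (simp add: rh_def algebra_simps)
  qed
  thus ?thesis unfolding tempered_def by blast
 qed
 have rhi: "tempered (%n t. 1 / rh n)" unfolding tempered_def
 proof (rule exI[of _ "1 / sqrt (abs ((cmod al)\<^sup>2 - de^2))"], rule exI[of _ 0], intro allI)
  fix n
  show "cmod (1 / rh n) <= 1 / sqrt (abs ((cmod al)\<^sup>2 - de^2)) * wt n ^ 0"
   using r0 rhnz[of n] divide_left_mono[of "sqrt (abs ((cmod al)\<^sup>2 - de^2))" "cmod (rh n)" 1]
    by (simp add: norm_divide rh_def real_le_lsqrt[OF norm_ge_zero rho_lower])
 qed
 \<comment> \<open>The eigenvalues of the system, for \<open>ep\<close> equal to 1 and to -1.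
   \<open>K\<close> are antiderivatives of them and \<open>P\<close> the increments over one
   period.\<close>
 define ka where "ka ep n t = \<i> * of_real (p0 * mm n) + of_real (s t) + ep * rh n * of_real (q t)" for ep ::
  complex and n t
 define K where "K ep n t = \<i> * of_real (p0 * mm n) * of_real t + of_real (Sg t) + ep * rh n * of_real (Q t)" for
  ep :: complex and n t
 define P where "P ep n = 2 * of_real pi * \<i> * of_real (mm n) * of_real p0 + of_real s0 + ep * rh n * of_real q0"
  for ep :: complex and n
 have K: "(K ep n hvd ka ep n t) (at t)" for ep n t proof -
  have "((%t. \<i> * of_real (p0 * mm n) * of_real t + of_real (Sg t) + ep * rh n * of_real (Q t)) hvd
   \<i> * of_real (p0 * mm n) * of_real 1 + of_real (s t) + ep * rh n * of_real (q t)) (at t)"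
   by (intro has_vector_derivative_add has_vector_derivative_mult_right bounded_linear.has_vector_derivative[OF
    bounded_linear_of_real]
    has_vector_derivative_id Sg Q)
  thus ?thesis by (simp add: K_def[abs_def] ka_def)
 qed
 have KP: "K ep n (t + 2 * pi) = K ep n t + P ep n" for ep n t
  unfolding K_def P_def Sg(2) Q(2) by (simp add: algebra_simps)
 have kap: "ka ep n (t + 2 * pi) = ka ep n t" for ep n t unfolding ka_def sp(2) qp(2) ..
 have TMs: "TM (%n t. cor (s t))" and TMq: "TM (%n t. cor (q t))" by (rule TM_periodic, fact)+
 have Tka: "TM (ka ep)" for ep proof -
  have "TM (%n t. \<i> * of_real p0 * of_real (mm n) + of_real (s t) + ep * rh n * of_real (q t))"
   by (intro TM_add TM_mult[OF _ TMq] TMs TM_const tempered_mult tempered_const mmt rht)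
  thus ?thesis by (simp add: ka_def[abs_def] mult.assoc)
 qed
 have III': "EX M>0. ALL Xi:dual. br Xi >= M --> (ALL m<dm Xi. min
     (cmod (exp (- rho lam de al (mus Xi m) * of_real q0)
      - exp (2 * of_real pi * \<i> * of_real (mus Xi m) * of_real p0 + of_real s0)))
     (cmod (1 - exp (- rho lam de al (mus Xi m) * of_real q0
      + (2 * of_real pi * \<i> * of_real (mus Xi m) * of_real p0 + of_real s0))))
    >= br Xi powr (- M))" using III unfolding add.assoc .
 obtain c N where c: "c > 0" "ALL Xi:dual. ALL m<dm Xi.
  c / br Xi ^ N <= cmod (1 - exp (2 * of_real pi * \<i> * of_real (mus Xi m) * of_real p0 + of_real s0 - rho lam de al
   (mus Xi m) * of_real q0)) &
  c / br Xi ^ N <= cmod (1 - exp (- (2 * of_real pi * \<i> * of_real (mus Xi m) * of_real p0 + of_real s0 + rho lam de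
   al (mus Xi m) * of_real q0)))"
  using mode_bounds[OF A0 B0 C0 II III'] by blast
 have cP: "c / wt n ^ N <= cmod (1 - exp (P (- 1) n))" "c / wt n ^ N <= cmod (1 - exp (- P 1 n))" if n: "n : ixs" for
  n
  using c(2)[rule_format, OF ixsD(1,3)[OF n]] n by (simp_all add: P_def rh_def mm_def wt_def)
 let ?E = "exp (2 * pi * S)"
 let ?M = "2 * pi * ?E * (?E / c + 1)"
 have M: "?M >= 0" using c(1) by simp
 have Mb: "2 * pi * ?E * (?E / (c / wt n ^ N) + 1) * B <= ?M * wt n ^ N * B" if "B >= 0" for n B
 proof -
  have "?E / (c / wt n ^ N) + 1 <= (?E / c + 1) * wt n ^ N"
   using one_le_power[OF wt_ge_1, of n N] by (simp add: algebra_simps)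
  thus ?thesis using that by (simp add: mult_left_mono mult_right_mono)
 qed
 have sol: "EX y. RD y & (ALL n t. (y n hvd (ka ep n t * y n t + g n t)) (at t)) & (ALL n t. y n (t + 2 * pi) = y n
  t)"
  if ep: "ep = 1 | ep = - 1" for ep proof (rule RD_solution[OF Tka g gz M])
  fix n B assume n: "n : ixs" and B: "ALL t. cmod (g n t) <= B"
  have B0: "B >= 0" using B norm_ge_zero order_trans by blast
  have D0: "c / wt n ^ N > 0" using c(1) wt_power_pos by simp
  \<comment> \<open>With this sign \<open>S\<close> alone bounds the real part of \<open>ka\<close>
    on the side that matters, however large \<open>rh n\<close> is.\<close>
  have R: "0 <= Re (rh n) * q t" for t using rho_Re q(2) by (simp add: rh_def)
  have "EX y. (ALL t. (y hvd (ka ep n t * y t + g n t)) (at t)) & (ALL t. y (t + 2 * pi) = y t) &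
    (ALL t. cmod (y t) <= 2 * pi * ?E * (?E / (c / wt n ^ N) + 1) * B)" proof (cases "ep = 1")
   case True
   show ?thesis
   proof (rule periodic_ode_reverse[of "K ep n", OF K KP kap _ S0 gc gp B[rule_format] D0])
    show "- S <= Re (ka ep n t)" for t using S[of t] R[of t] by (simp add: ka_def True)
    show "c / wt n ^ N <= cmod (1 - exp (- P ep n))" using cP(2)[OF n] by (simp add: True)
   qed
  next
   case False
   hence ep: "ep = - 1" using ep by simp
   show ?thesis proof (rule periodic_ode[of "K ep n", OF K KP kap _ S0 gc gp B[rule_format] D0])
    show "Re (ka ep n t) <= S" for t using S[of t] R[of t] by (simp add: ka_def ep)
    show "c / wt n ^ N <= cmod (1 - exp (P ep n))" using cP(1)[OF n] by (simp add: ep)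
   qed
  qed
  then obtain y where y: "ALL t. (y hvd (ka ep n t * y t + g n t)) (at t)" "ALL t. y (t + 2 * pi) = y t"
    "ALL t. cmod (y t) <= 2 * pi * ?E * (?E / (c / wt n ^ N) + 1) * B" by blast
  show "EX y. (ALL t. (y hvd (ka ep n t * y t + g n t)) (at t)) & (ALL t. y (t + 2 * pi) = y t) &
    (ALL t. cmod (y t) <= ?M * wt n ^ N * B)" using y(3) Mb[OF B0] y(1,2) by (blast intro: order_trans)
 qed
 obtain y where y: "RD y" "!!n t. (y n hvd (ka 1 n t * y n t + g n t)) (at t)" "!!n t. y n (t + 2 * pi) = y n t"
  using sol[of 1] by blast
 obtain z where z: "RD z" "!!n t. (z n hvd (ka (- 1) n t * z n t + g n t)) (at t)" "!!n t. z n (t + 2 * pi) = z n t"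
  using sol[of "- 1"] by blast
 define A where "A n = cor (lam * mm n) - \<i> * of_real de" for n
 have rh2: "rh n * rh n = A n * A n + al * cnj al" for n
  using rho_square[of lam de al "mm n"] unfolding complex_norm_square by (simp add: rh_def A_def power2_eq_square)
 have At: "tempered (%n t. A n)" proof -
  have "tempered (%n t. of_real lam * of_real (mm n) + - \<i> * of_real de)"
   by (intro tempered_add tempered_mult tempered_const mmt)
  thus ?thesis by (simp add: A_def)
 qed
 \<comment> \<open>The part of the system proportional to \<open>q\<close> has the matrix with rows
   \<open>(- A n, al)\<close> and \<open>(cnj al, A n)\<close>, whose square is
   \<open>rh n * rh n\<close> times the identity. Its spectral projections send
   \<open>(1, 0)\<close> to \<open>(ca n, cc n)\<close> for the eigenvalue \<open>rh n\<close> and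
   to \<open>(cb n, - cc n)\<close> for \<open>- rh n\<close>. This splits the data
   \<open>(g, 0)\<close> into eigenvectors, so both scalar equations carry the same right-hand side
   \<open>g\<close>.\<close>
 define ca where "ca n = (1 - A n / rh n) / 2" for n
 define cb where "cb n = (1 + A n / rh n) / 2" for n
 define cc where "cc n = cnj al / (2 * rh n)" for n
 have Aq: "tempered (%n t. A n * (1 / rh n))" by (rule tempered_mult[OF At rhi])
 have Tca: "TM (%n t. ca n)" proof (rule TM_const)
  have "tempered (%n t. 1 / 2 + - (1 / 2) * (A n * (1 / rh n)))"
   by (intro tempered_add tempered_mult[OF tempered_const] tempered_const Aq)
  thus "tempered (%n t. ca n)" by (simp add: ca_def diff_divide_distrib mult.commute)
 qed
 have Tcb: "TM (%n t. cb n)" proof (rule TM_const)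
  have "tempered (%n t. 1 / 2 + 1 / 2 * (A n * (1 / rh n)))"
   by (intro tempered_add tempered_mult[OF tempered_const] tempered_const Aq)
  thus "tempered (%n t. cb n)" by (simp add: cb_def add_divide_distrib mult.commute)
 qed
 have Tcc: "TM (%n t. cc n)" proof (rule TM_const)
  have "tempered (%n t. cnj al / 2 * (1 / rh n))" by (intro tempered_mult[OF tempered_const] rhi)
  thus "tempered (%n t. cc n)" by (simp add: cc_def)
 qed
 define a where "a n t = ca n * y n t + cb n * z n t" for n t
 define b where "b n t = cc n * y n t + (- cc n) * z n t" for n t
 have Tcc': "TM (%n t. - cc n)" using TM_mult[OF TM_constant[of "- 1"] Tcc] by simp
 have a: "RD a" unfolding a_def[abs_def] by (intro RD_add RD_mult Tca Tcb y z)
 have b: "RD b" unfolding b_def[abs_def] by (intro RD_add RD_mult Tcc Tcc' y z)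
 \<comment> \<open>The term \<open>al * q * cnj u\<close> is split: its part with \<open>V\<close>
   goes to the equation for \<open>U\<close>, its part with \<open>cnj U\<close>, after conjugation,
   to the equation for \<open>V\<close>. Conjugation also flips the sign of the imaginary
   coefficients, hence the opposite signs of \<open>A n\<close> in the two lines.\<close>
 define a' where "a' n t = of_real p0 * (\<i> * of_real (mm n) * a n t) + of_real (s t) * a n t - of_real (q t) * A n
  * a n t + al * of_real (q t) * b n t + g n t" for n t
 define b' where "b' n t = of_real p0 * (\<i> * of_real (mm n) * b n t) + of_real (s t) * b n t + of_real (q t) * A n
  * b n t + cnj al * of_real (q t) * a n t" for n t
 have da: "(a n hvd a' n t) (at t)" for n t proof -
  have "((%t. ca n * y n t + cb n * z n t) hvd
   ca n * (ka 1 n t * y n t + g n t) + cb n * (ka (- 1) n t * z n t + g n t)) (at t)"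
   by (intro has_vector_derivative_add has_vector_derivative_mult_right y z)
  moreover have "ca n * (ka 1 n t * y n t + g n t) + cb n * (ka (- 1) n t * z n t + g n t) = a' n t"
  proof -
   have 1: "ca n + cb n = 1" by (simp add: ca_def cb_def field_simps)
   \<comment> \<open>First components of the eigenvector equations for \<open>(ca n, cc n)\<close>
     and \<open>(cb n, - cc n)\<close>.\<close>
   have 2: "rh n * ca n = - A n * ca n + al * cc n" "- rh n * cb n = - A n * cb n - al * cc n"
    using rhnz[of n] rh2[of n] by (simp_all add: ca_def cb_def cc_def field_simps)
   have "ca n * (ka 1 n t * y n t + g n t) + cb n * (ka (- 1) n t * z n t + g n t) =
    (\<i> * of_real (p0 * mm n) + of_real (s t)) * a n t + of_real (q t) * ((rh n * ca n) * y n t + (- rh n * cb n) *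
     z n t) + (ca n + cb n) * g n t"
    by (simp add: ka_def a_def algebra_simps)
   thus ?thesis unfolding 1 2 by (simp add: a'_def a_def b_def algebra_simps)
  qed
  ultimately show ?thesis by (simp add: a_def[abs_def])
 qed
 have db: "(b n hvd b' n t) (at t)" for n t proof -
  have "((%t. cc n * y n t + (- cc n) * z n t) hvd
   cc n * (ka 1 n t * y n t + g n t) + (- cc n) * (ka (- 1) n t * z n t + g n t)) (at t)"
   by (intro has_vector_derivative_add has_vector_derivative_mult_right y z)
  moreover have "cc n * (ka 1 n t * y n t + g n t) + (- cc n) * (ka (- 1) n t * z n t + g n t) = b' n t"
  using rhnz[of n] by (simp add: ca_def cb_def cc_def field_simps ka_def b_def algebra_simps b'_def a_def)
  ultimately show ?thesis by (simp add: b_def[abs_def])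
 qed
 note a' = RD_deriv_unique[OF a da] and b' = RD_deriv_unique[OF b db]
 define am where "am n t = \<i> * of_real (mm n) * a n t" for n t
 define bm where "bm n t = \<i> * of_real (mm n) * b n t" for n t
 have Tmm: "TM (%n t. \<i> * of_real (mm n))" by (intro TM_const tempered_mult[OF tempered_const] mmt)
 have am: "RD am" unfolding am_def[abs_def] by (rule RD_mult[OF Tmm a])
 have bm: "RD bm" unfolding bm_def[abs_def] by (rule RD_mult[OF Tmm b])
 have Xfam: "lder X (fam n) x = \<i> * of_real (mm n) * fam n x" for n x
  using lder_X[OF ixsD(1-3)] by (simp add: fam_def mm_def lder_const)
 have La: "ser a (%n. lder X (fam n)) t x = ser am fam t x"
  and Lb: "ser b (%n. lder X (fam n)) t x = ser bm fam t x" for t x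
  unfolding ser_def Xfam am_def bm_def by (simp_all add: mult_ac)
 let ?U = "ser a fam" and ?V = "ser b fam"
 define u where "u t x = ?U t x + cnj (?V t x)" for t x
 have U: "tsm ?U" and V: "tsm ?V" by (rule tsm_ser[OF a tmg_fam], rule tsm_ser[OF b tmg_fam])
 have tu: "tsm u" unfolding u_def[abs_def] by (rule tsm_add[OF U tsm_cnj[OF V]])
 have du: "vector_derivative (%ta. u ta x) (at t) = ser a' fam t x + cnj (ser b' fam t x)" for t x
 proof (rule vector_derivative_at)
  have "((%ta. ?U ta x + cnj (?V ta x)) hvd dt ?U t x + cnj (dt ?V t x)) (at t)"
   by (intro has_vector_derivative_add bounded_linear.has_vector_derivative[OF bounded_linear_cnj] dt_hvd U V)
  thus "((%ta. u ta x) hvd ser a' fam t x + cnj (ser b' fam t x)) (at t)"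
   by (simp add: u_def dt_ser[OF a da tmg_fam] dt_ser[OF b db tmg_fam])
 qed
 have Xu: "left_field G X (u t) x = ser am fam t x + cnj (ser bm fam t x)" for t x
  unfolding left_field_eq[OF tsm_gsmooth[OF tu]]
   by (force simp: u_def[abs_def] lder_add[OF tsm_gsmooth[OF U] gsmooth_cnj[OF tsm_gsmooth[OF V]]] lder_cnj[OF
    tsm_gsmooth[OF V]] lder_ser[OF a tmg_fam] lder_ser[OF b tmg_fam] La Lb)
 have lincomb: "ser w fam t x = k1 * ser w1 fam t x + k2 * ser w2 fam t x + k3 * ser w3 fam t x + ser w4 fam t x"
  if "RD w" "RD w1" "RD w2" "RD w3" "RD w4" and "!!n. w n t = k1 * w1 n t + k2 * w2 n t + k3 * w3 n t + w4 n t"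
  for w w1 w2 w3 w4 k1 k2 k3 t x proof -
  have "(%n. (k1 * w1 n t + k2 * w2 n t + k3 * w3 n t) * fam n x + w4 n t * fam n x) sums
   (k1 * ser w1 fam t x + k2 * ser w2 fam t x + k3 * ser w3 fam t x + ser w4 fam t x)"
   by (intro sums_add[OF ser_combination ser_sums] RD_rapid that tmg_fam)
  thus ?thesis by (simp add: that(6) distrib_right sums_unique2[OF ser_sums[OF RD_rapid[OF that(1)] tmg_fam]])
 qed
 have z0: "RD (%n t. 0)" using RD_mult[OF TM_constant[of 0] g] by simp
 have Ua: "ser a' fam t x = (of_real p0 + \<i> * of_real (lam * q t)) * ser am fam t x + (of_real (s t) + \<i> *
  of_real (de * q t)) * ?U t x +
   (al * of_real (q t)) * ?V t x + f t x" for t x proof -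
  have "ser a' fam t x = (of_real p0 + \<i> * of_real (lam * q t)) * ser am fam t x + (of_real (s t) + \<i> * of_real
   (de * q t)) * ?U t x +
   (al * of_real (q t)) * ?V t x + ser g fam t x" proof (rule lincomb[OF a' am a b g])
   have ii: "\<i> * (\<i> * w) = - w" for w :: complex by simp
   show "a' n t = (of_real p0 + \<i> * of_real (lam * q t)) * am n t + (of_real (s t) + \<i> * of_real (de * q t)) * a
    n t + (al * of_real (q t)) * b n t + g n t" for n
    by (simp add: a'_def am_def A_def algebra_simps)
  qed
  thus ?thesis unfolding g_def expansion[of f, OF ft fp] .
 qed
 have Vb: "ser b' fam t x = (of_real p0 - \<i> * of_real (lam * q t)) * ser bm fam t x + (of_real (s t) - \<i> *
  of_real (de * q t)) * ?V t x +
   (cnj al * of_real (q t)) * ?U t x" for t x proof -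
  have "ser b' fam t x = (of_real p0 - \<i> * of_real (lam * q t)) * ser bm fam t x + (of_real (s t) - \<i> * of_real
   (de * q t)) * ?V t x +
   (cnj al * of_real (q t)) * ?U t x + ser (%n t. 0) fam t x" proof (rule lincomb[OF b' bm b a z0])
   have ii: "\<i> * (\<i> * w) = - w" for w :: complex by simp
   show "b' n t = (of_real p0 - \<i> * of_real (lam * q t)) * bm n t + (of_real (s t) - \<i> * of_real (de * q t)) * b
    n t + (cnj al * of_real (q t)) * a n t + 0" for n
    by (simp add: b'_def bm_def A_def algebra_simps)
  qed
  thus ?thesis by (simp add: ser_def)
 qed
 have "operator_P G X p0 lam de al q s u t x = f t x" for t x
  unfolding operator_P_def du Xu Ua Vb unfolding u_def by (simp add: algebra_simps)
 thus ?thesis using tu by (simp add: u_def ser_def a_def b_def y(3) z(3) smooth_torus_group_iff exI[of _ u])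
qed

end

theorem theorem4p1:
  fixes G :: "('g::t2_space, 'n::finite) lie_group"
    and ip :: "real ^ 'n \<Rightarrow> real ^ 'n \<Rightarrow> real"
    and X :: "real ^ 'n"
    and rep :: "('g \<Rightarrow> complex Matrix.mat) set \<Rightarrow> ('g \<Rightarrow> complex Matrix.mat)"
    and p0 lam \<delta> s0 q0 :: real
    and \<alpha> A0 B0 C0 :: complex
    and q s :: "real \<Rightarrow> real"
  assumes G: "compact_lie_group G"
    and metric: "killing_metric G ip"
    and X: "sqrt (ip X X) = 1"
    and rep: "diagonal_representatives G X rep"
    and alpha: "\<alpha> \<noteq> 0"
    and q: "smooth_periodic q" "\<forall>t. q t \<ge> 0" "\<exists>t. q t \<noteq> 0"
    and s: "smooth_periodic s"
    and s0: "s0 = integral {0..2 * pi} s"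
    and q0: "q0 = integral {0..2 * pi} q"
    and A0: "A0 = of_real s0 + \<i> * of_real \<delta> * of_real q0"
    and B0: "B0 = \<alpha> * of_real q0"
    and C0: "C0 = 2 * of_real pi * of_real p0 + \<i> * of_real lam * of_real q0"
    and I: "cmod \<alpha> \<noteq> \<bar>\<delta>\<bar>"
    and II: "\<forall>\<Xi>\<in>unitary_dual G. \<forall>m<rep_dim G (rep \<Xi>).
      \<not> (\<exists>k::int.
          Re (A0 * (2 * of_real pi * of_int k + of_real (mu G X (rep \<Xi>) m) * cnj C0)) = 0 \<and>
          (cmod (2 * of_real pi * of_int k + of_real (mu G X (rep \<Xi>) m) * C0))\<^sup>2
            = (cmod A0)\<^sup>2 - (cmod B0)\<^sup>2)"
    and III: "\<exists>M>0. \<forall>\<Xi>\<in>unitary_dual G. japanese_bracket G ip (rep \<Xi>) \<ge> M \<longrightarrow>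
      (\<forall>m<rep_dim G (rep \<Xi>).
        min
          (cmod (exp (- rho lam \<delta> \<alpha> (mu G X (rep \<Xi>) m) * of_real q0)
             - exp (2 * of_real pi * \<i> * of_real (mu G X (rep \<Xi>) m) * of_real p0 + of_real s0)))
          (cmod (1 - exp (- rho lam \<delta> \<alpha> (mu G X (rep \<Xi>) m) * of_real q0
             + 2 * of_real pi * \<i> * of_real (mu G X (rep \<Xi>) m) * of_real p0 + of_real s0)))
        \<ge> japanese_bracket G ip (rep \<Xi>) powr (- M))"
  shows "\<forall>f. smooth_torus_group G f \<longrightarrow>
    (\<exists>u. smooth_torus_group G u \<and> (\<forall>t x. operator_P G X p0 lam \<delta> \<alpha> q s u t x = f t x))"
proof -
 interpret lie_dual G ip X rep by unfold_locales (fact G metric rep)+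
 show ?thesis by (intro allI impI, rule solvable[OF q(1,2) s s0 q0 A0 B0 C0 I II III])
qed

end
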